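(* Let $\pi\propto e^{-V}$ where $V$ satisfies (R), (P1) and (RD), and let $\pi^\star$ be the minimizer of $\mathrm{KL}(\cdot\|\pi)$ over $\mathcal{C}_{\rm star}$ (assumed to have a differentiable density). Then $$\inf_{\mu\in\mathcal{C}_{\rm star}}\mathrm{KL}(\mu\|\pi)=\mathrm{KL}(\pi^\star\|\pi)\le\frac{L'_V}{2\ell'_V\ell_V^2}\sum_{i\ge2}\sum_{j>i}\mathbb{E}_{Z\sim\pi^\star}\big[(\partial_{ij}V(Z))^2\big].$$
   Context: $d\ge2$, $\pi(z)\propto e^{-V(z)}$ on $\mathbb{R}^d$ with $V$ of class $C^2$ satisfying the growth condition (for every $c_2>0$ there is $c_1>0$ with $|V(z)|\le c_1e^{c_2\|z\|^2}$). $\mathcal{C}_{\rm star}$ is the set of probability measures $\mu(\mathrm{d}z)=\mu_1(\mathrm{d}z_1)\prod_{j=2}^d\mu_j(\mathrm{d}z_j\mid z_1)$ on $\mathbb{R}^d$. Notation: $\partial_{ij}V$ Hessian entries, $(\nabla^2V)_{-1}$ Hessian with first row/column deleted, $\|f\|_{L^\infty}=\sup_z|f(z)|$; constants $\ell_V,\ell'_V,L'_V>0$. Assumptions (for all $z$): (R) $\partial_{11}V\le L'_V/2$; (P1) $(\nabla^2V)_{-1}\succeq\ell_VI_{d-1}$; (RD) $\partial_{11}V(z)-\|\sum_{j=2}^d(\partial_{1j}V)^2\|_{L^\infty}/\ell_V\ge\ell'_V$. *)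

theory Defs
  imports "HOL-Probability.Probability"
begin

definition KL_div :: "'a measure \<Rightarrow> 'a measure \<Rightarrow> ereal" where
  "KL_div \<mu> \<nu> =
     (if sets \<mu> = sets \<nu> \<and> absolutely_continuous \<nu> \<mu> then
        (let f = (\<lambda>x. enn2real (RN_deriv \<nu> \<mu> x)) in
           enn2ereal (\<integral>\<^sup>+ x. ennreal (f x * ln (f x)) \<partial>\<nu>)
         - enn2ereal (\<integral>\<^sup>+ x. ennreal (- (f x * ln (f x))) \<partial>\<nu>))
      else \<infinity>)"

definition gibbs :: "('n::euclidean_space \<Rightarrow> real) \<Rightarrow> 'n measure" where
  "gibbs V = density lborel
     (\<lambda>z. ennreal (exp (- V z) / (\<integral> w. exp (- V w) \<partial>lborel)))"

text \<open>The star class C_star with root coordinate r: probability measures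
  mu(dz) = mu_r(dz_r) prod_{j \<noteq> r} K_j(dz_j | z_r), given on measurable rectangles
  (which determine a Borel measure).\<close>
definition C_star :: "'n::finite \<Rightarrow> (real ^ 'n) measure set" where
  "C_star r = {\<mu>. prob_space \<mu> \<and> sets \<mu> = sets (borel :: (real ^ 'n) measure) \<and>
     (\<exists>(\<mu>1 :: real measure) (K :: 'n \<Rightarrow> real \<Rightarrow> real measure).
        prob_space \<mu>1 \<and> sets \<mu>1 = sets borel \<and>
        (\<forall>j. K j \<in> borel \<rightarrow>\<^sub>M prob_algebra borel) \<and>
        (\<forall>A :: 'n \<Rightarrow> real set. (\<forall>i. A i \<in> sets borel) \<longrightarrow>
           emeasure \<mu> {z. \<forall>i. z $ i \<in> A i} =
           (\<integral>\<^sup>+ t. indicator (A r) t * (\<Prod>j\<in>UNIV - {r}. emeasure (K j t) (A j)) \<partial>\<mu>1)))}"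

definition loewner_ge_sub :: "real ^ 'n ^ 'n \<Rightarrow> 'n set \<Rightarrow> real \<Rightarrow> bool" where
  "loewner_ge_sub A S c \<longleftrightarrow>
     (\<forall>x :: real ^ 'n. (\<forall>i. i \<notin> S \<longrightarrow> x $ i = 0) \<longrightarrow> c * (x \<bullet> x) \<le> x \<bullet> (A *v x))"

end

(* Let pi* = p1(t) prod_j q_j(s_j | t) be the minimizer, g = ln p + V and C = E[g]. Varying one
   conditional factor shows that for almost every t the conditional law solves a mean field problem for
   V(t, .): every q_j(. | t) is lV-strongly log-concave with score b_j(s) = E[d_j V | z_j = s, t], and
   C = ln p1(t) + E[sum_j ln q_j + V | t]. Copying a conditional law to a neighbouring root value is
   an admissible competitor, so with B(t) = E[d_1 V | t] and (R), minimality gives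
   p1(t + h) >= p1(t) exp(- B(t) h - LV' h^2 / 4): B is the score of p1.

   By (P1), (R) and (RD), V lies above its tangent planes by kappa/2 |y' - x'|^2 in the non-root
   variables, kappa = 2 lV' lV / LV'. Evaluating this along one-dimensional monotone transport maps,
   one factor at a time (their score terms integrate by parts), bounds the partition function: C + ln Z <= 1/(2 kappa) sum_j E[(d_j V - b_j)^2]. The conditional variance of
   d_j V is bounded by the tensorized Poincare inequality with constant 1/lV, which produces the
   off-diagonal Hessian entries. *)

theory Submission
  imports Defs
begin

text \<open>Since KL(pi* | pi) = C + ln Z, an upper bound on the partition function Z is all that is
  wanted; it is read off from inequalities between one-dimensional masses, and no map in dimension d
  is built. The obstacle is regularity. The factors of pi* exist only up to null sets. The
  conditional densities inherit differentiability from the joint density along lines, but nothing of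
  the kind is at hand for p1: its score B is known only through inequalities between p1(t) and p1(t
  + h) for almost every t. So integration by parts is carried out with finite increments, and one
  interface (\<open>score_density\<close>) serves both the log-concave factors and the root
  marginal. The constant kappa comes from a Schur complement: of the block bound lV the share 2 lV'
  / LV' is kept, and the rest absorbs the mixed entries of the root row; (RD) pays for these entries
  and (R) fixes the share.\<close>

section \<open>Transport bounds from one-dimensional scores\<close>

text \<open>Integrated form of a transport inequality. With \<open>B\<close> = -(ln \<nu>)' and T
  the monotone map from \<nu> to \<open>w\<close> divided by its mass Z, the change of variables
  gives ln Z \<le> ln T' + \<Xi> - B (T - id). After integration, ln T' \<le> T' - 1 and the
  integrations by parts of \<open>B\<close> against T and against the identity cancel, and the mean
  of \<Xi> remains. Only values of \<nu>, \<open>B\<close> and \<Xi> enter, so the notion makes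
  sense without a derivative of \<nu>. The bound is asked for almost every x, because in the product
  case \<Xi> becomes a conditional mean defined almost everywhere.\<close>

definition score_bound :: "(real \<Rightarrow> real) \<Rightarrow> (real \<Rightarrow> real) \<Rightarrow> bool" where
  "score_bound \<nu> B \<longleftrightarrow> (\<forall>w \<Xi>. w \<in> borel_measurable borel \<longrightarrow> (\<forall>y. 0 < w y) \<longrightarrow>
     integrable lborel (\<lambda>x. \<nu> x * \<Xi> x) \<longrightarrow>
     (AE x in lborel. 0 < \<nu> x \<longrightarrow> (\<forall>y. w y \<le> \<nu> x * exp (\<Xi> x - B x * (y - x)))) \<longrightarrow>
     (\<integral>\<^sup>+y. ennreal (w y) \<partial>lborel) \<le> ennreal (exp (\<integral>x. \<nu> x * \<Xi> x \<partial>lborel)))"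

text \<open>Quantile construction: \<open>T x\<close> is a solution of cdf M (T x) = Z cdf N x in
  [-R, R]. Positive mass of every subinterval makes cdf M strictly increasing there, which yields
  monotonicity and continuity of T. The transport identity is kept in increment form, since T need
  not be differentiable.\<close>

lemma monotone_transport_exists:
  fixes M N :: "real measure"
  assumes "finite_borel_measure M" "finite_borel_measure N"
    and atoms: "\<And>x. measure M {x} = 0" "\<And>x. measure N {x} = 0"
    and N1: "measure N UNIV = 1"
    and pos: "\<And>a b. - R \<le> a \<Longrightarrow> a < b \<Longrightarrow> b \<le> R \<Longrightarrow> 0 < measure M {a<..b}"
    and left: "measure M {..-R} = 0" and right: "measure M {..R} = Z" and R: "0 < R"
  obtains T where "mono T" "\<And>x. - R \<le> T x" "\<And>x. T x \<le> R"
    "\<And>x y. x \<le> y \<Longrightarrow> measure M {T x<..T y} = Z * measure N {x<..y}"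
    "\<And>x. continuous (at x) T"
proof -
  interpret M: finite_borel_measure M by fact
  interpret N: finite_borel_measure N by fact
  have spN: "space N = UNIV" using N.M_is_borel sets_eq_imp_space_eq[of N borel] by simp
  have cM: "isCont (cdf M) x" for x using M.isCont_cdf atoms by simp
  have cN: "isCont (cdf N) x" for x using N.isCont_cdf atoms by simp
  have sm: "cdf M a < cdf M b" if "- R \<le> a" "a < b" "b \<le> R" for a b
    using M.cdf_diff_eq[of a b] pos[of a b] that by simp
  have l: "cdf M (-R) = 0" and rr: "cdf M R = Z" using left right by (auto simp: cdf_def)
  have Z: "0 < Z" using sm[of "-R" R] l rr R by simp
  have N01: "0 \<le> cdf N x" "cdf N x \<le> 1" for x
    using N.cdf_nonneg[of x] N.cdf_bounded[of x] spN N1 by auto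
  have ex: "\<exists>y. -R \<le> y \<and> y \<le> R \<and> cdf M y = Z * cdf N x" for x
    by (rule IVT) (use l rr N01[of x] Z R cM in \<open>auto simp: mult_left_le\<close>)
  define T where "T x = (SOME y. -R \<le> y \<and> y \<le> R \<and> cdf M y = Z * cdf N x)" for x
  have T: "-R \<le> T x" "T x \<le> R" "cdf M (T x) = Z * cdf N x" for x
    using someI_ex[OF ex[of x]] unfolding T_def by auto
  have lt: "T x < b" if "Z * cdf N x < cdf M b" for x b
    using M.cdf_nondecreasing[of b "T x"] T(3)[of x] that by linarith
  have gt: "b < T x" if "cdf M b < Z * cdf N x" for x b
    using M.cdf_nondecreasing[of "T x" b] T(3)[of x] that by linarith
  have mT: "mono T"
  proof (rule monoI, rule ccontr)
    fix x y :: real assume "x \<le> y" "\<not> T x \<le> T y"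
    then have "cdf M (T y) < cdf M (T x)" using sm[of "T y" "T x"] T by auto
    then show False using N.cdf_nondecreasing[OF \<open>x \<le> y\<close>] T Z by simp
  qed
  have ct: "continuous (at x) T" for x
    unfolding continuous_at tendsto_iff eventually_at_topological[symmetric]
  proof (intro allI impI)
    fix e :: real assume e: "0 < e"
    have tl: "((\<lambda>y. Z * cdf N y) \<longlongrightarrow> Z * cdf N x) (at x)"
      using cN[of x] by (intro tendsto_intros) (simp add: continuous_at)
    \<comment> \<open>If T x - e lies below -R the inequality is automatic; otherwise strict
      monotonicity of cdf M turns it into an inequality between values of the continuous cdf
      N.\<close>
    have "eventually (\<lambda>y. T x - e < T y) (at x)"
    proof (cases "T x - e < -R")
      case True
      have "T x - e < T y" for y using T(1)[of y] True by linarith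
      then show ?thesis by simp
    next
      case False
      then have "cdf M (T x - e) < Z * cdf N x" using sm[of "T x - e" "T x"] T[of x] e by simp
      then have "eventually (\<lambda>y. cdf M (T x - e) < Z * cdf N y) (at x)"
        using tl order_tendstoD(1) by blast
      then show ?thesis by eventually_elim (rule gt)
    qed
    moreover have "eventually (\<lambda>y. T y < T x + e) (at x)"
    proof (cases "T x + e > R")
      case True
      have "T y < T x + e" for y using T(2)[of y] True by linarith
      then show ?thesis by simp
    next
      case False
      then have "Z * cdf N x < cdf M (T x + e)" using sm[of "T x" "T x + e"] T[of x] e by simp
      then have "eventually (\<lambda>y. Z * cdf N y < cdf M (T x + e)) (at x)"
        using tl order_tendstoD(2) by blast
      then show ?thesis by eventually_elim (rule lt)
    qed
    ultimately show "eventually (\<lambda>y. dist (T y) (T x) < e) (at x)"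
      by eventually_elim (auto simp: dist_real_def)
  qed
  have "measure M {T x<..T y} = Z * measure N {x<..y}" if "x \<le> y" for x y
  proof (cases "x = y")
    case False
    then have "x < y" using that by simp
    have "measure M {T x<..T y} = cdf M (T y) - cdf M (T x)"
      using M.cdf_diff_eq[of "T x" "T y"] monoD[OF mT that] by (cases "T x = T y") auto
    also have "\<dots> = Z * measure N {x<..y}"
      using N.cdf_diff_eq[OF \<open>x<y\<close>] T by (simp add: algebra_simps)
    finally show ?thesis .
  qed simp
  then show ?thesis using that mT T ct by blast
qed

text \<open>A density with score \<open>B\<close> in the sense of finite differences: along the
  steps \<open>h n\<close> the values of \<nu> change by at least the first-order amount, up to
  errors \<delta> whose \<nu>-mean vanishes. The translations by +h and -h together replace the
  equation \<nu>' = -B \<nu>; \<open>inc\<close> bounds the mass of a short interval from below and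
  stands for \<nu>(x) h in the change of variables. All conditions tolerate null sets, so that a
  density known only through an almost-everywhere translation inequality qualifies.\<close>

locale score_density =
  fixes \<nu> B :: "real \<Rightarrow> real" and \<delta> :: "nat \<Rightarrow> real \<Rightarrow> real" and h :: "nat \<Rightarrow> real"
  assumes meas[measurable]: "\<nu> \<in> borel_measurable borel" "B \<in> borel_measurable borel"
      "\<And>n. \<delta> n \<in> borel_measurable borel"
    and nonneg: "\<And>x. 0 \<le> \<nu> x" and int_nu: "integrable lborel \<nu>" and prob: "(\<integral>x. \<nu> x \<partial>lborel) = 1"
    and int_B: "integrable lborel (\<lambda>x. \<nu> x * B x)"
    and int_xB: "integrable lborel (\<lambda>x. \<nu> x * (x * B x))"
    and h_pos: "\<And>n. 0 < h n" and h_lim: "h \<longlonglongrightarrow> 0"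
    and \<delta>_nonneg: "\<And>n x. 0 \<le> \<delta> n x" and int_\<delta>: "\<And>n. integrable lborel (\<lambda>x. \<nu> x * \<delta> n x)"
    and \<delta>_lim: "(\<lambda>n. \<integral>x. \<nu> x * \<delta> n x \<partial>lborel) \<longlonglongrightarrow> 0"
    and up: "\<And>n. AE x in lborel. \<nu> x * (1 - h n * B x - h n * \<delta> n x) \<le> \<nu> (x + h n)"
    and dn: "\<And>n. AE x in lborel. \<nu> x * (1 + h n * B x - h n * \<delta> n x) \<le> \<nu> (x - h n)"
    and inc: "\<And>n. AE x in lborel. 0 < \<nu> x \<longrightarrow>
       h n * \<nu> x * exp (- h n * \<bar>B x\<bar> - h n * \<delta> n x) \<le> measure (density lborel \<nu>) {x - h n<..x}"
begin

lemma integrable_bounded_mult: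
  fixes f g :: "real \<Rightarrow> real"
  assumes "integrable lborel f" "g \<in> borel_measurable borel" "\<And>x. \<bar>g x\<bar> \<le> K"
  shows "integrable lborel (\<lambda>x. f x * g x)"
proof (rule Bochner_Integration.integrable_bound[OF integrable_mult_right[OF assms(1), of K]])
  show "(\<lambda>x. f x * g x) \<in> borel_measurable lborel"
    using assms borel_measurable_integrable[OF assms(1)] by simp
  show "AE x in lborel. norm (f x * g x) \<le> norm (K * f x)"
  proof (intro AE_I2)
    fix x
    have "\<bar>f x\<bar> * \<bar>g x\<bar> \<le> \<bar>f x\<bar> * \<bar>K\<bar>" 
      using assms(3)[of x] by (intro mult_left_mono) auto
    then show "norm (f x * g x) \<le> norm (K * f x)" by (simp add: abs_mult mult.commute)
  qed
qed

lemma shift: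
  assumes [measurable]: "g \<in> borel_measurable borel" and "\<And>x. \<bar>g x\<bar> \<le> K"
  shows "integrable lborel (\<lambda>x. \<nu> (x + c) * g x)" "(\<integral>x. \<nu> (x + c) * g x \<partial>lborel) = (\<integral>x. \<nu> x * g (x - c) \<partial>lborel)"
proof -
  have i: "integrable lborel (\<lambda>x. \<nu> x * g (x - c))"
    by (rule integrable_bounded_mult[OF int_nu]) (use assms in auto)
  show "integrable lborel (\<lambda>x. \<nu> (x + c) * g x)"
    using lborel_integrable_real_affine[OF i, of 1 c] by (simp add: add.commute)
  show "(\<integral>x. \<nu> (x + c) * g x \<partial>lborel) = (\<integral>x. \<nu> x * g (x - c) \<partial>lborel)"
    using lborel_integral_real_affine[of 1 "\<lambda>x. \<nu> x * g (x - c)" c] by (simp add: add.commute)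
qed

context
  fixes g :: "real \<Rightarrow> real" and K :: real
  assumes g[measurable]: "g \<in> borel_measurable borel" and g0: "\<And>x. 0 \<le> g x" and gK: "\<And>x. g x \<le> K"
begin

lemma gabs: "\<bar>g x\<bar> \<le> K" using g0 gK by simp

lemma integrables:
  "integrable lborel (\<lambda>x. \<nu> x * g x)" "integrable lborel (\<lambda>x. \<nu> x * g (x + c))"
  "integrable lborel (\<lambda>x. \<nu> x * B x * g x)" "integrable lborel (\<lambda>x. \<nu> x * \<delta> n x * g x)"
  by (rule integrable_bounded_mult; use int_nu int_B int_\<delta> gabs in auto)+

lemma delta_bound: "(\<integral>x. \<nu> x * \<delta> n x * g x \<partial>lborel) \<le> K * (\<integral>x. \<nu> x * \<delta> n x \<partial>lborel)"
  unfolding integral_mult_right_zero[symmetric]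
proof (rule integral_mono)
  fix x show "\<nu> x * \<delta> n x * g x \<le> K * (\<nu> x * \<delta> n x)"
    using mult_left_mono[OF gK, of "\<nu> x * \<delta> n x" x] nonneg \<delta>_nonneg by (simp add: mult.commute)
qed (use integrables int_\<delta> in auto)

text \<open>One half of the integration by parts: \<open>up\<close> is tested against g \<ge> 0 and
  the shift is moved from \<nu> to g. The sign of g matters because \<open>up\<close> is an
  inequality; bounded functions of any sign are reached by adding a constant, as the score has mean
  zero.\<close>

lemma increment_le:
  "(\<integral>x. \<nu> x * (g x - g (x - h n)) \<partial>lborel) \<le>
    h n * (\<integral>x. \<nu> x * B x * g x \<partial>lborel) + h n * (K * (\<integral>x. \<nu> x * \<delta> n x \<partial>lborel))"
proof -
  have "(\<integral>x. \<nu> x * g x - h n * (\<nu> x * B x * g x) - h n * (\<nu> x * \<delta> n x * g x) \<partial>lborel)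
      \<le> (\<integral>x. \<nu> (x + h n) * g x \<partial>lborel)"
  proof (rule integral_mono_AE)
    show "AE x in lborel. \<nu> x * g x - h n * (\<nu> x * B x * g x) - h n * (\<nu> x * \<delta> n x * g x) \<le> \<nu> (x + h n) * g x"
      using up[of n]
    proof eventually_elim
      case (elim x)
      from mult_right_mono[OF this g0[of x]] show ?case by (simp add: algebra_simps)
    qed
  qed (use integrables shift(1)[OF g gabs] in auto)
  then have "(\<integral>x. \<nu> x * g x \<partial>lborel) - h n * (\<integral>x. \<nu> x * B x * g x \<partial>lborel) - h n * (\<integral>x. \<nu> x * \<delta> n x * g x \<partial>lborel)
     \<le> (\<integral>x. \<nu> x * g (x - h n) \<partial>lborel)"
    using integrables shift(2)[OF g gabs] by simp
  moreover have "(\<integral>x. \<nu> x * (g x - g (x - h n)) \<partial>lborel) = (\<integral>x. \<nu> x * g x \<partial>lborel) - (\<integral>x. \<nu> x * g (x - h n) \<partial>lborel)"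
    using integrables(1) integrables(2)[of "- h n"] by (simp add: right_diff_distrib)
  ultimately show ?thesis using mult_left_mono[OF delta_bound, of "h n" n] h_pos[of n] by linarith
qed

text \<open>The reverse half, from the translation in the opposite direction \<open>dn\<close>.
  After division by h the only error is K times the mean of \<delta>, which vanishes in the
  limit.\<close>

lemma le_increment:
  "h n * (\<integral>x. \<nu> x * B x * g x \<partial>lborel) \<le>
   (\<integral>x. \<nu> x * (g (x + h n) - g x) \<partial>lborel) + h n * (K * (\<integral>x. \<nu> x * \<delta> n x \<partial>lborel))"
proof -
  have "(\<integral>x. \<nu> x * g x + h n * (\<nu> x * B x * g x) - h n * (\<nu> x * \<delta> n x * g x) \<partial>lborel)
      \<le> (\<integral>x. \<nu> (x + - h n) * g x \<partial>lborel)"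
  proof (rule integral_mono_AE)
    show "AE x in lborel. \<nu> x * g x + h n * (\<nu> x * B x * g x) - h n * (\<nu> x * \<delta> n x * g x) \<le> \<nu> (x + - h n) * g x"
      using dn[of n]
    proof eventually_elim
      case (elim x)
      from mult_right_mono[OF this g0[of x]] show ?case by (simp add: algebra_simps)
    qed
  qed (use integrables shift(1)[OF g gabs, of "- h n"] in auto)
  then have "(\<integral>x. \<nu> x * g x \<partial>lborel) + h n * (\<integral>x. \<nu> x * B x * g x \<partial>lborel) - h n * (\<integral>x. \<nu> x * \<delta> n x * g x \<partial>lborel)
     \<le> (\<integral>x. \<nu> x * g (x + h n) \<partial>lborel)"
    using integrables shift(2)[OF g gabs, of "- h n"] by simp
  moreover have "(\<integral>x. \<nu> x * (g (x + h n) - g x) \<partial>lborel) = (\<integral>x. \<nu> x * g (x + h n) \<partial>lborel) - (\<integral>x. \<nu> x * g x \<partial>lborel)"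
    using integrables(1) integrables(2)[of "h n"] by (simp add: right_diff_distrib)
  ultimately show ?thesis using mult_left_mono[OF delta_bound, of "h n" n] h_pos[of n] by linarith
qed

end

text \<open>Both halves are applied to the constant 1, whose increments vanish.\<close>

lemma mean_score: "(\<integral>x. \<nu> x * B x \<partial>lborel) = 0"
proof (rule antisym)
  have "h n * (\<integral>x. \<nu> x * B x \<partial>lborel) \<le> h n * (\<integral>x. \<nu> x * \<delta> n x \<partial>lborel)" for n
    using le_increment[of "\<lambda>_. 1" 1 n] by simp
  then have "(\<integral>x. \<nu> x * B x \<partial>lborel) \<le> (\<integral>x. \<nu> x * \<delta> n x \<partial>lborel)" for n using h_pos by simp
  then show "(\<integral>x. \<nu> x * B x \<partial>lborel) \<le> 0" using \<delta>_lim by (intro LIMSEQ_le_const) auto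
  have "0 \<le> h n * ((\<integral>x. \<nu> x * B x \<partial>lborel) + (\<integral>x. \<nu> x * \<delta> n x \<partial>lborel))" for n
    using increment_le[of "\<lambda>_. 1" 1 n] by (simp add: distrib_left)
  then have "0 \<le> (\<integral>x. \<nu> x * B x \<partial>lborel) + (\<integral>x. \<nu> x * \<delta> n x \<partial>lborel)" for n
    using h_pos[of n] by (metis not_less zero_le_mult_iff)
  moreover have "(\<lambda>n. (\<integral>x. \<nu> x * B x \<partial>lborel) + (\<integral>x. \<nu> x * \<delta> n x \<partial>lborel)) \<longlonglongrightarrow> (\<integral>x. \<nu> x * B x \<partial>lborel) + 0"
    by (intro tendsto_intros \<delta>_lim)
  ultimately show "0 \<le> (\<integral>x. \<nu> x * B x \<partial>lborel)" by (intro LIMSEQ_le_const[of _ "\<integral>x. \<nu> x * B x \<partial>lborel" 0]) auto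
qed

text \<open>The identity is cut off at \<plusminus>m and shifted by m to become an admissible test
  function; its increments never exceed h, so the truncated moments are at most 1 + o(1). The limit
  m \<rightarrow> \<infinity> is dominated by |x B|. Only an upper bound is recorded, since this
  moment enters the estimate of ln Z with a plus sign, against the -1 of ln s \<le> s - 1.\<close>

lemma virial: "(\<integral>x. \<nu> x * (x * B x) \<partial>lborel) \<le> 1"
proof -
  define cl where "cl m x = max (- real m) (min (real m) x)" for m x
  have [measurable]: "cl m \<in> borel_measurable borel" for m unfolding cl_def by measurable
  have bd: "\<bar>cl m x\<bar> \<le> \<bar>x\<bar>" "\<bar>cl m x\<bar> \<le> m" for m x unfolding cl_def by auto
  have inB: "integrable lborel (\<lambda>x. \<nu> x * B x * cl m x)" for m
    by (rule integrable_bounded_mult[OF int_B]) (use bd in auto)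
  have A: "(\<integral>x. \<nu> x * B x * cl m x \<partial>lborel) \<le> 1" for m
  proof -
    have main: "(\<integral>x. \<nu> x * B x * cl m x \<partial>lborel) \<le> 1 + 2 * m * (\<integral>x. \<nu> x * \<delta> n x \<partial>lborel)" for n
    proof -
      let ?g = "\<lambda>x. cl m x + m"
      have "h n * (\<integral>x. \<nu> x * B x * ?g x \<partial>lborel) \<le>
         (\<integral>x. \<nu> x * (?g (x + h n) - ?g x) \<partial>lborel) + h n * (2 * m * (\<integral>x. \<nu> x * \<delta> n x \<partial>lborel))"
        by (rule le_increment) (auto simp: cl_def)
      also have "(\<integral>x. \<nu> x * B x * ?g x \<partial>lborel) = (\<integral>x. \<nu> x * B x * cl m x \<partial>lborel)"
        using inB int_B mean_score by (simp add: distrib_left)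
      also have "(\<integral>x. \<nu> x * (?g (x + h n) - ?g x) \<partial>lborel) \<le> (\<integral>x. \<nu> x * h n \<partial>lborel)"
      proof (rule integral_mono)
        show "integrable lborel (\<lambda>x. \<nu> x * (?g (x + h n) - ?g x))"
          by (rule integrable_bounded_mult[OF int_nu, of _ "h n"]) (use h_pos[of n] in \<open>auto simp: cl_def\<close>)
        show "\<nu> x * (?g (x + h n) - ?g x) \<le> \<nu> x * h n" for x
          by (rule mult_left_mono) (use h_pos[of n] nonneg in \<open>auto simp: cl_def\<close>)
      qed (use int_nu in auto)
      finally have "h n * (\<integral>x. \<nu> x * B x * cl m x \<partial>lborel) \<le> h n * (1 + 2 * m * (\<integral>x. \<nu> x * \<delta> n x \<partial>lborel))"
        using prob by (simp add: distrib_left)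
      then show ?thesis using h_pos[of n] by simp
    qed
    have "(\<lambda>n. 1 + 2 * real m * (\<integral>x. \<nu> x * \<delta> n x \<partial>lborel)) \<longlonglongrightarrow> 1 + 2 * real m * 0"
      by (intro tendsto_intros \<delta>_lim)
    then show ?thesis using main by (intro LIMSEQ_le_const[of _ 1]) auto
  qed
  have "(\<lambda>m. \<integral>x. \<nu> x * B x * cl m x \<partial>lborel) \<longlonglongrightarrow> (\<integral>x. \<nu> x * B x * x \<partial>lborel)"
  proof (rule integral_dominated_convergence)
    show "integrable lborel (\<lambda>x. \<bar>\<nu> x * (x * B x)\<bar>)" using int_xB by simp
    show "AE x in lborel. norm (\<nu> x * B x * cl m x) \<le> \<bar>\<nu> x * (x * B x)\<bar>" for m
    proof (intro AE_I2)
      fix x show "norm (\<nu> x * B x * cl m x) \<le> \<bar>\<nu> x * (x * B x)\<bar>"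
        using mult_left_mono[OF bd(1)[of m x], of "\<bar>\<nu> x * B x\<bar>"] by (simp add: abs_mult mult_ac)
    qed
    show "AE x in lborel. (\<lambda>m. \<nu> x * B x * cl m x) \<longlonglongrightarrow> \<nu> x * B x * x"
    proof (intro AE_I2 tendsto_mult tendsto_const)
      fix x
      have "eventually (\<lambda>m. cl m x = x) sequentially"
        using eventually_ge_at_top[of "nat \<lceil>\<bar>x\<bar>\<rceil>"]
      proof eventually_elim
        case (elim m)
        then have "\<bar>x\<bar> \<le> real m" by linarith
        then show ?case unfolding cl_def by auto
      qed
      then show "(\<lambda>m. cl m x) \<longlonglongrightarrow> x" by (simp add: tendsto_eventually)
    qed
  qed measurable
  then have "(\<integral>x. \<nu> x * B x * x \<partial>lborel) \<le> 1" using A by (intro LIMSEQ_le_const2) auto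
  then show ?thesis by (simp add: mult_ac)
qed

text \<open>The transport argument on [-R, R]. Z times the \<nu>-mass of (x - h, x] equals the
  \<open>w\<close>-mass of its image. The hypothesis bounds \<open>w\<close> on the image; taking
  logarithms gives ln Z \<le> dT / h - 1 + \<Xi> - B (T x - x) plus errors, and
  \<open>increment_le\<close> cancels dT / h against B T. Continuity of T removes the error |B| dT
  as h tends to 0.\<close>

lemma increment_mass_ge:
  assumes [measurable]: "w \<in> borel_measurable borel" and pos: "\<And>y. 0 < w y"
    and int: "integrable lborel (\<lambda>x. \<nu> x * \<Xi> x)"
    and bound: "AE x in lborel. 0 < \<nu> x \<longrightarrow> (\<forall>y. w y \<le> \<nu> x * exp (\<Xi> x - B x * (y - x)))"
    and R: "0 < R"
  shows "(\<integral>\<^sup>+y. ennreal (w y) * indicator {-R..R} y \<partial>lborel) \<le> ennreal (exp (\<integral>x. \<nu> x * \<Xi> x \<partial>lborel))"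
proof -
  have "\<not> (AE x in lborel. \<nu> x = 0)" using prob integral_cong_AE[of \<nu> lborel "\<lambda>_. 0"] by auto
  then obtain x0 where x0: "0 < \<nu> x0" "\<forall>y. w y \<le> \<nu> x0 * exp (\<Xi> x0 - B x0 * (y - x0))"
    proof -
    have "\<exists>x. 0 < \<nu> x \<and> (\<forall>y. w y \<le> \<nu> x * exp (\<Xi> x - B x * (y - x)))"
    proof (rule ccontr)
      assume no: "\<not> ?thesis"
      have "AE x in lborel. \<nu> x = 0"
        using bound by eventually_elim (use no nonneg in \<open>force simp: order_le_less\<close>)
      with \<open>\<not> (AE x in lborel. \<nu> x = 0)\<close> show False ..
    qed
    then show ?thesis using that by blast
  qed
  \<comment> \<open>A single point \<open>x0\<close> at which the bound holds dominates
    \<open>w\<close> on [-R, R] by a constant; this makes the target measure finite.\<close>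
  define K where "K = \<nu> x0 * exp (\<bar>\<Xi> x0\<bar> + \<bar>B x0\<bar> * (R + \<bar>x0\<bar>))"
  have K: "w y \<le> K" if "y \<in> {-R..R}" for y
  proof -
    have "- (B x0 * (y - x0)) \<le> \<bar>B x0\<bar> * \<bar>y - x0\<bar>" by (simp add: abs_mult[symmetric])
    also have "\<dots> \<le> \<bar>B x0\<bar> * (R + \<bar>x0\<bar>)" using that by (intro mult_left_mono) auto
    finally have "\<nu> x0 * exp (\<Xi> x0 - B x0 * (y - x0)) \<le> K"
      unfolding K_def using x0(1) by auto
    then show ?thesis using x0(2) by (meson order_trans)
  qed
  let ?wR = "\<lambda>y. ennreal (w y) * indicator {-R..R} y"
  define M where "M = density lborel ?wR"
  define N where "N = density lborel (\<lambda>x. ennreal (\<nu> x))"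
  have sM[simp]: "sets M = sets borel" and sN[simp]: "sets N = sets borel" by (auto simp: M_def N_def)
  have emM: "emeasure M A = (\<integral>\<^sup>+y. ?wR y * indicator A y \<partial>lborel)" if "A \<in> sets borel" for A
    unfolding M_def using that by (subst emeasure_density) auto
  have finM: "emeasure M UNIV < \<infinity>"
  proof -
    have "emeasure M UNIV \<le> (\<integral>\<^sup>+y. ennreal K * indicator {-R..R} y \<partial>lborel)"
      by (subst emM, simp, intro nn_integral_mono) (auto simp: indicator_def ennreal_leI K)
    also have "\<dots> = ennreal K * ennreal (2 * R)" using R by (subst nn_integral_cmult_indicator) auto
    finally show ?thesis by (simp add: ennreal_mult_less_top order_le_less_trans)
  qed
  have N1: "emeasure N UNIV = 1"
    unfolding N_def using nn_integral_eq_integral[OF int_nu] nonneg prob by (subst emeasure_density) auto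
  have spM: "space M = UNIV" and spN: "space N = UNIV" by (auto simp: M_def N_def)
  interpret M: finite_borel_measure M
    by (intro finite_borel_measure.intro finite_measureI finite_borel_measure_axioms.intro) (use finM spM in auto)
  interpret N: finite_borel_measure N
    by (intro finite_borel_measure.intro finite_measureI finite_borel_measure_axioms.intro) (use N1 spN in auto)
  have at: "measure M {x} = 0" "measure N {x} = 0" for x
  proof -
    have "AE y in lborel. y \<noteq> x" by (rule AE_lborel_singleton)
    then have "emeasure M {x} = 0"
      by (subst emM) (auto intro!: nn_integral_zero' elim!: eventually_mono simp: indicator_def)
    then show "measure M {x} = 0" by (simp add: measure_def)
    have "emeasure N {x} = 0" unfolding N_def using \<open>AE y in lborel. y \<noteq> x\<close>
      by (subst emeasure_density) (auto intro!: nn_integral_zero' elim!: eventually_mono simp: indicator_def)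
    then show "measure N {x} = 0" by (simp add: measure_def)
  qed
  define Z where "Z = measure M UNIV"
  have eZ: "ennreal Z = (\<integral>\<^sup>+y. ?wR y \<partial>lborel)"
    unfolding Z_def M.emeasure_eq_measure[symmetric] by (subst emM) auto
  have left: "measure M {..-R} = 0"
  proof -
    have "AE y in lborel. y \<noteq> -R" by (rule AE_lborel_singleton)
    then have "emeasure M {..-R} = 0"
      by (subst emM) (auto intro!: nn_integral_zero' elim!: eventually_mono simp: indicator_def)
    then show ?thesis by (simp add: measure_def)
  qed
  have right: "measure M {..R} = Z"
  proof -
    have "emeasure M {..R} = emeasure M UNIV"
      by (simp add: emM) (auto intro!: nn_integral_cong simp: indicator_def)
    then show ?thesis by (simp add: measure_def Z_def)
  qed
  have pos': "0 < measure M {a<..b}" if "- R \<le> a" "a < b" "b \<le> R" for a b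
  proof -
    have "emeasure M {a<..b} \<noteq> 0"
    proof
      assume "emeasure M {a<..b} = 0"
      then have "AE y in lborel. ?wR y * indicator {a<..b} y = 0"
        by (subst (asm) emM) (auto simp: nn_integral_0_iff_AE)
      then have "AE y in lborel. y \<notin> {a<..b}"
        by eventually_elim (use that in \<open>auto simp: indicator_def ennreal_eq_0_iff pos not_le[THEN iffD2, OF pos] split: if_splits\<close>)
      then have "emeasure lborel {a<..b} = 0" by (subst (asm) AE_iff_measurable[OF _ refl])
        (auto simp: greaterThanAtMost_def greaterThan_def atMost_def Int_def conj_commute)
      then show False using that by simp
    qed
    then show ?thesis by (metis M.emeasure_eq_measure ennreal_0 measure_nonneg order_le_less)
  qed
  obtain T where T: "mono T" "\<And>x. - R \<le> T x" "\<And>x. T x \<le> R"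
    "\<And>x y. x \<le> y \<Longrightarrow> measure M {T x<..T y} = Z * measure N {x<..y}"
    "\<And>x. continuous (at x) T"
    using monotone_transport_exists[OF M.finite_borel_measure_axioms N.finite_borel_measure_axioms at _ pos' left right R]
      N1 by (auto simp: measure_def)
  have Tm[measurable]: "T \<in> borel_measurable borel" using T(1) by (rule borel_measurable_mono)
  have Z: "0 < Z"
    using pos'[of "-R" R] R M.finite_measure_mono[of "{-R<..R}" UNIV] by (simp add: Z_def)
  define dT where "dT n x = T x - T (x - h n)" for n x
  have [measurable]: "dT n \<in> borel_measurable borel" for n unfolding dT_def by measurable
  have dT: "0 \<le> dT n x" "dT n x \<le> 2 * R" for n x
    using monoD[OF T(1), of "x - h n" x] h_pos[of n] T(2)[of "x - h n"] T(3)[of x] by (auto simp: dT_def)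
  \<comment> \<open>The bound ln s \<le> s - 1 at s = dT / h replaces the logarithm of the
    derivative of T. The term |B| dT pays for replacing a point y of the image interval by its right
    end \<open>T x\<close>; the terms with \<open>h n\<close> come from the exponential loss in
    \<open>inc\<close>.\<close>
  have step: "AE x in lborel. \<nu> x * ln Z \<le> (1 / h n) * (\<nu> x * dT n x) - \<nu> x + \<nu> x * \<Xi> x - \<nu> x * B x * T x
      + \<nu> x * (x * B x) + \<nu> x * \<bar>B x\<bar> * dT n x + h n * (\<nu> x * \<bar>B x\<bar>) + h n * (\<nu> x * \<delta> n x)" for n
    using inc[of n] bound
  proof eventually_elim
    case (elim x)
    show ?case
    proof (cases "0 < \<nu> x")
      case False
      then have "\<nu> x = 0" using nonneg[of x] by simp
      then show ?thesis by simp
    next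
      case True
      let ?a = "T (x - h n)" and ?b = "T x"
      let ?c = "\<Xi> x - B x * (T x - x) + \<bar>B x\<bar> * dT n x"
      have ub: "w y \<le> \<nu> x * exp ?c" if "y \<in> {?a<..?b}" for y
      proof -
        have "B x * (T x - y) \<le> \<bar>B x\<bar> * (T x - y)" using that by (intro mult_right_mono) auto
        also have "\<dots> \<le> \<bar>B x\<bar> * dT n x" using that by (intro mult_left_mono) (auto simp: dT_def)
        finally have "\<Xi> x - B x * (y - x) \<le> ?c" by (simp add: algebra_simps)
        then have "\<nu> x * exp (\<Xi> x - B x * (y - x)) \<le> \<nu> x * exp ?c" using True by simp
        then show ?thesis using elim(2) True by (meson order_trans)
      qed
      have "Z * (h n * \<nu> x * exp (- h n * \<bar>B x\<bar> - h n * \<delta> n x)) \<le> Z * measure N {x - h n<..x}"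
        using elim(1) True Z by (simp add: N_def)
      also have "\<dots> = measure M {?a<..?b}" using T(4)[of "x - h n" x] h_pos[of n] by simp
      also have "\<dots> \<le> \<nu> x * exp ?c * dT n x"
      proof -
        have "emeasure M {?a<..?b} \<le> (\<integral>\<^sup>+y. ennreal (\<nu> x * exp ?c) * indicator {?a<..?b} y \<partial>lborel)"
          by (subst emM) (auto intro!: nn_integral_mono ennreal_leI ub simp: indicator_def)
        also have "\<dots> = ennreal (\<nu> x * exp ?c) * ennreal (dT n x)"
          using dT(1)[of n x] by (subst nn_integral_cmult_indicator) (auto simp: dT_def)
        also have "\<dots> = ennreal (\<nu> x * exp ?c * dT n x)" using True dT by (simp add: ennreal_mult)
        finally show ?thesis
          using True dT(1)[of n x] by (simp add: M.emeasure_eq_measure)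
      qed
      finally have le: "Z * (h n * exp (- h n * \<bar>B x\<bar> - h n * \<delta> n x)) \<le> exp ?c * dT n x"
        using True by (simp add: mult_ac)
      have "0 < Z * (h n * exp (- h n * \<bar>B x\<bar> - h n * \<delta> n x))" using Z h_pos[of n] by simp
      with le have dpos: "0 < dT n x"
        by (metis dT(1) exp_gt_zero less_le_trans mult_zero_right order_le_less order_less_irrefl)
      have "ln Z + ln (h n) + (- h n * \<bar>B x\<bar> - h n * \<delta> n x) \<le> ?c + ln (dT n x)"
        using iffD2[OF ln_le_cancel_iff le] \<open>0 < Z * _\<close> le dpos Z h_pos[of n] by (simp add: ln_mult)
      moreover have "ln (dT n x) - ln (h n) \<le> dT n x / h n - 1"
        using ln_le_minus_one[of "dT n x / h n"] dpos h_pos[of n] by (simp add: ln_div)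
      ultimately have "ln Z \<le> dT n x / h n - 1 + ?c + h n * \<bar>B x\<bar> + h n * \<delta> n x" by linarith
      from mult_left_mono[OF this nonneg[of x]] show ?thesis by (simp add: algebra_simps)
    qed
  qed
  have Tabs: "\<bar>T x\<bar> \<le> R" for x using T(2)[of x] T(3)[of x] by auto
  have Tp: "0 \<le> T x + R" "T x + R \<le> 2 * R" for x using T(2)[of x] T(3)[of x] by auto
  have intB': "integrable lborel (\<lambda>x. \<nu> x * \<bar>B x\<bar>)" using integrable_abs[OF int_B] nonneg by (simp add: abs_mult)
  have iT: "integrable lborel (\<lambda>x. \<nu> x * B x * T x)" by (rule integrable_bounded_mult[OF int_B Tm Tabs])
  have idT: "integrable lborel (\<lambda>x. \<nu> x * dT n x)" for n
    by (rule integrable_bounded_mult[OF int_nu, of _ "2*R"]) (use dT in auto)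
  have iBdT: "integrable lborel (\<lambda>x. \<nu> x * \<bar>B x\<bar> * dT n x)" for n
    by (rule integrable_bounded_mult[OF intB', of _ "2*R"]) (use dT in auto)
  let ?D = "\<lambda>n. \<integral>x. \<nu> x * \<delta> n x \<partial>lborel"
  let ?E = "\<integral>x. \<nu> x * \<Xi> x \<partial>lborel"
  have main: "ln Z \<le> ?E + 2 * R * ?D n + (\<integral>x. \<nu> x * \<bar>B x\<bar> * dT n x \<partial>lborel) + h n * (\<integral>x. \<nu> x * \<bar>B x\<bar> \<partial>lborel) + h n * ?D n" for n
  proof -
    note ii = int_nu int iT int_xB intB' idT iBdT int_\<delta>
    have "(\<integral>x. \<nu> x * ln Z \<partial>lborel) \<le> (\<integral>x. (1 / h n) * (\<nu> x * dT n x) - \<nu> x + \<nu> x * \<Xi> x - \<nu> x * B x * T x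
      + \<nu> x * (x * B x) + \<nu> x * \<bar>B x\<bar> * dT n x + h n * (\<nu> x * \<bar>B x\<bar>) + h n * (\<nu> x * \<delta> n x) \<partial>lborel)"
      by (rule integral_mono_AE[OF _ _ step]) (use ii in auto)
    also have "\<dots> = (1 / h n) * (\<integral>x. \<nu> x * dT n x \<partial>lborel) - 1 + ?E - (\<integral>x. \<nu> x * B x * T x \<partial>lborel)
      + (\<integral>x. \<nu> x * (x * B x) \<partial>lborel) + (\<integral>x. \<nu> x * \<bar>B x\<bar> * dT n x \<partial>lborel) + h n * (\<integral>x. \<nu> x * \<bar>B x\<bar> \<partial>lborel) + h n * ?D n"
      using ii prob by simp
    finally have 1: "ln Z \<le> \<dots>" using prob by simp
    \<comment> \<open>T + R stands in for T because test functions must be nonnegative; the constant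
      drops out on both sides.\<close>
    have "(\<integral>x. \<nu> x * ((T x + R) - (T (x - h n) + R)) \<partial>lborel) \<le>
      h n * (\<integral>x. \<nu> x * B x * (T x + R) \<partial>lborel) + h n * (2 * R * ?D n)"
      by (rule increment_le) (use Tp in auto)
    also have "(\<integral>x. \<nu> x * B x * (T x + R) \<partial>lborel) = (\<integral>x. \<nu> x * B x * T x \<partial>lborel)"
      using iT int_B mean_score by (simp add: distrib_left)
    finally have "(\<integral>x. \<nu> x * dT n x \<partial>lborel) \<le> h n * ((\<integral>x. \<nu> x * B x * T x \<partial>lborel) + 2 * R * ?D n)"
      by (simp add: dT_def distrib_left)
    then have "(1 / h n) * (\<integral>x. \<nu> x * dT n x \<partial>lborel) \<le> (\<integral>x. \<nu> x * B x * T x \<partial>lborel) + 2 * R * ?D n"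
      using h_pos[of n] by (simp add: field_simps)
    then show ?thesis using 1 virial by linarith
  qed
  have lim: "(\<lambda>n. \<integral>x. \<nu> x * \<bar>B x\<bar> * dT n x \<partial>lborel) \<longlonglongrightarrow> (\<integral>x. \<nu> x * \<bar>B x\<bar> * 0 \<partial>lborel)"
  proof (rule integral_dominated_convergence)
    show "integrable lborel (\<lambda>x. \<nu> x * \<bar>B x\<bar> * (2 * R))" using intB' by simp
    show "AE x in lborel. norm (\<nu> x * \<bar>B x\<bar> * dT n x) \<le> \<nu> x * \<bar>B x\<bar> * (2 * R)" for n
      using dT nonneg by (intro AE_I2) (auto simp: abs_mult intro!: mult_left_mono)
    show "AE x in lborel. (\<lambda>n. \<nu> x * \<bar>B x\<bar> * dT n x) \<longlonglongrightarrow> \<nu> x * \<bar>B x\<bar> * 0"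
    proof (intro AE_I2 tendsto_mult tendsto_const)
      fix x
      have "(\<lambda>n. x - h n) \<longlonglongrightarrow> x - 0" by (intro tendsto_intros h_lim)
      then have "(\<lambda>n. T (x - h n)) \<longlonglongrightarrow> T x" using isCont_tendsto_compose[OF T(5)] by simp
      then show "(\<lambda>n. dT n x) \<longlonglongrightarrow> 0" unfolding dT_def by (auto intro!: tendsto_eq_intros)
    qed
  qed measurable
  have "(\<lambda>n. ?E + 2 * R * ?D n + (\<integral>x. \<nu> x * \<bar>B x\<bar> * dT n x \<partial>lborel) + h n * (\<integral>x. \<nu> x * \<bar>B x\<bar> \<partial>lborel) + h n * ?D n)
    \<longlonglongrightarrow> ?E + 2 * R * 0 + 0 + 0 * (\<integral>x. \<nu> x * \<bar>B x\<bar> \<partial>lborel) + 0 * 0"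
    using lim by (intro tendsto_intros \<delta>_lim h_lim) simp
  then have "ln Z \<le> ?E" using main by (intro LIMSEQ_le_const[of _ "?E"]) auto
  then have "Z \<le> exp ?E" using Z by (metis exp_le_cancel_iff exp_ln)
  then show ?thesis unfolding eZ[symmetric] by (rule ennreal_leI)
qed

text \<open>The bound on [-R, R] does not depend on R, so monotone convergence along an exhaustion
  of the line concludes.\<close>

lemma score_bound: "score_bound \<nu> B"
  unfolding score_bound_def
proof (intro allI impI)
  fix w \<Xi> :: "real \<Rightarrow> real"
  assume w[measurable]: "w \<in> borel_measurable borel" and *: "\<forall>y. 0 < w y" "integrable lborel (\<lambda>x. \<nu> x * \<Xi> x)"
    "AE x in lborel. 0 < \<nu> x \<longrightarrow> (\<forall>y. w y \<le> \<nu> x * exp (\<Xi> x - B x * (y - x)))"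
  have "(\<integral>\<^sup>+y. ennreal (w y) \<partial>lborel) = (\<integral>\<^sup>+y. (SUP n. ennreal (w y) * indicator {-real (Suc n)..real (Suc n)} y) \<partial>lborel)"
  proof (rule nn_integral_cong)
    fix y
    obtain m :: nat where "\<bar>y\<bar> \<le> real (Suc m)" using real_arch_simple[of "\<bar>y\<bar>"] by (metis le_Suc_eq linorder_linear of_nat_le_iff order_trans)
    then have "ennreal (w y) \<le> ennreal (w y) * indicator {-real (Suc m)..real (Suc m)} y" by (auto simp: indicator_def)
    also have "\<dots> \<le> (SUP n. ennreal (w y) * indicator {-real (Suc n)..real (Suc n)} y)" by (rule SUP_upper) simp
    finally show "ennreal (w y) = (SUP n. ennreal (w y) * indicator {-real (Suc n)..real (Suc n)} y)"
      by (intro antisym SUP_least) (auto simp: indicator_def)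
  qed
  also have "\<dots> = (SUP n. \<integral>\<^sup>+y. ennreal (w y) * indicator {-real (Suc n)..real (Suc n)} y \<partial>lborel)"
    by (intro nn_integral_monotone_convergence_SUP)
      (auto simp: incseq_def le_fun_def indicator_def)
  also have "\<dots> \<le> ennreal (exp (\<integral>x. \<nu> x * \<Xi> x \<partial>lborel))"
    by (intro SUP_least increment_mass_ge) (use * in auto)
  finally show "(\<integral>\<^sup>+y. ennreal (w y) \<partial>lborel) \<le> ennreal (exp (\<integral>x. \<nu> x * \<Xi> x \<partial>lborel))" .
qed

end

section \<open>Fubini for one distinguished coordinate of a finite product\<close>

context product_sigma_finite
begin

lemma measurable_insert_upd:
  "i \<notin> I \<Longrightarrow> (\<lambda>(y, x). x(i := y)) \<in> measurable (M i \<Otimes>\<^sub>M Pi\<^sub>M I M) (Pi\<^sub>M (insert i I) M)"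
  by measurable

text \<open>Tonelli on indicators. Presenting the enlarged product as an image of a binary product
  makes the almost-everywhere and Bochner forms of Fubini available for it.\<close>

lemma distr_insert:
  assumes I: "finite I" "i \<notin> I"
  shows "distr (M i \<Otimes>\<^sub>M Pi\<^sub>M I M) (Pi\<^sub>M (insert i I) M) (\<lambda>(y, x). x(i := y)) = Pi\<^sub>M (insert i I) M"
proof (rule measure_eqI)
  fix A assume "A \<in> sets (distr (M i \<Otimes>\<^sub>M Pi\<^sub>M I M) (Pi\<^sub>M (insert i I) M) (\<lambda>(y, x). x(i := y)))"
  then have A[measurable]: "A \<in> sets (Pi\<^sub>M (insert i I) M)" by simp
  interpret pair_sigma_finite "M i" "Pi\<^sub>M I M"
    by (simp add: I(1) pair_sigma_finite.intro sigma_finite sigma_finite_measures)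
  note [measurable] = measurable_insert_upd[OF I(2)]
  have "emeasure (distr (M i \<Otimes>\<^sub>M Pi\<^sub>M I M) (Pi\<^sub>M (insert i I) M) (\<lambda>(y, x). x(i := y))) A =
     (\<integral>\<^sup>+z. indicator A z \<partial>distr (M i \<Otimes>\<^sub>M Pi\<^sub>M I M) (Pi\<^sub>M (insert i I) M) (\<lambda>(y, x). x(i := y)))"
    by simp
  also have "\<dots> = (\<integral>\<^sup>+z. indicator A ((\<lambda>(y, x). x(i := y)) z) \<partial>(M i \<Otimes>\<^sub>M Pi\<^sub>M I M))"
    by (subst nn_integral_distr) auto
  also have "\<dots> = (\<integral>\<^sup>+y. \<integral>\<^sup>+x. indicator A (x(i := y)) \<partial>Pi\<^sub>M I M \<partial>M i)"
    by (subst M2.nn_integral_fst[symmetric]) auto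
  also have "\<dots> = (\<integral>\<^sup>+z. indicator A z \<partial>Pi\<^sub>M (insert i I) M)"
    by (rule product_nn_integral_insert_rev[symmetric]) (use I in auto)
  also have "\<dots> = emeasure (Pi\<^sub>M (insert i I) M) A" by simp
  finally show "emeasure (distr (M i \<Otimes>\<^sub>M Pi\<^sub>M I M) (Pi\<^sub>M (insert i I) M) (\<lambda>(y, x). x(i := y))) A
    = emeasure (Pi\<^sub>M (insert i I) M) A" .
qed simp

lemma AE_insert:
  assumes I: "finite I" "i \<notin> I" and ae: "AE z in Pi\<^sub>M (insert i I) M. P z"
  shows "AE y in M i. AE x in Pi\<^sub>M I M. P (x(i := y))"
proof -
  interpret pair_sigma_finite "M i" "Pi\<^sub>M I M"
    by (simp add: I(1) pair_sigma_finite.intro sigma_finite sigma_finite_measures)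
  have "AE z in distr (M i \<Otimes>\<^sub>M Pi\<^sub>M I M) (Pi\<^sub>M (insert i I) M) (\<lambda>(y, x). x(i := y)). P z"
    using ae by (simp only: distr_insert[OF I])
  then have "AE z in M i \<Otimes>\<^sub>M Pi\<^sub>M I M. P ((\<lambda>(y, x). x(i := y)) z)"
    by (rule AE_distrD[OF measurable_insert_upd[OF I(2)]])
  then show ?thesis by (auto dest: AE_pair)
qed

lemma integrable_insert:
  fixes f :: "_ \<Rightarrow> real"
  assumes I: "finite I" "i \<notin> I" and f: "integrable (Pi\<^sub>M (insert i I) M) f"
  shows "AE y in M i. integrable (Pi\<^sub>M I M) (\<lambda>x. f (x(i := y)))" (is ?A)
    and "integrable (M i) (\<lambda>y. \<integral>x. f (x(i := y)) \<partial>Pi\<^sub>M I M)" (is ?B)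
    and "(\<integral>z. f z \<partial>Pi\<^sub>M (insert i I) M) = (\<integral>y. \<integral>x. f (x(i := y)) \<partial>Pi\<^sub>M I M \<partial>M i)" (is ?C)
proof -
  interpret pair_sigma_finite "M i" "Pi\<^sub>M I M"
    by (simp add: I(1) pair_sigma_finite.intro sigma_finite sigma_finite_measures)
  have *: "integrable (M i \<Otimes>\<^sub>M Pi\<^sub>M I M) (\<lambda>(y, x). f (x(i := y)))"
    using integrable_distr[OF measurable_insert_upd[OF I(2)], of f] f
    unfolding distr_insert[OF I] by (simp add: case_prod_beta')
  show ?A using AE_integrable_fst'[OF *] by simp
  show ?B using integrable_fst'[OF *] by simp
  have "(\<integral>z. f z \<partial>Pi\<^sub>M (insert i I) M) = (\<integral>z. f ((\<lambda>(y, x). x(i := y)) z) \<partial>(M i \<Otimes>\<^sub>M Pi\<^sub>M I M))"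
    using integral_distr[OF measurable_insert_upd[OF I(2)], of f] f
    by (simp add: distr_insert[OF I] borel_measurable_integrable)
  then show ?C using integral_fst'[OF *] by (simp add: case_prod_beta')
qed

end

text \<open>Guarantees that a statement holding almost everywhere on a slice holds somewhere; it
  refutes that a positive function has integral zero. The empty product is included.\<close>

lemma PiM_lborel_nonnull: "finite I \<Longrightarrow> emeasure (Pi\<^sub>M I (\<lambda>_. lborel :: real measure)) (space (Pi\<^sub>M I (\<lambda>_. lborel))) \<noteq> 0"
proof -
  assume I: "finite I"
  interpret product_sigma_finite "\<lambda>_::'a. lborel :: real measure" by standard
  have "emeasure (Pi\<^sub>M I (\<lambda>_. lborel :: real measure)) (Pi\<^sub>E I (\<lambda>_. UNIV)) = (\<Prod>i\<in>I. emeasure (lborel::real measure) UNIV)"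
    by (rule emeasure_PiM) (use I in auto)
  also have "\<dots> \<noteq> 0" using I by simp
  finally show ?thesis by (simp add: space_PiM)
qed

text \<open>Induction over coordinates in the manner of the Prekopa-Leindler inequality. For fixed
  values s and t of coordinate k the induction hypothesis integrates out the others, with \<Xi>
  frozen at s; what remains is a one-dimensional bound for the partial integral \<open>u\<close>, in
  which \<Xi> is replaced by its mean \<Psi> over the other coordinates. Since \<Xi> and
  \<open>w\<close> may couple all coordinates, the factors cannot simply be treated
  independently.\<close>

lemma score_bound_PiM:
  fixes \<nu> B :: "'i \<Rightarrow> real \<Rightarrow> real"
  assumes fin: "finite I"
    and sb: "\<And>j. j \<in> I \<Longrightarrow> score_bound (\<nu> j) (B j)"
    and [measurable]: "\<And>j. \<nu> j \<in> borel_measurable borel"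
    and pos: "\<And>j x. 0 < \<nu> j x"
    and prob: "\<And>j. prob_space (density lborel (\<nu> j))"
    and w: "w \<in> borel_measurable (Pi\<^sub>M I (\<lambda>_. lborel))" "\<And>y. y \<in> space (Pi\<^sub>M I (\<lambda>_. lborel)) \<Longrightarrow> 0 < w y"
    and \<Xi>: "integrable (Pi\<^sub>M I (\<lambda>j. density lborel (\<nu> j))) \<Xi>"
    and bound: "\<And>x y. x \<in> space (Pi\<^sub>M I (\<lambda>_. lborel)) \<Longrightarrow> y \<in> space (Pi\<^sub>M I (\<lambda>_. lborel)) \<Longrightarrow>
        w y \<le> (\<Prod>j\<in>I. \<nu> j (x j)) * exp (\<Xi> x - (\<Sum>j\<in>I. B j (x j) * (y j - x j)))"
  shows "(\<integral>\<^sup>+y. ennreal (w y) \<partial>Pi\<^sub>M I (\<lambda>_. lborel)) \<le> ennreal (exp (\<integral>x. \<Xi> x \<partial>Pi\<^sub>M I (\<lambda>j. density lborel (\<nu> j))))"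
  using fin sb w \<Xi> bound
proof (induction I arbitrary: w \<Xi> rule: finite_induct)
  case empty
  interpret N: product_prob_space "\<lambda>j. density lborel (\<nu> j)" by (simp add: product_prob_space_def product_prob_space_axioms_def product_sigma_finite_def prob prob_space_imp_sigma_finite)
  show ?case using empty(5)[of "\<lambda>_. undefined" "\<lambda>_. undefined"]
    by (simp add: space_PiM PiM_empty nn_integral_count_space_finite lebesgue_integral_count_space_finite ennreal_leI)
next
  case (insert k I)
  interpret L: product_sigma_finite "\<lambda>_::'i. lborel :: real measure" by standard
  interpret N: product_prob_space "\<lambda>j. density lborel (\<nu> j)" by (simp add: product_prob_space_def product_prob_space_axioms_def product_sigma_finite_def prob prob_space_imp_sigma_finite)
  let ?L = "Pi\<^sub>M I (\<lambda>_. lborel :: real measure)" and ?N = "Pi\<^sub>M I (\<lambda>j. density lborel (\<nu> j))"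
  note w[measurable] = insert.prems(2)
  have sp: "x(k := t) \<in> space (Pi\<^sub>M (insert k I) (\<lambda>_. lborel))" if "x \<in> space ?L" for x and t :: real
    using that by (auto simp: space_PiM PiE_def extensional_def)
  define u where "u t = (\<integral>\<^sup>+x. ennreal (w (x(k := t))) \<partial>?L)" for t
  define \<Psi> where "\<Psi> s = (\<integral>x. \<Xi> (x(k := s)) \<partial>?N)" for s
  note ins = N.integrable_insert[OF insert(1,2) insert.prems(4)]
  interpret sfL: sigma_finite_measure ?L by (rule L.sigma_finite) fact
  have um[measurable]: "u \<in> borel_measurable borel"
  proof -
    have "(\<lambda>t. \<integral>\<^sup>+x. ennreal (w (x(k := t))) \<partial>?L) \<in> borel_measurable lborel"
      using insert(2) by measurable
    then show ?thesis by (simp add: u_def[abs_def])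
  qed
  \<comment> \<open>The factor \<nu>_k(s) exp(- B_k(s) (t - s)) is constant in the remaining
    variables and is moved into \<Xi> through its logarithm; here positivity of \<nu>
    enters.\<close>
  have ub: "u t \<le> ennreal (\<nu> k s * exp (\<Psi> s - B k s * (t - s)))"
    if s: "integrable ?N (\<lambda>x. \<Xi> (x(k := s)))" for s t
  proof -
    have "u t \<le> ennreal (exp (\<integral>x. \<Xi> (x(k := s)) + (ln (\<nu> k s) - B k s * (t - s)) \<partial>?N))"
      unfolding u_def
    proof (rule insert.IH)
      show "score_bound (\<nu> j) (B j)" if "j \<in> I" for j using insert.prems(1) that by auto
      show "(\<lambda>x. w (x(k := t))) \<in> borel_measurable ?L" using insert(2) by measurable
      show "0 < w (x(k := t))" if "x \<in> space ?L" for x using insert.prems(3)[OF sp[OF that]] .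
      show "integrable ?N (\<lambda>x. \<Xi> (x(k := s)) + (ln (\<nu> k s) - B k s * (t - s)))"
        using s N.P.finite_measure by (intro Bochner_Integration.integrable_add) (auto intro: finite_measure.integrable_const N.finite_measure_axioms prob_space.finite_measure N.prob_space_axioms prob_space_PiM prob)
      fix x y assume xy: "x \<in> space ?L" "y \<in> space ?L"
      have "w (y(k := t)) \<le> (\<Prod>j\<in>insert k I. \<nu> j ((x(k := s)) j)) *
         exp (\<Xi> (x(k := s)) - (\<Sum>j\<in>insert k I. B j ((x(k := s)) j) * ((y(k := t)) j - (x(k := s)) j)))"
        by (rule insert.prems(5)[OF sp[OF xy(1)] sp[OF xy(2)]])
      also have "(\<Prod>j\<in>insert k I. \<nu> j ((x(k := s)) j)) = \<nu> k s * (\<Prod>j\<in>I. \<nu> j (x j))"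
        using insert(1,2) by (auto intro!: prod.cong)
      also have "(\<Sum>j\<in>insert k I. B j ((x(k := s)) j) * ((y(k := t)) j - (x(k := s)) j)) =
         B k s * (t - s) + (\<Sum>j\<in>I. B j (x j) * (y j - x j))"
        using insert(1,2) by (auto intro!: sum.cong)
      also have "\<nu> k s * (\<Prod>j\<in>I. \<nu> j (x j)) * exp (\<Xi> (x(k := s)) - (B k s * (t - s) + (\<Sum>j\<in>I. B j (x j) * (y j - x j))))
        = (\<Prod>j\<in>I. \<nu> j (x j)) * exp (\<Xi> (x(k := s)) + (ln (\<nu> k s) - B k s * (t - s)) - (\<Sum>j\<in>I. B j (x j) * (y j - x j)))"
        using pos[of k s] by (simp add: exp_add exp_diff divide_simps)
      finally show "w (y(k := t)) \<le> \<dots>" .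
    qed
    also have "(\<integral>x. \<Xi> (x(k := s)) + (ln (\<nu> k s) - B k s * (t - s)) \<partial>?N) = \<Psi> s + (ln (\<nu> k s) - B k s * (t - s))"
      unfolding \<Psi>_def using s by (subst Bochner_Integration.integral_add)
        (auto simp: prob_space.prob_space[OF prob_space_PiM[OF prob]] intro: finite_measure.integrable_const prob_space.finite_measure prob_space_PiM prob)
    also have "exp \<dots> = \<nu> k s * exp (\<Psi> s - B k s * (t - s))"
      using pos[of k s] by (simp add: exp_add exp_diff divide_simps)
    finally show ?thesis .
  qed
  \<comment> \<open>Slices of \<Xi> are integrable only for almost every s. Positivity of \<nu>_k
    transfers this from the weighted measure to Lebesgue measure.\<close>
  have aeN: "AE s in lborel. integrable ?N (\<lambda>x. \<Xi> (x(k := s)))"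
    using ins(1) pos by (subst (asm) AE_density) auto
  have "\<exists>s. integrable ?N (\<lambda>x. \<Xi> (x(k := s)))"
    using eventually_happens[OF aeN] ae_filter_eq_bot_iff[of "lborel :: real measure"] by simp
  then obtain s0 where s0: "integrable ?N (\<lambda>x. \<Xi> (x(k := s0)))" ..
  have ufin: "u t < \<infinity>" for t using order_le_less_trans[OF ub[OF s0]] by simp
  have upos: "u t \<noteq> 0" for t
  proof
    assume "u t = 0"
    then have "AE x in ?L. ennreal (w (x(k := t))) = 0"
      unfolding u_def using insert(2) by (subst (asm) nn_integral_0_iff_AE) auto
    then have "AE x in ?L. False"
      by (rule AE_mp) (use insert.prems(3)[OF sp] in \<open>auto intro!: AE_I2 simp: ennreal_eq_0_iff not_le simp del: fun_upd_apply\<close>)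
    then have "emeasure ?L (space ?L) = 0" by (subst (asm) AE_iff_measurable[OF _ refl]) auto
    with PiM_lborel_nonnull[OF insert(1)] show False by simp
  qed
  have Psi_int: "integrable lborel (\<lambda>s. \<nu> k s * \<Psi> s)" "(\<integral>s. \<nu> k s * \<Psi> s \<partial>lborel) = (\<integral>x. \<Xi> x \<partial>Pi\<^sub>M (insert k I) (\<lambda>j. density lborel (\<nu> j)))"
  proof -
    have m: "\<Psi> \<in> borel_measurable lborel"
      using ins(2) unfolding \<Psi>_def[abs_def, symmetric] by (auto dest!: borel_measurable_integrable)
    show "integrable lborel (\<lambda>s. \<nu> k s * \<Psi> s)"
      using ins(2) m unfolding \<Psi>_def[symmetric] by (subst (asm) integrable_density) (auto simp: pos less_imp_le)
    show "(\<integral>s. \<nu> k s * \<Psi> s \<partial>lborel) = (\<integral>x. \<Xi> x \<partial>Pi\<^sub>M (insert k I) (\<lambda>j. density lborel (\<nu> j)))"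
      unfolding ins(3) \<Psi>_def[symmetric] using m by (subst integral_density) (auto simp: pos less_imp_le)
  qed
  have "AE s in lborel. 0 < \<nu> k s \<longrightarrow> (\<forall>t. enn2real (u t) \<le> \<nu> k s * exp (\<Psi> s - B k s * (t - s)))"
    using aeN
  proof eventually_elim
    case (elim s)
    show ?case
    proof (intro impI allI)
      fix t show "enn2real (u t) \<le> \<nu> k s * exp (\<Psi> s - B k s * (t - s))"
        using enn2real_mono[OF ub[OF elim, of t]] pos[of k s] by simp
    qed
  qed
  moreover have "0 < enn2real (u t)" for t
    using ufin[of t] upos[of t] by (simp add: enn2real_positive_iff zero_less_iff_neq_zero)
  ultimately have "(\<integral>\<^sup>+t. ennreal (enn2real (u t)) \<partial>lborel) \<le> ennreal (exp (\<integral>s. \<nu> k s * \<Psi> s \<partial>lborel))"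
    using insert.prems(1)[of k] Psi_int(1) unfolding score_bound_def by auto
  also have "(\<integral>\<^sup>+t. ennreal (enn2real (u t)) \<partial>lborel) = (\<integral>\<^sup>+t. u t \<partial>lborel)"
    using ufin by (intro nn_integral_cong) simp
  also have "\<dots> = (\<integral>\<^sup>+y. ennreal (w y) \<partial>Pi\<^sub>M (insert k I) (\<lambda>_. lborel))"
    unfolding u_def by (rule L.product_nn_integral_insert_rev[symmetric]) (use insert(1,2) in auto)
  finally show ?case unfolding Psi_int(2) .
qed

section \<open>Tensorization of squared differences\<close>

lemma quadrilateral:
  fixes a b c d :: real
  shows "(a - d)\<^sup>2 + (c - b)\<^sup>2 \<le> (a - c)\<^sup>2 + (b - d)\<^sup>2 + (a - b)\<^sup>2 + (c - d)\<^sup>2"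
proof -
  have "(a - c)\<^sup>2 + (b - d)\<^sup>2 + (a - b)\<^sup>2 + (c - d)\<^sup>2 - ((a - d)\<^sup>2 + (c - b)\<^sup>2) = (a - b - c + d)\<^sup>2"
    by (simp add: power2_eq_square algebra_simps)
  then show ?thesis by (smt (verit) zero_le_power2)
qed

text \<open>The Efron-Stein inequality with the variance written as a double integral of squared
  differences, so that in nonnegative integrals no integrability of f has to be known. For z = (s,
  x) and z' = (s', x') the four values of f form a quadrilateral whose diagonals are controlled by
  its sides: sides with equal s fall under the induction hypothesis, sides with equal x under the
  one-coordinate hypothesis for k.\<close>

lemma (in product_prob_space) double_square_tensor:
  fixes f :: "('i \<Rightarrow> 'a) \<Rightarrow> real" and g :: "'i \<Rightarrow> ('i \<Rightarrow> 'a) \<Rightarrow> ennreal"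
  assumes fin: "finite J"
    and f: "f \<in> borel_measurable (Pi\<^sub>M J M)" and g: "\<And>k. k \<in> J \<Longrightarrow> g k \<in> borel_measurable (Pi\<^sub>M J M)"
    and one: "\<And>k x. k \<in> J \<Longrightarrow> x \<in> space (Pi\<^sub>M J M) \<Longrightarrow>
      (\<integral>\<^sup>+s. \<integral>\<^sup>+s'. ennreal ((f (x(k := s)) - f (x(k := s')))\<^sup>2) \<partial>M k \<partial>M k) \<le> (\<integral>\<^sup>+s. g k (x(k := s)) \<partial>M k)"
  shows "(\<integral>\<^sup>+x. \<integral>\<^sup>+x'. ennreal ((f x - f x')\<^sup>2) \<partial>Pi\<^sub>M J M \<partial>Pi\<^sub>M J M) \<le> (\<Sum>k\<in>J. \<integral>\<^sup>+x. g k x \<partial>Pi\<^sub>M J M)"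
  using assms
proof (induction J arbitrary: f g rule: finite_induct)
  case empty
  then show ?case by (simp add: PiM_empty nn_integral_count_space_finite)
next
  case (insert k J)
  let ?P = "Pi\<^sub>M J M" and ?Q = "Pi\<^sub>M (insert k J) M"
  note [measurable] = insert.prems(1,2)
  interpret PJ: prob_space ?P by (rule prob_space_PiM) (rule prob_space)
  interpret PP: pair_sigma_finite ?P ?P ..
  interpret kP: pair_sigma_finite "M k" ?P ..
  have kJ: "k \<notin> J" by fact
  have fm[measurable]: "(\<lambda>p. f ((snd p)(k := fst p))) \<in> borel_measurable (M k \<Otimes>\<^sub>M ?P)"
    by measurable
  have gm[measurable]: "(\<lambda>p. g j ((snd p)(k := fst p))) \<in> borel_measurable (M k \<Otimes>\<^sub>M ?P)" if "j \<in> insert k J" for j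
    using insert.prems(2)[OF that] by measurable
  define a where "a s x = f (x(k := s))" for s x
  have am[measurable]: "case_prod a \<in> borel_measurable (M k \<Otimes>\<^sub>M ?P)"
    using fm by (simp add: a_def[abs_def] case_prod_beta')
  have sp: "x(k := s) \<in> space ?Q" if "x \<in> space ?P" "s \<in> space (M k)" for x s
    using that by (auto simp: space_PiM PiE_def extensional_def)
  define Q where "Q s = (\<integral>\<^sup>+x. \<integral>\<^sup>+x'. ennreal ((a s x - a s x')\<^sup>2) \<partial>?P \<partial>?P)" for s
  define R where "R s s' = (\<integral>\<^sup>+x. ennreal ((a s x - a s' x)\<^sup>2) \<partial>?P)" for s s'
  have Qm[measurable]: "Q \<in> borel_measurable (M k)" unfolding Q_def[abs_def] by measurable
  have Rm[measurable]: "case_prod R \<in> borel_measurable (M k \<Otimes>\<^sub>M M k)" unfolding R_def[abs_def] by measurable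
  \<comment> \<open>Exchanging x and x' turns one diagonal into the other, so twice the integral of
    one diagonal is the integral of both.\<close>
  have J: "2 * (\<integral>\<^sup>+x. \<integral>\<^sup>+x'. ennreal ((a s x - a s' x')\<^sup>2) \<partial>?P \<partial>?P) \<le> Q s + Q s' + 2 * R s s'"
    if [measurable]: "s \<in> space (M k)" "s' \<in> space (M k)" for s s'
  proof -
    have [measurable]: "a s \<in> borel_measurable ?P" "a s' \<in> borel_measurable ?P"
      using measurable_Pair2[OF am that(1)] measurable_Pair2[OF am that(2)] by auto
    have sw: "(\<integral>\<^sup>+x. \<integral>\<^sup>+x'. ennreal ((a s x - a s' x')\<^sup>2) \<partial>?P \<partial>?P) = (\<integral>\<^sup>+x. \<integral>\<^sup>+x'. ennreal ((a s x' - a s' x)\<^sup>2) \<partial>?P \<partial>?P)"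
      by (rule PP.Fubini') measurable
    have "2 * (\<integral>\<^sup>+x. \<integral>\<^sup>+x'. ennreal ((a s x - a s' x')\<^sup>2) \<partial>?P \<partial>?P) =
       (\<integral>\<^sup>+x. \<integral>\<^sup>+x'. ennreal ((a s x - a s' x')\<^sup>2) + ennreal ((a s x' - a s' x)\<^sup>2) \<partial>?P \<partial>?P)"
      unfolding mult_2 by (subst (2) sw) (simp add: nn_integral_add)
    also have "\<dots> \<le> (\<integral>\<^sup>+x. \<integral>\<^sup>+x'. ennreal ((a s x - a s x')\<^sup>2) + ennreal ((a s' x - a s' x')\<^sup>2)
        + ennreal ((a s x - a s' x)\<^sup>2) + ennreal ((a s x' - a s' x')\<^sup>2) \<partial>?P \<partial>?P)"
      by (intro nn_integral_mono) (use quadrilateral in \<open>auto simp flip: ennreal_plus intro!: ennreal_leI\<close>)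
    also have "\<dots> = Q s + Q s' + 2 * R s s'"
      unfolding Q_def R_def by (simp add: nn_integral_add PJ.emeasure_space_1 mult_2 add.assoc)
    finally show ?thesis .
  qed
  have "(\<integral>\<^sup>+z. \<integral>\<^sup>+z'. ennreal ((f z - f z')\<^sup>2) \<partial>?Q \<partial>?Q) =
     (\<integral>\<^sup>+s. \<integral>\<^sup>+x. \<integral>\<^sup>+s'. \<integral>\<^sup>+x'. ennreal ((a s x - a s' x')\<^sup>2) \<partial>?P \<partial>M k \<partial>?P \<partial>M k)"
    by (subst product_nn_integral_insert_rev; (simp add: insert(1,2) a_def[symmetric] del: fun_upd_apply)?)
      (subst product_nn_integral_insert_rev; simp add: insert(1,2) a_def)
  also have "\<dots> = (\<integral>\<^sup>+s. \<integral>\<^sup>+s'. \<integral>\<^sup>+x. \<integral>\<^sup>+x'. ennreal ((a s x - a s' x')\<^sup>2) \<partial>?P \<partial>?P \<partial>M k \<partial>M k)"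
    by (rule nn_integral_cong, rule kP.Fubini') measurable
  finally have E1: "(\<integral>\<^sup>+z. \<integral>\<^sup>+z'. ennreal ((f z - f z')\<^sup>2) \<partial>?Q \<partial>?Q) = \<dots>" .
  have "2 * (\<integral>\<^sup>+s. \<integral>\<^sup>+s'. \<integral>\<^sup>+x. \<integral>\<^sup>+x'. ennreal ((a s x - a s' x')\<^sup>2) \<partial>?P \<partial>?P \<partial>M k \<partial>M k) =
     (\<integral>\<^sup>+s. \<integral>\<^sup>+s'. 2 * (\<integral>\<^sup>+x. \<integral>\<^sup>+x'. ennreal ((a s x - a s' x')\<^sup>2) \<partial>?P \<partial>?P) \<partial>M k \<partial>M k)"
    by (subst nn_integral_cmult[symmetric], measurable, intro nn_integral_cong, subst nn_integral_cmult[symmetric]) measurable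
  also have "\<dots> \<le> (\<integral>\<^sup>+s. \<integral>\<^sup>+s'. Q s + Q s' + 2 * R s s' \<partial>M k \<partial>M k)"
    by (intro nn_integral_mono J) auto
  also have "\<dots> = 2 * ((\<integral>\<^sup>+s. Q s \<partial>M k) + (\<integral>\<^sup>+s. \<integral>\<^sup>+s'. R s s' \<partial>M k \<partial>M k))"
  proof -
    have "(\<integral>\<^sup>+s. \<integral>\<^sup>+s'. Q s + Q s' + 2 * R s s' \<partial>M k \<partial>M k) = (\<integral>\<^sup>+s. Q s + (\<integral>\<^sup>+s'. Q s' \<partial>M k) + 2 * (\<integral>\<^sup>+s'. R s s' \<partial>M k) \<partial>M k)"
    proof (rule nn_integral_cong)
      fix s assume "s \<in> space (M k)"
      then have [measurable]: "R s \<in> borel_measurable (M k)" using measurable_Pair2[OF Rm] by simp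
      show "(\<integral>\<^sup>+s'. Q s + Q s' + 2 * R s s' \<partial>M k) = Q s + (\<integral>\<^sup>+s'. Q s' \<partial>M k) + 2 * (\<integral>\<^sup>+s'. R s s' \<partial>M k)"
        by (simp add: nn_integral_add nn_integral_cmult M.emeasure_space_1)
    qed
    also have "\<dots> = 2 * ((\<integral>\<^sup>+s. Q s \<partial>M k) + (\<integral>\<^sup>+s. \<integral>\<^sup>+s'. R s s' \<partial>M k \<partial>M k))"
      by (simp add: nn_integral_add nn_integral_cmult M.emeasure_space_1 distrib_left) (simp add: mult_2)
    finally show ?thesis .
  qed
  finally have E2: "(\<integral>\<^sup>+s. \<integral>\<^sup>+s'. \<integral>\<^sup>+x. \<integral>\<^sup>+x'. ennreal ((a s x - a s' x')\<^sup>2) \<partial>?P \<partial>?P \<partial>M k \<partial>M k) \<le>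
     (\<integral>\<^sup>+s. Q s \<partial>M k) + (\<integral>\<^sup>+s. \<integral>\<^sup>+s'. R s s' \<partial>M k \<partial>M k)"
    by (subst (asm) ennreal_mult_le_mult_iff) auto
  have "(\<integral>\<^sup>+s. Q s \<partial>M k) \<le> (\<integral>\<^sup>+s. (\<Sum>j\<in>J. \<integral>\<^sup>+x. g j (x(k := s)) \<partial>?P) \<partial>M k)"
  proof (rule nn_integral_mono)
    fix s assume s[measurable]: "s \<in> space (M k)"
    have m: "(\<lambda>x. g j (x(k := s))) \<in> borel_measurable ?P" if "j \<in> insert k J" for j
      using measurable_Pair2[OF gm[OF that] s] by simp
    show "Q s \<le> (\<Sum>j\<in>J. \<integral>\<^sup>+x. g j (x(k := s)) \<partial>?P)"
      unfolding Q_def a_def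
    proof (rule insert.IH)
      show "(\<lambda>x. f (x(k := s))) \<in> borel_measurable ?P" using measurable_Pair2[OF fm s] by simp
      show "(\<lambda>x. g j (x(k := s))) \<in> borel_measurable ?P" if "j \<in> J" for j using m that by simp
      fix j x assume j: "j \<in> J" and x: "x \<in> space ?P"
      from j have "j \<noteq> k" using j kJ by auto
      show "(\<integral>\<^sup>+ sa. \<integral>\<^sup>+ s'. ennreal ((f (x(j := sa, k := s)) - f (x(j := s', k := s)))\<^sup>2) \<partial>M j \<partial>M j)
           \<le> (\<integral>\<^sup>+ sa. g j (x(j := sa, k := s)) \<partial>M j)"
        using insert.prems(3)[OF insertI2[OF j] sp[OF x s]] by (simp only: fun_upd_twist[OF \<open>j \<noteq> k\<close>])
    qed
  qed
  also have "\<dots> = (\<Sum>j\<in>J. \<integral>\<^sup>+s. \<integral>\<^sup>+x. g j (x(k := s)) \<partial>?P \<partial>M k)"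
    by (rule nn_integral_sum) (rule PJ.borel_measurable_nn_integral, use gm in \<open>simp add: case_prod_beta'\<close>)
  also have "\<dots> = (\<Sum>j\<in>J. \<integral>\<^sup>+z. g j z \<partial>?Q)"
    by (intro sum.cong refl product_nn_integral_insert_rev[symmetric]) (use insert in auto)
  finally have E3: "(\<integral>\<^sup>+s. Q s \<partial>M k) \<le> (\<Sum>j\<in>J. \<integral>\<^sup>+z. g j z \<partial>?Q)" .
  have "(\<integral>\<^sup>+s. \<integral>\<^sup>+s'. R s s' \<partial>M k \<partial>M k) = (\<integral>\<^sup>+x. \<integral>\<^sup>+s. \<integral>\<^sup>+s'. ennreal ((a s x - a s' x)\<^sup>2) \<partial>M k \<partial>M k \<partial>?P)"
  proof -
    have "(\<integral>\<^sup>+s. \<integral>\<^sup>+s'. R s s' \<partial>M k \<partial>M k) = (\<integral>\<^sup>+s. \<integral>\<^sup>+x. \<integral>\<^sup>+s'. ennreal ((a s x - a s' x)\<^sup>2) \<partial>M k \<partial>?P \<partial>M k)"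
      unfolding R_def by (rule nn_integral_cong, rule kP.Fubini'[symmetric]) measurable
    also have "\<dots> = (\<integral>\<^sup>+x. \<integral>\<^sup>+s. \<integral>\<^sup>+s'. ennreal ((a s x - a s' x)\<^sup>2) \<partial>M k \<partial>M k \<partial>?P)"
      by (rule kP.Fubini'[symmetric]) measurable
    finally show ?thesis .
  qed
  also have "\<dots> \<le> (\<integral>\<^sup>+x. \<integral>\<^sup>+s. g k (x(k := s)) \<partial>M k \<partial>?P)"
    unfolding a_def
  proof (rule nn_integral_mono)
    fix x assume x: "x \<in> space ?P"
    obtain s0 where "s0 \<in> space (M k)" using M.not_empty by auto
    then show "(\<integral>\<^sup>+ s. \<integral>\<^sup>+ s'. ennreal ((f (x(k := s)) - f (x(k := s')))\<^sup>2) \<partial>M k \<partial>M k) \<le> (\<integral>\<^sup>+ s. g k (x(k := s)) \<partial>M k)"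
      using insert.prems(3)[OF insertI1 sp[OF x, of s0]] by (simp only: fun_upd_upd)
  qed
  also have "\<dots> = (\<integral>\<^sup>+z. g k z \<partial>?Q)"
    by (rule product_nn_integral_insert[symmetric]) (use insert in auto)
  finally have E4: "(\<integral>\<^sup>+s. \<integral>\<^sup>+s'. R s s' \<partial>M k \<partial>M k) \<le> (\<integral>\<^sup>+z. g k z \<partial>?Q)" .
  show ?case unfolding E1 using E2 add_mono[OF E3 E4] insert(1,2)
    by (auto simp: add.commute intro: order_trans)
qed

section \<open>Strongly log-concave densities on the line: Poincare inequality and score
  bound\<close>

lemma nn_integral_reflect:
  fixes f :: "real \<Rightarrow> ennreal"
  assumes "f \<in> borel_measurable borel"
  shows "(\<integral>\<^sup>+x. f x \<partial>lborel) = (\<integral>\<^sup>+x. f (- x) \<partial>lborel)"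
  using nn_integral_real_affine[OF assms, of "-1" 0] by simp

text \<open>Strong convexity is expressed by increments of \<open>U'\<close>: for the conditional
  densities the derivative of the potential will be an averaged slope, for which exactly such
  increments are controlled.\<close>

locale strongly_convex_potential =
  fixes U U' :: "real \<Rightarrow> real" and l :: real
  assumes deriv: "\<And>x. (U has_real_derivative U' x) (at x)"
    and mono: "\<And>x y. x \<le> y \<Longrightarrow> l * (y - x) \<le> U' y - U' x"
    and l: "0 < l"
    and prob: "prob_space (density lborel (\<lambda>x. ennreal (exp (- U x))))"
begin

abbreviation "N \<equiv> density lborel (\<lambda>x. ennreal (exp (- U x)))"

sublocale N: prob_space N by (rule prob)

lemma U_cont: "continuous_on A U"
  by (rule DERIV_continuous_on[OF has_field_derivative_at_within[OF deriv]])

lemma U_meas[measurable]: "U \<in> borel_measurable borel"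
  using U_cont by (intro borel_measurable_continuous_onI) 

lemma U'_mono: "x \<le> y \<Longrightarrow> U' x \<le> U' y"
  using mono[of x y] l mult_nonneg_nonneg[of l "y - x"] by linarith

lemma U'_meas[measurable]: "U' \<in> borel_measurable borel"
  by (rule borel_measurable_mono) (auto simp: mono_def U'_mono)

text \<open>The symmetry that turns each statement about right tails into its counterpart for left
  tails.\<close>

lemma reflect: "strongly_convex_potential (\<lambda>x. U (- x)) (\<lambda>x. - U' (- x)) l"
proof (rule strongly_convex_potential.intro)
  show "((\<lambda>x. U (- x)) has_real_derivative - U' (- x)) (at x)" for x
    by (rule DERIV_chain2[of U "U' (- x)" uminus x "- 1" UNIV, simplified]) (auto intro!: deriv derivative_eq_intros)
  show "l * (y - x) \<le> - U' (- y) - - U' (- x)" if "x \<le> y" for x y using mono[of "-y" "-x"] that by simp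
  show "0 < l" by (rule l)
  show "prob_space (density lborel (\<lambda>x. ennreal (exp (- U (- x)))))"
  proof
    have "emeasure N UNIV = (\<integral>\<^sup>+x. ennreal (exp (- U x)) \<partial>lborel)"
      by (subst emeasure_density) auto
    also have "\<dots> = (\<integral>\<^sup>+x. ennreal (exp (- U (- x))) \<partial>lborel)"
      by (rule nn_integral_reflect) simp
    finally show "emeasure (density lborel (\<lambda>x. ennreal (exp (- U (- x))))) (space (density lborel (\<lambda>x. ennreal (exp (- U (- x)))))) = 1"
      using N.emeasure_space_1 by (subst emeasure_density) auto
  qed
qed

lemma tendsto_at_top: "((\<lambda>x. exp (- U x)) \<longlongrightarrow> 0) at_top"
proof -
  \<comment> \<open>Beyond \<open>x0\<close> strong monotonicity gives U' \<ge> 1, hence at least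
    linear growth of U.\<close>
  define x0 where "x0 = (1 + \<bar>U' 0\<bar>) / l"
  have x0: "0 < x0" "l * x0 = 1 + \<bar>U' 0\<bar>" using l by (auto simp: x0_def intro!: divide_pos_pos)
  have U'1: "1 \<le> U' x" if "x0 \<le> x" for x
  proof -
    have "l * x0 \<le> l * x" using that l by simp
    then show ?thesis using mono[of 0 x] x0 that by simp
  qed
  have "x + (U x0 - x0) \<le> U x" if "x0 \<le> x" for x
  proof (cases "x0 = x")
    case False
    then have "x0 < x" using that by simp
    then obtain z where "x0 < z" "z < x" "U x - U x0 = (x - x0) * U' z"
      using MVT2[OF _ deriv] by metis
    moreover have "(x - x0) * 1 \<le> (x - x0) * U' z" using \<open>x0 < z\<close> that by (intro mult_left_mono U'1) auto
    ultimately show ?thesis by (simp add: algebra_simps)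
  qed simp
  then have "eventually (\<lambda>x. x + (U x0 - x0) \<le> U x) at_top" by (rule eventually_at_top_linorderI)
  moreover have "filterlim (\<lambda>x. x + (U x0 - x0)) at_top at_top"
    using filterlim_tendsto_add_at_top[OF tendsto_const filterlim_ident, of "U x0 - x0"] by (simp add: add.commute)
  ultimately have "filterlim U at_top at_top" by (rule filterlim_at_top_mono[rotated])
  then have "filterlim (\<lambda>x. - U x) at_bot at_top" by (simp add: filterlim_uminus_at_top)
  then show ?thesis by (rule filterlim_compose[OF exp_at_bot])
qed

lemma cdf_deriv: "(cdf N has_real_derivative exp (- U x)) (at x)"
proof -
  interpret R: real_distribution N by (intro real_distribution.intro real_distribution_axioms.intro prob) auto
  let ?\<Phi> = "\<lambda>y. integral {x - 1..y} (\<lambda>s. exp (- U s))"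
  have c: "continuous_on A (\<lambda>s. exp (- U s))" for A by (intro continuous_intros U_cont)
  have "(?\<Phi> has_real_derivative exp (- U x)) (at x within {x - 1..x + 1})"
    by (rule integral_has_real_derivative) (auto intro: c)
  then have d: "(?\<Phi> has_real_derivative exp (- U x)) (at x)"
    by (subst (asm) at_within_interior) auto
  have "cdf N y = cdf N (x - 1) + ?\<Phi> y" if "x - 1 < y" for y
  proof -
    have "emeasure N {x-1<..y} = (\<integral>\<^sup>+s. ennreal (exp (- U s)) * indicator {x - 1..y} s \<partial>lborel)"
    proof -
      have "AE s in lborel. s \<noteq> x - 1" by (rule AE_lborel_singleton)
      then have "AE s in lborel. ennreal (exp (- U s)) * indicator {x-1<..y} s = ennreal (exp (- U s)) * indicator {x - 1..y} s"
        by eventually_elim (auto simp: indicator_def)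
      then show ?thesis by (subst emeasure_density) (auto intro!: nn_integral_cong_AE)
    qed
    also have "\<dots> = ennreal (?\<Phi> y)"
      by (rule nn_integral_has_integral_lebesgue') (auto intro: integrable_integral integrable_continuous_real c)
    finally have "measure N {x-1<..y} = ?\<Phi> y"
      using integral_nonneg[OF integrable_continuous_real[OF c], of "x-1" y] by (simp add: measure_def)
    then show ?thesis using R.cdf_diff_eq[OF that] by simp
  qed
  then have *: "cdf N y = cdf N (x - 1) + ?\<Phi> y" if "y \<in> {x - 1<..}" for y using that by simp
  have "eventually (\<lambda>y. y \<in> {x - 1<..}) (nhds x)" by (rule eventually_nhds_in_open) auto
  then have "eventually (\<lambda>y. cdf N y = cdf N (x - 1) + ?\<Phi> y) (nhds x)"
    by (rule eventually_mono) (rule *)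
  moreover have "((\<lambda>y. cdf N (x - 1) + ?\<Phi> y) has_real_derivative exp (- U x)) (at x)"
    using d by (auto intro!: derivative_eq_intros)
  ultimately show ?thesis by (subst DERIV_cong_ev[OF refl _ refl]) auto
qed

text \<open>U' exp(-U) is an exact derivative, so -exp(-U) - U'(s) F, with F the distribution
  function, is an antiderivative of (U' - U'(s)) exp(-U).\<close>

lemma right_tail:
  "(\<integral>\<^sup>+y. ennreal ((U' y - U' s) * exp (- U y)) * indicator {s..} y \<partial>lborel)
     = ennreal (exp (- U s) - U' s * (1 - cdf N s))"
proof -
  interpret R: real_distribution N by (intro real_distribution.intro real_distribution_axioms.intro prob) auto
  have "((\<lambda>y. - exp (- U y) - U' s * cdf N y) has_real_derivative (U' x - U' s) * exp (- U x)) (at x)" for x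
    by (auto intro!: derivative_eq_intros deriv cdf_deriv simp: algebra_simps)
  moreover have "((\<lambda>y. - exp (- U y) - U' s * cdf N y) \<longlongrightarrow> - 0 - U' s * 1) at_top"
    using R.cdf_lim_at_top_prob by (intro tendsto_intros tendsto_at_top) 
  ultimately have "(\<integral>\<^sup>+y. ennreal ((U' y - U' s) * exp (- U y)) * indicator {s..} y \<partial>lborel)
     = ennreal ((- 0 - U' s * 1) - (- exp (- U s) - U' s * cdf N s))"
    by (intro nn_integral_FTC_atLeast[where F="\<lambda>y. - exp (- U y) - U' s * cdf N y"]) (auto simp: U'_mono)
  then show ?thesis by (simp add: algebra_simps)
qed

lemma no_atoms: "measure N {x} = 0"
proof -
  have "AE y in lborel. y \<noteq> x" by (rule AE_lborel_singleton)
  then have "emeasure N {x} = 0"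
    by (subst emeasure_density) (auto intro!: nn_integral_zero' elim!: eventually_mono simp: indicator_def)
  then show ?thesis by (simp add: measure_def)
qed

text \<open>Single points carry no mass, so open and closed tails may be exchanged.\<close>

lemma cdf_reflect: "1 - cdf (density lborel (\<lambda>x. ennreal (exp (- U (- x))))) (- s) = cdf N s"
proof -
  interpret r: strongly_convex_potential "\<lambda>x. U (- x)" "\<lambda>x. - U' (- x)" l by (rule reflect)
  let ?r = "density lborel (\<lambda>x. ennreal (exp (- U (- x))))"
  have "emeasure ?r {- s<..} = (\<integral>\<^sup>+x. ennreal (exp (- U (- x))) * indicator {- s<..} x \<partial>lborel)"
    by (subst emeasure_density) auto
  also have "\<dots> = (\<integral>\<^sup>+x. ennreal (exp (- U x)) * indicator {..<s} x \<partial>lborel)"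
    by (subst nn_integral_reflect) (auto intro!: nn_integral_cong simp: indicator_def)
  also have "\<dots> = emeasure N {..<s}" by (subst emeasure_density) auto
  finally have "measure ?r {- s<..} = measure N {..<s}" by (simp add: measure_def)
  moreover have "measure N {..s} = measure N {..<s} + measure N {s}"
  proof -
    have "{..s} = {..<s} \<union> {s}" by auto
    then show ?thesis by (simp only:) (rule N.finite_measure_Union; auto)
  qed
  moreover have "measure ?r {- s<..} = 1 - measure ?r {..(- s)}"
  proof -
    have "{- s<..} = space ?r - {..(- s)}" by auto
    then show ?thesis by (simp only:) (rule r.N.prob_compl; simp)
  qed
  ultimately show ?thesis by (simp add: cdf_def no_atoms)
qed

text \<open>The antiderivative of the tail formula is nondecreasing to the right of s. The sign has
  to be recorded because \<open>ennreal\<close> cuts off negative values and the two tail formulas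
  will be added as real numbers.\<close>

lemma right_tail_nonneg: "0 \<le> exp (- U s) - U' s * (1 - cdf N s)"
proof -
  interpret R: real_distribution N by (intro real_distribution.intro real_distribution_axioms.intro prob) auto
  let ?\<phi> = "\<lambda>y. - exp (- U y) - U' s * cdf N y"
  have lim: "(?\<phi> \<longlongrightarrow> - 0 - U' s * 1) at_top"
    using R.cdf_lim_at_top_prob by (intro tendsto_intros tendsto_at_top)
  have d: "(?\<phi> has_real_derivative (U' x - U' s) * exp (- U x)) (at x)" for x
    by (auto intro!: derivative_eq_intros deriv cdf_deriv simp: algebra_simps)
  have "?\<phi> s \<le> ?\<phi> y" if "s \<le> y" for y
  proof (rule DERIV_nonneg_imp_nondecreasing[OF that])
    fix x assume "s \<le> x"
    then have "0 \<le> (U' x - U' s) * exp (- U x)" by (simp add: U'_mono)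
    with d show "\<exists>y. (?\<phi> has_real_derivative y) (at x) \<and> 0 \<le> y" by blast
  qed
  then have "eventually (\<lambda>y. ?\<phi> s \<le> ?\<phi> y) at_top" by (rule eventually_at_top_linorderI)
  then have "?\<phi> s \<le> - 0 - U' s * 1"
    by (intro tendsto_lowerbound[OF lim]) auto
  then show ?thesis by (simp add: algebra_simps)
qed

lemma left_tail_nonneg: "0 \<le> exp (- U s) + U' s * cdf N s"
proof -
  interpret r: strongly_convex_potential "\<lambda>x. U (- x)" "\<lambda>x. - U' (- x)" l by (rule reflect)
  show ?thesis using r.right_tail_nonneg[of "- s"] cdf_reflect[of s] by simp
qed

lemma left_tail:
  "(\<integral>\<^sup>+x. ennreal ((U' s - U' x) * exp (- U x)) * indicator {..s} x \<partial>lborel)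
     = ennreal (exp (- U s) + U' s * cdf N s)"
proof -
  interpret r: strongly_convex_potential "\<lambda>x. U (- x)" "\<lambda>x. - U' (- x)" l by (rule reflect)
  have "(\<integral>\<^sup>+x. ennreal ((U' s - U' x) * exp (- U x)) * indicator {..s} x \<partial>lborel) =
    (\<integral>\<^sup>+y. ennreal ((- U' (- y) - - U' (- (- s))) * exp (- U (- y))) * indicator {- s..} y \<partial>lborel)"
    by (subst nn_integral_reflect[of "\<lambda>x. ennreal ((U' s - U' x) * exp (- U x)) * indicator {..s} x"])
      (auto intro!: nn_integral_cong simp: indicator_def)
  then show ?thesis using r.right_tail[of "- s"] cdf_reflect[of s] by simp
qed

lemma convex: "convex_on UNIV U"
  by (rule convex_on_realI[where f'=U']) (auto intro: deriv U'_mono)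

lemma tangent_le: "U x + U' x * (y - x) \<le> U y"
proof -
  consider "x < y" | "x = y" | "y < x" by linarith
  then show ?thesis
  proof cases
    case 1
    then obtain z where z: "x < z" "z < y" "U y - U x = (y - x) * U' z" using MVT2[OF _ deriv] by metis
    then have "(y - x) * U' x \<le> (y - x) * U' z" by (intro mult_left_mono U'_mono) auto
    then show ?thesis using z(3) by (simp add: mult.commute)
  next
    case 3
    then obtain z where z: "y < z" "z < x" "U x - U y = (x - y) * U' z" using MVT2[OF _ deriv] by metis
    then have "(x - y) * U' z \<le> (x - y) * U' x" by (intro mult_left_mono U'_mono) auto
    then show ?thesis using z(3) by (simp add: algebra_simps)
  qed simp
qed

text \<open>The double integral is the covariance of the identity with the indicator of {s<..}, that
  is, the Stein kernel times the density. Where x < s < y, l (y - x) \<le> (U' y - U' s) + (U' s -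
  U' x). Each bracket integrates to a tail formula, the other variable contributing F or 1 - F; the
  terms with U'(s) cancel and exactly exp(-U s) is left. Here strong log-concavity becomes the
  Poincare constant.\<close>

lemma covariance_kernel_le:
  "ennreal l * (\<integral>\<^sup>+x. \<integral>\<^sup>+y. indicator {x<..<y} s * ennreal (y - x) \<partial>N \<partial>N) \<le> ennreal (exp (- U s))"
proof -
  let ?A = "\<lambda>y. ennreal (U' y - U' s) * indicator {s..} y" and ?B = "\<lambda>x. ennreal (U' s - U' x) * indicator {..s} x"
  have A: "(\<integral>\<^sup>+y. ?A y \<partial>N) = ennreal (exp (- U s) - U' s * (1 - cdf N s))"
    unfolding right_tail[symmetric]
    by (subst nn_integral_density) (auto intro!: nn_integral_cong simp: indicator_def U'_mono mult.commute simp flip: ennreal_mult)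
  have B: "(\<integral>\<^sup>+x. ?B x \<partial>N) = ennreal (exp (- U s) + U' s * cdf N s)"
    unfolding left_tail[symmetric]
    by (subst nn_integral_density) (auto intro!: nn_integral_cong simp: indicator_def U'_mono mult.commute simp flip: ennreal_mult)
  have F: "emeasure N {..s} = ennreal (cdf N s)" "emeasure N {s..} = ennreal (1 - cdf N s)"
  proof -
    show "emeasure N {..s} = ennreal (cdf N s)" by (simp add: cdf_def N.emeasure_eq_measure)
    have "{s..} = insert s {s<..}" by auto
    then have "measure N {s..} = measure N {s<..} + measure N {s}"
      by (subst N.finite_measure_Union[symmetric]) auto
    also have "\<dots> = 1 - measure N {..s}"
      using N.prob_compl[of "{..s}"] by (simp add: no_atoms Compl_eq_Diff_UNIV[symmetric])
    finally show "emeasure N {s..} = ennreal (1 - cdf N s)" by (simp add: N.emeasure_eq_measure cdf_def)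
  qed
  have A0: "0 \<le> exp (- U s) - U' s * (1 - cdf N s)" "0 \<le> exp (- U s) + U' s * cdf N s"
    by (rule right_tail_nonneg left_tail_nonneg)+
  have "ennreal l * (\<integral>\<^sup>+x. \<integral>\<^sup>+y. indicator {x<..<y} s * ennreal (y - x) \<partial>N \<partial>N)
    = (\<integral>\<^sup>+x. \<integral>\<^sup>+y. ennreal l * (indicator {x<..<y} s * ennreal (y - x)) \<partial>N \<partial>N)"
  proof -
    have [measurable]: "Measurable.pred (borel \<Otimes>\<^sub>M borel) (\<lambda>p. s \<in> {fst p<..<snd p :: real})" by simp
    show ?thesis by (simp add: nn_integral_cmult indicator_def cong: if_cong)
  qed
  also have "\<dots> \<le> (\<integral>\<^sup>+x. \<integral>\<^sup>+y. ?A y * indicator {..s} x + ?B x * indicator {s..} y \<partial>N \<partial>N)"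
  proof (intro nn_integral_mono)
    fix x y
    show "ennreal l * (indicator {x<..<y} s * ennreal (y - x)) \<le> ?A y * indicator {..s} x + ?B x * indicator {s..} y"
    proof (cases "x < s \<and> s < y")
      case True
      have "ennreal l * ennreal (y - x) \<le> ennreal ((U' y - U' s) + (U' s - U' x))"
        using mono[of x y] True l by (subst ennreal_mult[symmetric]) (auto intro!: ennreal_leI)
      also have "\<dots> = ennreal (U' y - U' s) + ennreal (U' s - U' x)"
        using True by (intro ennreal_plus) (auto intro!: U'_mono)
      finally show ?thesis using True by (simp add: indicator_def)
    qed (auto simp: indicator_def)
  qed
  also have "\<dots> = (\<integral>\<^sup>+x. (\<integral>\<^sup>+y. ?A y \<partial>N) * indicator {..s} x + ?B x * emeasure N {s..} \<partial>N)"
    by (intro nn_integral_cong) (simp add: nn_integral_add nn_integral_multc nn_integral_cmult)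
  also have "\<dots> = (\<integral>\<^sup>+y. ?A y \<partial>N) * emeasure N {..s} + (\<integral>\<^sup>+x. ?B x \<partial>N) * emeasure N {s..}"
    by (simp add: nn_integral_add nn_integral_multc nn_integral_cmult)
  also have "\<dots> = ennreal ((exp (- U s) - U' s * (1 - cdf N s)) * cdf N s + (exp (- U s) + U' s * cdf N s) * (1 - cdf N s))"
    unfolding A B F using A0 by (simp add: cdf_def ennreal_mult ennreal_plus)
  also have "\<dots> = ennreal (exp (- U s))" by (simp add: algebra_simps)
  finally show ?thesis .
qed

end

text \<open>Cauchy-Schwarz for the integral of f', obtained by expanding the nonnegative integral of
  (f' - m)^2 at the mean slope m. The open interval is chosen to match the covariance
  kernel.\<close>

lemma square_increment_le:
  fixes f f' :: "real \<Rightarrow> real"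
  assumes d: "\<And>x. (f has_real_derivative f' x) (at x)" and c: "continuous_on UNIV f'" and "x < y"
  shows "ennreal ((f y - f x)\<^sup>2) \<le> (\<integral>\<^sup>+s. ennreal ((y - x) * (f' s)\<^sup>2) * indicator {x<..<y} s \<partial>lborel)"
proof -
  have cc: "continuous_on A f'" for A by (rule continuous_on_subset[OF c]) simp
  define m where "m = (f y - f x) / (y - x)"
  have I: "(f' has_integral (f y - f x)) {x..y}"
  proof (rule fundamental_theorem_of_calculus)
    show "(f has_vector_derivative f' s) (at s within {x..y})" for s
      using has_field_derivative_at_within[OF d] by (simp add: has_real_derivative_iff_has_vector_derivative)
  qed (use \<open>x < y\<close> in simp)
  define J where "J = integral {x..y} (\<lambda>s. (f' s)\<^sup>2)"
  have J: "((\<lambda>s. (f' s)\<^sup>2) has_integral J) {x..y}"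
    unfolding J_def by (intro integrable_integral integrable_continuous_real continuous_intros cc)
  have "((\<lambda>s. (f' s)\<^sup>2 - 2 * m * f' s + m\<^sup>2) has_integral (J - 2 * m * (f y - f x) + m\<^sup>2 * (y - x))) {x..y}"
  proof -
    have "((\<lambda>s. m\<^sup>2) has_integral (m\<^sup>2 * (y - x))) {x..y}"
      using has_integral_const_real[of "m\<^sup>2" x y] \<open>x < y\<close> by (simp add: mult.commute)
    then show ?thesis
      by (rule has_integral_add[OF has_integral_diff[OF J has_integral_mult_right[OF I]]])
  qed
  moreover have "(f' s)\<^sup>2 - 2 * m * f' s + m\<^sup>2 = (f' s - m)\<^sup>2" for s by (simp add: power2_eq_square algebra_simps)
  ultimately have "0 \<le> J - 2 * m * (f y - f x) + m\<^sup>2 * (y - x)"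
    by (metis (no_types, lifting) has_integral_nonneg zero_le_power2)
  moreover have "m * (f y - f x) = (f y - f x)\<^sup>2 / (y - x)" "m\<^sup>2 * (y - x) = (f y - f x)\<^sup>2 / (y - x)"
    using \<open>x < y\<close> by (auto simp: m_def power2_eq_square)
  ultimately have "(f y - f x)\<^sup>2 / (y - x) \<le> J" by simp
  then have "(f y - f x)\<^sup>2 \<le> (y - x) * J"
    using \<open>x < y\<close> by (simp add: field_simps)
  then have "ennreal ((f y - f x)\<^sup>2) \<le> ennreal ((y - x) * J)" by (rule ennreal_leI)
  also have "\<dots> = (\<integral>\<^sup>+s. ennreal ((y - x) * (f' s)\<^sup>2) * indicator {x..y} s \<partial>lborel)"
    using \<open>x < y\<close> by (intro nn_integral_has_integral_lebesgue'[symmetric] has_integral_mult_right[OF J]) simp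
  also have "\<dots> = (\<integral>\<^sup>+s. ennreal ((y - x) * (f' s)\<^sup>2) * indicator {x<..<y} s \<partial>lborel)"
  proof (rule nn_integral_cong_AE)
    have "AE s in lborel. s \<noteq> x" "AE s in lborel. s \<noteq> y" by (rule AE_lborel_singleton)+
    then show "AE s in lborel. ennreal ((y - x) * (f' s)\<^sup>2) * indicator {x..y} s = ennreal ((y - x) * (f' s)\<^sup>2) * indicator {x<..<y} s"
      by eventually_elim (auto simp: indicator_def)
  qed
  finally show ?thesis .
qed

context strongly_convex_potential
begin

text \<open>By symmetry one may take x < y, at the price of a factor 2. After Cauchy-Schwarz on
  [x, y] and Tonelli, the weight of f'(s)^2 is the covariance kernel at s. The left side is twice
  the variance, so the constant is 1 / l.\<close>

lemma poincare:
  fixes f f' :: "real \<Rightarrow> real"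
  assumes d: "\<And>x. (f has_real_derivative f' x) (at x)" and c: "continuous_on UNIV f'"
  shows "(\<integral>\<^sup>+x. \<integral>\<^sup>+y. ennreal ((f x - f y)\<^sup>2) \<partial>N \<partial>N) \<le> (\<integral>\<^sup>+s. ennreal (2 / l * (f' s)\<^sup>2) \<partial>N)"
proof -
  have fm[measurable]: "f \<in> borel_measurable borel" 
    by (intro borel_measurable_continuous_onI DERIV_continuous_on[OF has_field_derivative_at_within[OF d]])
  have f'm[measurable]: "f' \<in> borel_measurable borel" using c by (rule borel_measurable_continuous_onI)
  interpret NN: pair_sigma_finite N N ..
  interpret NL: pair_sigma_finite N lborel ..
  define k where "k x y = (if x < y then ennreal ((f y - f x)\<^sup>2) else 0)" for x y
  define q where "q s x y = (if x < s \<and> s < y then ennreal (y - x) else 0)" for s x y :: real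
  have km: "(\<lambda>p. k (fst p) (snd p)) \<in> borel_measurable (borel \<Otimes>\<^sub>M borel)" unfolding k_def by measurable
  have k1[measurable (raw)]: "(\<lambda>z. k (a z) (b z)) \<in> borel_measurable M" if "a \<in> borel_measurable M" "b \<in> borel_measurable M" for a b M
    using measurable_compose[OF measurable_Pair[OF that] km] by simp
  have qm[measurable (raw)]: "(\<lambda>z. q (e z) (a z) (b z)) \<in> borel_measurable M" 
    if [measurable]: "a \<in> borel_measurable M" "b \<in> borel_measurable M" "e \<in> borel_measurable M" for a b e M
    unfolding q_def by measurable
  have "(\<integral>\<^sup>+x. \<integral>\<^sup>+y. ennreal ((f x - f y)\<^sup>2) \<partial>N \<partial>N) = (\<integral>\<^sup>+x. \<integral>\<^sup>+y. k x y + k y x \<partial>N \<partial>N)"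
    by (intro nn_integral_cong) (auto simp: k_def power2_commute)
  also have "\<dots> = (\<integral>\<^sup>+x. \<integral>\<^sup>+y. k x y \<partial>N \<partial>N) + (\<integral>\<^sup>+x. \<integral>\<^sup>+y. k y x \<partial>N \<partial>N)"
  proof -
    have "(\<integral>\<^sup>+x. \<integral>\<^sup>+y. k x y + k y x \<partial>N \<partial>N) = (\<integral>\<^sup>+x. (\<integral>\<^sup>+y. k x y \<partial>N) + (\<integral>\<^sup>+y. k y x \<partial>N) \<partial>N)"
      by (intro nn_integral_cong nn_integral_add) measurable
    also have "\<dots> = (\<integral>\<^sup>+x. \<integral>\<^sup>+y. k x y \<partial>N \<partial>N) + (\<integral>\<^sup>+x. \<integral>\<^sup>+y. k y x \<partial>N \<partial>N)"
      by (intro nn_integral_add) measurable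
    finally show ?thesis .
  qed
  also have "(\<integral>\<^sup>+x. \<integral>\<^sup>+y. k y x \<partial>N \<partial>N) = (\<integral>\<^sup>+x. \<integral>\<^sup>+y. k x y \<partial>N \<partial>N)"
    by (rule NN.Fubini') measurable
  finally have 1: "(\<integral>\<^sup>+x. \<integral>\<^sup>+y. ennreal ((f x - f y)\<^sup>2) \<partial>N \<partial>N) = 2 * (\<integral>\<^sup>+x. \<integral>\<^sup>+y. k x y \<partial>N \<partial>N)" by (simp add: mult_2)
  have "(\<integral>\<^sup>+x. \<integral>\<^sup>+y. k x y \<partial>N \<partial>N) \<le> (\<integral>\<^sup>+x. \<integral>\<^sup>+y. \<integral>\<^sup>+s. ennreal ((f' s)\<^sup>2) * q s x y \<partial>lborel \<partial>N \<partial>N)"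
  proof (intro nn_integral_mono)
    fix x y show "k x y \<le> (\<integral>\<^sup>+s. ennreal ((f' s)\<^sup>2) * q s x y \<partial>lborel)"
    proof (cases "x < y")
      case True
      have "(\<integral>\<^sup>+s. ennreal ((y - x) * (f' s)\<^sup>2) * indicator {x<..<y} s \<partial>lborel) = (\<integral>\<^sup>+s. ennreal ((f' s)\<^sup>2) * q s x y \<partial>lborel)"
        using True by (intro nn_integral_cong) (auto simp: q_def ennreal_mult' mult.commute)
      then show ?thesis using square_increment_le[OF d c True] True by (simp add: k_def)
    qed (simp add: k_def)
  qed
  also have "\<dots> = (\<integral>\<^sup>+x. \<integral>\<^sup>+s. \<integral>\<^sup>+y. ennreal ((f' s)\<^sup>2) * q s x y \<partial>N \<partial>lborel \<partial>N)"
    by (rule nn_integral_cong, rule NL.Fubini'[symmetric]) measurable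
  also have "\<dots> = (\<integral>\<^sup>+s. \<integral>\<^sup>+x. \<integral>\<^sup>+y. ennreal ((f' s)\<^sup>2) * q s x y \<partial>N \<partial>N \<partial>lborel)"
    by (rule NL.Fubini'[symmetric]) measurable
  also have "\<dots> = (\<integral>\<^sup>+s. ennreal ((f' s)\<^sup>2) * (\<integral>\<^sup>+x. \<integral>\<^sup>+y. q s x y \<partial>N \<partial>N) \<partial>lborel)"
    by (intro nn_integral_cong) (subst nn_integral_cmult[symmetric], measurable, intro nn_integral_cong, subst nn_integral_cmult, measurable)
  also have "\<dots> \<le> (\<integral>\<^sup>+s. ennreal ((f' s)\<^sup>2) * ennreal (exp (- U s) / l) \<partial>lborel)"
  proof (intro nn_integral_mono mult_left_mono)
    fix s
    have "(\<integral>\<^sup>+x. \<integral>\<^sup>+y. q s x y \<partial>N \<partial>N) = (\<integral>\<^sup>+x. \<integral>\<^sup>+y. indicator {x<..<y} s * ennreal (y - x) \<partial>N \<partial>N)"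
      by (intro nn_integral_cong) (auto simp: q_def)
    also have "\<dots> = ennreal (1 / l) * (ennreal l * (\<integral>\<^sup>+x. \<integral>\<^sup>+y. indicator {x<..<y} s * ennreal (y - x) \<partial>N \<partial>N))"
      using l by (simp add: mult.assoc[symmetric] flip: ennreal_mult)
    also have "\<dots> \<le> ennreal (1 / l) * ennreal (exp (- U s))"
      by (intro mult_left_mono covariance_kernel_le) auto
    also have "\<dots> = ennreal (exp (- U s) / l)" using l by (simp flip: ennreal_mult)
    finally show "(\<integral>\<^sup>+x. \<integral>\<^sup>+y. q s x y \<partial>N \<partial>N) \<le> ennreal (exp (- U s) / l)" .
  qed auto
  finally have "2 * (\<integral>\<^sup>+x. \<integral>\<^sup>+y. k x y \<partial>N \<partial>N) \<le> 2 * (\<integral>\<^sup>+s. ennreal ((f' s)\<^sup>2) * ennreal (exp (- U s) / l) \<partial>lborel)"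
    by (rule mult_left_mono) simp
  also have "\<dots> = (\<integral>\<^sup>+s. 2 * (ennreal ((f' s)\<^sup>2) * ennreal (exp (- U s) / l)) \<partial>lborel)"
    by (rule nn_integral_cmult[symmetric]) measurable
  also have "\<dots> = (\<integral>\<^sup>+s. ennreal (exp (- U s)) * ennreal (2 / l * (f' s)\<^sup>2) \<partial>lborel)"
  proof (rule nn_integral_cong)
    fix s
    have "2 * (ennreal ((f' s)\<^sup>2) * ennreal (exp (- U s) / l)) = ennreal (2 * ((f' s)\<^sup>2 * (exp (- U s) / l)))"
    proof -
      have "2 * (ennreal a * ennreal b) = ennreal (2 * (a * b))" if "0 \<le> a" "0 \<le> b" for a b
        using that by (simp add: ennreal_mult)
      then show ?thesis using l by simp
    qed
    also have "\<dots> = ennreal (exp (- U s)) * ennreal (2 / l * (f' s)\<^sup>2)"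
      using l by (simp add: mult_ac flip: ennreal_mult)
    finally show "2 * (ennreal ((f' s)\<^sup>2) * ennreal (exp (- U s) / l)) = \<dots>" .
  qed
  also have "\<dots> = (\<integral>\<^sup>+s. ennreal (2 / l * (f' s)\<^sup>2) \<partial>N)"
    by (rule nn_integral_density[symmetric]) measurable
  finally show ?thesis unfolding 1 .
qed

lemma second_difference_mono:
  assumes "0 < h" "h \<le> k"
  shows "(U (x + h) - U x) / h \<le> (U (x + k) - U x) / k"
proof -
  have "U ((1 - h / k) * x + (h / k) * (x + k)) \<le> (1 - h / k) * U x + (h / k) * U (x + k)"
    using convex_onD[OF convex, of "h / k" x "x + k"] assms by simp
  moreover have "(1 - h / k) * x + (h / k) * (x + k) = x + h" using assms by (simp add: field_simps)
  ultimately have "U (x + h) - U x \<le> (h / k) * (U (x + k) - U x)" by (simp add: algebra_simps)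
  then show ?thesis using assms by (simp add: field_simps)
qed

text \<open>The error \<delta> is the symmetric second difference divided by h. Convexity makes it
  nonnegative and shrinking with h, differentiability makes it tend to 0 at each point, and the
  hypotheses with shifts by 1 make its largest member integrable, so dominated convergence
  applies.\<close>

lemma score_bound:
  assumes i0: "integrable lborel (\<lambda>x. exp (- U x) * U x)"
    and i1: "integrable lborel (\<lambda>x. exp (- U x) * U (x + 1))"
    and i2: "integrable lborel (\<lambda>x. exp (- U x) * U (x - 1))"
    and i3: "integrable lborel (\<lambda>x. exp (- U x) * (x * U' x))"
  shows "score_bound (\<lambda>x. exp (- U x)) U'"
proof -
  define h where "h n = 1 / real (Suc n)" for n
  define \<delta> where "\<delta> n x = (U (x + h n) - U x) / h n + (U (x - h n) - U x) / h n" for n x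
  have h: "0 < h n" "h n \<le> 1" for n by (auto simp: h_def)
  have hl: "h \<longlonglongrightarrow> 0" unfolding h_def using LIMSEQ_inverse_real_of_nat by (simp add: inverse_eq_divide)
  have d1: "0 \<le> (U (x + h n) - U x) / h n - U' x" for n x
    using tangent_le[of x "x + h n"] h[of n] by (simp add: field_simps)
  have d2: "0 \<le> (U (x - h n) - U x) / h n + U' x" for n x
    using tangent_le[of x "x - h n"] h[of n] by (simp add: field_simps)
  have d0: "0 \<le> \<delta> n x" for n x using d1[of x n] d2[of x n] by (simp add: \<delta>_def)
  interpret r: strongly_convex_potential "\<lambda>x. U (- x)" "\<lambda>x. - U' (- x)" l by (rule reflect)
  \<comment> \<open>\<open>h 0\<close> = 1 is the largest step; chord slopes of a convex function
    shrink with the step, to the right directly and to the left by reflection.\<close>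
  have dle: "\<delta> n x \<le> \<delta> 0 x" for n x
    using second_difference_mono[OF h, of x n] r.second_difference_mono[OF h, of "- x" n] by (simp add: \<delta>_def h_def)
  have [measurable]: "\<delta> n \<in> borel_measurable borel" for n unfolding \<delta>_def by measurable
  have id0: "integrable lborel (\<lambda>x. exp (- U x) * \<delta> 0 x)"
  proof -
    have "(\<lambda>x. exp (- U x) * \<delta> 0 x) = (\<lambda>x. exp (- U x) * U (x + 1) + exp (- U x) * U (x - 1) - 2 * (exp (- U x) * U x))"
      by (auto simp: \<delta>_def h_def algebra_simps)
    then show ?thesis using i0 i1 i2 by auto
  qed
  have id: "integrable lborel (\<lambda>x. exp (- U x) * \<delta> n x)" for n
    by (rule Bochner_Integration.integrable_bound[OF id0]) (use d0 dle in \<open>auto intro!: AE_I2 simp: abs_mult\<close>)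
  \<comment> \<open>Tangents evaluated at unit distance bound |U'| by values of U, whose moments are
    given.\<close>
  have iB: "integrable lborel (\<lambda>x. exp (- U x) * U' x)"
  proof (rule Bochner_Integration.integrable_bound)
    show "integrable lborel (\<lambda>x. \<bar>exp (- U x) * U (x + 1)\<bar> + \<bar>exp (- U x) * U (x - 1)\<bar> + 2 * \<bar>exp (- U x) * U x\<bar>)"
      using i0 i1 i2 by auto
    show "AE x in lborel. norm (exp (- U x) * U' x) \<le> norm (\<bar>exp (- U x) * U (x + 1)\<bar> + \<bar>exp (- U x) * U (x - 1)\<bar> + 2 * \<bar>exp (- U x) * U x\<bar>)"
    proof (intro AE_I2)
      fix x
      have "\<bar>U' x\<bar> \<le> \<bar>U (x + 1)\<bar> + \<bar>U (x - 1)\<bar> + 2 * \<bar>U x\<bar>"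
        using tangent_le[of x "x + 1"] tangent_le[of x "x - 1"] by (auto simp: abs_if split: if_splits)
      from mult_left_mono[OF this, of "exp (- U x)"]
      show "norm (exp (- U x) * U' x) \<le> norm (\<bar>exp (- U x) * U (x + 1)\<bar> + \<bar>exp (- U x) * U (x - 1)\<bar> + 2 * \<bar>exp (- U x) * U x\<bar>)"
        by (simp add: abs_mult algebra_simps)
    qed
  qed measurable
  have "(\<lambda>n. \<integral>x. exp (- U x) * \<delta> n x \<partial>lborel) \<longlonglongrightarrow> (\<integral>x. exp (- U x) * 0 \<partial>lborel)"
  proof (rule integral_dominated_convergence[OF _ _ id0])
    show "AE x in lborel. norm (exp (- U x) * \<delta> n x) \<le> exp (- U x) * \<delta> 0 x" for n
      using d0 dle by (auto intro!: AE_I2 simp: abs_mult)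
    show "AE x in lborel. (\<lambda>n. exp (- U x) * \<delta> n x) \<longlonglongrightarrow> exp (- U x) * 0"
    proof (intro AE_I2 tendsto_mult tendsto_const)
      fix x
      have fl: "filterlim h (at 0) sequentially" using hl h(1) by (auto simp: filterlim_at intro!: always_eventually less_imp_neq[symmetric])
      have "((\<lambda>t. (U (x + t) - U x) / t) \<longlongrightarrow> U' x) (at 0)" using deriv[of x] by (simp add: DERIV_def)
      then have a: "(\<lambda>n. (U (x + h n) - U x) / h n) \<longlonglongrightarrow> U' x" using fl by (rule filterlim_compose)
      have "((\<lambda>t. (U (- (- x + t)) - U (- (- x))) / t) \<longlongrightarrow> - U' (- (- x))) (at 0)" using r.deriv[of "- x"] by (simp only: DERIV_def)
      then have "((\<lambda>t. (U (x - t) - U x) / t) \<longlongrightarrow> - U' x) (at 0)" by simp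
      then have b: "(\<lambda>n. (U (x - h n) - U x) / h n) \<longlonglongrightarrow> - U' x" using fl by (rule filterlim_compose)
      show "(\<lambda>n. \<delta> n x) \<longlonglongrightarrow> 0" unfolding \<delta>_def using tendsto_add[OF a b] by simp
    qed
  qed measurable
  then have dl: "(\<lambda>n. \<integral>x. exp (- U x) * \<delta> n x \<partial>lborel) \<longlonglongrightarrow> 0" by simp
  have inU: "integrable lborel (\<lambda>x. exp (- U x))" "(\<integral>x. exp (- U x) \<partial>lborel) = 1"
  proof -
    have "(\<integral>\<^sup>+x. ennreal (exp (- U x)) \<partial>lborel) = 1"
      using N.emeasure_space_1 by (subst (asm) emeasure_density) auto
    then show "integrable lborel (\<lambda>x. exp (- U x))" "(\<integral>x. exp (- U x) \<partial>lborel) = 1"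
      by (auto simp: integral_eq_nn_integral intro!: integrableI_nonneg)
  qed
  have ex: "exp (- U x) * (1 - a) \<le> exp (- U y)" if "U y - U x \<le> a" for x y a
  proof -
    have "exp (- U x) * (1 - a) \<le> exp (- U x) * exp (- (U y - U x))"
    proof (rule mult_left_mono)
      show "1 - a \<le> exp (- (U y - U x))" using exp_ge_add_one_self[of "- (U y - U x)"] that by linarith
    qed simp
    then show ?thesis by (simp flip: exp_add)
  qed
  have h\<delta>: "h n * \<delta> n x = U (x + h n) + U (x - h n) - 2 * U x" for n x
    using h(1)[of n] by (simp add: \<delta>_def distrib_left)
  have step1: "U (x + h n) - U x \<le> h n * U' x + h n * \<delta> n x" for x n
    unfolding h\<delta> using tangent_le[of x "x - h n"] by (simp add: algebra_simps)
  have step2: "U (x - h n) - U x \<le> - h n * U' x + h n * \<delta> n x" for x n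
    unfolding h\<delta> using tangent_le[of x "x + h n"] by (simp add: algebra_simps)
  have "score_density (\<lambda>x. exp (- U x)) U' \<delta> h"
  proof (unfold_locales, goal_cases)
    case (14 n) show ?case using ex[OF step1] by (intro AE_I2) (simp add: algebra_simps)
  next
    case (15 n) show ?case using ex[OF step2] by (intro AE_I2) (simp add: algebra_simps)
  next
    case (16 n)
    show ?case
    proof (intro AE_I2 impI)
      fix x
      let ?c = "exp (- U x) * exp (- h n * \<bar>U' x\<bar> - h n * \<delta> n x)"
      \<comment> \<open>A point of (x - h, x] is a convex combination of the end points, with weight
        t = (x - y) / h on the left one; convexity puts U y below the chord.\<close>
      have lb: "?c \<le> exp (- U y)" if "y \<in> {x - h n<..x}" for y
      proof -
        define t where "t = (x - y) / h n"
        have t: "0 \<le> t" "t \<le> 1" using that h[of n] by (auto simp: t_def)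
        have "U ((1 - t) * x + t * (x - h n)) \<le> (1 - t) * U x + t * U (x - h n)"
          using convex_onD[OF convex, of t x "x - h n"] t by simp
        moreover have "(1 - t) * x + t * (x - h n) = y" using h[of n] by (simp add: t_def field_simps)
        ultimately have "U y - U x \<le> t * (U (x - h n) - U x)" by (simp add: algebra_simps)
        also have "\<dots> \<le> t * (h n * \<bar>U' x\<bar> + h n * \<delta> n x)"
        proof (rule mult_left_mono[OF _ t(1)])
          have "- h n * U' x \<le> h n * \<bar>U' x\<bar>" using h(1)[of n] by (metis abs_ge_minus_self mult_left_mono mult_minus_left mult_minus_right order_less_imp_le)
          then show "U (x - h n) - U x \<le> h n * \<bar>U' x\<bar> + h n * \<delta> n x" using step2[of x n] by simp
        qed
        also have "\<dots> \<le> 1 * (h n * \<bar>U' x\<bar> + h n * \<delta> n x)"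
          using t h(1)[of n] d0[of n x] by (intro mult_right_mono) auto
        finally have "- U x + (- h n * \<bar>U' x\<bar> - h n * \<delta> n x) \<le> - U y" by simp
        then show ?thesis by (simp flip: exp_add)
      qed
      have "ennreal (?c * h n) = (\<integral>\<^sup>+y. ennreal ?c * indicator {x - h n<..x} y \<partial>lborel)"
        using h(1)[of n] by (subst nn_integral_cmult_indicator) (auto simp flip: ennreal_mult)
      also have "\<dots> \<le> (\<integral>\<^sup>+y. ennreal (exp (- U y)) * indicator {x - h n<..x} y \<partial>lborel)"
        using lb by (intro nn_integral_mono) (auto simp: indicator_def intro!: ennreal_leI)
      also have "\<dots> = emeasure N {x - h n<..x}" by (subst emeasure_density) auto
      finally show "h n * exp (- U x) * exp (- h n * \<bar>U' x\<bar> - h n * \<delta> n x) \<le> measure N {x - h n<..x}"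
        by (simp add: N.emeasure_eq_measure mult_ac)
    qed
  qed (use h hl d0 id dl inU iB i3 in auto)
  then show ?thesis by (rule score_density.score_bound)
qed

end

section \<open>Mean field equations\<close>

lemma integrable_gaussian: "0 < (a::real) \<Longrightarrow> integrable lborel (\<lambda>x::real. exp (- a * x\<^sup>2))"
proof -
  assume a: "0 < a"
  have "(\<lambda>x. exp (- a * x\<^sup>2)) = (\<lambda>x. sqrt (2 * pi * (1 / sqrt (2 * a))\<^sup>2) * normal_density 0 (1 / sqrt (2 * a)) x)"
    using a by (auto simp: normal_density_def power_divide)
  then show ?thesis using integrable_normal_density[of "1 / sqrt (2 * a)" 0] a by simp
qed

text \<open>Nonempty open sets are not null. This is the device by which almost-everywhere equations
  between continuous functions become equations everywhere.\<close>

lemma AE_open_ex: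
  fixes Q :: "real \<Rightarrow> bool"
  assumes ae: "AE x in lborel. Q x" and X: "open X" "X \<noteq> {}"
  shows "\<exists>x\<in>X. Q x"
proof (rule ccontr)
  assume no: "\<not> ?thesis"
  obtain x e where "x \<in> X" "0 < e" "ball x e \<subseteq> X" using X(1,2) openE[OF X(1)] by blast
  then have *: "y \<in> X" if "y \<in> {x - e<..<x + e}" for y using that by (auto simp: dist_real_def)
  have "AE y in lborel. y \<notin> {x - e<..<x + e}" using ae by eventually_elim (use no * in blast)
  then have "emeasure lborel {x - e<..<x + e} = 0"
    by (subst (asm) AE_iff_measurable[OF _ refl]) (auto simp: greaterThanLessThan_def greaterThan_def lessThan_def Int_def conj_commute)
  then show False using \<open>0 < e\<close> by simp
qed

text \<open>One slice W = V(t, .) with its conditional densities. \<open>opt\<close> is the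
  first-order condition: where f_i is positive, almost every s gives the same mean of the sum of
  logarithms plus W. Positivity of f_i, its Gaussian decay and the integrability of W are all to be
  extracted from this condition and from convexity; even the integrability of the separate summands
  is unknown at the start.\<close>

locale mean_field =
  fixes S :: "'i set" and W :: "('i \<Rightarrow> real) \<Rightarrow> real" and D :: "'i \<Rightarrow> ('i \<Rightarrow> real) \<Rightarrow> real"
    and f :: "'i \<Rightarrow> real \<Rightarrow> real" and l :: real and c :: "'i \<Rightarrow> real"
  assumes fin: "finite S" and l: "0 < l"
    and W_meas[measurable]: "W \<in> borel_measurable (Pi\<^sub>M S (\<lambda>_. borel))"
    and D_meas[measurable]: "\<And>i. i \<in> S \<Longrightarrow> D i \<in> borel_measurable (Pi\<^sub>M S (\<lambda>_. borel))"
    and conv: "\<And>i x s. i \<in> S \<Longrightarrow> x \<in> space (Pi\<^sub>M S (\<lambda>_. borel)) \<Longrightarrow>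
        W x + D i x * (s - x i) + l / 2 * (s - x i)\<^sup>2 \<le> W (x(i := s))"
    and growth: "\<And>a. 0 < a \<Longrightarrow> \<exists>b>0. \<forall>x\<in>space (Pi\<^sub>M S (\<lambda>_. borel)). \<bar>W x\<bar> \<le> b * exp (a * (\<Sum>i\<in>S. (x i)\<^sup>2))"
    and f_nonneg: "\<And>i s. 0 \<le> f i s"
    and f_diff: "\<And>i s. i \<in> S \<Longrightarrow> f i differentiable (at s)"
    and f_meas[measurable]: "\<And>i. f i \<in> borel_measurable borel"
    and prob: "\<And>i. prob_space (density lborel (\<lambda>s. ennreal (f i s)))"
    and opt: "\<And>i. i \<in> S \<Longrightarrow> AE s in lborel. 0 < f i s \<longrightarrow>
       integrable (Pi\<^sub>M (S - {i}) (\<lambda>j. density lborel (\<lambda>s. ennreal (f j s))))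
         (\<lambda>x. (\<Sum>j\<in>S - {i}. ln (f j (x j))) + ln (f i s) + W (x(i := s))) \<and>
       (\<integral>x. (\<Sum>j\<in>S - {i}. ln (f j (x j))) + ln (f i s) + W (x(i := s)) \<partial>Pi\<^sub>M (S - {i}) (\<lambda>j. density lborel (\<lambda>s. ennreal (f j s)))) = c i"
begin

abbreviation N where "N j \<equiv> density lborel (\<lambda>s. ennreal (f j s))"

sublocale N: product_prob_space N S
  by (simp add: product_prob_space_def product_prob_space_axioms_def product_sigma_finite_def prob prob_space_imp_sigma_finite)

lemma prob_PiM: "prob_space (Pi\<^sub>M J N)" by (intro prob_space_PiM prob)

lemma sets_PiM_N[measurable_cong, simp]: "sets (Pi\<^sub>M J N) = sets (Pi\<^sub>M J (\<lambda>_. borel))"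
  by (rule sets_PiM_cong) auto

lemma space_PiM_N: "space (Pi\<^sub>M J N) = space (Pi\<^sub>M J (\<lambda>_. borel))"
  by (simp add: space_PiM)

lemma f_cont: "i \<in> S \<Longrightarrow> continuous_on A (f i)"
  by (intro continuous_at_imp_continuous_on ballI differentiable_imp_continuous_within f_diff)

lemma upd_space: "i \<in> S \<Longrightarrow> x \<in> space (Pi\<^sub>M (S - {i}) N) \<Longrightarrow> x(i := s) \<in> space (Pi\<^sub>M S (\<lambda>_. borel))"
  by (auto simp: space_PiM PiE_def extensional_def)

lemma upd_meas[measurable]: "i \<in> S \<Longrightarrow> (\<lambda>x. x(i := s)) \<in> measurable (Pi\<^sub>M (S - {i}) N) (Pi\<^sub>M S (\<lambda>_. borel))"
proof (rule measurable_PiM_single')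
  fix j assume i: "i \<in> S" and j: "j \<in> S"
  show "(\<lambda>x. (x(i := s)) j) \<in> measurable (Pi\<^sub>M (S - {i}) N) borel"
    using j by (cases "j = i") auto
qed (auto simp: space_PiM PiE_def extensional_def)

text \<open>Points at which the first-order condition holds literally; they are dense in the open
  set where \<open>f i\<close> is positive.\<close>

definition good where "good i s \<longleftrightarrow> 0 < f i s \<and>
   integrable (Pi\<^sub>M (S - {i}) N)
         (\<lambda>x. (\<Sum>j\<in>S - {i}. ln (f j (x j))) + ln (f i s) + W (x(i := s))) \<and>
       (\<integral>x. (\<Sum>j\<in>S - {i}. ln (f j (x j))) + ln (f i s) + W (x(i := s)) \<partial>Pi\<^sub>M (S - {i}) N) = c i"

lemma good_dense:
  assumes i: "i \<in> S" and X: "open X" "X \<noteq> {}" "\<And>s. s \<in> X \<Longrightarrow> 0 < f i s"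
  shows "\<exists>s\<in>X. good i s"
  using AE_open_ex[OF opt[OF i] X(1,2)] X(3) unfolding good_def by blast

text \<open>Subtracting the condition at two good points removes the logarithms of the other
  factors, which cannot yet be integrated separately.\<close>

lemma good_diff:
  assumes i: "i \<in> S" and g: "good i s" "good i s'"
  shows "integrable (Pi\<^sub>M (S - {i}) N) (\<lambda>x. W (x(i := s)) - W (x(i := s')))"
    and "(\<integral>x. W (x(i := s)) - W (x(i := s')) \<partial>Pi\<^sub>M (S - {i}) N) = ln (f i s') - ln (f i s)"
proof -
  interpret P: prob_space "Pi\<^sub>M (S - {i}) N" by (rule prob_PiM)
  let ?h = "\<lambda>s x. (\<Sum>j\<in>S - {i}. ln (f j (x j))) + ln (f i s) + W (x(i := s))"
  have *: "(\<lambda>x. W (x(i := s)) - W (x(i := s'))) = (\<lambda>x. (?h s x - ?h s' x) + (ln (f i s') - ln (f i s)))" by auto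
  have I: "integrable (Pi\<^sub>M (S - {i}) N) (?h s)" "integrable (Pi\<^sub>M (S - {i}) N) (?h s')"
    and E: "(\<integral>x. ?h s x \<partial>Pi\<^sub>M (S - {i}) N) = c i" "(\<integral>x. ?h s' x \<partial>Pi\<^sub>M (S - {i}) N) = c i"
    using g unfolding good_def by auto
  note dI = Bochner_Integration.integrable_diff[OF I]
  show "integrable (Pi\<^sub>M (S - {i}) N) (\<lambda>x. W (x(i := s)) - W (x(i := s')))"
    unfolding * by (rule Bochner_Integration.integrable_add[OF dI P.integrable_const])
  have "(\<integral>x. (?h s x - ?h s' x) + (ln (f i s') - ln (f i s)) \<partial>Pi\<^sub>M (S - {i}) N) =
      (\<integral>x. ?h s x - ?h s' x \<partial>Pi\<^sub>M (S - {i}) N) + (\<integral>x. (ln (f i s') - ln (f i s)) \<partial>Pi\<^sub>M (S - {i}) N)"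
    by (rule Bochner_Integration.integral_add[OF dI P.integrable_const])
  also have "(\<integral>x. ?h s x - ?h s' x \<partial>Pi\<^sub>M (S - {i}) N) = 0"
    unfolding Bochner_Integration.integral_diff[OF I] E by simp
  also have "0 + (\<integral>x. (ln (f i s') - ln (f i s)) \<partial>Pi\<^sub>M (S - {i}) N) = ln (f i s') - ln (f i s)" using P.prob_space by simp
  finally show "(\<integral>x. W (x(i := s)) - W (x(i := s')) \<partial>Pi\<^sub>M (S - {i}) N) = ln (f i s') - ln (f i s)"
    unfolding * .
qed

lemma subgradient:
  assumes i: "i \<in> S" and x: "x \<in> space (Pi\<^sub>M (S - {i}) N)"
  shows "W (x(i := s')) + D i (x(i := s')) * (s - s') + l / 2 * (s - s')\<^sup>2 \<le> W (x(i := s))"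
  using conv[OF i upd_space[OF i x, of s'], of s] by simp

text \<open>By convexity the slope at s' lies between the chord slopes towards points on either
  side, and both of these are integrable.\<close>

lemma subgradient_integrable:
  assumes i: "i \<in> S" and s: "s0 < s'" "s' < s1"
    and I0: "integrable (Pi\<^sub>M (S - {i}) N) (\<lambda>x. W (x(i := s0)) - W (x(i := s')))"
    and I1: "integrable (Pi\<^sub>M (S - {i}) N) (\<lambda>x. W (x(i := s1)) - W (x(i := s')))"
  shows "integrable (Pi\<^sub>M (S - {i}) N) (\<lambda>x. D i (x(i := s')))"
proof (rule Bochner_Integration.integrable_bound)
  let ?a = "\<lambda>x. (W (x(i := s0)) - W (x(i := s'))) / (s' - s0)" and ?b = "\<lambda>x. (W (x(i := s1)) - W (x(i := s'))) / (s1 - s')"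
  show "integrable (Pi\<^sub>M (S - {i}) N) (\<lambda>x. \<bar>?a x\<bar> + \<bar>?b x\<bar>)"
    using I0 I1 by (intro Bochner_Integration.integrable_add integrable_abs integrable_divide) auto
  show "(\<lambda>x. D i (x(i := s'))) \<in> borel_measurable (Pi\<^sub>M (S - {i}) N)" using i by measurable
  show "AE x in Pi\<^sub>M (S - {i}) N. norm (D i (x(i := s'))) \<le> norm (\<bar>?a x\<bar> + \<bar>?b x\<bar>)"
  proof (rule AE_I2)
    fix x assume x: "x \<in> space (Pi\<^sub>M (S - {i}) N)"
    have "0 \<le> l / 2 * (s0 - s')\<^sup>2" "0 \<le> l / 2 * (s1 - s')\<^sup>2" using l by auto
    then have "D i (x(i := s')) * (s0 - s') \<le> W (x(i := s0)) - W (x(i := s'))"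
       "D i (x(i := s')) * (s1 - s') \<le> W (x(i := s1)) - W (x(i := s'))"
      using subgradient[OF i x, of s' s0] subgradient[OF i x, of s' s1] by linarith+
    then have "- D i (x(i := s')) \<le> ?a x" "D i (x(i := s')) \<le> ?b x" using s by (auto simp: field_simps)
    then show "norm (D i (x(i := s'))) \<le> norm (\<bar>?a x\<bar> + \<bar>?b x\<bar>)" by (simp add: abs_if split: if_splits)
  qed
qed

lemma integral_subgradient:
  assumes i: "i \<in> S" and D: "integrable (Pi\<^sub>M (S - {i}) N) (\<lambda>x. D i (x(i := s')))"
    and I: "integrable (Pi\<^sub>M (S - {i}) N) (\<lambda>x. W (x(i := s)) - W (x(i := s')))"
  shows "(\<integral>x. D i (x(i := s')) \<partial>Pi\<^sub>M (S - {i}) N) * (s - s') + l / 2 * (s - s')\<^sup>2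
    \<le> (\<integral>x. W (x(i := s)) - W (x(i := s')) \<partial>Pi\<^sub>M (S - {i}) N)"
proof -
  interpret P: prob_space "Pi\<^sub>M (S - {i}) N" by (rule prob_PiM)
  have "(\<integral>x. D i (x(i := s')) * (s - s') + l / 2 * (s - s')\<^sup>2 \<partial>Pi\<^sub>M (S - {i}) N) \<le> (\<integral>x. W (x(i := s)) - W (x(i := s')) \<partial>Pi\<^sub>M (S - {i}) N)"
    by (rule integral_mono) (use D I subgradient[OF i, of _ s' s] in \<open>auto simp: algebra_simps\<close>)
  then show ?thesis using D by (simp add: P.prob_space)
qed

text \<open>Strong convexity in coordinate i, averaged at a good base point s', bounds ln f_i by a
  concave parabola at all good points, and continuity of f_i extends the bound to every s. As
  integrability of W is not yet available, s' is placed between two further good points, so that the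
  averaged slope at s' exists.\<close>

lemma gaussian_tail: 
  assumes i: "i \<in> S"
  obtains A where "0 < A" "\<And>s. f i s \<le> A * exp (- (l / 8) * s\<^sup>2)"
proof -
  have "\<not> (\<forall>s. f i s = 0)"
  proof
    assume "\<forall>s. f i s = 0"
    moreover have "emeasure (N i) (space (N i)) = 1" using prob_space.emeasure_space_1[OF prob] by simp
    ultimately show False by (subst (asm) emeasure_density) auto
  qed
  then obtain m where "f i m \<noteq> 0" by blast
  then have m: "0 < f i m" using f_nonneg[of i m] by simp
  have op: "open {s. 0 < f i s}" using f_cont[OF i, of UNIV] by (simp add: open_Collect_less)
  then obtain e where e: "0 < e" "ball m e \<subseteq> {s. 0 < f i s}" using openE[OF op, of m] m by blast
  have pos: "0 < f i s" if "s \<in> {m - e<..<m + e}" for s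
    using e(2) that by (auto simp: subset_iff dist_real_def)
  have "\<exists>s\<in>{m - e<..<m - e/2}. good i s" using e(1) by (intro good_dense[OF i]) (auto intro!: pos)
  then obtain s0 where s0: "s0 < m - e/2" "good i s0" by auto
  have "\<exists>s\<in>{m - e/2<..<m + e/2}. good i s" using e(1) by (intro good_dense[OF i]) (auto intro!: pos)
  then obtain s' where s': "m - e/2 < s'" "s' < m + e/2" "good i s'" by auto
  have "\<exists>s\<in>{m + e/2<..<m + e}. good i s" using e(1) by (intro good_dense[OF i]) (auto intro!: pos)
  then obtain s1 where s1: "m + e/2 < s1" "good i s1" by auto
  have iD: "integrable (Pi\<^sub>M (S - {i}) N) (\<lambda>x. D i (x(i := s')))"
    using s0 s' s1 good_diff(1)[OF i] by (intro subgradient_integrable[OF i, of s0 s' s1]) auto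
  define \<beta> where "\<beta> = (\<integral>x. D i (x(i := s')) \<partial>Pi\<^sub>M (S - {i}) N)"
  define q where "q s = f i s' * exp (- \<beta> * (s - s') - l / 2 * (s - s')\<^sup>2)" for s
  have gq: "f i s \<le> q s" if g: "good i s" for s
  proof -
    have "\<beta> * (s - s') + l / 2 * (s - s')\<^sup>2 \<le> ln (f i s') - ln (f i s)"
      using integral_subgradient[OF i iD good_diff(1)[OF i g s'(3)]] good_diff(2)[OF i g s'(3)] by (simp add: \<beta>_def)
    then have "exp (ln (f i s)) \<le> exp (ln (f i s') + (- \<beta> * (s - s') - l / 2 * (s - s')\<^sup>2))" by simp
    then show ?thesis using g s'(3) unfolding exp_add q_def by (simp add: good_def)
  qed
  have q: "f i s \<le> q s" for s
  proof (rule ccontr)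
    assume "\<not> f i s \<le> q s"
    have "open {s. q s < f i s}" unfolding q_def
      by (intro open_Collect_less continuous_intros f_cont[OF i])
    moreover have "0 < q s" for s using s'(3) by (simp add: q_def good_def)
    then have "0 < f i s" if "q s < f i s" for s using less_trans[OF _ that] by blast
    ultimately have "\<exists>s\<in>{s. q s < f i s}. good i s"
      using \<open>\<not> f i s \<le> q s\<close> by (intro good_dense[OF i]) (auto simp: not_le)
    then obtain y where "q y < f i y" "good i y" by blast
    then show False using gq[of y] by simp
  qed
  \<comment> \<open>Completing the square in s - s' consumes half of l/2, and s^2 \<le> 2 (s - s')^2
    + 2 s'^2 halves the remaining l/4; hence the rate l/8.\<close>
  let ?A = "f i s' * exp (\<beta>\<^sup>2 / l + l * s'\<^sup>2 / 4)"
  have "f i s \<le> ?A * exp (- (l / 8) * s\<^sup>2)" for s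
  proof -
    have "0 \<le> (l * (s - s') / 2 + \<beta>)\<^sup>2" "0 \<le> l\<^sup>2 * ((s - s') - s')\<^sup>2" by auto
    then have "0 \<le> (l * (s - s') / 2 + \<beta>)\<^sup>2 / l" "0 \<le> l * ((s - s') - s')\<^sup>2" using l by auto
    moreover have "(\<beta>\<^sup>2 / l + l * s'\<^sup>2 / 4) + - (l / 8) * s\<^sup>2 - (- \<beta> * (s - s') - l / 2 * (s - s')\<^sup>2) =
       (l * (s - s') / 2 + \<beta>)\<^sup>2 / l + (l * ((s - s') - s')\<^sup>2) / 8"
      using l by (simp add: power2_eq_square field_simps)
    ultimately have "- \<beta> * (s - s') - l / 2 * (s - s')\<^sup>2 \<le> (\<beta>\<^sup>2 / l + l * s'\<^sup>2 / 4) + - (l / 8) * s\<^sup>2" by linarith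
    then have "q s \<le> f i s' * exp ((\<beta>\<^sup>2 / l + l * s'\<^sup>2 / 4) + - (l / 8) * s\<^sup>2)"
      unfolding q_def by (intro mult_left_mono f_nonneg) (simp only: exp_le_cancel_iff)
    then show ?thesis using q[of s] by (simp only: exp_add mult.assoc[symmetric])
  qed
  moreover have "0 < ?A" using s'(3) by (simp add: good_def)
  ultimately show ?thesis using that by blast
qed

text \<open>Growth at rate l/16 leaves half of the Gaussian decay l/8.\<close>

lemma integrable_subgaussian:
  assumes i: "i \<in> S" and [measurable]: "g \<in> borel_measurable borel" and g: "\<And>s. \<bar>g s\<bar> \<le> K * exp (l / 16 * s\<^sup>2)"
  shows "integrable lborel (\<lambda>s. f i s * g s)" "integrable (N i) g"
proof -
  obtain A where A: "0 < A" "\<And>s. f i s \<le> A * exp (- (l / 8) * s\<^sup>2)" using gaussian_tail[OF i] by blast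
  have K: "0 \<le> K" using g[of 0] by simp
  show *: "integrable lborel (\<lambda>s. f i s * g s)"
  proof (rule Bochner_Integration.integrable_bound)
    show "integrable lborel (\<lambda>s. (A * K) * exp (- (l / 16) * s\<^sup>2))"
      using l by (intro integrable_mult_right integrable_gaussian) auto
    show "AE s in lborel. norm (f i s * g s) \<le> norm ((A * K) * exp (- (l / 16) * s\<^sup>2))"
    proof (rule AE_I2)
      fix s
      have "\<bar>f i s\<bar> * \<bar>g s\<bar> \<le> (A * exp (- (l / 8) * s\<^sup>2)) * (K * exp (l / 16 * s\<^sup>2))"
        using A f_nonneg[of i s] g[of s] by (intro mult_mono) auto
      also have "\<dots> = (A * K) * exp (- (l / 16) * s\<^sup>2)" by (simp add: exp_add[symmetric] field_simps)
      finally show "norm (f i s * g s) \<le> norm ((A * K) * exp (- (l / 16) * s\<^sup>2))" using A K by (simp add: abs_mult)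
    qed
  qed measurable
  then show "integrable (N i) g" by (subst integrable_density) (auto simp: f_nonneg)
qed

lemma integrable_prod_subgaussian:
  assumes J: "J \<subseteq> S" and [measurable]: "g \<in> borel_measurable (Pi\<^sub>M J (\<lambda>_. borel))"
    and g: "\<And>x. x \<in> space (Pi\<^sub>M J (\<lambda>_. borel)) \<Longrightarrow> \<bar>g x\<bar> \<le> K * exp (l / 16 * (\<Sum>j\<in>J. (x j)\<^sup>2))"
  shows "integrable (Pi\<^sub>M J N) g"
proof (rule Bochner_Integration.integrable_bound)
  have fJ: "finite J" using J fin finite_subset by blast
  have "integrable (Pi\<^sub>M J N) (\<lambda>x. \<Prod>j\<in>J. exp (l / 16 * (x j)\<^sup>2))"
  proof (rule N.product_integrable_prod[OF fJ])
    fix j assume "j \<in> J"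
    then show "integrable (N j) (\<lambda>s. exp (l / 16 * s\<^sup>2))"
      using J by (intro integrable_subgaussian(2)[of _ _ 1]) auto
  qed
  then show "integrable (Pi\<^sub>M J N) (\<lambda>x. K * exp (l / 16 * (\<Sum>j\<in>J. (x j)\<^sup>2)))"
    by (simp add: exp_sum[OF fJ] sum_distrib_left)
  show "g \<in> borel_measurable (Pi\<^sub>M J N)" by measurable
  show "AE x in Pi\<^sub>M J N. norm (g x) \<le> norm (K * exp (l / 16 * (\<Sum>j\<in>J. (x j)\<^sup>2)))"
  proof (rule AE_I2)
    fix x assume "x \<in> space (Pi\<^sub>M J N)"
    then have "\<bar>g x\<bar> \<le> K * exp (l / 16 * (\<Sum>j\<in>J. (x j)\<^sup>2))" using g by (simp add: space_PiM_N)
    then show "norm (g x) \<le> norm (K * exp (l / 16 * (\<Sum>j\<in>J. (x j)\<^sup>2)))" unfolding real_norm_def by linarith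
  qed
qed

lemma W_integrable: "integrable (Pi\<^sub>M S N) W"
proof -
  obtain b where "\<forall>x\<in>space (Pi\<^sub>M S (\<lambda>_. borel)). \<bar>W x\<bar> \<le> b * exp (l / 16 * (\<Sum>i\<in>S. (x i)\<^sup>2))"
    using growth[of "l / 16"] l by auto
  then show ?thesis by (intro integrable_prod_subgaussian) auto
qed

definition \<phi> where "\<phi> i s = (\<integral>x. W (x(i := s)) \<partial>Pi\<^sub>M (S - {i}) N)"
definition b where "b i s = (\<integral>x. D i (x(i := s)) \<partial>Pi\<^sub>M (S - {i}) N)"

lemma sum_upd: "i \<in> S \<Longrightarrow> (\<Sum>j\<in>S. ((x(i := s)) j)\<^sup>2) = s\<^sup>2 + (\<Sum>j\<in>S - {i}. (x j)\<^sup>2)"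
  using fin by (subst sum.remove[of S i]) auto

lemma W_slice:
  assumes i: "i \<in> S" and a: "0 < a" "a \<le> l / 16"
  obtains K where "\<And>s. integrable (Pi\<^sub>M (S - {i}) N) (\<lambda>x. W (x(i := s)))" "0 \<le> K" "\<And>s. \<bar>\<phi> i s\<bar> \<le> K * exp (a * s\<^sup>2)"
proof -
  obtain B where B: "0 < B" "\<And>x. x\<in>space (Pi\<^sub>M S (\<lambda>_. borel)) \<Longrightarrow> \<bar>W x\<bar> \<le> B * exp (a * (\<Sum>i\<in>S. (x i)\<^sup>2))"
    using growth[OF a(1)] by auto
  let ?E = "\<lambda>x. exp (a * (\<Sum>j\<in>S - {i}. (x j)\<^sup>2))"
  have bd: "\<bar>W (x(i := s))\<bar> \<le> B * exp (a * s\<^sup>2) * ?E x" if "x \<in> space (Pi\<^sub>M (S - {i}) N)" for x s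
    using B(2)[OF upd_space[OF i that, of s]] sum_upd[OF i, of x s] by (simp add: distrib_left exp_add mult.assoc)
  have iE: "integrable (Pi\<^sub>M (S - {i}) N) ?E"
  proof (rule integrable_prod_subgaussian[of _ _ 1])
    fix x :: "'i \<Rightarrow> real"
    have "a * (\<Sum>j\<in>S - {i}. (x j)\<^sup>2) \<le> l / 16 * (\<Sum>j\<in>S - {i}. (x j)\<^sup>2)"
      using a by (intro mult_right_mono sum_nonneg) auto
    then show "\<bar>?E x\<bar> \<le> 1 * exp (l / 16 * (\<Sum>j\<in>S - {i}. (x j)\<^sup>2))" by simp
  qed auto
  have I: "integrable (Pi\<^sub>M (S - {i}) N) (\<lambda>x. W (x(i := s)))" for s
  proof (rule Bochner_Integration.integrable_bound)
    show "integrable (Pi\<^sub>M (S - {i}) N) (\<lambda>x. B * exp (a * s\<^sup>2) * ?E x)" using iE by simp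
    show "(\<lambda>x. W (x(i := s))) \<in> borel_measurable (Pi\<^sub>M (S - {i}) N)" using i by measurable
    show "AE x in Pi\<^sub>M (S - {i}) N. norm (W (x(i := s))) \<le> norm (B * exp (a * s\<^sup>2) * ?E x)"
      using bd B(1) by (intro AE_I2) (simp add: abs_mult del: fun_upd_apply)
  qed
  have "\<bar>\<phi> i s\<bar> \<le> (B * (\<integral>x. ?E x \<partial>Pi\<^sub>M (S - {i}) N)) * exp (a * s\<^sup>2)" for s
  proof -
    have "\<bar>\<phi> i s\<bar> \<le> (\<integral>x. \<bar>W (x(i := s))\<bar> \<partial>Pi\<^sub>M (S - {i}) N)" unfolding \<phi>_def by (rule integral_abs_bound)
    also have "\<dots> \<le> (\<integral>x. B * exp (a * s\<^sup>2) * ?E x \<partial>Pi\<^sub>M (S - {i}) N)"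
      by (rule integral_mono) (use I iE bd in auto)
    finally show ?thesis by (simp add: mult_ac)
  qed
  moreover have "0 \<le> B * (\<integral>x. ?E x \<partial>Pi\<^sub>M (S - {i}) N)" using B by simp
  ultimately show ?thesis using that I by blast
qed

lemma W_slice_integrable: "i \<in> S \<Longrightarrow> integrable (Pi\<^sub>M (S - {i}) N) (\<lambda>x. W (x(i := s)))"
  by (rule W_slice[of i "l / 16"]) (use l in auto)

lemma D_slice_integrable: "i \<in> S \<Longrightarrow> integrable (Pi\<^sub>M (S - {i}) N) (\<lambda>x. D i (x(i := s)))"
  by (rule subgradient_integrable[of i "s - 1" s "s + 1"]) (auto intro: W_slice_integrable)

lemma \<phi>_subgradient: "i \<in> S \<Longrightarrow> \<phi> i s' + b i s' * (s - s') + l / 2 * (s - s')\<^sup>2 \<le> \<phi> i s"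
  using integral_subgradient[OF _ D_slice_integrable, of i s s'] W_slice_integrable
  by (simp add: \<phi>_def b_def)

text \<open>A function with a supporting line at every point is convex, and a finite convex function
  on the line is continuous.\<close>

lemma \<phi>_cont: assumes i: "i \<in> S" shows "continuous_on UNIV (\<phi> i)"
proof (rule convex_on_continuous)
  have sub: "\<phi> i z + b i z * (s - z) \<le> \<phi> i s" for s z
    using \<phi>_subgradient[OF i, of z s] l by (smt (verit) divide_pos_pos mult_nonneg_nonneg zero_le_power2)
  show "convex_on UNIV (\<phi> i)"
  proof (rule convex_onI)
    fix t x y :: real assume t: "0 < t" "t < 1"
    define z where "z = (1 - t) * x + t * y"
    have "(1 - t) * (\<phi> i z + b i z * (x - z)) + t * (\<phi> i z + b i z * (y - z)) \<le> (1 - t) * \<phi> i x + t * \<phi> i y"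
      using t by (intro add_mono mult_left_mono sub) auto
    moreover have "(1 - t) * (\<phi> i z + b i z * (x - z)) + t * (\<phi> i z + b i z * (y - z)) = \<phi> i z + b i z * ((1 - t) * x + t * y - z)"
      by (simp add: algebra_simps)
    ultimately show "\<phi> i ((1 - t) *\<^sub>R x + t *\<^sub>R y) \<le> (1 - t) * \<phi> i x + t * \<phi> i y"
      by (simp add: z_def)
  qed auto
qed auto

lemma good_eq: "i \<in> S \<Longrightarrow> good i s \<Longrightarrow> good i s' \<Longrightarrow> ln (f i s) + \<phi> i s = ln (f i s') + \<phi> i s'"
  using good_diff(2)[of i s s'] W_slice_integrable by (simp add: \<phi>_def)

text \<open>At good points ln f_i + \<phi> is constant, so on a compact interval f_i is bounded
  below there by some m > 0. A zero would, by the intermediate value theorem, create a point with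
  value m/2, hence a nonempty open set with values in (0, m); such a set contains a good
  point.\<close>

lemma f_pos:
  assumes i: "i \<in> S" shows "0 < f i s"
proof (rule ccontr)
  assume "\<not> 0 < f i s"
  then have s0: "f i s = 0" using f_nonneg[of i s] by simp
  obtain s' where s': "good i s'"
  proof -
    have "\<not> (\<forall>s. f i s = 0)"
    proof
      assume "\<forall>s. f i s = 0"
      moreover have "emeasure (N i) (space (N i)) = 1" using prob_space.emeasure_space_1[OF prob] by simp
      ultimately show False by (subst (asm) emeasure_density) auto
    qed
    then obtain m where "f i m \<noteq> 0" by blast
    then have m: "0 < f i m" using f_nonneg[of i m] by simp
    have "open {s. 0 < f i s}" using f_cont[OF i, of UNIV] by (simp add: open_Collect_less)
    then have "\<exists>s\<in>{s. 0 < f i s}. good i s" by (rule good_dense[OF i]) (use m in auto)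
    then show ?thesis using that by blast
  qed
  \<comment> \<open>The margin 1 leaves room for an open neighbourhood of the point supplied by the
    intermediate value theorem.\<close>
  define C where "C = {min s s' - 1..max s s' + 1}"
  obtain z where z: "z \<in> C" "\<And>y. y \<in> C \<Longrightarrow> \<phi> i y \<le> \<phi> i z"
  proof -
    have "compact C" "C \<noteq> {}" by (auto simp: C_def)
    then show ?thesis
      using continuous_attains_sup[of C "\<phi> i"] continuous_on_subset[OF \<phi>_cont[OF i], of C] that by blast
  qed
  define m where "m = min (exp (ln (f i s') + \<phi> i s' - \<phi> i z)) (f i s')"
  have m: "0 < m" and mf: "m \<le> f i s'" using s' by (auto simp: m_def good_def)
  have lower: "m \<le> f i y" if "y \<in> C" "good i y" for y
  proof -
    have "ln (f i s') + \<phi> i s' - \<phi> i z \<le> ln (f i y)" using good_eq[OF i that(2) s'] z(2)[OF that(1)] by simp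
    then have "exp (ln (f i s') + \<phi> i s' - \<phi> i z) \<le> f i y" using that(2) by (metis good_def exp_le_cancel_iff exp_ln)
    then show ?thesis by (simp add: m_def)
  qed
  have "\<exists>y. (s \<le> y \<and> y \<le> s' \<or> s' \<le> y \<and> y \<le> s) \<and> f i y = m / 2"
  proof (cases "s \<le> s'")
    case True
    have "f i s \<le> m / 2" "m / 2 \<le> f i s'" using s0 m mf by auto
    then show ?thesis using IVT'[of "f i" s "m / 2" s'] True f_cont[OF i] by blast
  next
    case False
    have "f i s \<le> m / 2" "m / 2 \<le> f i s'" using s0 m mf by auto
    then show ?thesis using IVT2'[of "f i" s "m / 2" s'] False f_cont[OF i] by force
  qed
  then obtain y where y: "min s s' \<le> y" "y \<le> max s s'" "f i y = m / 2" by auto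
  have "open ({min s s' - 1<..<max s s' + 1} \<inter> {s. 0 < f i s \<and> f i s < m})"
    using f_cont[OF i, of UNIV] by (intro open_Int open_greaterThanLessThan open_Collect_conj open_Collect_less continuous_intros) auto
  then have "\<exists>y\<in>{min s s' - 1<..<max s s' + 1} \<inter> {s. 0 < f i s \<and> f i s < m}. good i y"
  proof (rule good_dense[OF i])
    have "y \<in> {min s s' - 1<..<max s s' + 1} \<inter> {s. 0 < f i s \<and> f i s < m}" using y m by auto
    then show "{min s s' - 1<..<max s s' + 1} \<inter> {s. 0 < f i s \<and> f i s < m} \<noteq> {}" by blast
  qed auto
  then obtain y where y: "y \<in> {min s s' - 1<..<max s s' + 1} \<inter> {s. 0 < f i s \<and> f i s < m}" "good i y" by blast
  then have "y \<in> C" by (auto simp: C_def)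
  then show False using lower[of y] y by simp
qed

text \<open>The set where the identity fails is open by continuity; were it nonempty it would
  contain a good point.\<close>

lemma log_density:
  assumes i: "i \<in> S"
  obtains k where "\<And>s. - ln (f i s) = \<phi> i s + k"
proof -
  have nz: "f i s \<noteq> 0" for s using f_pos[OF i, of s] by simp
  have "\<exists>s\<in>UNIV. good i s" by (rule good_dense[OF i]) (use f_pos[OF i] in auto)
  then obtain s' where s': "good i s'" by blast
  define k where "k = - ln (f i s') - \<phi> i s'"
  let ?X = "{s. - ln (f i s) \<noteq> \<phi> i s + k}"
  have op: "open ?X"
    by (intro open_Collect_neq continuous_intros f_cont[OF i] \<phi>_cont[OF i]) (simp add: nz)
  have "?X = {}"
  proof (rule ccontr)
    assume "?X \<noteq> {}"
    then have "\<exists>s\<in>?X. good i s" by (rule good_dense[OF i op]) (rule f_pos[OF i])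
    then obtain y where "- ln (f i y) \<noteq> \<phi> i y + k" "good i y" by blast
    then show False using good_eq[OF i _ s', of y] by (simp add: k_def)
  qed
  then show ?thesis using that[of k] by blast
qed

text \<open>The averaged slope \<open>b i x\<close> supports -ln f_i from below at x, so subtracting
  the line leaves a minimum at x; as f_i is differentiable and positive, the derivative of -ln f_i
  exists and equals that slope. Adding the two strong support inequalities at x and y yields the
  constant l as twice l/2.\<close>

lemma potential:
  assumes i: "i \<in> S"
  shows "strongly_convex_potential (\<lambda>s. - ln (f i s)) (b i) l"
proof (rule strongly_convex_potential.intro)
  obtain k where k: "\<And>s. - ln (f i s) = \<phi> i s + k" by (rule log_density[OF i]) (rule that)
  have sub: "- ln (f i z) + b i z * (s - z) + l / 2 * (s - z)\<^sup>2 \<le> - ln (f i s)" for s z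
    using \<phi>_subgradient[OF i, of z s] by (simp add: k)
  show "((\<lambda>s. - ln (f i s)) has_real_derivative b i x) (at x)" for x
  proof -
    obtain d where d: "(f i has_real_derivative d) (at x)"
      using f_diff[OF i, of x] by (auto simp: real_differentiable_def)
    have "((\<lambda>s. ln (f i s)) has_real_derivative (1 / f i x * d)) (at x)"
      by (rule DERIV_chain2[OF DERIV_ln_divide[OF f_pos[OF i]] d])
    from DERIV_minus[OF this] have U: "((\<lambda>s. - ln (f i s)) has_real_derivative (- (d / f i x))) (at x)"
      by simp
    have "((\<lambda>s. - ln (f i s) - b i x * s) has_real_derivative (- (d / f i x) - b i x)) (at x)"
      using DERIV_diff[OF U DERIV_cmult[OF DERIV_ident, of "b i x"]] by simp
    moreover have "- ln (f i x) - b i x * x \<le> - ln (f i s) - b i x * s" for s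
    proof -
      have "0 \<le> l / 2 * (s - x)\<^sup>2" using l by simp
      then show ?thesis using sub[of x s] by (simp add: algebra_simps)
    qed
    ultimately have "- (d / f i x) - b i x = 0" by (intro DERIV_local_min[of "\<lambda>s. - ln (f i s) - b i x * s" _ x 1]) auto
    then show ?thesis using U by simp
  qed
  show "l * (y - x) \<le> b i y - b i x" if "x \<le> y" for x y
  proof (cases "x = y")
    case False
    have "l * (y - x)\<^sup>2 \<le> (b i y - b i x) * (y - x)"
      using sub[of x y] sub[of y x] by (simp add: power2_eq_square algebra_simps)
    then show ?thesis using False that by (simp add: power2_eq_square)
  qed simp
  show "0 < l" by (rule l)
  show "prob_space (density lborel (\<lambda>x. ennreal (exp (- (- ln (f i x))))))"
    using prob[of i] f_pos[OF i] by simp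
qed

text \<open>The rate l/64 leaves room for the score: a shift by 1 doubles it to l/32, and
  multiplication by s costs another l/32, which stays within l/16.\<close>

lemma ln_bound:
  assumes i: "i \<in> S"
  obtains K where "0 \<le> K" "\<And>s. \<bar>ln (f i s)\<bar> \<le> K * exp (l / 64 * s\<^sup>2)"
proof -
  obtain k where k: "\<And>s. - ln (f i s) = \<phi> i s + k" by (rule log_density[OF i]) (rule that)
  obtain K where K: "0 \<le> K" "\<And>s. \<bar>\<phi> i s\<bar> \<le> K * exp (l / 64 * s\<^sup>2)"
  proof -
    have "0 < l / 64" "l / 64 \<le> l / 16" using l by auto
    then show ?thesis by (rule W_slice[OF i]) (rule that)
  qed
  have "\<And>s. \<bar>ln (f i s)\<bar> \<le> (K + \<bar>k\<bar>) * exp (l / 64 * s\<^sup>2)"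
  proof -
    fix s
    have "\<bar>k\<bar> * 1 \<le> \<bar>k\<bar> * exp (l / 64 * s\<^sup>2)" using l by (intro mult_left_mono) auto
    then have "\<bar>\<phi> i s\<bar> + \<bar>k\<bar> \<le> (K + \<bar>k\<bar>) * exp (l / 64 * s\<^sup>2)" using K(2)[of s] by (simp add: distrib_right)
    moreover have "\<bar>ln (f i s)\<bar> \<le> \<bar>\<phi> i s\<bar> + \<bar>k\<bar>" using k[of s] by linarith
    ultimately show "\<bar>ln (f i s)\<bar> \<le> (K + \<bar>k\<bar>) * exp (l / 64 * s\<^sup>2)" by linarith
  qed
  moreover have "0 \<le> K + \<bar>k\<bar>" using K by simp
  ultimately show ?thesis by (rule that[rotated])
qed

text \<open>Tangents of the convex function -ln f_i at unit distance control \<open>b i\<close> by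
  values of ln f_i, so every moment required by the one-dimensional bound reduces to the growth of
  ln f_i.\<close>

lemma score_bound_f:
  assumes i: "i \<in> S"
  shows "score_bound (f i) (b i)"
proof -
  interpret U: strongly_convex_potential "\<lambda>s. - ln (f i s)" "b i" l by (rule potential[OF i])
  obtain K where K: "0 \<le> K" "\<And>s. \<bar>ln (f i s)\<bar> \<le> K * exp (l / 64 * s\<^sup>2)" by (rule ln_bound[OF i]) (rule that)
  define K2 where "K2 = K * exp (l / 32)"
  have K2: "K \<le> K2" "0 \<le> K2" using K l by (auto simp: K2_def mult_le_cancel_left1)
  have sh: "\<bar>ln (f i (s + e))\<bar> \<le> K2 * exp (l / 32 * s\<^sup>2)" if "\<bar>e\<bar> \<le> 1" for s e
  proof -
    have "(s + e)\<^sup>2 \<le> 2 * s\<^sup>2 + 2 * e\<^sup>2" using zero_le_power2[of "s - e"] by (simp add: power2_eq_square algebra_simps)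
    also have "e\<^sup>2 \<le> 1" using that by (simp add: abs_square_le_1)
    finally have "l / 64 * (s + e)\<^sup>2 \<le> l / 64 * (2 * s\<^sup>2 + 2)" using l by (intro mult_left_mono) auto
    then have "exp (l / 64 * (s + e)\<^sup>2) \<le> exp (l / 32 + l / 32 * s\<^sup>2)" by (simp add: distrib_left)
    then have "K * exp (l / 64 * (s + e)\<^sup>2) \<le> K * (exp (l / 32) * exp (l / 32 * s\<^sup>2))"
      unfolding exp_add using K(1) by (rule mult_left_mono)
    then show ?thesis using K(2)[of "s + e"] by (simp add: K2_def mult.assoc)
  qed
  have up: "exp (l / 32 * s\<^sup>2) \<le> exp (l / 16 * s\<^sup>2)" for s using l by (simp add: mult_right_mono)
  have sh': "\<bar>ln (f i (s + e))\<bar> \<le> K2 * exp (l / 16 * s\<^sup>2)" if "\<bar>e\<bar> \<le> 1" for s e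
    using sh[OF that, of s] mult_left_mono[OF up K2(2), of s] by linarith
  have bb: "\<bar>s * b i s\<bar> \<le> (4 * K2 * (1 + 32 / l)) * exp (l / 16 * s\<^sup>2)" for s
  proof -
    have "\<bar>b i s\<bar> \<le> \<bar>ln (f i (s + 1))\<bar> + \<bar>ln (f i (s + -1))\<bar> + 2 * \<bar>ln (f i (s + 0))\<bar>"
    proof -
      have "b i s \<le> - ln (f i (s + 1)) + ln (f i s)" "- b i s \<le> - ln (f i (s + -1)) + ln (f i s)"
        using U.tangent_le[of s "s + 1"] U.tangent_le[of s "s - 1"] by auto
      then show ?thesis by simp
    qed
    also have "\<dots> \<le> 4 * K2 * exp (l / 32 * s\<^sup>2)" using sh[of 1 s] sh[of "-1" s] sh[of 0 s] by simp
    finally have 1: "\<bar>b i s\<bar> \<le> 4 * K2 * exp (l / 32 * s\<^sup>2)" .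
    have "2 * \<bar>s\<bar> \<le> 1 + s\<^sup>2" using zero_le_power2[of "\<bar>s\<bar> - 1"] by (simp add: power2_diff)
    then have "\<bar>s\<bar> \<le> 1 + s\<^sup>2" by linarith
    also have "\<dots> \<le> (1 + 32 / l) * (1 + l / 32 * s\<^sup>2)" using l by (simp add: field_simps)
    also have "\<dots> \<le> (1 + 32 / l) * exp (l / 32 * s\<^sup>2)" using l by (intro mult_left_mono exp_ge_add_one_self) auto
    finally have 2: "\<bar>s\<bar> \<le> (1 + 32 / l) * exp (l / 32 * s\<^sup>2)" .
    have "\<bar>s\<bar> * \<bar>b i s\<bar> \<le> ((1 + 32 / l) * exp (l / 32 * s\<^sup>2)) * (4 * K2 * exp (l / 32 * s\<^sup>2))"
      using 1 2 by (intro mult_mono) auto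
    also have "\<dots> = (4 * K2 * (1 + 32 / l)) * (exp (l / 32 * s\<^sup>2) * exp (l / 32 * s\<^sup>2))" by (simp add: mult_ac)
    also have "exp (l / 32 * s\<^sup>2) * exp (l / 32 * s\<^sup>2) = exp (l / 16 * s\<^sup>2)" by (simp flip: exp_add)
    finally show ?thesis by (simp add: abs_mult)
  qed
  have fe: "exp (- (- ln (f i s))) = f i s" for s using f_pos[OF i] by simp
  have "score_bound (\<lambda>s. exp (- (- ln (f i s)))) (b i)"
  proof (rule U.score_bound; unfold fe)
    show "integrable lborel (\<lambda>x. f i x * - ln (f i x))"
      by (rule integrable_subgaussian(1)[OF i, of _ K2]) (use sh'[of 0] in auto)
    show "integrable lborel (\<lambda>x. f i x * - ln (f i (x + 1)))"
      by (rule integrable_subgaussian(1)[OF i, of _ K2]) (use sh'[of 1] in auto)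
    show "integrable lborel (\<lambda>x. f i x * - ln (f i (x - 1)))"
      by (rule integrable_subgaussian(1)[OF i, of _ K2]) (use sh'[of "-1"] in auto)
    show "integrable lborel (\<lambda>x. f i x * (x * b i x))"
      by (rule integrable_subgaussian(1)[OF i, of _ "4 * K2 * (1 + 32 / l)"]) (use bb U.U'_meas in auto)
  qed
  then show ?thesis unfolding fe .
qed

lemma ln_integrable: assumes i: "i \<in> S" shows "integrable (Pi\<^sub>M S N) (\<lambda>x. ln (f i (x i)))"
proof -
  obtain K where K: "0 \<le> K" "\<And>s. \<bar>ln (f i s)\<bar> \<le> K * exp (l / 64 * s\<^sup>2)" by (rule ln_bound[OF i]) (rule that)
  show ?thesis
  proof (rule integrable_prod_subgaussian)
    fix x :: "'i \<Rightarrow> real"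
    have "(x i)\<^sup>2 \<le> (\<Sum>j\<in>S. (x j)\<^sup>2)" by (rule member_le_sum) (use i fin in auto)
    then have "l / 64 * (x i)\<^sup>2 \<le> l / 16 * (\<Sum>j\<in>S. (x j)\<^sup>2)" using l by (intro mult_mono sum_nonneg) auto
    then have "K * exp (l / 64 * (x i)\<^sup>2) \<le> K * exp (l / 16 * (\<Sum>j\<in>S. (x j)\<^sup>2))" using K by (intro mult_left_mono) auto
    then show "\<bar>ln (f i (x i))\<bar> \<le> K * exp (l / 16 * (\<Sum>j\<in>S. (x j)\<^sup>2))" using K(2)[of "x i"] by linarith
  qed (use i in auto)
qed

end

lemma taylor_lower:
  fixes \<phi> \<phi>' \<phi>'' :: "real \<Rightarrow> real"
  assumes d1: "\<And>s. (\<phi> has_real_derivative \<phi>' s) (at s)" and d2: "\<And>s. (\<phi>' has_real_derivative \<phi>'' s) (at s)"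
    and q: "\<And>s. q \<le> \<phi>'' s"
  shows "\<phi> 0 + \<phi>' 0 + q / 2 \<le> \<phi> 1"
proof -
  have m: "\<phi>' 0 + q * s \<le> \<phi>' s" if "0 \<le> s" for s
  proof -
    have "\<phi>' 0 - q * 0 \<le> \<phi>' s - q * s"
    proof (rule DERIV_nonneg_imp_nondecreasing[OF that])
      fix x
      have "((\<lambda>s. \<phi>' s - q * s) has_real_derivative (\<phi>'' x - q)) (at x)"
        using DERIV_diff[OF d2 DERIV_cmult[OF DERIV_ident, of q]] by simp
      moreover have "0 \<le> \<phi>'' x - q" using q[of x] by simp
      ultimately show "\<exists>y. ((\<lambda>s. \<phi>' s - q * s) has_real_derivative y) (at x) \<and> 0 \<le> y" by blast
    qed
    then show ?thesis by simp
  qed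
  have "\<phi> 0 - \<phi>' 0 * 0 - q / 2 * 0\<^sup>2 \<le> \<phi> 1 - \<phi>' 0 * 1 - q / 2 * 1\<^sup>2"
  proof (rule DERIV_nonneg_imp_nondecreasing[of 0 1 "\<lambda>s. \<phi> s - \<phi>' 0 * s - q / 2 * s\<^sup>2"])
    fix x :: real assume "0 \<le> x"
    have "((\<lambda>s. \<phi> s - \<phi>' 0 * s - q / 2 * s\<^sup>2) has_real_derivative (\<phi>' x - \<phi>' 0 - q * x)) (at x)"
      by (rule derivative_eq_intros d1 refl | simp)+
    moreover have "0 \<le> \<phi>' x - \<phi>' 0 - q * x" using m[OF \<open>0 \<le> x\<close>] by simp
    ultimately show "\<exists>y. ((\<lambda>s. \<phi> s - \<phi>' 0 * s - q / 2 * s\<^sup>2) has_real_derivative y) (at x) \<and> 0 \<le> y" by blast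
  qed simp
  then show ?thesis by simp
qed

section \<open>Convexity of the potential\<close>

locale smooth_potential =
  fixes V :: "real ^ 'n \<Rightarrow> real" and G :: "real ^ 'n \<Rightarrow> real ^ 'n" and H :: "real ^ 'n \<Rightarrow> real ^ 'n ^ 'n"
  assumes grad: "\<And>z. (V has_derivative (\<lambda>h. G z \<bullet> h)) (at z)"
    and hess: "\<And>z. (G has_derivative (\<lambda>h. H z *v h)) (at z)"
    and hess_cont: "continuous_on UNIV H"
begin

lemma line_deriv:
  "((\<lambda>s. V (x + s *\<^sub>R d)) has_real_derivative G (x + s *\<^sub>R d) \<bullet> d) (at s)"
  "((\<lambda>s. G (x + s *\<^sub>R d) \<bullet> e) has_real_derivative e \<bullet> (H (x + s *\<^sub>R d) *v d)) (at s)"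
proof -
  have l: "((\<lambda>s. x + s *\<^sub>R d) has_derivative (\<lambda>h. h *\<^sub>R d)) (at s)"
    by (auto intro!: derivative_eq_intros)
  show "((\<lambda>s. V (x + s *\<^sub>R d)) has_real_derivative G (x + s *\<^sub>R d) \<bullet> d) (at s)"
  proof -
    have "(\<lambda>h. G (x + s *\<^sub>R d) \<bullet> (h *\<^sub>R d)) = (*) (G (x + s *\<^sub>R d) \<bullet> d)" by (auto simp: mult.commute)
    then show ?thesis using has_derivative_compose[OF l grad] unfolding has_field_derivative_def by simp
  qed
  have "((\<lambda>s. G (x + s *\<^sub>R d) \<bullet> e) has_derivative (\<lambda>h. (H (x + s *\<^sub>R d) *v (h *\<^sub>R d)) \<bullet> e)) (at s)"
    by (rule has_derivative_inner_left[OF has_derivative_compose[OF l hess]])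
  moreover have "(\<lambda>h. (H (x + s *\<^sub>R d) *v (h *\<^sub>R d)) \<bullet> e) = (*) (e \<bullet> (H (x + s *\<^sub>R d) *v d))"
    by (auto simp: matrix_vector_mult_scaleR inner_commute mult.commute)
  ultimately show "((\<lambda>s. G (x + s *\<^sub>R d) \<bullet> e) has_real_derivative e \<bullet> (H (x + s *\<^sub>R d) *v d)) (at s)"
    unfolding has_field_derivative_def by simp
qed

lemma quadratic_lower:
  assumes "\<And>z. q \<le> d \<bullet> (H z *v d)"
  shows "V x + G x \<bullet> d + q / 2 \<le> V (x + d)"
  using taylor_lower[of "\<lambda>s. V (x + s *\<^sub>R d)" "\<lambda>s. G (x + s *\<^sub>R d) \<bullet> d" "\<lambda>s. d \<bullet> (H (x + s *\<^sub>R d) *v d)" q]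
    line_deriv assms by simp

lemma quadratic_upper:
  assumes "\<And>z. d \<bullet> (H z *v d) \<le> q"
  shows "V (x + d) \<le> V x + G x \<bullet> d + q / 2"
proof -
  have "- V (x + 0 *\<^sub>R d) + - (G (x + 0 *\<^sub>R d) \<bullet> d) + (- q) / 2 \<le> - V (x + 1 *\<^sub>R d)"
    by (rule taylor_lower[of "\<lambda>s. - V (x + s *\<^sub>R d)" "\<lambda>s. - (G (x + s *\<^sub>R d) \<bullet> d)" "\<lambda>s. - (d \<bullet> (H (x + s *\<^sub>R d) *v d))" "- q"])
      (auto intro!: DERIV_minus line_deriv assms)
  then show ?thesis by simp
qed

lemma H_entry: "axis i 1 \<bullet> (H z *v axis j 1) = H z $ i $ j"
  by (simp add: inner_axis' matrix_vector_mul_component inner_axis)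

lemma G_cont: "continuous_on A G"
  by (rule has_derivative_continuous_on[OF has_derivative_at_withinI[OF hess]])

lemma V_cont: "continuous_on A V"
  by (rule has_derivative_continuous_on[OF has_derivative_at_withinI[OF grad]])

lemma H_entry_cont: "continuous_on A (\<lambda>z. H z $ i $ j)"
  by (intro continuous_intros continuous_on_subset[OF hess_cont]) simp

text \<open>Mean value theorem applied twice to the mixed second difference.\<close>

lemma mixed_difference:
  assumes "0 < s"
  shows "\<exists>a b. 0 \<le> a \<and> a \<le> s \<and> 0 \<le> b \<and> b \<le> s \<and>
    V (z + s *\<^sub>R u + s *\<^sub>R w) - V (z + s *\<^sub>R u) - V (z + s *\<^sub>R w) + V z = s\<^sup>2 * (u \<bullet> (H (z + a *\<^sub>R u + b *\<^sub>R w) *v w))"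
proof -
  define \<psi> where "\<psi> t = V ((z + s *\<^sub>R w) + t *\<^sub>R u) - V (z + t *\<^sub>R u)" for t
  have d\<psi>: "(\<psi> has_real_derivative (G ((z + s *\<^sub>R w) + t *\<^sub>R u) \<bullet> u - G (z + t *\<^sub>R u) \<bullet> u)) (at t)" for t
    unfolding \<psi>_def by (rule DERIV_diff[OF line_deriv(1) line_deriv(1)])
  then obtain a where a: "0 < a" "a < s" "\<psi> s - \<psi> 0 = (s - 0) * (G ((z + s *\<^sub>R w) + a *\<^sub>R u) \<bullet> u - G (z + a *\<^sub>R u) \<bullet> u)"
    using MVT2[OF assms d\<psi>] by metis
  obtain b where b: "0 < b" "b < s"
    "G ((z + a *\<^sub>R u) + s *\<^sub>R w) \<bullet> u - G ((z + a *\<^sub>R u) + 0 *\<^sub>R w) \<bullet> u = (s - 0) * (u \<bullet> (H ((z + a *\<^sub>R u) + b *\<^sub>R w) *v w))"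
    using MVT2[OF assms, of "\<lambda>t. G ((z + a *\<^sub>R u) + t *\<^sub>R w) \<bullet> u" "\<lambda>t. u \<bullet> (H ((z + a *\<^sub>R u) + t *\<^sub>R w) *v w)"] line_deriv(2) by metis
  have "V (z + s *\<^sub>R u + s *\<^sub>R w) - V (z + s *\<^sub>R u) - V (z + s *\<^sub>R w) + V z = \<psi> s - \<psi> 0"
    by (simp add: \<psi>_def add_ac)
  also have "\<dots> = s\<^sup>2 * (u \<bullet> (H (z + a *\<^sub>R u + b *\<^sub>R w) *v w))"
    using a(3) b(3) by (simp add: power2_eq_square add_ac)
  finally show ?thesis using a b by (intro exI[of _ a] exI[of _ b]) auto
qed

text \<open>X is the mixed second difference quotient with step 1 / (n + 1), an expression symmetric
  in u and w; continuity of the Hessian at z gives the limit. Exchanging u and w then yields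
  symmetry of the Hessian.\<close>

lemma mixed_limit:
  obtains X where "X \<longlonglongrightarrow> u \<bullet> (H z *v w)"
    "\<And>n. (1 / real (Suc n))\<^sup>2 * X n = V (z + (1 / real (Suc n)) *\<^sub>R u + (1 / real (Suc n)) *\<^sub>R w) - V (z + (1 / real (Suc n)) *\<^sub>R u) - V (z + (1 / real (Suc n)) *\<^sub>R w) + V z"
proof -
  have "\<forall>n. \<exists>a b. 0 \<le> a \<and> a \<le> 1 / real (Suc n) \<and> 0 \<le> b \<and> b \<le> 1 / real (Suc n) \<and>
    V (z + (1 / real (Suc n)) *\<^sub>R u + (1 / real (Suc n)) *\<^sub>R w) - V (z + (1 / real (Suc n)) *\<^sub>R u) - V (z + (1 / real (Suc n)) *\<^sub>R w) + V z
      = (1 / real (Suc n))\<^sup>2 * (u \<bullet> (H (z + a *\<^sub>R u + b *\<^sub>R w) *v w))"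
    by (intro allI mixed_difference) simp
  then obtain a b where ab: "\<And>n. 0 \<le> a n" "\<And>n. a n \<le> 1 / real (Suc n)" "\<And>n. 0 \<le> b n" "\<And>n. b n \<le> 1 / real (Suc n)"
    and E: "\<And>n. V (z + (1 / real (Suc n)) *\<^sub>R u + (1 / real (Suc n)) *\<^sub>R w) - V (z + (1 / real (Suc n)) *\<^sub>R u) - V (z + (1 / real (Suc n)) *\<^sub>R w) + V z
      = (1 / real (Suc n))\<^sup>2 * (u \<bullet> (H (z + a n *\<^sub>R u + b n *\<^sub>R w) *v w))" by metis
  have l: "(\<lambda>n. 1 / real (Suc n)) \<longlonglongrightarrow> 0" using LIMSEQ_inverse_real_of_nat by (simp add: inverse_eq_divide)
  have "a \<longlonglongrightarrow> 0" by (rule tendsto_sandwich[OF _ _ tendsto_const l]) (use ab in auto)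
  moreover have "b \<longlonglongrightarrow> 0" by (rule tendsto_sandwich[OF _ _ tendsto_const l]) (use ab in auto)
  ultimately have "(\<lambda>n. z + a n *\<^sub>R u + b n *\<^sub>R w) \<longlonglongrightarrow> z + 0 *\<^sub>R u + 0 *\<^sub>R w" by (intro tendsto_intros)
  then have lim: "(\<lambda>n. z + a n *\<^sub>R u + b n *\<^sub>R w) \<longlonglongrightarrow> z" by simp
  have "continuous_on UNIV (\<lambda>z. u \<bullet> (H z *v w))"
    unfolding matrix_vector_mult_def inner_vec_def by (intro continuous_intros H_entry_cont)
  then have "isCont (\<lambda>z. u \<bullet> (H z *v w)) z" by (simp add: continuous_on_eq_continuous_at)
  from isCont_tendsto_compose[OF this lim] show ?thesis
    by (rule that) (simp only: E)
qed

lemma hess_sym: "H z $ i $ j = H z $ j $ i"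
proof -
  obtain X where X: "X \<longlonglongrightarrow> axis i 1 \<bullet> (H z *v axis j 1)"
    "\<And>n. (1 / real (Suc n))\<^sup>2 * X n = V (z + (1 / real (Suc n)) *\<^sub>R axis i 1 + (1 / real (Suc n)) *\<^sub>R axis j 1) - V (z + (1 / real (Suc n)) *\<^sub>R axis i 1) - V (z + (1 / real (Suc n)) *\<^sub>R axis j 1) + V z"
    by (rule mixed_limit[of "axis i 1" z "axis j 1"]) (rule that)
  obtain Y where Y: "Y \<longlonglongrightarrow> axis j 1 \<bullet> (H z *v axis i 1)"
    "\<And>n. (1 / real (Suc n))\<^sup>2 * Y n = V (z + (1 / real (Suc n)) *\<^sub>R axis j 1 + (1 / real (Suc n)) *\<^sub>R axis i 1) - V (z + (1 / real (Suc n)) *\<^sub>R axis j 1) - V (z + (1 / real (Suc n)) *\<^sub>R axis i 1) + V z"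
    by (rule mixed_limit[of "axis j 1" z "axis i 1"]) (rule that)
  have "(1 / real (Suc n))\<^sup>2 * X n = (1 / real (Suc n))\<^sup>2 * Y n" for n
    unfolding X(2) Y(2) by (simp add: add_ac)
  then have "X n = Y n" for n by simp
  then have "X = Y" by auto
  then show ?thesis using LIMSEQ_unique X(1) Y(1) H_entry by metis
qed

end

locale structured_potential = smooth_potential V G H
  for V :: "real ^ 'n \<Rightarrow> real" and G H +
  fixes r :: 'n and lV lV' LV' :: real
  assumes pos: "lV > 0" "lV' > 0" "LV' > 0"
    and R: "\<And>z. H z $ r $ r \<le> LV' / 2"
    and P1: "\<And>z. loewner_ge_sub (H z) (UNIV - {r}) lV"
    and RD_bdd: "bdd_above (range (\<lambda>w. \<Sum>j\<in>UNIV - {r}. (H w $ r $ j)\<^sup>2))"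
    and RD: "\<And>z. H z $ r $ r - (SUP w. \<Sum>j\<in>UNIV - {r}. (H w $ r $ j)\<^sup>2) / lV \<ge> lV'"
begin

abbreviation "S \<equiv> UNIV - {r}"
definition "\<beta> = (SUP w. \<Sum>j\<in>UNIV - {r}. (H w $ r $ j)\<^sup>2)"

lemma row_le: "(\<Sum>j\<in>S. (H z $ r $ j)\<^sup>2) \<le> \<beta>" unfolding \<beta>_def by (rule cSUP_upper[OF _ RD_bdd]) simp

lemma \<beta>_nonneg: "0 \<le> \<beta>" using row_le[of undefined] sum_nonneg[of S "\<lambda>j. (H undefined $ r $ j)\<^sup>2"] by simp

lemma Hrr_ge: "lV' + \<beta> / lV \<le> H z $ r $ r" using RD[of z] by (simp add: \<beta>_def)

lemma lV'_le: "lV' \<le> LV' / 2" using Hrr_ge[of undefined] R[of undefined] \<beta>_nonneg pos divide_nonneg_pos[of \<beta> lV] by linarith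

lemma sum_split_r: "(\<Sum>i\<in>UNIV. f i) = f r + (\<Sum>i\<in>S. f i)" for f :: "'n \<Rightarrow> real"
  by (rule sum.remove) auto

lemma hess_form:
  "d \<bullet> (H z *v d) = H z $ r $ r * (d $ r)\<^sup>2 + 2 * d $ r * (\<Sum>j\<in>S. H z $ r $ j * d $ j) + (\<Sum>i\<in>S. \<Sum>j\<in>S. d $ i * H z $ i $ j * d $ j)"
proof -
  have "d \<bullet> (H z *v d) = (\<Sum>i\<in>UNIV. \<Sum>j\<in>UNIV. d $ i * H z $ i $ j * d $ j)"
    by (simp add: inner_vec_def matrix_vector_mult_def sum_distrib_left mult.assoc)
  also have "\<dots> = d $ r * H z $ r $ r * d $ r + (\<Sum>j\<in>S. d $ r * H z $ r $ j * d $ j)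
     + ((\<Sum>i\<in>S. d $ i * H z $ i $ r * d $ r) + (\<Sum>i\<in>S. \<Sum>j\<in>S. d $ i * H z $ i $ j * d $ j))"
    by (simp only: sum_split_r sum.distrib)
  also have "(\<Sum>i\<in>S. d $ i * H z $ i $ r * d $ r) = (\<Sum>j\<in>S. d $ r * H z $ r $ j * d $ j)"
    by (intro sum.cong refl) (simp add: hess_sym[of z _ r] mult_ac)
  finally show ?thesis by (simp add: power2_eq_square sum_distrib_left mult_ac)
qed

lemma block_ge: "lV * (\<Sum>i\<in>S. (d $ i)\<^sup>2) \<le> (\<Sum>i\<in>S. \<Sum>j\<in>S. d $ i * H z $ i $ j * d $ j)"
proof -
  define x where "x = (\<chi> i. if i = r then 0 else d $ i)"
  have "lV * (x \<bullet> x) \<le> x \<bullet> (H z *v x)" using P1[of z] unfolding loewner_ge_sub_def by (auto simp: x_def)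
  also have "x \<bullet> (H z *v x) = (\<Sum>i\<in>S. \<Sum>j\<in>S. d $ i * H z $ i $ j * d $ j)"
    unfolding hess_form by (simp add: x_def)
  also have "x \<bullet> x = (\<Sum>i\<in>S. (d $ i)\<^sup>2)"
    by (simp add: inner_vec_def sum_split_r) (simp add: x_def power2_eq_square)
  finally show ?thesis .
qed

text \<open>Schur complement with respect to the root. Let a be the root entry, b the mixed term and
  q the squared length of the rest. A share \<theta> of the block bound is kept, so b^2 \<le> (a -
  e) (1 - \<theta>) lV q is wanted. Cauchy-Schwarz and (RD) give b^2 \<le> lV (a - lV') q, and a -
  lV' \<le> (1 - \<theta>) a - e is the same as \<theta> a \<le> lV' - e, which follows from (R) and
  the assumption on \<theta>.\<close>

lemma hess_lower:
  assumes \<theta>: "0 < \<theta>" "\<theta> \<le> 1" and a: "\<theta> * (LV' / 2) \<le> lV' - e * 1" and e: "0 \<le> e"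
  shows "e * (d $ r)\<^sup>2 + \<theta> * lV * (\<Sum>i\<in>S. (d $ i)\<^sup>2) \<le> d \<bullet> (H z *v d)"
proof -
  let ?a = "H z $ r $ r" and ?q = "\<Sum>i\<in>S. (d $ i)\<^sup>2" and ?b = "\<Sum>j\<in>S. H z $ r $ j * d $ j"
  let ?\<beta> = "\<Sum>j\<in>S. (H z $ r $ j)\<^sup>2"
  have q0: "0 \<le> ?q" and b0: "0 \<le> ?\<beta>" by (auto intro: sum_nonneg)
  have cs: "?b\<^sup>2 \<le> ?\<beta> * ?q" by (rule Cauchy_Schwarz_ineq_sum)
  have bl: "?\<beta> \<le> lV * (?a - lV')" using row_le[of z] Hrr_ge[of z] pos by (simp add: field_simps)
  have "\<theta> * ?a \<le> \<theta> * (LV' / 2)" using R[of z] \<theta> by (intro mult_left_mono) auto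
  then have ta: "\<theta> * ?a \<le> lV' - e" using a by simp
  have "?b\<^sup>2 \<le> (lV * (?a - lV')) * ?q" using cs mult_right_mono[OF bl q0] by linarith
  also have "\<dots> \<le> (lV * ((1 - \<theta>) * ?a - e)) * ?q"
    using ta pos q0 by (intro mult_right_mono mult_left_mono) (auto simp: algebra_simps)
  also have "\<dots> \<le> (lV * ((1 - \<theta>) * (?a - e))) * ?q"
  proof (intro mult_right_mono mult_left_mono)
    have "0 \<le> \<theta> * e" using \<theta> e by simp
    then show "(1 - \<theta>) * ?a - e \<le> (1 - \<theta>) * (?a - e)" by (simp add: algebra_simps)
  qed (use pos q0 in auto)
  finally have key: "?b\<^sup>2 \<le> (?a - e) * ((1 - \<theta>) * lV * ?q)" by (simp add: mult_ac)
  \<comment> \<open>Positivity of the pivot: the root entry is at least lV', and lV' exceeds e by at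
    least \<theta> LV' / 2.\<close>
  have ae: "0 < ?a - e"
  proof -
    have "?a \<ge> lV'" using Hrr_ge[of z] \<beta>_nonneg pos divide_nonneg_pos[of \<beta> lV] by linarith
    moreover have "0 < \<theta> * (LV' / 2)" using \<theta> pos by simp
    ultimately show ?thesis using a by linarith
  qed
  have "0 \<le> ((?a - e) * d $ r + ?b)\<^sup>2" by simp
  then have "0 \<le> (?a - e) * ((?a - e) * (d $ r)\<^sup>2 + 2 * d $ r * ?b) + ?b\<^sup>2"
    by (simp add: power2_eq_square algebra_simps)
  also have "\<dots> \<le> (?a - e) * ((?a - e) * (d $ r)\<^sup>2 + 2 * d $ r * ?b) + (?a - e) * ((1 - \<theta>) * lV * ?q)"
    using key by simp
  also have "\<dots> = (?a - e) * ((?a - e) * (d $ r)\<^sup>2 + 2 * d $ r * ?b + (1 - \<theta>) * lV * ?q)" by (simp add: algebra_simps)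
  finally have "0 \<le> (?a - e) * (d $ r)\<^sup>2 + 2 * d $ r * ?b + (1 - \<theta>) * lV * ?q" using ae by (simp add: zero_le_mult_iff)
  moreover have "lV * ?q \<le> (\<Sum>i\<in>S. \<Sum>j\<in>S. d $ i * H z $ i $ j * d $ j)" by (rule block_ge)
  ultimately show ?thesis unfolding hess_form by (simp add: algebra_simps)
qed

definition "\<kappa> = 2 * lV' / LV' * lV"

lemma \<kappa>_pos: "0 < \<kappa>" using pos by (simp add: \<kappa>_def)

lemma tangent: "V x + G x \<bullet> (y - x) + \<kappa> / 2 * (\<Sum>i\<in>S. (y $ i - x $ i)\<^sup>2) \<le> V y"
proof -
  have "\<kappa> * (\<Sum>i\<in>S. ((y - x) $ i)\<^sup>2) \<le> (y - x) \<bullet> (H z *v (y - x))" for z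
    using hess_lower[of "2 * lV' / LV'" 0 "y - x" z] pos lV'_le by (simp add: \<kappa>_def field_simps)
  from quadratic_lower[OF this, of x] show ?thesis by simp
qed

text \<open>Half of lV' is reserved for the root direction, which halves the share left to the other
  coordinates. The result serves the finiteness of moments only and does not influence the final
  constant.\<close>

lemma quadratic_growth:
  obtains m where "0 < m" "\<And>x y. V x + G x \<bullet> (y - x) + m / 2 * (norm (y - x))\<^sup>2 \<le> V y"
proof -
  define m where "m = min (lV' / 2) (lV' / LV' * lV)"
  have m: "0 < m" using pos by (simp add: m_def)
  have "V x + G x \<bullet> (y - x) + m / 2 * (norm (y - x))\<^sup>2 \<le> V y" for x y
  proof -
    have "m * (norm (y - x))\<^sup>2 \<le> (y - x) \<bullet> (H z *v (y - x))" for z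
    proof -
      have "m * (norm (y - x))\<^sup>2 = m * ((y - x) $ r)\<^sup>2 + m * (\<Sum>i\<in>S. ((y - x) $ i)\<^sup>2)"
        by (simp add: norm_eq_sqrt_inner inner_vec_def sum_split_r power2_eq_square distrib_left sum_nonneg)
      also have "\<dots> \<le> lV' / 2 * ((y - x) $ r)\<^sup>2 + lV' / LV' * lV * (\<Sum>i\<in>S. ((y - x) $ i)\<^sup>2)"
      proof (intro add_mono mult_right_mono sum_nonneg)
        show "m \<le> lV' / 2" "m \<le> lV' / LV' * lV" by (simp_all only: m_def min.cobounded1 min.cobounded2)
      qed auto
      also have "\<dots> \<le> (y - x) \<bullet> (H z *v (y - x))"
        by (rule hess_lower) (use pos lV'_le in \<open>auto simp: field_simps\<close>)
      finally show ?thesis .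
    qed
    from quadratic_lower[OF this, of x] show ?thesis by simp
  qed
  then show ?thesis using that m by blast
qed

lemma coordinate_convex:
  assumes "i \<in> S"
  shows "V x + G x $ i * s + lV / 2 * s\<^sup>2 \<le> V (x + s *\<^sub>R axis i 1)"
proof -
  have "lV * s\<^sup>2 \<le> (s *\<^sub>R axis i 1) \<bullet> (H z *v (s *\<^sub>R axis i 1))" for z
  proof -
    define e :: "real ^ 'n" where "e = s *\<^sub>R axis i 1"
    have e0: "e $ r = 0" using assms by (simp add: e_def axis_def)
    have "lV * (e \<bullet> e) \<le> e \<bullet> (H z *v e)"
      using P1[of z] e0 unfolding loewner_ge_sub_def by auto
    then show ?thesis by (simp add: e_def inner_axis_axis power2_eq_square)
  qed
  from quadratic_lower[OF this, of x] show ?thesis by (simp add: inner_axis mult.commute)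
qed

text \<open>Semiconcavity in the root direction: the source of the loss LV' h^2 / 4 when a slice is
  copied to the root value t + h.\<close>

lemma root_upper: "V (x + s *\<^sub>R axis r 1) \<le> V x + G x $ r * s + LV' / 4 * s\<^sup>2"
proof -
  have e: "(s *\<^sub>R axis r 1) \<bullet> (H z *v (s *\<^sub>R axis r 1)) = s\<^sup>2 * H z $ r $ r" for z
    by (simp add: matrix_vector_mult_scaleR H_entry power2_eq_square)
  have "(s *\<^sub>R axis r 1) \<bullet> (H z *v (s *\<^sub>R axis r 1)) \<le> s\<^sup>2 * (LV' / 2)" for z
    unfolding e by (intro mult_left_mono R) auto
  from quadratic_upper[OF this, of x] show ?thesis by (simp add: inner_axis mult.commute)
qed

text \<open>(R) bounds the diagonal entry and (RD) the other entries of the root row of the Hessian,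
  so the root derivative is Lipschitz; its linear growth makes the moments of the root score
  finite.\<close>

lemma root_gradient_bound:
  obtains c where "0 \<le> c" "\<And>z. \<bar>G z $ r\<bar> \<le> c * (1 + norm z)"
proof -
  define K where "K = sqrt ((LV' / 2)\<^sup>2 + \<beta>)"
  have K0: "0 \<le> K" using \<beta>_nonneg by (simp add: K_def)
  have row: "norm (H z $ r) \<le> K" for z
  proof -
    have "0 \<le> H z $ r $ r" using Hrr_ge[of z] \<beta>_nonneg pos divide_nonneg_pos[of \<beta> lV] by linarith
    then have "(H z $ r $ r)\<^sup>2 \<le> (LV' / 2)\<^sup>2" using R[of z] by (intro power_mono)
    then show ?thesis unfolding K_def norm_eq_sqrt_inner using row_le[of z]
      by (intro real_sqrt_le_mono) (simp add: inner_vec_def sum_split_r power2_eq_square)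
  qed
  have "\<bar>G z $ r\<bar> \<le> (\<bar>G 0 $ r\<bar> + K) * (1 + norm z)" for z
  proof -
    obtain t where t: "G (0 + 1 *\<^sub>R z) \<bullet> axis r 1 - G (0 + 0 *\<^sub>R z) \<bullet> axis r 1 = (1 - 0) * (axis r 1 \<bullet> (H (0 + t *\<^sub>R z) *v z))"
      using MVT2[OF zero_less_one, of "\<lambda>t. G (0 + t *\<^sub>R z) \<bullet> axis r 1" "\<lambda>t. axis r 1 \<bullet> (H (0 + t *\<^sub>R z) *v z)"] line_deriv(2) by metis
    have "axis r 1 \<bullet> (H (0 + t *\<^sub>R z) *v z) = (H (0 + t *\<^sub>R z) $ r) \<bullet> z"
      by (simp add: inner_axis' matrix_vector_mul_component)
    then have "G z $ r - G 0 $ r = (H (0 + t *\<^sub>R z) $ r) \<bullet> z" using t by (simp add: inner_axis)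
    then have "\<bar>G z $ r\<bar> \<le> \<bar>G 0 $ r\<bar> + norm (H (0 + t *\<^sub>R z) $ r) * norm z"
      using Cauchy_Schwarz_ineq2[of "H (0 + t *\<^sub>R z) $ r" z] by linarith
    also have "\<dots> \<le> \<bar>G 0 $ r\<bar> + K * norm z" using row by (intro add_left_mono mult_right_mono) auto
    also have "\<dots> \<le> (\<bar>G 0 $ r\<bar> + K) * (1 + norm z)" using K0 by (simp add: algebra_simps)
    finally show ?thesis .
  qed
  then show ?thesis using that[of "\<bar>G 0 $ r\<bar> + K"] K0 by simp
qed

lemma G_coordinate_deriv: "((\<lambda>s. G (x + s *\<^sub>R axis k 1) $ j) has_real_derivative H (x + s *\<^sub>R axis k 1) $ j $ k) (at s)"
  using line_deriv(2)[of x "axis k 1" "axis j 1" s] by (simp add: inner_axis H_entry)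

end

section \<open>Lebesgue measure split into the root and the other coordinates\<close>

lemma measurable_vec_lambda[measurable]:
  "(\<lambda>x. \<chi> i. x i) \<in> borel_measurable (Pi\<^sub>M UNIV (\<lambda>_::'n::finite. lborel :: real measure))"
  by (subst borel_measurable_euclidean_space) (auto simp: Basis_vec_def inner_axis)

text \<open>Bridge from vectors to functions on the index set, where single coordinates can be
  updated and integrated separately.\<close>

lemma lborel_vec_eq:
  "(lborel :: (real ^ 'n::finite) measure) = distr (Pi\<^sub>M UNIV (\<lambda>_. lborel)) borel (\<lambda>x. \<chi> i. x i)"
proof (rule lborel_eqI)
  interpret product_sigma_finite "\<lambda>_::'n. lborel :: real measure" by standard
  fix l u :: "real ^ 'n"
  assume le: "\<And>b. b \<in> Basis \<Longrightarrow> l \<bullet> b \<le> u \<bullet> b"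
  have le': "l $ i \<le> u $ i" for i using le[of "axis i 1"] by (simp add: inner_axis axis_in_Basis_iff)
  have pre: "(\<lambda>x. \<chi> i. x i) -` box l u \<inter> space (Pi\<^sub>M UNIV (\<lambda>_. lborel :: real measure)) = Pi\<^sub>E UNIV (\<lambda>i. {l $ i<..<u $ i})"
    by (auto simp: space_PiM mem_box_cart PiE_iff)
  have B: "(Basis :: (real ^ 'n) set) = (\<lambda>i. axis i 1) ` UNIV" by (auto simp: Basis_vec_def)
  have "emeasure (distr (Pi\<^sub>M UNIV (\<lambda>_. lborel)) borel (\<lambda>x. \<chi> i. x i)) (box l u) =
    emeasure (Pi\<^sub>M UNIV (\<lambda>_. lborel :: real measure)) (Pi\<^sub>E UNIV (\<lambda>i. {l $ i<..<u $ i}))"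
    by (subst emeasure_distr) (auto simp: pre)
  also have "\<dots> = (\<Prod>i\<in>UNIV. ennreal (u $ i - l $ i))"
    by (subst emeasure_PiM) (auto simp: le')
  also have "\<dots> = ennreal (\<Prod>i\<in>UNIV. u $ i - l $ i)"
    by (rule prod_ennreal) (simp add: le')
  also have "(\<Prod>i\<in>UNIV. u $ i - l $ i) = (\<Prod>b\<in>Basis. (u - l) \<bullet> b)"
    unfolding B by (subst prod.reindex) (auto simp: inj_on_def axis_eq_axis inner_axis)
  finally show "emeasure (distr (Pi\<^sub>M UNIV (\<lambda>_. lborel)) borel (\<lambda>x. \<chi> i. x i)) (box l u) = ennreal (\<Prod>b\<in>Basis. (u - l) \<bullet> b)" .
qed simp

locale root_coordinate =
  fixes r :: "'n::finite"
begin

abbreviation "S \<equiv> UNIV - {r}"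
abbreviation "LS \<equiv> Pi\<^sub>M S (\<lambda>_. lborel :: real measure)"

definition v :: "real \<Rightarrow> ('n \<Rightarrow> real) \<Rightarrow> real ^ 'n" where "v t x = (\<chi> i. (x(r := t)) i)"

lemma v_root[simp]: "v t x $ r = t" and v_other: "j \<noteq> r \<Longrightarrow> v t x $ j = x j"
  by (auto simp: v_def)

lemma insert_S: "insert r S = UNIV" by auto

sublocale L: product_sigma_finite "\<lambda>_::'n. lborel :: real measure" by standard

sublocale LS: sigma_finite_measure LS by (rule L.sigma_finite) simp

lemma sets_LS[measurable_cong]: "sets LS = sets (Pi\<^sub>M S (\<lambda>_. borel))"
  by (rule sets_PiM_cong) auto

lemma measurable_v: "(\<lambda>p. v (fst p) (snd p)) \<in> borel_measurable (borel \<Otimes>\<^sub>M Pi\<^sub>M S (\<lambda>_. borel))"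
proof -
  have "(\<lambda>p. (v (fst p) (snd p)) \<bullet> b) \<in> borel_measurable (borel \<Otimes>\<^sub>M Pi\<^sub>M S (\<lambda>_. borel))" if b: "b \<in> Basis" for b :: "real ^ 'n"
  proof -
    obtain j where j: "b = axis j 1" using b by (auto simp: Basis_vec_def)
    show ?thesis
    proof (cases "j = r")
      case True then show ?thesis by (simp add: j inner_axis)
    next
      case False
      then have "(\<lambda>p. snd p j) \<in> borel_measurable (borel \<Otimes>\<^sub>M Pi\<^sub>M S (\<lambda>_. borel :: real measure))"
        by (intro measurable_compose[OF measurable_snd measurable_component_singleton]) auto
      then show ?thesis using False by (simp add: j inner_axis v_other)
    qed
  qed
  then show ?thesis by (subst borel_measurable_euclidean_space) auto
qed

lemma measurable_v_raw[measurable (raw)]: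
  assumes "f \<in> borel_measurable M" "g \<in> measurable M (Pi\<^sub>M S (\<lambda>_. borel))"
  shows "(\<lambda>z. v (f z) (g z)) \<in> borel_measurable M"
  using measurable_compose[OF measurable_Pair[OF assms] measurable_v] by simp

lemma nn_integral_vec:
  fixes f :: "real ^ 'n \<Rightarrow> ennreal"
  assumes [measurable]: "f \<in> borel_measurable borel"
  shows "(\<integral>\<^sup>+z. f z \<partial>lborel) = (\<integral>\<^sup>+t. \<integral>\<^sup>+x. f (v t x) \<partial>LS \<partial>lborel)"
proof -
  have "(\<integral>\<^sup>+z. f z \<partial>lborel) = (\<integral>\<^sup>+x. f (\<chi> i. x i) \<partial>Pi\<^sub>M (insert r S) (\<lambda>_. lborel))"
    unfolding insert_S by (subst lborel_vec_eq, subst nn_integral_distr) auto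
  also have "\<dots> = (\<integral>\<^sup>+t. \<integral>\<^sup>+x. f (v t x) \<partial>LS \<partial>lborel)"
    unfolding v_def
  proof (rule L.product_nn_integral_insert_rev)
    show "(\<lambda>x. f (\<chi> i. x i)) \<in> borel_measurable (Pi\<^sub>M (insert r S) (\<lambda>_. lborel))"
      unfolding insert_S by measurable
  qed auto
  finally show ?thesis .
qed

lemma AE_vec:
  assumes "AE z in lborel. P z" shows "AE t in lborel. AE x in LS. P (v t x)"
proof -
  have "AE z in distr (Pi\<^sub>M UNIV (\<lambda>_. lborel)) borel (\<lambda>x. \<chi> i. x i :: real ^ 'n). P z"
    using assms by (simp only: lborel_vec_eq[symmetric])
  then have "AE x in Pi\<^sub>M (insert r S) (\<lambda>_. lborel). P (\<chi> i. x i)"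
    unfolding insert_S by (rule AE_distrD[OF measurable_vec_lambda])
  then have "AE t in lborel. AE x in LS. P (\<chi> i. (x(r := t)) i)"
    by (rule L.AE_insert[rotated 2]) auto
  then show ?thesis by (simp only: v_def)
qed

lemma integrable_vec:
  fixes f :: "real ^ 'n \<Rightarrow> real"
  assumes f: "integrable lborel f"
  shows "AE t in lborel. integrable LS (\<lambda>x. f (v t x))"
    and "integrable lborel (\<lambda>t. \<integral>x. f (v t x) \<partial>LS)"
    and "(\<integral>z. f z \<partial>lborel) = (\<integral>t. \<integral>x. f (v t x) \<partial>LS \<partial>lborel)"
proof -
  have fm[measurable]: "f \<in> borel_measurable borel" using f by auto
  have i: "integrable (Pi\<^sub>M (insert r S) (\<lambda>_. lborel)) (\<lambda>x. f (\<chi> i. x i))"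
    unfolding insert_S using f by (subst (asm) lborel_vec_eq) (rule integrable_distr[OF measurable_vec_lambda])
  have e: "(\<integral>z. f z \<partial>lborel) = (\<integral>x. f (\<chi> i. x i) \<partial>Pi\<^sub>M (insert r S) (\<lambda>_. lborel))"
    unfolding insert_S by (subst lborel_vec_eq, subst integral_distr) auto
  have I: "finite S" "r \<notin> S" by auto
  show "AE t in lborel. integrable LS (\<lambda>x. f (v t x))"
    using L.integrable_insert(1)[OF I i] by (simp only: v_def)
  show "integrable lborel (\<lambda>t. \<integral>x. f (v t x) \<partial>LS)"
    using L.integrable_insert(2)[OF I i] by (simp only: v_def)
  show "(\<integral>z. f z \<partial>lborel) = (\<integral>t. \<integral>x. f (v t x) \<partial>LS \<partial>lborel)"
    unfolding e using L.integrable_insert(3)[OF I i] by (simp only: v_def)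
qed

end

section \<open>Relative entropy with respect to a Gibbs measure\<close>

lemma mult_ln_ge: "0 \<le> x \<Longrightarrow> x - 1 \<le> x * ln (x::real)"
proof (cases "x = 0")
  case False
  assume "0 \<le> x"
  with False have x: "0 < x" by simp
  then have "ln (1 / x) \<le> 1 / x - 1" by (intro ln_le_minus_one) simp
  then have "x * (1 - 1 / x) \<le> x * ln x" using x by (intro mult_left_mono) (auto simp: ln_div)
  then show ?thesis using x by (simp add: algebra_simps)
qed simp

context
  fixes V m :: "'a::euclidean_space \<Rightarrow> real" and Z :: real
  assumes V[measurable]: "V \<in> borel_measurable borel" and int: "integrable lborel (\<lambda>z. exp (- V z))"
    and Z: "Z = (\<integral>z. exp (- V z) \<partial>lborel)"
    and m[measurable]: "m \<in> borel_measurable borel" and m0: "\<And>z. 0 \<le> m z" and m1: "(\<integral>\<^sup>+z. ennreal (m z) \<partial>lborel) = 1"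
begin

lemma partition_pos: "0 < Z"
proof -
  have "Z \<noteq> 0"
  proof
    assume "Z = 0"
    then have "AE z in lborel. exp (- V z) = 0"
      using integral_nonneg_eq_0_iff_AE[OF int] by (simp add: Z)
    then have "AE z in (lborel :: 'a measure). False" by simp
    then have "emeasure (lborel :: 'a measure) UNIV = 0" by (subst (asm) AE_iff_measurable[OF _ refl]) auto
    then show False by (simp add: emeasure_lborel_UNIV)
  qed
  moreover have "0 \<le> Z" unfolding Z by (rule Bochner_Integration.integral_nonneg) simp
  ultimately show ?thesis by simp
qed

lemma gibbs_prob: "prob_space (gibbs V)"
proof
  have "(\<integral>\<^sup>+z. ennreal (exp (- V z) / Z) \<partial>lborel) = ennreal (\<integral>z. exp (- V z) / Z \<partial>lborel)"
    using partition_pos int by (intro nn_integral_eq_integral) auto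
  also have "\<dots> = 1" using partition_pos by (simp add: Z[symmetric])
  finally show "emeasure (gibbs V) (space (gibbs V)) = 1"
    unfolding gibbs_def Z[symmetric] by (subst emeasure_density) auto
qed

definition kl_integrand where "kl_integrand z = m z * (ln (m z) + V z + ln Z)"

lemma kl_integrand_meas[measurable]: "kl_integrand \<in> borel_measurable borel"
  unfolding kl_integrand_def by measurable

text \<open>The density relative to the Gibbs measure is m exp(V) Z, and weighting x ln x of it by
  the Gibbs density gives \<open>kl_integrand\<close>. The factor c in \<open>conv\<close> treats
  the positive part (c = 1) and the negative part (c = -1) at once.\<close>

lemma KL_div_eq:
  "KL_div (density lborel (\<lambda>z. ennreal (m z))) (gibbs V) =
     enn2ereal (\<integral>\<^sup>+z. ennreal (kl_integrand z) \<partial>lborel) - enn2ereal (\<integral>\<^sup>+z. ennreal (- kl_integrand z) \<partial>lborel)"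
proof -
  let ?\<nu> = "gibbs V" and ?\<mu> = "density lborel (\<lambda>z. ennreal (m z))"
  define f where "f z = m z * exp (V z) * Z" for z
  have f[measurable]: "f \<in> borel_measurable borel" unfolding f_def by measurable
  have f0: "0 \<le> f z" for z using m0 partition_pos by (simp add: f_def)
  have Zp: "0 < Z" by (rule partition_pos)
  have g: "?\<nu> = density lborel (\<lambda>z. ennreal (exp (- V z) / Z))" by (simp add: gibbs_def Z)
  interpret \<nu>: prob_space ?\<nu> by (rule gibbs_prob)
  have eq: "density ?\<nu> (\<lambda>z. ennreal (f z)) = ?\<mu>"
    unfolding g
  proof (subst density_density_eq, measurable, rule density_cong, measurable, rule AE_I2)
    fix z
    have "exp (- V z) / Z * f z = m z" using Zp by (simp add: f_def exp_minus field_simps)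
    then show "ennreal (exp (- V z) / Z) * ennreal (f z) = ennreal (m z)"
      using Zp f0 by (simp flip: ennreal_mult)
  qed
  have s: "sets ?\<mu> = sets ?\<nu>" by (simp add: g)
  have ac: "absolutely_continuous ?\<nu> ?\<mu>"
    unfolding eq[symmetric] by (rule absolutely_continuousI_density) (simp add: g)
  have "AE z in ?\<nu>. ennreal (f z) = RN_deriv ?\<nu> ?\<mu> z"
    by (rule \<nu>.RN_deriv_unique[OF _ eq]) (simp add: g)
  then have rn: "AE z in ?\<nu>. enn2real (RN_deriv ?\<nu> ?\<mu> z) = f z"
    by eventually_elim (metis enn2real_ennreal f0)
  have k: "exp (- V z) / Z * (f z * ln (f z)) = kl_integrand z" for z
  proof (cases "m z = 0")
    case False
    then have mz: "0 < m z" using m0[of z] by simp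
    have "ln (f z) = ln (m z) + V z + ln Z" using mz Zp by (simp add: f_def ln_mult)
    moreover have "exp (- V z) / Z * f z = m z" using Zp by (simp add: f_def exp_minus field_simps)
    ultimately show ?thesis by (simp only: kl_integrand_def mult.assoc[symmetric])
  qed (simp add: f_def kl_integrand_def)
  have conv: "(\<integral>\<^sup>+z. ennreal (c * (enn2real (RN_deriv ?\<nu> ?\<mu> z) * ln (enn2real (RN_deriv ?\<nu> ?\<mu> z)))) \<partial>?\<nu>) = (\<integral>\<^sup>+z. ennreal (c * kl_integrand z) \<partial>lborel)" for c
  proof -
    have "(\<integral>\<^sup>+z. ennreal (c * (enn2real (RN_deriv ?\<nu> ?\<mu> z) * ln (enn2real (RN_deriv ?\<nu> ?\<mu> z)))) \<partial>?\<nu>) = (\<integral>\<^sup>+z. ennreal (c * (f z * ln (f z))) \<partial>?\<nu>)"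
      using rn by (intro nn_integral_cong_AE) (auto elim: eventually_mono)
    also have "\<dots> = (\<integral>\<^sup>+z. ennreal (exp (- V z) / Z) * ennreal (c * (f z * ln (f z))) \<partial>lborel)"
      unfolding g by (subst nn_integral_density) auto
    also have "\<dots> = (\<integral>\<^sup>+z. ennreal (c * kl_integrand z) \<partial>lborel)"
    proof (rule nn_integral_cong)
      fix z
      have "ennreal (exp (- V z) / Z) * ennreal (c * (f z * ln (f z))) = ennreal (exp (- V z) / Z * (c * (f z * ln (f z))))"
        using Zp by (subst ennreal_mult') auto
      also have "exp (- V z) / Z * (c * (f z * ln (f z))) = c * kl_integrand z" unfolding k[symmetric] by simp
      finally show "ennreal (exp (- V z) / Z) * ennreal (c * (f z * ln (f z))) = ennreal (c * kl_integrand z)" .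
    qed
    finally show ?thesis .
  qed
  show ?thesis
    unfolding KL_div_def Let_def using s ac conv[of 1] conv[of "-1"] by simp
qed

text \<open>This is x ln x \<ge> -1 for the relative density, weighted by the Gibbs density. It
  keeps the negative part integrable, so the difference of extended integrals is never of the form
  \<infinity> - \<infinity>.\<close>

lemma kl_integrand_ge: "- (exp (- V z) / Z) \<le> kl_integrand z"
proof (cases "m z = 0")
  case True then show ?thesis using partition_pos by (simp add: kl_integrand_def)
next
  case False
  then have mz: "0 < m z" using m0[of z] by simp
  let ?f = "m z * exp (V z) * Z"
  have "?f - 1 \<le> ?f * ln ?f" using mz partition_pos by (intro mult_ln_ge) simp
  moreover have "0 \<le> ?f" using mz partition_pos by simp
  ultimately have "- 1 \<le> ?f * ln ?f" by linarith
  then have "exp (- V z) / Z * (- 1) \<le> exp (- V z) / Z * (?f * ln ?f)" using partition_pos by (intro mult_left_mono) auto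
  moreover have "exp (- V z) / Z * ?f = m z" using partition_pos by (simp add: exp_minus field_simps)
  moreover have "ln ?f = ln (m z) + V z + ln Z" using mz partition_pos by (simp add: ln_mult)
  ultimately show ?thesis by (simp add: kl_integrand_def mult.assoc[symmetric])
qed

lemma kl_neg_finite: "(\<integral>\<^sup>+z. ennreal (- kl_integrand z) \<partial>lborel) \<noteq> \<infinity>"
proof -
  have "(\<integral>\<^sup>+z. ennreal (- kl_integrand z) \<partial>lborel) \<le> (\<integral>\<^sup>+z. ennreal (exp (- V z) / Z) \<partial>lborel)"
    using kl_integrand_ge by (intro nn_integral_mono ennreal_leI) (simp add: minus_le_iff)
  also have "\<dots> = ennreal (\<integral>z. exp (- V z) / Z \<partial>lborel)"
    using partition_pos int by (intro nn_integral_eq_integral) auto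
  finally show ?thesis by (auto simp: top_unique)
qed

lemma int_m: "integrable lborel m" "(\<integral>z. m z \<partial>lborel) = 1"
  using m1 m0 by (auto simp: integral_eq_nn_integral intro!: integrableI_nonneg)

lemma kl_integrand_split: "kl_integrand = (\<lambda>z. m z * (ln (m z) + V z) + ln Z * m z)"
  by (auto simp: kl_integrand_def algebra_simps)

lemma KL_div_integrable:
  assumes "integrable lborel (\<lambda>z. m z * (ln (m z) + V z))"
  shows "KL_div (density lborel (\<lambda>z. ennreal (m z))) (gibbs V) = ereal ((\<integral>z. m z * (ln (m z) + V z) \<partial>lborel) + ln Z)"
proof -
  have i: "integrable lborel kl_integrand" unfolding kl_integrand_split using assms int_m by auto
  have pf: "(\<integral>\<^sup>+z. ennreal (kl_integrand z) \<partial>lborel) \<noteq> \<infinity>" using i by (simp add: real_integrable_def)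
  have e: "(\<integral>z. kl_integrand z \<partial>lborel) = (\<integral>z. m z * (ln (m z) + V z) \<partial>lborel) + ln Z"
    unfolding kl_integrand_split using assms int_m by simp
  have "KL_div (density lborel (\<lambda>z. ennreal (m z))) (gibbs V) =
     ereal (enn2real (\<integral>\<^sup>+z. ennreal (kl_integrand z) \<partial>lborel) - enn2real (\<integral>\<^sup>+z. ennreal (- kl_integrand z) \<partial>lborel))"
    unfolding KL_div_eq using pf kl_neg_finite
    by (cases "\<integral>\<^sup>+z. ennreal (kl_integrand z) \<partial>lborel"; cases "\<integral>\<^sup>+z. ennreal (- kl_integrand z) \<partial>lborel") (auto simp: enn2ereal_ennreal)
  also have "\<dots> = ereal (\<integral>z. kl_integrand z \<partial>lborel)" by (simp add: real_lebesgue_integral_def[OF i])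
  finally show ?thesis unfolding e .
qed

lemma KL_div_finite:
  assumes "KL_div (density lborel (\<lambda>z. ennreal (m z))) (gibbs V) < \<infinity>"
  shows "integrable lborel (\<lambda>z. m z * (ln (m z) + V z))"
proof -
  have "(\<integral>\<^sup>+z. ennreal (kl_integrand z) \<partial>lborel) \<noteq> \<infinity>"
    using assms kl_neg_finite unfolding KL_div_eq
    by (cases "\<integral>\<^sup>+z. ennreal (- kl_integrand z) \<partial>lborel") (auto simp: enn2ereal_ennreal)
  then have "integrable lborel kl_integrand" using kl_neg_finite by (simp add: real_integrable_def)
  then have "integrable lborel (\<lambda>z. kl_integrand z - ln Z * m z)" using int_m by auto
  then show ?thesis by (simp add: kl_integrand_split)
qed

end

section \<open>Star-structured densities\<close>

text \<open>Open boxes are rectangles and form an intersection-stable generator, so the rectangle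
  formula, the only information carried by \<open>C_star\<close>, determines the measure.\<close>

lemma measure_eqI_boxes:
  fixes M N :: "(real ^ 'n::finite) measure"
  assumes M: "sets M = sets borel" "finite_measure M" and N: "sets N = sets borel"
    and eq: "\<And>A. (\<And>i. A i \<in> sets borel) \<Longrightarrow> emeasure M {z. \<forall>i. z $ i \<in> A i} = emeasure N {z. \<forall>i. z $ i \<in> A i}"
  shows "M = N"
proof (rule measure_eqI_generator_eq)
  let ?E = "range (\<lambda>(a, b). box a b :: (real ^ 'n) set)"
  show "Int_stable ?E" by (auto simp: Int_stable_def box_Int_box)
  show "?E \<subseteq> Pow UNIV" "sets M = sigma_sets UNIV ?E" "sets N = sigma_sets UNIV ?E"
    by (simp_all add: borel_eq_box M N)
  let ?A = "\<lambda>n::nat. box (- (real n *\<^sub>R One)) (real n *\<^sub>R One) :: (real ^ 'n) set"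
  show "range ?A \<subseteq> ?E" "(\<Union>i. ?A i) = UNIV" unfolding UN_box_eq_UNIV by auto
  show "emeasure M (?A i) \<noteq> \<infinity>" for i using finite_measure.emeasure_finite[OF M(2)] by simp
  fix X assume "X \<in> ?E"
  then obtain a b :: "real ^ 'n" where X: "X = box a b" by auto
  have "X = {z. \<forall>i. z $ i \<in> {a $ i<..<b $ i}}" unfolding X by (auto simp: mem_box_cart)
  then show "emeasure M X = emeasure N X" using eq[of "\<lambda>i. {a $ i<..<b $ i}"] by simp
qed

context root_coordinate
begin

text \<open>The factors are deliberately not normalised: a competitor may change a conditional
  factor without restoring its mass.\<close>

definition star :: "(real \<Rightarrow> real) \<Rightarrow> ('n \<Rightarrow> real \<Rightarrow> real \<Rightarrow> real) \<Rightarrow> real ^ 'n \<Rightarrow> real" where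
  "star a k z = a (z $ r) * (\<Prod>j\<in>S. k j (z $ r) (z $ j))"

lemma rect_sets:
  assumes [measurable]: "\<And>i. A i \<in> sets borel"
  shows "{z :: real ^ 'n. \<forall>i. z $ i \<in> A i} \<in> sets borel"
  by measurable

lemma sets_PiM_lborel[measurable_cong]: "sets (Pi\<^sub>M I (\<lambda>_. lborel :: real measure)) = sets (Pi\<^sub>M I (\<lambda>_. borel))"
  by (rule sets_PiM_cong) auto

lemma mem_rect: "v t x \<in> {z. \<forall>i. z $ i \<in> A i} \<longleftrightarrow> t \<in> A r \<and> (\<forall>j\<in>S. x j \<in> A j)"
proof
  assume "v t x \<in> {z. \<forall>i. z $ i \<in> A i}"
  then have h: "\<forall>i. v t x $ i \<in> A i" by simp
  show "t \<in> A r \<and> (\<forall>j\<in>S. x j \<in> A j)"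
  proof (intro conjI ballI)
    show "t \<in> A r" using spec[OF h, of r] by simp
    show "x j \<in> A j" if "j \<in> S" for j using spec[OF h, of j] that by (simp add: v_other)
  qed
next
  assume h: "t \<in> A r \<and> (\<forall>j\<in>S. x j \<in> A j)"
  have "v t x $ i \<in> A i" for i using h by (cases "i = r") (simp_all add: v_other)
  then show "v t x \<in> {z. \<forall>i. z $ i \<in> A i}" by simp
qed

lemma star_v: "star a k (v t x) = a t * (\<Prod>j\<in>S. k j t (x j))"
  by (auto simp: star_def v_other intro!: prod.cong)

definition factors :: "(real \<Rightarrow> real) \<Rightarrow> ('n \<Rightarrow> real \<Rightarrow> real \<Rightarrow> real) \<Rightarrow> bool" where
  "factors a k \<longleftrightarrow> a \<in> borel_measurable borel \<and> (\<forall>t. 0 \<le> a t) \<and>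
     (\<forall>j. (\<lambda>p. k j (fst p) (snd p)) \<in> borel_measurable (borel \<Otimes>\<^sub>M borel)) \<and> (\<forall>j t s. 0 \<le> k j t s)"

context
  fixes a k assumes ak: "factors a k"
begin

lemma a_meas[measurable]: "a \<in> borel_measurable borel" and a_nonneg: "0 \<le> a t"
  and k_meas: "(\<lambda>p. k j (fst p) (snd p)) \<in> borel_measurable (borel \<Otimes>\<^sub>M borel)" and k_nonneg: "0 \<le> k j t s"
  using ak by (auto simp: factors_def)

lemma k_meas_raw[measurable (raw)]:
  assumes "f \<in> borel_measurable M" "g \<in> borel_measurable M"
  shows "(\<lambda>z. k j (f z) (g z)) \<in> borel_measurable M"
  using measurable_compose[OF measurable_Pair[OF assms] k_meas] by simp

lemma star_meas[measurable]: "star a k \<in> borel_measurable borel"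
  unfolding star_def[abs_def] by measurable

lemma star_nonneg: "0 \<le> star a k z"
  unfolding star_def by (intro mult_nonneg_nonneg prod_nonneg ballI a_nonneg k_nonneg)

lemma star_nn_rect:
  assumes A[measurable]: "\<And>i. A i \<in> sets borel"
  shows "(\<integral>\<^sup>+z. ennreal (star a k z) * indicator {z. \<forall>i. z $ i \<in> A i} z \<partial>lborel)
     = (\<integral>\<^sup>+t. ennreal (a t) * indicator (A r) t * (\<Prod>j\<in>S. \<integral>\<^sup>+s. ennreal (k j t s) * indicator (A j) s \<partial>lborel) \<partial>lborel)"
proof -
  have rect[measurable]: "{z :: real ^ 'n. \<forall>i. z $ i \<in> A i} \<in> sets borel" by measurable
  have "(\<integral>\<^sup>+z. ennreal (star a k z) * indicator {z. \<forall>i. z $ i \<in> A i} z \<partial>lborel) =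
    (\<integral>\<^sup>+t. \<integral>\<^sup>+x. ennreal (star a k (v t x)) * indicator {z. \<forall>i. z $ i \<in> A i} (v t x) \<partial>LS \<partial>lborel)"
    by (rule nn_integral_vec) measurable
  also have "\<dots> = (\<integral>\<^sup>+t. \<integral>\<^sup>+x. (ennreal (a t) * indicator (A r) t) * (\<Prod>j\<in>S. ennreal (k j t (x j)) * indicator (A j) (x j)) \<partial>LS \<partial>lborel)"
  proof (intro nn_integral_cong)
    fix t x
    have "indicator {z. \<forall>i. z $ i \<in> A i} (v t x) = (indicator (A r) t * (\<Prod>j\<in>S. indicator (A j) (x j)) :: ennreal)"
    proof (cases "t \<in> A r \<and> (\<forall>j\<in>S. x j \<in> A j)")
      case True
      then have "v t x \<in> {z. \<forall>i. z $ i \<in> A i}" by (rule mem_rect[THEN iffD2])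
      then show ?thesis using True by simp
    next
      case False
      then have "v t x \<notin> {z. \<forall>i. z $ i \<in> A i}" using mem_rect[of t x A] by blast
      moreover have "indicator (A r) t * (\<Prod>j\<in>S. indicator (A j) (x j)) = (0::ennreal)"
      proof (cases "t \<in> A r")
        case True
        then obtain j where "j \<in> S" "x j \<notin> A j" using False by blast
        then have "(\<Prod>j\<in>S. indicator (A j) (x j)) = (0::ennreal)" by (intro prod_zero bexI[of _ j]) auto
        then show ?thesis by simp
      qed simp
      ultimately show ?thesis by simp
    qed
    then show "ennreal (star a k (v t x)) * indicator {z. \<forall>i. z $ i \<in> A i} (v t x) =
      (ennreal (a t) * indicator (A r) t) * (\<Prod>j\<in>S. ennreal (k j t (x j)) * indicator (A j) (x j))"
      unfolding star_v using a_nonneg k_nonneg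
      by (simp add: ennreal_mult prod_nonneg prod_ennreal prod.distrib mult_ac)
  qed
  also have "\<dots> = (\<integral>\<^sup>+t. (ennreal (a t) * indicator (A r) t) * (\<integral>\<^sup>+x. (\<Prod>j\<in>S. ennreal (k j t (x j)) * indicator (A j) (x j)) \<partial>LS) \<partial>lborel)"
    by (intro nn_integral_cong nn_integral_cmult) measurable
  also have "\<dots> = (\<integral>\<^sup>+t. ennreal (a t) * indicator (A r) t * (\<Prod>j\<in>S. \<integral>\<^sup>+s. ennreal (k j t s) * indicator (A j) s \<partial>lborel) \<partial>lborel)"
    by (intro nn_integral_cong arg_cong2[where f="(*)"] refl L.product_nn_integral_prod) measurable
  finally show ?thesis .
qed

text \<open>The conditional masses \<open>m j t\<close> are moved into the root density, which
  absorbs the normalisation. Where some mass is 0 or infinite the kernel becomes a Gaussian by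
  default; the root density vanishes at almost every such t.\<close>

lemma C_star_memI:
  assumes c: "0 < c" and mass: "(\<integral>\<^sup>+z. ennreal (star a k z) \<partial>lborel) = ennreal c"
  shows "density lborel (\<lambda>z. ennreal (star a k z / c)) \<in> C_star r"
proof -
  let ?n = "\<lambda>z. ennreal (star a k z / c)"
  have nd: "?n z = ennreal (1 / c) * ennreal (star a k z)" for z
    using c star_nonneg[of z] by (simp flip: ennreal_mult)
  define m where "m j t = (\<integral>\<^sup>+s. ennreal (k j t s) \<partial>lborel)" for j t
  have m_meas[measurable]: "m j \<in> borel_measurable borel" for j unfolding m_def[abs_def] by measurable
  define k' where "k' j t s = (if 0 < m j t \<and> m j t < \<infinity> then ennreal (k j t s) / m j t else ennreal (std_normal_density s))" for j t s
  have k'_meas: "(\<lambda>p. k' j (fst p) (snd p)) \<in> borel_measurable (borel \<Otimes>\<^sub>M borel)" for j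
    unfolding k'_def by measurable
  have k'_raw[measurable (raw)]: "(\<lambda>z. k' j (f z) (g z)) \<in> borel_measurable M" if "f \<in> borel_measurable M" "g \<in> borel_measurable M" for f g M j
    using measurable_compose[OF measurable_Pair[OF that] k'_meas] by simp
  define K where "K j t = density lborel (k' j t)" for j t
  have emK: "emeasure (K j t) B = (\<integral>\<^sup>+s. k' j t s * indicator B s \<partial>lborel)" if "B \<in> sets borel" for j t B
    unfolding K_def using that by (subst emeasure_density) auto
  have K1: "prob_space (K j t)" for j t
  proof
    have "(\<integral>\<^sup>+s. k' j t s \<partial>lborel) = 1"
    proof (cases "0 < m j t \<and> m j t < \<infinity>")
      case True
      then have "(\<integral>\<^sup>+s. k' j t s \<partial>lborel) = (\<integral>\<^sup>+s. ennreal (k j t s) \<partial>lborel) / m j t"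
        unfolding k'_def by (simp add: nn_integral_divide)
      also have "\<dots> = 1" using True unfolding m_def[symmetric] by (intro ennreal_divide_self) auto
      finally show ?thesis .
    next
      case False
      then have "(\<integral>\<^sup>+s. k' j t s \<partial>lborel) = (\<integral>\<^sup>+s. ennreal (std_normal_density s) \<partial>lborel)"
        by (intro nn_integral_cong) (auto simp: k'_def)
      also have "\<dots> = 1" by (subst nn_integral_eq_integral) auto
      finally show ?thesis .
    qed
    then show "emeasure (K j t) (space (K j t)) = 1" by (simp add: K_def emeasure_density)
  qed
  have Km: "K j \<in> borel \<rightarrow>\<^sub>M prob_algebra borel" for j
  proof (rule measurable_prob_algebraI)
    show "prob_space (K j t)" for t by (rule K1)
    show "K j \<in> borel \<rightarrow>\<^sub>M subprob_algebra borel"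
    proof (rule measurable_subprob_algebra)
      show "subprob_space (K j t)" for t by (rule prob_space_imp_subprob_space[OF K1])
      show "sets (K j t) = sets borel" for t by (simp add: K_def)
      show "(\<lambda>t. emeasure (K j t) B) \<in> borel_measurable borel" if [measurable]: "B \<in> sets borel" for B
        unfolding emK[OF that] by measurable
    qed
  qed
  define b where "b t = ennreal (1 / c) * (ennreal (a t) * (\<Prod>j\<in>S. m j t))" for t
  have bm[measurable]: "b \<in> borel_measurable borel" unfolding b_def[abs_def] by measurable
  have tot: "(\<integral>\<^sup>+t. ennreal (a t) * (\<Prod>j\<in>S. m j t) \<partial>lborel) = ennreal c"
    using star_nn_rect[of "\<lambda>_. UNIV"] mass by (simp add: m_def)
  have cc: "ennreal (1 / c) * ennreal c = 1" using c by (simp flip: ennreal_mult)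
  have b1: "(\<integral>\<^sup>+t. b t \<partial>lborel) = 1"
    unfolding b_def by (subst nn_integral_cmult) (auto simp: tot cc)
  \<comment> \<open>The total mass is finite, so, up to a null set, an infinite conditional mass is
    compatible only with a vanishing root factor or another factor of mass zero.\<close>
  have bfin: "AE t in lborel. ennreal (a t) * (\<Prod>j\<in>S. m j t) \<noteq> \<infinity>"
    by (rule nn_integral_PInf_AE) (use tot in auto)
  have rect: "emeasure (density lborel ?n) {z. \<forall>i. z $ i \<in> A i} =
      (\<integral>\<^sup>+ t. indicator (A r) t * (\<Prod>j\<in>S. emeasure (K j t) (A j)) \<partial>density lborel b)"
    if A: "\<forall>i. A i \<in> sets borel" for A
  proof -
    have A'[measurable]: "A i \<in> sets borel" for i using A by simp
    have [measurable]: "(\<lambda>t. emeasure (K j t) (A j)) \<in> borel_measurable borel" for j unfolding emK[OF A'] by measurable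
    have rm[measurable]: "{z :: real ^ 'n. \<forall>i. z $ i \<in> A i} \<in> sets borel" by measurable
    have "emeasure (density lborel ?n) {z. \<forall>i. z $ i \<in> A i} = (\<integral>\<^sup>+z. ?n z * indicator {z. \<forall>i. z $ i \<in> A i} z \<partial>lborel)"
      by (rule emeasure_density) auto
    also have "\<dots> = (\<integral>\<^sup>+z. ennreal (1 / c) * (ennreal (star a k z) * indicator {z. \<forall>i. z $ i \<in> A i} z) \<partial>lborel)"
      by (simp only: nd mult.assoc)
    also have "\<dots> = ennreal (1 / c) * (\<integral>\<^sup>+z. ennreal (star a k z) * indicator {z. \<forall>i. z $ i \<in> A i} z \<partial>lborel)"
      by (rule nn_integral_cmult) auto
    also have "\<dots> = ennreal (1 / c) * (\<integral>\<^sup>+t. ennreal (a t) * indicator (A r) t * (\<Prod>j\<in>S. \<integral>\<^sup>+s. ennreal (k j t s) * indicator (A j) s \<partial>lborel) \<partial>lborel)"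
      by (subst star_nn_rect) auto
    also have "\<dots> = (\<integral>\<^sup>+t. ennreal (1 / c) * (ennreal (a t) * indicator (A r) t * (\<Prod>j\<in>S. \<integral>\<^sup>+s. ennreal (k j t s) * indicator (A j) s \<partial>lborel)) \<partial>lborel)"
      by (rule nn_integral_cmult[symmetric]) measurable
    also have "\<dots> = (\<integral>\<^sup>+t. b t * (indicator (A r) t * (\<Prod>j\<in>S. emeasure (K j t) (A j))) \<partial>lborel)"
    proof (rule nn_integral_cong_AE)
      show "AE t in lborel. ennreal (1 / c) * (ennreal (a t) * indicator (A r) t * (\<Prod>j\<in>S. \<integral>\<^sup>+s. ennreal (k j t s) * indicator (A j) s \<partial>lborel))
         = b t * (indicator (A r) t * (\<Prod>j\<in>S. emeasure (K j t) (A j)))"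
        using bfin
      proof eventually_elim
        case (elim t)
        let ?I = "\<lambda>j. \<integral>\<^sup>+s. ennreal (k j t s) * indicator (A j) s \<partial>lborel"
        have le: "?I j \<le> m j t" for j unfolding m_def by (intro nn_integral_mono) (auto simp: indicator_def)
        have "ennreal (a t) * (\<Prod>j\<in>S. ?I j) = ennreal (a t) * (\<Prod>j\<in>S. m j t) * (\<Prod>j\<in>S. emeasure (K j t) (A j))"
        proof (cases "\<exists>j\<in>S. m j t = 0")
          case True
          then obtain j where j: "j \<in> S" "m j t = 0" by blast
          then have "?I j = 0" using le[of j] by simp
          then have "(\<Prod>j\<in>S. ?I j) = 0" "(\<Prod>j\<in>S. m j t) = 0" using j by (auto intro!: prod_zero)
          then show ?thesis by (simp only: mult_zero_left mult_zero_right)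
        next
          case False
          then have nz: "m j t \<noteq> 0" if "j \<in> S" for j using that by blast
          show ?thesis
          proof (cases "\<exists>j\<in>S. m j t = \<infinity>")
            case True
            then have "(\<Prod>j\<in>S. m j t) = \<infinity>" using nz by (auto simp: ennreal_prod_eq_top)
            then have "ennreal (a t) = 0" using elim by (auto simp: ennreal_mult_eq_top_iff)
            then show ?thesis by simp
          next
            case False
            have "?I j = m j t * emeasure (K j t) (A j)" if "j \<in> S" for j
            proof -
              have mj: "0 < m j t" "m j t < \<infinity>" using nz[OF that] False that by (auto simp: zero_less_iff_neq_zero less_top)
              have "m j t * emeasure (K j t) (A j) = (\<integral>\<^sup>+s. m j t * (k' j t s * indicator (A j) s) \<partial>lborel)"
                unfolding emK[OF A'] by (rule nn_integral_cmult[symmetric]) measurable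
              also have "\<dots> = ?I j"
              proof (rule nn_integral_cong)
                fix s
                have "m j t * (ennreal (k j t s) / m j t) = ennreal (k j t s)"
                  using mj ennreal_mult_divide_eq[of "m j t" "ennreal (k j t s)"] by (simp add: mult.commute ennreal_times_divide)
                then show "m j t * (k' j t s * indicator (A j) s) = ennreal (k j t s) * indicator (A j) s"
                  using mj by (simp add: k'_def mult.assoc[symmetric])
              qed
              finally show ?thesis by simp
            qed
            then have "(\<Prod>j\<in>S. ?I j) = (\<Prod>j\<in>S. m j t * emeasure (K j t) (A j))" by (intro prod.cong) auto
            then show ?thesis by (simp add: prod.distrib mult.assoc)
          qed
        qed
        note E = this
        have "ennreal (1 / c) * (ennreal (a t) * indicator (A r) t * (\<Prod>j\<in>S. ?I j)) = ennreal (1 / c) * indicator (A r) t * (ennreal (a t) * (\<Prod>j\<in>S. ?I j))"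
          by (simp only: mult_ac)
        also have "\<dots> = ennreal (1 / c) * indicator (A r) t * (ennreal (a t) * (\<Prod>j\<in>S. m j t) * (\<Prod>j\<in>S. emeasure (K j t) (A j)))"
          by (simp only: E)
        also have "\<dots> = b t * (indicator (A r) t * (\<Prod>j\<in>S. emeasure (K j t) (A j)))"
          unfolding b_def by (simp only: mult_ac)
        finally show ?case .
      qed
    qed
    also have "\<dots> = (\<integral>\<^sup>+ t. indicator (A r) t * (\<Prod>j\<in>S. emeasure (K j t) (A j)) \<partial>density lborel b)"
      by (rule nn_integral_density[symmetric]) measurable
    finally show ?thesis .
  qed
  have prob_n: "prob_space (density lborel ?n)"
  proof
    have "(\<integral>\<^sup>+z. ?n z \<partial>lborel) = 1" unfolding nd by (subst nn_integral_cmult) (auto simp: mass cc)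
    then show "emeasure (density lborel ?n) (space (density lborel ?n)) = 1" by (simp add: emeasure_density)
  qed
  have prob_b: "prob_space (density lborel b)"
    by (rule prob_spaceI) (simp add: emeasure_density b1)
  show ?thesis
    unfolding C_star_def
    by (intro CollectI conjI exI[of _ "density lborel b"] exI[of _ K] allI impI rect prob_n prob_b Km) auto
qed

end

lemma measurable_v_upd:
  assumes j: "j \<in> S" and f: "f \<in> borel_measurable M" and e: "e \<in> borel_measurable M"
    and g: "g \<in> measurable M (Pi\<^sub>M (S - {j}) (\<lambda>_. borel))"
  shows "(\<lambda>w. v (f w) ((g w)(j := e w))) \<in> borel_measurable M"
proof (rule measurable_v_raw[OF f])
  have "(\<lambda>w. (g w)(j := e w)) \<in> measurable M (Pi\<^sub>M (insert j (S - {j})) (\<lambda>_. borel))"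
    by (rule measurable_fun_upd[OF _ g e]) auto
  then show "(\<lambda>w. (g w)(j := e w)) \<in> measurable M (Pi\<^sub>M S (\<lambda>_. borel))"
    using j by (simp add: insert_absorb)
qed

declare a_meas[measurable del] k_meas_raw[measurable del] star_meas[measurable del]

text \<open>The kernels in \<open>C_star\<close> are abstract, so the conditional densities are
  built anew as quotients of the joint marginals of (r, j) by the root marginal \<open>pe\<close>.
  They agree with the given kernels on each fixed set for almost every t. The exceptional set
  depends on the test set, but a rectangle involves only finitely many of these, which suffices to
  identify the measure.\<close>

lemma C_star_density_factor:
  fixes p :: "real ^ 'n \<Rightarrow> real"
  assumes p[measurable]: "p \<in> borel_measurable borel" and p0: "\<And>z. 0 \<le> p z"
    and P: "density lborel (\<lambda>z. ennreal (p z)) \<in> C_star r"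
  obtains p1 q where "factors p1 q" "\<And>j t. (\<integral>\<^sup>+s. ennreal (q j t s) \<partial>lborel) = 1"
    "(\<integral>\<^sup>+t. ennreal (p1 t) \<partial>lborel) = 1" "AE z in lborel. p z = star p1 q z"
proof -
  let ?P = "density lborel (\<lambda>z. ennreal (p z))"
  obtain \<mu>1 K where \<mu>1: "prob_space \<mu>1" "sets \<mu>1 = sets borel"
    and K: "\<And>j. K j \<in> borel \<rightarrow>\<^sub>M prob_algebra borel"
    and rect: "\<And>A. (\<And>i. A i \<in> sets borel) \<Longrightarrow> emeasure ?P {z. \<forall>i. z $ i \<in> A i} =
           (\<integral>\<^sup>+ t. indicator (A r) t * (\<Prod>j\<in>S. emeasure (K j t) (A j)) \<partial>\<mu>1)"
    and prP: "prob_space ?P"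
    using P unfolding C_star_def by auto
  have Kp: "prob_space (K j t)" for j t
    using measurable_space[OF K[of j], of t] by (simp add: space_prob_algebra)
  have Ks: "sets (K j t) = sets borel" for j t
    using measurable_space[OF K[of j], of t] by (simp add: space_prob_algebra)
  have KU: "emeasure (K j t) UNIV = 1" for j t
    using prob_space.emeasure_space_1[OF Kp[of j t]] sets_eq_imp_space_eq[OF Ks[of j t]] by simp
  have Km[measurable]: "(\<lambda>t. emeasure (K j t) D) \<in> borel_measurable borel" if "D \<in> sets borel" for j D
    using measurable_emeasure_kernel[OF measurable_prob_algebraD[OF K[of j]] that] .
  have em: "emeasure ?P X = (\<integral>\<^sup>+t. \<integral>\<^sup>+x. ennreal (p (v t x)) * indicator X (v t x) \<partial>LS \<partial>lborel)" if [measurable]: "X \<in> sets borel" for X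
  proof -
    have "emeasure ?P X = (\<integral>\<^sup>+z. ennreal (p z) * indicator X z \<partial>lborel)" by (rule emeasure_density) auto
    also have "\<dots> = (\<integral>\<^sup>+t. \<integral>\<^sup>+x. ennreal (p (v t x)) * indicator X (v t x) \<partial>LS \<partial>lborel)"
      by (rule nn_integral_vec) measurable
    finally show ?thesis .
  qed
  define pe where "pe t = (\<integral>\<^sup>+x. ennreal (p (v t x)) \<partial>LS)" for t
  have pem[measurable]: "pe \<in> borel_measurable borel" unfolding pe_def[abs_def] by measurable
  have tot: "(\<integral>\<^sup>+t. pe t \<partial>lborel) = 1"
    using em[of UNIV] prob_space.emeasure_space_1[OF prP] by (simp add: pe_def)
  have marg: "\<mu>1 = density lborel pe"
  proof (rule measure_eqI)
    fix D assume "D \<in> sets \<mu>1"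
    then have D[measurable]: "D \<in> sets borel" using \<mu>1(2) by simp
    let ?A = "\<lambda>i. if i = r then D else UNIV"
    have "emeasure ?P {z. \<forall>i. z $ i \<in> ?A i} = (\<integral>\<^sup>+ t. indicator D t \<partial>\<mu>1)"
      by (subst rect) (auto simp: KU)
    also have "\<dots> = emeasure \<mu>1 D" using D \<mu>1(2) by simp
    finally have 1: "emeasure \<mu>1 D = emeasure ?P {z. \<forall>i. z $ i \<in> ?A i}" by simp
    have rm[measurable]: "{z::real^'n. \<forall>i. z $ i \<in> ?A i} \<in> sets borel" by (rule rect_sets) auto
    have "emeasure ?P {z. \<forall>i. z $ i \<in> ?A i} = (\<integral>\<^sup>+t. \<integral>\<^sup>+x. ennreal (p (v t x)) * indicator D t \<partial>LS \<partial>lborel)"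
      by (subst em, measurable, intro nn_integral_cong) (simp add: indicator_def mem_rect[simplified])
    also have "\<dots> = (\<integral>\<^sup>+t. pe t * indicator D t \<partial>lborel)"
      unfolding pe_def by (intro nn_integral_cong nn_integral_multc) measurable
    also have "\<dots> = emeasure (density lborel pe) D" by (rule emeasure_density[symmetric]) auto
    finally show "emeasure \<mu>1 D = emeasure (density lborel pe) D" using 1 by simp
  qed (simp add: \<mu>1)
  define m where "m j t s = (\<integral>\<^sup>+x. ennreal (p (v t (x(j := s)))) \<partial>Pi\<^sub>M (S - {j}) (\<lambda>_. lborel))" for j t s
  have sfj: "sigma_finite_measure (Pi\<^sub>M (S - {j}) (\<lambda>_. lborel :: real measure))" for j
    by (rule L.sigma_finite) simp
  have mm: "(\<lambda>p. m j (fst p) (snd p)) \<in> borel_measurable (borel \<Otimes>\<^sub>M borel)" if j: "j \<in> S" for j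
  proof -
    interpret sigma_finite_measure "Pi\<^sub>M (S - {j}) (\<lambda>_. lborel :: real measure)" by (rule sfj)
    have "(\<lambda>w. p (v (fst (fst w)) ((snd w)(j := snd (fst w))))) \<in> borel_measurable ((borel \<Otimes>\<^sub>M borel) \<Otimes>\<^sub>M Pi\<^sub>M (S - {j}) (\<lambda>_. lborel :: real measure))"
      by (rule measurable_compose[OF measurable_v_upd[OF j] p]) measurable
    then show ?thesis unfolding m_def by measurable
  qed
  have mraw[measurable (raw)]: "(\<lambda>w. m j (f w) (g w)) \<in> borel_measurable M" if "j \<in> S" "f \<in> borel_measurable M" "g \<in> borel_measurable M" for f g M j
    using measurable_compose[OF measurable_Pair[OF that(2,3)] mm[OF that(1)]] by simp
  have split: "(\<integral>\<^sup>+x. ennreal (p (v t x)) * indicator D (x j) \<partial>LS) = (\<integral>\<^sup>+s. m j t s * indicator D s \<partial>lborel)"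
    if j: "j \<in> S" and D[measurable]: "D \<in> sets borel" for j t D
  proof -
    have iS: "insert j (S - {j}) = S" using j by auto
    have fm: "(\<lambda>x. ennreal (p (v t x)) * indicator D (x j)) \<in> borel_measurable LS" using j by measurable
    have "(\<integral>\<^sup>+x. ennreal (p (v t x)) * indicator D (x j) \<partial>LS) = (\<integral>\<^sup>+s. \<integral>\<^sup>+x. ennreal (p (v t (x(j := s)))) * indicator D s \<partial>Pi\<^sub>M (S - {j}) (\<lambda>_. lborel) \<partial>lborel)"
      using L.product_nn_integral_insert_rev[of "S - {j}" j "\<lambda>x. ennreal (p (v t x)) * indicator D (x j)"] fm unfolding iS by simp
    also have "\<dots> = (\<integral>\<^sup>+s. m j t s * indicator D s \<partial>lborel)"
    proof (rule nn_integral_cong)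
      fix s
        have "(\<lambda>x. p (v t (x(j := s)))) \<in> borel_measurable (Pi\<^sub>M (S - {j}) (\<lambda>_. lborel :: real measure))"
        by (rule measurable_compose[OF measurable_v_upd[OF j] p]) measurable
      then show "(\<integral>\<^sup>+x. ennreal (p (v t (x(j := s)))) * indicator D s \<partial>Pi\<^sub>M (S - {j}) (\<lambda>_. lborel)) = m j t s * indicator D s"
        unfolding m_def by (intro nn_integral_multc measurable_compose[OF _ measurable_ennreal])
    qed
    finally show ?thesis .
  qed
  have pe_m: "pe t = (\<integral>\<^sup>+s. m j t s \<partial>lborel)" if "j \<in> S" for j t
    using split[OF that, of UNIV t] by (simp add: pe_def)
  \<comment> \<open>Both sides are densities in t of one finite measure, the law of the root on the
    event that coordinate j lies in D; densities are unique up to null sets.\<close>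
  have cond: "AE t in lborel. pe t * emeasure (K j t) D = (\<integral>\<^sup>+s. m j t s * indicator D s \<partial>lborel)"
    if j: "j \<in> S" and D[measurable]: "D \<in> sets borel" for j D
  proof -
    let ?f = "\<lambda>t. pe t * emeasure (K j t) D" and ?g = "\<lambda>t. \<integral>\<^sup>+s. m j t s * indicator D s \<partial>lborel"
    have fm[measurable]: "?f \<in> borel_measurable borel" by measurable
    have gm[measurable]: "?g \<in> borel_measurable borel" using j by measurable
    have eq: "density lborel ?f = density lborel ?g"
    proof (rule measure_eqI)
      fix B assume "B \<in> sets (density lborel ?f)"
      then have B[measurable]: "B \<in> sets borel" by simp
      let ?A = "\<lambda>i. if i = r then B else if i = j then D else UNIV"
      have jr: "j \<noteq> r" using j by simp
      have rm[measurable]: "{z::real^'n. \<forall>i. z $ i \<in> ?A i} \<in> sets borel" by (rule rect_sets) auto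
      have pr: "(\<Prod>i\<in>S. emeasure (K i t) (?A i)) = emeasure (K j t) D" for t
      proof -
        have "(\<Prod>i\<in>S. emeasure (K i t) (?A i)) = emeasure (K j t) (?A j) * (\<Prod>i\<in>S - {j}. emeasure (K i t) (?A i))"
          using j by (intro prod.remove) auto
        also have "(\<Prod>i\<in>S - {j}. emeasure (K i t) (?A i)) = 1" by (intro prod.neutral) (auto simp: KU)
        finally show ?thesis using jr by simp
      qed
      have "emeasure ?P {z. \<forall>i. z $ i \<in> ?A i} = (\<integral>\<^sup>+ t. indicator B t * emeasure (K j t) D \<partial>\<mu>1)"
        by (subst rect) (simp_all only: pr if_True, auto)
      also have "\<dots> = (\<integral>\<^sup>+t. pe t * (indicator B t * emeasure (K j t) D) \<partial>lborel)"
        unfolding marg by (rule nn_integral_density) measurable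
      also have "\<dots> = emeasure (density lborel ?f) B"
        by (subst emeasure_density) (auto simp: mult_ac)
      finally have 1: "emeasure (density lborel ?f) B = emeasure ?P {z. \<forall>i. z $ i \<in> ?A i}" by simp
      have ind: "indicator {z. \<forall>i. z $ i \<in> ?A i} (v t x) = (indicator D (x j) * indicator B t :: ennreal)" for t x
        using j jr unfolding indicator_def mem_rect by (auto split: if_splits)
      have "emeasure ?P {z. \<forall>i. z $ i \<in> ?A i} = (\<integral>\<^sup>+t. \<integral>\<^sup>+x. (ennreal (p (v t x)) * indicator D (x j)) * indicator B t \<partial>LS \<partial>lborel)"
        by (subst em, measurable) (simp only: ind mult.assoc)
      also have "\<dots> = (\<integral>\<^sup>+t. ?g t * indicator B t \<partial>lborel)"
      proof (rule nn_integral_cong)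
        fix t
        have "(\<integral>\<^sup>+x. (ennreal (p (v t x)) * indicator D (x j)) * indicator B t \<partial>LS) = (\<integral>\<^sup>+x. ennreal (p (v t x)) * indicator D (x j) \<partial>LS) * indicator B t"
          by (rule nn_integral_multc) (use j in measurable)
        then show "(\<integral>\<^sup>+x. (ennreal (p (v t x)) * indicator D (x j)) * indicator B t \<partial>LS) = ?g t * indicator B t"
          unfolding split[OF j D] .
      qed
      also have "\<dots> = emeasure (density lborel ?g) B" by (rule emeasure_density[symmetric]) auto
      finally show "emeasure (density lborel ?f) B = emeasure (density lborel ?g) B" using 1 by simp
    qed simp
    have "emeasure (density lborel ?f) (space (density lborel ?f)) \<noteq> \<infinity>"
    proof -
      have K1: "emeasure (K j t) D \<le> 1" for t using emeasure_mono[of D UNIV "K j t"] KU[of j t] Ks[of j t] by simp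
      have "(\<integral>\<^sup>+t. ?f t \<partial>lborel) \<le> (\<integral>\<^sup>+t. pe t \<partial>lborel)"
        using mult_left_mono[OF K1] by (intro nn_integral_mono) (metis mult.right_neutral zero_le)
      then show ?thesis using tot by (auto simp: emeasure_density top_unique)
    qed
    then have "sigma_finite_measure (density lborel ?f)" by (intro finite_measure.sigma_finite_measure finite_measureI)
    then show ?thesis using sigma_finite_density_unique[of ?f lborel ?g] eq by simp
  qed
  have pfin: "AE t in lborel. pe t \<noteq> \<infinity>" by (rule nn_integral_PInf_AE) (use tot in auto)
  define p1 where "p1 t = enn2real (pe t)" for t
  \<comment> \<open>The normal density is a default value, at the root index and at root values with
    marginal 0 or \<infinity>, so that every \<open>q j t\<close> is a probability density.\<close>
  define q where "q j t s = (if j \<in> S \<and> 0 < pe t \<and> pe t < \<infinity> then enn2real (m j t s) / enn2real (pe t) else std_normal_density s)" for j t s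
  have fac: "factors p1 q"
    unfolding factors_def
  proof (intro conjI allI)
    show "p1 \<in> borel_measurable borel" unfolding p1_def by measurable
    show "0 \<le> p1 t" for t by (simp add: p1_def)
    show "0 \<le> q j t s" for j t s by (simp add: q_def)
    show "(\<lambda>w. q j (fst w) (snd w)) \<in> borel_measurable (borel \<Otimes>\<^sub>M borel)" for j
    proof (cases "j \<in> S")
      case True
      show ?thesis unfolding q_def using True by measurable
    next
      case False
      then show ?thesis unfolding q_def by simp
    qed
  qed
  have qmD: "(\<integral>\<^sup>+s. ennreal (q j t s) * indicator D s \<partial>lborel) = (\<integral>\<^sup>+s. m j t s * indicator D s \<partial>lborel) / pe t"
    if j: "j \<in> S" and t: "0 < pe t" "pe t < \<infinity>" and D[measurable]: "D \<in> sets borel" for j t D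
  proof -
    have "AE s in lborel. m j t s \<noteq> \<infinity>"
      by (rule nn_integral_PInf_AE) (use j t pe_m[OF j, of t] in \<open>auto\<close>)
    then have "(\<integral>\<^sup>+s. ennreal (q j t s) * indicator D s \<partial>lborel) = (\<integral>\<^sup>+s. m j t s * indicator D s / pe t \<partial>lborel)"
    proof (intro nn_integral_cong_AE, eventually_elim)
      case (elim s)
      have "0 < enn2real (pe t)" using t by (simp add: enn2real_positive_iff)
      then have "ennreal (q j t s) = ennreal (enn2real (m j t s)) / ennreal (enn2real (pe t))"
        using j t by (subst divide_ennreal) (auto simp: q_def)
      also have "\<dots> = m j t s / pe t" using elim t by (simp add: less_top)
      finally show ?case by (simp add: ennreal_times_divide mult.commute)
    qed
    also have "\<dots> = (\<integral>\<^sup>+s. m j t s * indicator D s \<partial>lborel) / pe t"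
      by (rule nn_integral_divide) (use j in measurable)
    finally show ?thesis .
  qed
  have q1: "(\<integral>\<^sup>+s. ennreal (q j t s) \<partial>lborel) = 1" for j t
  proof (cases "j \<in> S \<and> 0 < pe t \<and> pe t < \<infinity>")
    case True
    then show ?thesis using qmD[of j t UNIV] pe_m[of j t] by (simp add: ennreal_divide_self)
  next
    case False
    then have "(\<integral>\<^sup>+s. ennreal (q j t s) \<partial>lborel) = (\<integral>\<^sup>+s. ennreal (std_normal_density s) \<partial>lborel)"
      by (intro nn_integral_cong) (auto simp: q_def)
    also have "\<dots> = 1" by (subst nn_integral_eq_integral) auto
    finally show ?thesis .
  qed
  have p11: "(\<integral>\<^sup>+t. ennreal (p1 t) \<partial>lborel) = 1"
    unfolding tot[symmetric] using pfin by (intro nn_integral_cong_AE) (auto elim!: eventually_mono simp: p1_def less_top)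
  have starm[measurable]: "star p1 q \<in> borel_measurable borel" by (rule star_meas[OF fac])
  have "?P = density lborel (\<lambda>z. ennreal (star p1 q z))"
  proof (rule measure_eqI_boxes)
    show "finite_measure ?P" using prP by (rule prob_space.finite_measure)
    fix A :: "'n \<Rightarrow> real set" assume A[measurable]: "\<And>i. A i \<in> sets borel"
    have rm[measurable]: "{z :: real ^ 'n. \<forall>i. z $ i \<in> A i} \<in> sets borel" by measurable
    have "emeasure ?P {z. \<forall>i. z $ i \<in> A i} = (\<integral>\<^sup>+t. pe t * (indicator (A r) t * (\<Prod>j\<in>S. emeasure (K j t) (A j))) \<partial>lborel)"
      unfolding rect[OF A] marg by (rule nn_integral_density) measurable
    also have "\<dots> = (\<integral>\<^sup>+t. ennreal (p1 t) * indicator (A r) t * (\<Prod>j\<in>S. \<integral>\<^sup>+s. ennreal (q j t s) * indicator (A j) s \<partial>lborel) \<partial>lborel)"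
    proof (rule nn_integral_cong_AE)
      have "AE t in lborel. \<forall>j\<in>S. pe t * emeasure (K j t) (A j) = (\<integral>\<^sup>+s. m j t s * indicator (A j) s \<partial>lborel)"
        by (rule AE_finite_allI) (auto intro: cond)
      then show "AE t in lborel. pe t * (indicator (A r) t * (\<Prod>j\<in>S. emeasure (K j t) (A j))) =
        ennreal (p1 t) * indicator (A r) t * (\<Prod>j\<in>S. \<integral>\<^sup>+s. ennreal (q j t s) * indicator (A j) s \<partial>lborel)"
        using pfin
      proof eventually_elim
        case (elim t)
        show ?case
        proof (cases "pe t = 0")
          case True
          then show ?thesis by (simp add: p1_def)
        next
          case False
          then have t: "0 < pe t" "pe t < \<infinity>" using elim by (auto simp: zero_less_iff_neq_zero less_top)
          have "(\<integral>\<^sup>+s. ennreal (q j t s) * indicator (A j) s \<partial>lborel) = emeasure (K j t) (A j)" if j: "j \<in> S" for j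
          proof -
            have "(\<integral>\<^sup>+s. ennreal (q j t s) * indicator (A j) s \<partial>lborel) = pe t * emeasure (K j t) (A j) / pe t"
              unfolding qmD[OF j t A] using elim(1) j by simp
            also have "\<dots> = emeasure (K j t) (A j)"
              using t ennreal_mult_divide_eq[of "pe t" "emeasure (K j t) (A j)"] ennreal_mult_divide_eq[of "emeasure (K j t) (A j)" "pe t"]
              by (simp add: mult.commute less_top)
            finally show ?thesis .
          qed
          then have "(\<Prod>j\<in>S. \<integral>\<^sup>+s. ennreal (q j t s) * indicator (A j) s \<partial>lborel) = (\<Prod>j\<in>S. emeasure (K j t) (A j))"
            by (intro prod.cong) auto
          moreover have "ennreal (p1 t) = pe t" using t by (simp add: p1_def)
          ultimately show ?thesis by (simp add: mult.assoc)
        qed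
      qed
    qed
    also have "\<dots> = (\<integral>\<^sup>+z. ennreal (star p1 q z) * indicator {z. \<forall>i. z $ i \<in> A i} z \<partial>lborel)"
      by (rule star_nn_rect[OF fac A, symmetric])
    also have "\<dots> = emeasure (density lborel (\<lambda>z. ennreal (star p1 q z))) {z. \<forall>i. z $ i \<in> A i}"
      by (rule emeasure_density[symmetric]) auto
    finally show "emeasure ?P {z. \<forall>i. z $ i \<in> A i} = emeasure (density lborel (\<lambda>z. ennreal (star p1 q z))) {z. \<forall>i. z $ i \<in> A i}" .
  qed simp_all
  moreover have "sigma_finite_measure ?P" using prP by (rule prob_space_imp_sigma_finite)
  ultimately have "AE z in lborel. ennreal (p z) = ennreal (star p1 q z)"
    using sigma_finite_density_unique[of "\<lambda>z. ennreal (p z)" lborel "\<lambda>z. ennreal (star p1 q z)"] by simp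
  then have "AE z in lborel. p z = star p1 q z"
    by eventually_elim (use p0 star_nonneg[OF fac] in simp)
  with fac q1 p11 show ?thesis by (rule that)
qed

end

section \<open>Optimality of the minimizer\<close>

locale star_minimizer = structured_potential V G H r lV lV' LV' + rc: root_coordinate r
  for V :: "real ^ 'n \<Rightarrow> real" and G H and r :: 'n and lV lV' LV' +
  fixes p :: "real ^ 'n \<Rightarrow> real"
  assumes normalizable: "integrable lborel (\<lambda>z. exp (- V z))"
    and p_in: "density lborel (\<lambda>z. ennreal (p z)) \<in> C_star r"
    and p_min: "\<And>\<mu>. \<mu> \<in> C_star r \<Longrightarrow> KL_div (density lborel (\<lambda>z. ennreal (p z))) (gibbs V) \<le> KL_div \<mu> (gibbs V)"
    and p_nonneg: "\<And>z. p z \<ge> 0"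
    and p_diff: "\<And>z. p differentiable (at z)"
begin

lemma p_meas[measurable]: "p \<in> borel_measurable borel"
  by (intro borel_measurable_continuous_onI continuous_at_imp_continuous_on ballI differentiable_imp_continuous_within p_diff)

lemma V_meas[measurable]: "V \<in> borel_measurable borel"
  by (rule borel_measurable_continuous_onI[OF V_cont])

lemma G_meas[measurable]: "(\<lambda>z. G z $ i) \<in> borel_measurable borel"
  by (intro borel_measurable_continuous_onI continuous_intros G_cont)

lemma p_mass: "(\<integral>\<^sup>+z. ennreal (p z) \<partial>lborel) = 1"
proof -
  have "prob_space (density lborel (\<lambda>z. ennreal (p z)))" using p_in by (simp add: C_star_def)
  from prob_space.emeasure_space_1[OF this] show ?thesis by (simp add: emeasure_density)
qed

lemma p_integrable: "integrable lborel p" "(\<integral>z. p z \<partial>lborel) = 1"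
  using p_mass p_nonneg by (auto simp: integral_eq_nn_integral intro!: integrableI_nonneg)

definition "Z = (\<integral>z. exp (- V z) \<partial>lborel)"

lemma Z_pos: "0 < Z"
  by (rule partition_pos[OF V_meas normalizable Z_def p_meas p_nonneg p_mass])

text \<open>The uniform law on the unit cube is a star measure, and V is bounded on this compact
  set. Hence the minimum is finite, and p (ln p + V) turns out to be integrable.\<close>

lemma cube_competitor: "KL_div (density lborel (\<lambda>z. ennreal (p z))) (gibbs V) < \<infinity>"
proof -
  define a :: "real \<Rightarrow> real" where "a = indicator {0..1}"
  define k :: "'n \<Rightarrow> real \<Rightarrow> real \<Rightarrow> real" where "k j t s = indicator {0..1} s" for j t s
  have fac: "rc.factors a k" unfolding rc.factors_def a_def k_def by auto
  let ?Q = "cbox 0 (\<chi> i. 1) :: (real ^ 'n) set"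
  have n: "rc.star a k z = indicator ?Q z" for z
  proof (cases "z \<in> ?Q")
    case True
    then have "0 \<le> z $ i \<and> z $ i \<le> 1" for i by (simp add: mem_box_cart)
    then show ?thesis using True by (simp add: rc.star_def a_def k_def)
  next
    case False
    then obtain i where i: "\<not> (0 \<le> z $ i \<and> z $ i \<le> 1)" by (auto simp: mem_box_cart)
    have "rc.star a k z = 0"
    proof (cases "i = r")
      case True then show ?thesis using i by (simp add: rc.star_def a_def)
    next
      case False
      then have "(\<Prod>j\<in>UNIV - {r}. k j (z $ r) (z $ j)) = 0"
        using i by (intro prod_zero bexI[of _ i]) (auto simp: k_def)
      then show ?thesis by (simp add: rc.star_def)
    qed
    then show ?thesis using False by simp
  qed
  have mass: "(\<integral>\<^sup>+z. ennreal (rc.star a k z) \<partial>lborel) = ennreal 1"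
    using rc.star_nn_rect[OF fac, of "\<lambda>_. UNIV"] by (simp add: a_def k_def ennreal_indicator)
  have mem: "density lborel (\<lambda>z. ennreal (rc.star a k z / 1)) \<in> C_star r"
    by (rule rc.C_star_memI[OF fac _ mass]) simp
  have i: "integrable lborel (\<lambda>z. rc.star a k z * (ln (rc.star a k z) + V z))"
  proof -
    have "integrable lborel (\<lambda>z. indicator ?Q z *\<^sub>R V z)"
      by (rule borel_integrable_compact) (auto intro: V_cont)
    moreover have "(\<lambda>z. indicator ?Q z *\<^sub>R V z) = (\<lambda>z. rc.star a k z * (ln (rc.star a k z) + V z))"
      by (auto simp: n indicator_def)
    ultimately show ?thesis by simp
  qed
  have "KL_div (density lborel (\<lambda>z. ennreal (p z))) (gibbs V) \<le> KL_div (density lborel (\<lambda>z. ennreal (rc.star a k z))) (gibbs V)"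
    using p_min[OF mem] by simp
  also have "\<dots> < \<infinity>"
    by (subst KL_div_integrable[OF V_meas normalizable Z_def rc.star_meas[OF fac] rc.star_nonneg[OF fac] _ i]) (use mass in auto)
  finally show ?thesis .
qed

definition "g z = ln (p z) + V z"
definition "C = (\<integral>z. p z * g z \<partial>lborel)"

lemma g_meas[measurable]: "g \<in> borel_measurable borel" unfolding g_def[abs_def] by measurable

lemma pg_integrable: "integrable lborel (\<lambda>z. p z * g z)"
  unfolding g_def by (rule KL_div_finite[OF V_meas normalizable Z_def p_meas p_nonneg p_mass cube_competitor])

lemma KL_eq: "KL_div (density lborel (\<lambda>z. ennreal (p z))) (gibbs V) = ereal (C + ln Z)"
  unfolding C_def g_def
  by (rule KL_div_integrable[OF V_meas normalizable Z_def p_meas p_nonneg p_mass pg_integrable[unfolded g_def]])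

text \<open>Minimality against the normalised competitor n / c, multiplied by c. The normalisation
  survives only as -c ln c, the term that later decides between c = 1 and c > 1.\<close>

lemma optimality:
  assumes fac: "rc.factors a k" and c: "0 < c" and mass: "(\<integral>\<^sup>+z. ennreal (rc.star a k z) \<partial>lborel) = ennreal c"
    and i: "integrable lborel (\<lambda>z. rc.star a k z * (ln (rc.star a k z) + V z))"
  shows "C * c \<le> (\<integral>z. rc.star a k z * (ln (rc.star a k z) + V z) \<partial>lborel) - c * ln c"
proof -
  let ?n = "rc.star a k" and ?m = "\<lambda>z. rc.star a k z / c"
  have nm[measurable]: "?n \<in> borel_measurable borel" by (rule rc.star_meas[OF fac])
  have n0: "0 \<le> ?n z" for z by (rule rc.star_nonneg[OF fac])
  have ni: "integrable lborel ?n" "(\<integral>z. ?n z \<partial>lborel) = c"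
    using mass n0 c by (auto simp: integral_eq_nn_integral intro!: integrableI_nonneg)
  have e: "?m z * (ln (?m z) + V z) = (1 / c) * (?n z * (ln (?n z) + V z)) - (ln c / c) * ?n z" for z
  proof (cases "?n z = 0")
    case False
    then have "0 < ?n z" using n0[of z] by simp
    then show ?thesis using c by (simp add: ln_div field_simps)
  qed simp
  have im: "integrable lborel (\<lambda>z. ?m z * (ln (?m z) + V z))" unfolding e using i ni by auto
  have m1: "(\<integral>\<^sup>+z. ennreal (?m z) \<partial>lborel) = 1"
  proof -
    have "(\<integral>\<^sup>+z. ennreal (?m z) \<partial>lborel) = ennreal (\<integral>z. ?m z \<partial>lborel)"
      using ni c n0 by (intro nn_integral_eq_integral) auto
    then show ?thesis using ni c by simp
  qed
  have "ereal (C + ln Z) \<le> KL_div (density lborel (\<lambda>z. ennreal (?m z))) (gibbs V)"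
    using p_min[OF rc.C_star_memI[OF fac c mass]] KL_eq by simp
  also have "\<dots> = ereal ((\<integral>z. ?m z * (ln (?m z) + V z) \<partial>lborel) + ln Z)"
    by (rule KL_div_integrable[OF V_meas normalizable Z_def _ _ m1 im]) (use n0 c in auto)
  finally have "C \<le> (\<integral>z. ?m z * (ln (?m z) + V z) \<partial>lborel)" by simp
  also have "\<dots> = (1 / c) * (\<integral>z. ?n z * (ln (?n z) + V z) \<partial>lborel) - (ln c / c) * c"
    unfolding e using i ni by simp
  finally have "C \<le> (1 / c) * (\<integral>z. ?n z * (ln (?n z) + V z) \<partial>lborel) - ln c" using c by simp
  from mult_left_mono[OF this, of c] c show ?thesis by (simp add: algebra_simps)
qed

end

section \<open>First variation in one conditional factor\<close>

locale factored_minimizer = star_minimizer V G H r lV lV' LV' p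
  for V :: "real ^ 'n \<Rightarrow> real" and G H r lV lV' LV' p +
  fixes p1 :: "real \<Rightarrow> real" and q :: "'n \<Rightarrow> real \<Rightarrow> real \<Rightarrow> real"
  assumes fac: "rc.factors p1 q" and q1: "\<And>j t. (\<integral>\<^sup>+s. ennreal (q j t s) \<partial>lborel) = 1"
    and p11: "(\<integral>\<^sup>+t. ennreal (p1 t) \<partial>lborel) = 1" and p_star: "AE z in lborel. p z = rc.star p1 q z"
begin

lemmas p1_meas[measurable] = rc.a_meas[OF fac]
lemmas q_meas[measurable (raw)] = rc.k_meas_raw[OF fac]
lemmas p1_nonneg = rc.a_nonneg[OF fac]
lemmas q_nonneg = rc.k_nonneg[OF fac]

text \<open>The factor q_i is multiplied by 1 + e \<eta>, where \<eta> is \<psi> minus its overall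
  mean, so the total mass stays 1 while the conditional masses may change. As \<psi> depends on the
  root value too, the root marginal is varied along with the conditional factor; this is why one
  constant C serves all root values.\<close>

lemma first_variation:
  assumes i: "i \<in> S" and \<psi>m: "(\<lambda>w. \<psi> (fst w) (snd w)) \<in> borel_measurable (borel \<Otimes>\<^sub>M borel)"
    and bd: "\<And>t s. \<bar>\<psi> t s\<bar> \<le> (K::real)"
  shows "(\<integral>z. p z * (g z - C) * \<psi> (z $ r) (z $ i) \<partial>lborel) = 0"
proof -
  have \<psi>r[measurable (raw)]: "(\<lambda>z. \<psi> (f z) (h z)) \<in> borel_measurable M" if "f \<in> borel_measurable M" "h \<in> borel_measurable M" for f h M
    using measurable_compose[OF measurable_Pair[OF that] \<psi>m] by simp
  have bnd: "integrable lborel (\<lambda>z. f z * h z)" if f: "integrable lborel f" and [measurable]: "h \<in> borel_measurable borel" and b: "\<And>z. \<bar>h z\<bar> \<le> B"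
    for f h :: "real ^ 'n \<Rightarrow> real" and B
  proof (rule Bochner_Integration.integrable_bound[OF integrable_mult_right[OF f, of B]])
    show "(\<lambda>z. f z * h z) \<in> borel_measurable lborel" using borel_measurable_integrable[OF f] by simp
    show "AE z in lborel. norm (f z * h z) \<le> norm (B * f z)"
    proof (rule AE_I2)
      fix z
      have "\<bar>f z\<bar> * \<bar>h z\<bar> \<le> \<bar>f z\<bar> * \<bar>B\<bar>" using b[of z] by (intro mult_left_mono) auto
      then show "norm (f z * h z) \<le> norm (B * f z)" by (simp add: abs_mult mult.commute)
    qed
  qed
  let ?\<psi> = "\<lambda>z::real^'n. \<psi> (z $ r) (z $ i)"
  define m where "m = (\<integral>z. p z * ?\<psi> z \<partial>lborel)"
  define \<eta> where "\<eta> t s = \<psi> t s - m" for t s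
  let ?\<eta> = "\<lambda>z::real^'n. \<eta> (z $ r) (z $ i)"
  have \<eta>r[measurable (raw)]: "(\<lambda>z. \<eta> (f z) (h z)) \<in> borel_measurable M" if [measurable]: "f \<in> borel_measurable M" "h \<in> borel_measurable M" for f h M
    unfolding \<eta>_def by measurable
  define M where "M = K + \<bar>m\<bar> + 1"
  have K0: "0 \<le> K" using bd[of 0 0] by simp
  have M: "0 < M" "\<bar>\<eta> t s\<bar> \<le> M" for t s using K0 bd[of t s] by (auto simp: M_def \<eta>_def)
  have ip\<psi>: "integrable lborel (\<lambda>z. p z * ?\<psi> z)" by (rule bnd[OF p_integrable(1), of _ K]) (use bd in auto)
  have ip\<eta>: "integrable lborel (\<lambda>z. p z * ?\<eta> z)" by (rule bnd[OF p_integrable(1), of _ M]) (use M in auto)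
  have m\<eta>: "(\<integral>z. p z * ?\<eta> z \<partial>lborel) = 0"
    unfolding \<eta>_def right_diff_distrib using ip\<psi> p_integrable by (simp add: m_def)
  have ipg\<eta>: "integrable lborel (\<lambda>z. p z * g z * ?\<eta> z)" by (rule bnd[OF pg_integrable, of _ M]) (use M in auto)
  have ipg\<psi>: "integrable lborel (\<lambda>z. p z * g z * ?\<psi> z)" by (rule bnd[OF pg_integrable, of _ K]) (use bd in auto)
  define X where "X = (\<integral>z. p z * g z * ?\<eta> z \<partial>lborel)"
  have XX: "(\<integral>z. p z * (g z - C) * ?\<psi> z \<partial>lborel) = X"
  proof -
    have "X = (\<integral>z. p z * g z * ?\<psi> z - m * (p z * g z) \<partial>lborel)" unfolding X_def \<eta>_def by (simp add: algebra_simps)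
    also have "\<dots> = (\<integral>z. p z * g z * ?\<psi> z \<partial>lborel) - C * m" using ipg\<psi> pg_integrable by (simp add: C_def)
    also have "\<dots> = (\<integral>z. p z * g z * ?\<psi> z - C * (p z * ?\<psi> z) \<partial>lborel)" using ipg\<psi> ip\<psi> by (simp add: m_def)
    also have "\<dots> = (\<integral>z. p z * (g z - C) * ?\<psi> z \<partial>lborel)" by (simp add: algebra_simps)
    finally show ?thesis by simp
  qed
  \<comment> \<open>From ln u \<le> u - 1, the entropy u ln u of the perturbation is at most e
    \<eta> + e^2 \<eta>^2, whose linear part has mean zero. The restriction |e| \<le> 1 / (2 M)
    keeps u between 1/2 and 2.\<close>
  have var: "0 \<le> e * X + e\<^sup>2 * M\<^sup>2" if e: "\<bar>e\<bar> \<le> 1 / (2 * M)" for e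
  proof -
    have eM: "\<bar>e * \<eta> t s\<bar> \<le> 1 / 2" for t s
    proof -
      have "\<bar>e\<bar> * \<bar>\<eta> t s\<bar> \<le> 1 / (2 * M) * M" using e M by (intro mult_mono) auto
      then show ?thesis using M(1) by (simp add: abs_mult)
    qed
    define u where "u t s = 1 + e * \<eta> t s" for t s
    let ?u = "\<lambda>z::real^'n. u (z $ r) (z $ i)"
    have u: "1 / 2 \<le> u t s" "u t s \<le> 2" for t s using eM[of t s] by (auto simp: u_def abs_le_iff)
    have uabs: "\<bar>u t s\<bar> \<le> 2" for t s using u[of t s] by (simp add: abs_le_iff)
    have u0: "0 \<le> u t s" for t s using u(1)[of t s] by linarith
    have ur[measurable (raw)]: "(\<lambda>z. u (f z) (h z)) \<in> borel_measurable M" if [measurable]: "f \<in> borel_measurable M" "h \<in> borel_measurable M" for f h M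
      unfolding u_def by measurable
    define k where "k j t s = (if j = i then q j t s * u t s else q j t s)" for j t s
    have fk: "rc.factors p1 k"
      unfolding rc.factors_def
    proof (intro conjI allI)
      show "(\<lambda>w. k j (fst w) (snd w)) \<in> borel_measurable (borel \<Otimes>\<^sub>M borel)" for j
        unfolding k_def by measurable
      show "0 \<le> k j t s" for j t s
      proof -
        have "0 \<le> u t s" using u(1)[of t s] by linarith
        then show ?thesis using q_nonneg by (simp add: k_def)
      qed
    qed (use p1_nonneg in auto)
    have nk: "rc.star p1 k z = rc.star p1 q z * ?u z" for z
    proof -
      have "(\<Prod>j\<in>S. k j (z $ r) (z $ j)) = k i (z $ r) (z $ i) * (\<Prod>j\<in>S - {i}. k j (z $ r) (z $ j))"
        using i by (intro prod.remove) auto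
      also have "(\<Prod>j\<in>S - {i}. k j (z $ r) (z $ j)) = (\<Prod>j\<in>S - {i}. q j (z $ r) (z $ j))"
        by (intro prod.cong) (auto simp: k_def)
      finally have "(\<Prod>j\<in>S. k j (z $ r) (z $ j)) = (q i (z $ r) (z $ i) * (\<Prod>j\<in>S - {i}. q j (z $ r) (z $ j))) * ?u z"
        by (simp add: k_def)
      also have "q i (z $ r) (z $ i) * (\<Prod>j\<in>S - {i}. q j (z $ r) (z $ j)) = (\<Prod>j\<in>S. q j (z $ r) (z $ j))"
        using i by (intro prod.remove[symmetric]) auto
      finally show ?thesis by (simp add: rc.star_def mult.assoc)
    qed
    have km[measurable]: "rc.star p1 k \<in> borel_measurable borel" by (rule rc.star_meas[OF fk])
    have ae: "AE z in lborel. rc.star p1 k z = p z * ?u z"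
      using p_star by eventually_elim (simp add: nk)
    have ipu: "integrable lborel (\<lambda>z. p z * ?u z)" by (rule bnd[OF p_integrable(1), of _ 2]) (use uabs in auto)
    have pu1: "(\<integral>z. p z * ?u z \<partial>lborel) = 1"
    proof -
      have "(\<integral>z. p z * ?u z \<partial>lborel) = (\<integral>z. p z + e * (p z * ?\<eta> z) \<partial>lborel)" by (simp add: u_def algebra_simps)
      then show ?thesis using p_integrable ip\<eta> m\<eta> by simp
    qed
    have mass: "(\<integral>\<^sup>+z. ennreal (rc.star p1 k z) \<partial>lborel) = ennreal 1"
    proof -
      have "(\<integral>\<^sup>+z. ennreal (rc.star p1 k z) \<partial>lborel) = (\<integral>\<^sup>+z. ennreal (p z * ?u z) \<partial>lborel)"
        using ae by (intro nn_integral_cong_AE) (auto elim: eventually_mono)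
      also have "\<dots> = ennreal 1"
      proof (subst nn_integral_eq_integral[OF ipu])
        show "AE z in lborel. 0 \<le> p z * ?u z"
          by (intro AE_I2 mult_nonneg_nonneg p_nonneg u0)
      qed (simp add: pu1)
      finally show ?thesis .
    qed
    define w where "w t s = u t s * ln (u t s)" for t s
    have wle: "w t s \<le> e * \<eta> t s + e\<^sup>2 * M\<^sup>2" for t s
    proof -
      have "ln (u t s) \<le> u t s - 1" using u(1)[of t s] by (intro ln_le_minus_one) linarith
      then have "w t s \<le> u t s * (e * \<eta> t s)" unfolding w_def using u(1)[of t s] by (intro mult_left_mono) (auto simp: u_def)
      also have "\<dots> = e * \<eta> t s + e\<^sup>2 * (\<eta> t s)\<^sup>2" by (simp add: u_def power2_eq_square algebra_simps)
      also have "(\<eta> t s)\<^sup>2 \<le> M\<^sup>2" using M by (simp add: abs_le_square_iff[symmetric])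
      finally show ?thesis by (simp add: mult_left_mono)
    qed
    have wb: "\<bar>w t s\<bar> \<le> 4" for t s
    proof -
      have "ln (u t s) \<le> u t s - 1" "ln (1 / u t s) \<le> 1 / u t s - 1" using u(1)[of t s] by (auto intro!: ln_le_minus_one)
      moreover have "ln (1 / u t s) = - ln (u t s)" using u(1)[of t s] by (simp add: ln_div)
      moreover have "1 / u t s \<le> 2" using u(1)[of t s] by (simp add: field_simps)
      ultimately have "\<bar>ln (u t s)\<bar> \<le> 2" using u[of t s] by (simp add: abs_le_iff)
      then have "\<bar>u t s\<bar> * \<bar>ln (u t s)\<bar> \<le> 2 * 2" using u[of t s] by (intro mult_mono) auto
      then show ?thesis by (simp add: w_def abs_mult)
    qed
    have wr[measurable (raw)]: "(\<lambda>z. w (f z) (h z)) \<in> borel_measurable M" if [measurable]: "f \<in> borel_measurable M" "h \<in> borel_measurable M" for f h M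
      unfolding w_def by measurable
    let ?w = "\<lambda>z::real^'n. w (z $ r) (z $ i)"
    have ipw: "integrable lborel (\<lambda>z. p z * ?w z)" by (rule bnd[OF p_integrable(1), of _ 4]) (use wb in auto)
    have aeJ: "AE z in lborel. rc.star p1 k z * (ln (rc.star p1 k z) + V z) = p z * g z + e * (p z * g z * ?\<eta> z) + p z * ?w z"
      using ae
    proof eventually_elim
      case (elim z)
      show ?case
      proof (cases "p z = 0")
        case True then show ?thesis using elim by simp
      next
        case False
        then have pz: "0 < p z" using p_nonneg[of z] by simp
        have uz: "0 < ?u z" using u(1)[of "z $ r" "z $ i"] by linarith
        have "ln (p z * ?u z) = ln (p z) + ln (?u z)" using pz uz by (simp add: ln_mult)
        then have "rc.star p1 k z * (ln (rc.star p1 k z) + V z) = p z * ?u z * (g z + ln (?u z))"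
          using elim by (simp add: g_def)
        also have "\<dots> = p z * (1 + e * ?\<eta> z) * g z + p z * ?w z" by (simp add: w_def u_def algebra_simps)
        finally show ?thesis by (simp add: algebra_simps)
      qed
    qed
    have iJ: "integrable lborel (\<lambda>z. p z * g z + e * (p z * g z * ?\<eta> z) + p z * ?w z)"
      using pg_integrable ipg\<eta> ipw by auto
    have iJ': "integrable lborel (\<lambda>z. rc.star p1 k z * (ln (rc.star p1 k z) + V z))"
      by (subst integrable_cong_AE[OF _ _ aeJ]) (use iJ in auto)
    have "C * 1 \<le> (\<integral>z. rc.star p1 k z * (ln (rc.star p1 k z) + V z) \<partial>lborel) - 1 * ln 1"
      by (rule optimality[OF fk _ mass iJ']) simp
    also have "(\<integral>z. rc.star p1 k z * (ln (rc.star p1 k z) + V z) \<partial>lborel) = (\<integral>z. p z * g z + e * (p z * g z * ?\<eta> z) + p z * ?w z \<partial>lborel)"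
      by (rule integral_cong_AE[OF _ _ aeJ]) auto
    also have "\<dots> = C + e * X + (\<integral>z. p z * ?w z \<partial>lborel)" using pg_integrable ipg\<eta> ipw by (simp add: C_def X_def)
    finally have "0 \<le> e * X + (\<integral>z. p z * ?w z \<partial>lborel)" by simp
    also have "(\<integral>z. p z * ?w z \<partial>lborel) \<le> (\<integral>z. e * (p z * ?\<eta> z) + e\<^sup>2 * M\<^sup>2 * p z \<partial>lborel)"
    proof (rule integral_mono)
      show "p z * ?w z \<le> e * (p z * ?\<eta> z) + e\<^sup>2 * M\<^sup>2 * p z" for z
        using mult_left_mono[OF wle p_nonneg[of z]] by (simp add: algebra_simps)
    qed (use ipw ip\<eta> p_integrable in auto)
    also have "\<dots> = e\<^sup>2 * M\<^sup>2" using ip\<eta> p_integrable m\<eta> by simp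
    finally show ?thesis by simp
  qed
  have "X = 0"
  proof (rule ccontr)
    assume X: "X \<noteq> 0"
    \<comment> \<open>A step against the sign of X, so small that the quadratic term is at most half
      of the linear one.\<close>
    define t where "t = min (1 / (2 * M)) (\<bar>X\<bar> / (2 * M\<^sup>2))"
    have t: "0 < t" using X M by (simp add: t_def)
    have "0 \<le> (- (t * sgn X)) * X + (- (t * sgn X))\<^sup>2 * M\<^sup>2"
      by (rule var) (use t X in \<open>simp add: abs_mult abs_sgn_eq, simp add: t_def\<close>)
    also have "(- (t * sgn X)) * X = - (t * \<bar>X\<bar>)" by (simp add: abs_sgn mult_ac)
    also have "(- (t * sgn X))\<^sup>2 = t * t" using X by (simp add: power2_eq_square sgn_if)
    finally have "t * \<bar>X\<bar> \<le> t * (t * M\<^sup>2)" by (simp add: mult.assoc)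
    then have "\<bar>X\<bar> \<le> t * M\<^sup>2" using t by simp
    also have "\<dots> \<le> \<bar>X\<bar> / (2 * M\<^sup>2) * M\<^sup>2" by (intro mult_right_mono) (auto simp: t_def)
    also have "\<dots> = \<bar>X\<bar> / 2" using M by simp
    finally show False using X by simp
  qed
  then show ?thesis using XX by simp
qed

lemma pgC_integrable: "integrable lborel (\<lambda>z. p z * (g z - C))"
  using pg_integrable p_integrable by (simp add: right_diff_distrib)

text \<open>The test function is the sign of the conditional integral \<Gamma>(t, s). It depends on
  the root and the i-th coordinate only, hence is admissible, and it turns the vanishing first
  variation into the integral of |\<Gamma>|.\<close>

lemma first_order:
  assumes i: "i \<in> S"
  shows "AE t in lborel. AE s in lborel.
     integrable (Pi\<^sub>M (S - {i}) (\<lambda>_. lborel)) (\<lambda>x. p (rc.v t (x(i := s))) * (g (rc.v t (x(i := s))) - C)) \<and>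
     (\<integral>x. p (rc.v t (x(i := s))) * (g (rc.v t (x(i := s))) - C) \<partial>Pi\<^sub>M (S - {i}) (\<lambda>_. lborel)) = 0"
proof -
  let ?L = "Pi\<^sub>M (S - {i}) (\<lambda>_. lborel :: real measure)"
  interpret Li: sigma_finite_measure ?L by (rule rc.L.sigma_finite) simp
  define h where "h z = p z * (g z - C)" for z
  have hm[measurable]: "h \<in> borel_measurable borel" unfolding h_def[abs_def] by measurable
  have hi: "integrable lborel h" using pgC_integrable by (simp add: h_def[abs_def])
  define \<Gamma> where "\<Gamma> t s = (\<integral>x. h (rc.v t (x(i := s))) \<partial>?L)" for t s
  have \<Gamma>m: "(\<lambda>w. \<Gamma> (fst w) (snd w)) \<in> borel_measurable (borel \<Otimes>\<^sub>M borel)"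
  proof -
    have "(\<lambda>w. h (rc.v (fst (fst w)) ((snd w)(i := snd (fst w))))) \<in> borel_measurable ((borel \<Otimes>\<^sub>M borel) \<Otimes>\<^sub>M ?L)"
      by (rule measurable_compose[OF rc.measurable_v_upd[OF i] hm]) measurable
    then show ?thesis unfolding \<Gamma>_def by measurable
  qed
  have \<Gamma>r[measurable (raw)]: "(\<lambda>z. \<Gamma> (f z) (e z)) \<in> borel_measurable M" if "f \<in> borel_measurable M" "e \<in> borel_measurable M" for f e M
    using measurable_compose[OF measurable_Pair[OF that] \<Gamma>m] by simp
  have iS: "insert i (S - {i}) = S" "finite (S - {i})" "i \<notin> S - {i}" using i by auto
  note fub = rc.L.integrable_insert[OF iS(2,3), unfolded iS(1)]
  define sg :: "real \<Rightarrow> real" where "sg x = (if 0 < x then 1 else if x < 0 then - 1 else 0)" for x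
  have sg: "\<bar>sg x\<bar> \<le> 1" "x * sg x = \<bar>x\<bar>" for x by (auto simp: sg_def)
  have [measurable]: "sg \<in> borel_measurable borel" unfolding sg_def[abs_def] by measurable
  let ?\<psi> = "\<lambda>t s. sg (\<Gamma> t s)"
  have zero: "(\<integral>z. h z * ?\<psi> (z $ r) (z $ i) \<partial>lborel) = 0"
    unfolding h_def by (rule first_variation[OF i, of ?\<psi> 1]) (measurable, rule sg)
  have hpi: "integrable lborel (\<lambda>z. h z * ?\<psi> (z $ r) (z $ i))"
    by (rule Bochner_Integration.integrable_bound[OF hi]) (auto intro!: AE_I2 mult_left_le simp: abs_mult sg)
  have slice: "AE t in lborel. integrable rc.LS (\<lambda>x. h (rc.v t x))" by (rule rc.integrable_vec(1)[OF hi])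
  have eq: "AE t in lborel. (\<integral>x. h (rc.v t x) * ?\<psi> (rc.v t x $ r) (rc.v t x $ i) \<partial>rc.LS) = (\<integral>s. \<bar>\<Gamma> t s\<bar> \<partial>lborel) \<and> integrable lborel (\<lambda>s. \<Gamma> t s)"
    using rc.integrable_vec(1)[OF hpi] slice
  proof eventually_elim
    case (elim t)
    have ir: "i \<noteq> r" using i by simp
    have "(\<integral>x. h (rc.v t x) * ?\<psi> (rc.v t x $ r) (rc.v t x $ i) \<partial>rc.LS) = (\<integral>s. \<integral>x. h (rc.v t (x(i := s))) * ?\<psi> t s \<partial>?L \<partial>lborel)"
      using fub(3)[OF elim(1)] ir by (simp add: rc.v_other)
    also have "\<dots> = (\<integral>s. \<bar>\<Gamma> t s\<bar> \<partial>lborel)"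
      by (intro Bochner_Integration.integral_cong refl) (simp add: \<Gamma>_def[symmetric] sg)
    finally show ?case using fub(2)[OF elim(2)] by (simp add: \<Gamma>_def)
  qed
  have "(\<integral>t. \<integral>s. \<bar>\<Gamma> t s\<bar> \<partial>lborel \<partial>lborel) = 0"
  proof -
    have "(\<integral>t. \<integral>s. \<bar>\<Gamma> t s\<bar> \<partial>lborel \<partial>lborel) = (\<integral>t. \<integral>x. h (rc.v t x) * ?\<psi> (rc.v t x $ r) (rc.v t x $ i) \<partial>rc.LS \<partial>lborel)"
    proof (rule integral_cong_AE)
      show "AE t in lborel. (\<integral>s. \<bar>\<Gamma> t s\<bar> \<partial>lborel) = (\<integral>x. h (rc.v t x) * ?\<psi> (rc.v t x $ r) (rc.v t x $ i) \<partial>rc.LS)"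
        using eq by eventually_elim simp
      show "(\<lambda>t. \<integral>x. h (rc.v t x) * ?\<psi> (rc.v t x $ r) (rc.v t x $ i) \<partial>rc.LS) \<in> borel_measurable lborel"
        using rc.integrable_vec(2)[OF hpi] by (rule borel_measurable_integrable)
    qed measurable
    then show ?thesis using rc.integrable_vec(3)[OF hpi] zero by simp
  qed
  moreover have "integrable lborel (\<lambda>t. \<integral>s. \<bar>\<Gamma> t s\<bar> \<partial>lborel)"
  proof (subst integrable_cong_AE)
    show "AE t in lborel. (\<integral>s. \<bar>\<Gamma> t s\<bar> \<partial>lborel) = (\<integral>x. h (rc.v t x) * ?\<psi> (rc.v t x $ r) (rc.v t x $ i) \<partial>rc.LS)"
      using eq by eventually_elim simp
    show "integrable lborel (\<lambda>t. \<integral>x. h (rc.v t x) * ?\<psi> (rc.v t x $ r) (rc.v t x $ i) \<partial>rc.LS)" by (rule rc.integrable_vec(2)[OF hpi])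
    then show "(\<lambda>t. \<integral>x. h (rc.v t x) * ?\<psi> (rc.v t x $ r) (rc.v t x $ i) \<partial>rc.LS) \<in> borel_measurable lborel" by (rule borel_measurable_integrable)
  qed measurable
  ultimately have "AE t in lborel. (\<integral>s. \<bar>\<Gamma> t s\<bar> \<partial>lborel) = 0"
    using integral_nonneg_eq_0_iff_AE[of lborel "\<lambda>t. \<integral>s. \<bar>\<Gamma> t s\<bar> \<partial>lborel"] by simp
  then show ?thesis
    using eq slice
  proof eventually_elim
    case (elim t)
    have "AE s in lborel. \<bar>\<Gamma> t s\<bar> = 0"
      using elim integral_nonneg_eq_0_iff_AE[of lborel "\<lambda>s. \<bar>\<Gamma> t s\<bar>"] by simp
    then show ?case using fub(1)[OF elim(3)] by eventually_elim (simp add: \<Gamma>_def h_def)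
  qed
qed

end

section \<open>Products of densities, conditional variances and averaged first-order
  conditions\<close>

lemma (in product_sigma_finite) AE_insert_rev:
  assumes I: "finite I" "i \<notin> I" and ae: "AE z in Pi\<^sub>M (insert i I) M. P z"
  shows "AE x in Pi\<^sub>M I M. AE y in M i. P (x(i := y))"
proof -
  interpret R: pair_sigma_finite "Pi\<^sub>M I M" "M i"
    by (simp add: I(1) pair_sigma_finite.intro sigma_finite sigma_finite_measures)
  interpret pair_sigma_finite "M i" "Pi\<^sub>M I M"
    by (simp add: I(1) pair_sigma_finite.intro sigma_finite sigma_finite_measures)
  have "AE z in distr (M i \<Otimes>\<^sub>M Pi\<^sub>M I M) (Pi\<^sub>M (insert i I) M) (\<lambda>(y, x). x(i := y)). P z"
    using ae by (simp only: distr_insert[OF I])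
  then have "AE z in M i \<Otimes>\<^sub>M Pi\<^sub>M I M. P ((\<lambda>(y, x). x(i := y)) z)"
    by (rule AE_distrD[OF measurable_insert_upd[OF I(2)]])
  then have "AE z in distr (Pi\<^sub>M I M \<Otimes>\<^sub>M M i) (M i \<Otimes>\<^sub>M Pi\<^sub>M I M) (\<lambda>(x, y). (y, x)). P ((\<lambda>(y, x). x(i := y)) z)"
    by (simp only: distr_pair_swap[symmetric])
  then have "AE z in Pi\<^sub>M I M \<Otimes>\<^sub>M M i. P ((\<lambda>(y, x). x(i := y)) ((\<lambda>(x, y). (y, x)) z))"
    by (rule AE_distrD[OF measurable_pair_swap'])
  then show ?thesis by (auto dest: R.AE_pair)
qed

lemma PiM_density_lborel:
  fixes f :: "'i \<Rightarrow> real \<Rightarrow> real"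
  assumes fin: "finite I" and m[measurable]: "\<And>j. f j \<in> borel_measurable borel" and f0: "\<And>j s. 0 \<le> f j s"
    and prob: "\<And>j. prob_space (density lborel (\<lambda>s. ennreal (f j s)))"
  shows "Pi\<^sub>M I (\<lambda>j. density lborel (\<lambda>s. ennreal (f j s))) = density (Pi\<^sub>M I (\<lambda>_. lborel)) (\<lambda>x. ennreal (\<Prod>j\<in>I. f j (x j)))"
proof -
  interpret N: product_sigma_finite "\<lambda>j. density lborel (\<lambda>s. ennreal (f j s))"
    by (simp add: product_sigma_finite_def prob prob_space_imp_sigma_finite)
  interpret L: product_sigma_finite "\<lambda>_::'i. lborel :: real measure" by standard
  show ?thesis
  proof (rule N.PiM_eqI[OF fin, symmetric])
    show "sets (density (Pi\<^sub>M I (\<lambda>_. lborel)) (\<lambda>x. ennreal (\<Prod>j\<in>I. f j (x j)))) = sets (Pi\<^sub>M I (\<lambda>j. density lborel (\<lambda>s. ennreal (f j s))))"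
      by (simp, rule sets_PiM_cong) auto
    fix A :: "'i \<Rightarrow> real set" assume "\<And>i. i \<in> I \<Longrightarrow> A i \<in> sets (density lborel (\<lambda>s. ennreal (f i s)))"
    then have A: "A i \<in> sets borel" if "i \<in> I" for i using that by simp
    have fm: "(\<lambda>x. ennreal (\<Prod>j\<in>I. f j (x j))) \<in> borel_measurable (Pi\<^sub>M I (\<lambda>_. lborel))" by measurable
    have "emeasure (density (Pi\<^sub>M I (\<lambda>_. lborel)) (\<lambda>x. ennreal (\<Prod>j\<in>I. f j (x j)))) (Pi\<^sub>E I A)
       = (\<integral>\<^sup>+x. ennreal (\<Prod>j\<in>I. f j (x j)) * indicator (Pi\<^sub>E I A) x \<partial>Pi\<^sub>M I (\<lambda>_. lborel))"
      by (rule emeasure_density[OF fm]) (use fin A in auto)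
    also have "\<dots> = (\<integral>\<^sup>+x. (\<Prod>j\<in>I. ennreal (f j (x j)) * indicator (A j) (x j)) \<partial>Pi\<^sub>M I (\<lambda>_. lborel))"
    proof (rule nn_integral_cong)
      fix x assume x: "x \<in> space (Pi\<^sub>M I (\<lambda>_. lborel :: real measure))"
      have "indicator (Pi\<^sub>E I A) x = (\<Prod>j\<in>I. indicator (A j) (x j) :: ennreal)"
      proof (cases "\<forall>j\<in>I. x j \<in> A j")
        case True then show ?thesis using x by (auto simp: space_PiM PiE_def)
      next
        case False
        then obtain j where j: "j \<in> I" "x j \<notin> A j" by blast
        then have "(\<Prod>j\<in>I. indicator (A j) (x j) :: ennreal) = 0" using fin by (intro prod_zero bexI[of _ j]) auto
        moreover have "x \<notin> Pi\<^sub>E I A" using j by auto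
        ultimately show ?thesis by simp
      qed
      then show "ennreal (\<Prod>j\<in>I. f j (x j)) * indicator (Pi\<^sub>E I A) x = (\<Prod>j\<in>I. ennreal (f j (x j)) * indicator (A j) (x j))"
        using f0 by (simp add: prod.distrib prod_ennreal)
    qed
    also have "\<dots> = (\<Prod>j\<in>I. \<integral>\<^sup>+s. ennreal (f j s) * indicator (A j) s \<partial>lborel)"
      by (rule L.product_nn_integral_prod[OF fin]) (use A in auto)
    also have "\<dots> = (\<Prod>j\<in>I. emeasure (density lborel (\<lambda>s. ennreal (f j s))) (A j))"
      by (intro prod.cong refl emeasure_density[symmetric]) (use A in auto)
    finally show "emeasure (density (Pi\<^sub>M I (\<lambda>_. lborel)) (\<lambda>x. ennreal (\<Prod>j\<in>I. f j (x j)))) (Pi\<^sub>E I A) =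
      (\<Prod>j\<in>I. emeasure (density lborel (\<lambda>s. ennreal (f j s))) (A j))" .
  qed
qed

text \<open>If the double integral is finite, a single section shows that f^2 is integrable, and
  expanding the square gives equality.\<close>

lemma (in prob_space) variance_le_double:
  fixes f :: "'a \<Rightarrow> real"
  assumes f: "integrable M f"
  shows "2 * (\<integral>\<^sup>+x. ennreal ((f x - expectation f)\<^sup>2) \<partial>M) \<le> (\<integral>\<^sup>+x. \<integral>\<^sup>+y. ennreal ((f x - f y)\<^sup>2) \<partial>M \<partial>M)"
proof (cases "(\<integral>\<^sup>+x. \<integral>\<^sup>+y. ennreal ((f x - f y)\<^sup>2) \<partial>M \<partial>M) = \<infinity>")
  case False
  have fm[measurable]: "f \<in> borel_measurable M" using f by auto
  have "AE x in M. (\<integral>\<^sup>+y. ennreal ((f x - f y)\<^sup>2) \<partial>M) \<noteq> \<infinity>"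
    by (rule nn_integral_PInf_AE) (use False in auto)
  then obtain x0 where x0: "(\<integral>\<^sup>+y. ennreal ((f x0 - f y)\<^sup>2) \<partial>M) \<noteq> \<infinity>"
    using eventually_happens[of _ "ae_filter M"] ae_filter_bot by blast
  have "integrable M (\<lambda>y. (f x0 - f y)\<^sup>2)" using x0 by (intro integrableI_nonneg) (auto simp: less_top)
  then have "integrable M (\<lambda>y. (f x0 - f y)\<^sup>2 + 2 * f x0 * f y - (f x0)\<^sup>2)" using f by auto
  then have f2: "integrable M (\<lambda>y. (f y)\<^sup>2)" by (simp add: power2_eq_square algebra_simps)
  define m where "m = expectation f"
  define s where "s = expectation (\<lambda>y. (f y)\<^sup>2)"
  have inner: "(\<integral>\<^sup>+y. ennreal ((c - f y)\<^sup>2) \<partial>M) = ennreal (c\<^sup>2 - 2 * c * m + s)" and pos: "0 \<le> c\<^sup>2 - 2 * c * m + s" for c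
  proof -
    have e: "(c - f y)\<^sup>2 = c\<^sup>2 - 2 * c * f y + (f y)\<^sup>2" for y by (simp add: power2_eq_square algebra_simps)
    have i: "integrable M (\<lambda>y. (c - f y)\<^sup>2)" unfolding e using f f2 by auto
    have v: "(\<integral>y. (c - f y)\<^sup>2 \<partial>M) = c\<^sup>2 - 2 * c * m + s"
      unfolding e using f f2 by (simp add: m_def s_def prob_space)
    show "(\<integral>\<^sup>+y. ennreal ((c - f y)\<^sup>2) \<partial>M) = ennreal (c\<^sup>2 - 2 * c * m + s)"
      using nn_integral_eq_integral[OF i] v by simp
    have "0 \<le> (\<integral>y. (c - f y)\<^sup>2 \<partial>M)" by simp
    then show "0 \<le> c\<^sup>2 - 2 * c * m + s" using v by simp
  qed
  have "(\<integral>\<^sup>+x. \<integral>\<^sup>+y. ennreal ((f x - f y)\<^sup>2) \<partial>M \<partial>M) = (\<integral>\<^sup>+x. ennreal ((f x)\<^sup>2 - 2 * f x * m + s) \<partial>M)"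
    by (simp only: inner)
  also have "\<dots> = ennreal (\<integral>x. (f x)\<^sup>2 - 2 * f x * m + s \<partial>M)"
    using f f2 pos by (intro nn_integral_eq_integral) auto
  also have "(\<integral>x. (f x)\<^sup>2 - 2 * f x * m + s \<partial>M) = 2 * (m\<^sup>2 - 2 * m * m + s)"
    using f f2 by (simp add: m_def s_def prob_space power2_eq_square)
  also have "ennreal \<dots> = 2 * ennreal (m\<^sup>2 - 2 * m * m + s)"
    using ennreal_mult[of 2 "m\<^sup>2 - 2 * m * m + s"] pos[of m] by simp
  also have "ennreal (m\<^sup>2 - 2 * m * m + s) = (\<integral>\<^sup>+x. ennreal ((f x - m)\<^sup>2) \<partial>M)"
    unfolding inner[of m, symmetric] by (simp add: power2_commute)
  finally show ?thesis by (simp add: m_def)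
qed simp

context mean_field
begin

text \<open>For fixed x_i = s, \<open>b i s\<close> is the mean of \<open>D i\<close> over the other
  coordinates, so the left side is an averaged conditional variance. Tensorization and the
  one-dimensional Poincare inequality bound it by derivatives in the other coordinates; coordinate i
  is frozen, which is why only off-diagonal derivatives appear.\<close>

lemma fisher_le:
  fixes K :: "'i \<Rightarrow> ('i \<Rightarrow> real) \<Rightarrow> real"
  assumes i: "i \<in> S"
    and K[measurable]: "\<And>k. k \<in> S - {i} \<Longrightarrow> K k \<in> borel_measurable (Pi\<^sub>M S (\<lambda>_. borel))"
    and dK: "\<And>k x s. k \<in> S - {i} \<Longrightarrow> x \<in> space (Pi\<^sub>M S (\<lambda>_. borel)) \<Longrightarrow>
       ((\<lambda>s. D i (x(k := s))) has_real_derivative K k (x(k := s))) (at s)"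
    and cK: "\<And>k x. k \<in> S - {i} \<Longrightarrow> x \<in> space (Pi\<^sub>M S (\<lambda>_. borel)) \<Longrightarrow> continuous_on UNIV (\<lambda>s. K k (x(k := s)))"
  shows "(\<integral>\<^sup>+x. ennreal ((D i x - b i (x i))\<^sup>2) \<partial>Pi\<^sub>M S N) \<le> (\<Sum>k\<in>S - {i}. \<integral>\<^sup>+x. ennreal (1 / l * (K k x)\<^sup>2) \<partial>Pi\<^sub>M S N)"
proof -
  let ?P = "Pi\<^sub>M (S - {i}) N"
  interpret P: prob_space ?P by (rule prob_PiM)
  interpret Ui: strongly_convex_potential "\<lambda>s. - ln (f i s)" "b i" l by (rule potential[OF i])
  have [measurable]: "b i \<in> borel_measurable borel" by (rule Ui.U'_meas)
  have iS: "insert i (S - {i}) = S" "finite (S - {i})" "i \<notin> S - {i}" using i fin by auto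
  have step: "(\<integral>\<^sup>+x. ennreal ((D i (x(i := s)) - b i s)\<^sup>2) \<partial>?P) \<le> (\<Sum>k\<in>S - {i}. \<integral>\<^sup>+x. ennreal (1 / l * (K k (x(i := s)))\<^sup>2) \<partial>?P)" for s
  proof -
    have Dm: "(\<lambda>x. D i (x(i := s))) \<in> borel_measurable ?P" using i by measurable
    have Km: "(\<lambda>x. K k (x(i := s))) \<in> borel_measurable ?P" if "k \<in> S - {i}" for k
      using measurable_compose[OF upd_meas[OF i] K[OF that]] .
    have "2 * (\<integral>\<^sup>+x. ennreal ((D i (x(i := s)) - b i s)\<^sup>2) \<partial>?P) \<le> (\<integral>\<^sup>+x. \<integral>\<^sup>+y. ennreal ((D i (x(i := s)) - D i (y(i := s)))\<^sup>2) \<partial>?P \<partial>?P)"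
      using P.variance_le_double[OF D_slice_integrable[OF i, of s]] by (simp add: b_def)
    also have "\<dots> \<le> (\<Sum>k\<in>S - {i}. \<integral>\<^sup>+x. ennreal (2 / l * (K k (x(i := s)))\<^sup>2) \<partial>?P)"
    proof (rule N.double_square_tensor[OF iS(2) Dm])
      show "(\<lambda>x. ennreal (2 / l * (K k (x(i := s)))\<^sup>2)) \<in> borel_measurable ?P" if "k \<in> S - {i}" for k
        using Km[OF that] by measurable
      fix k x assume k: "k \<in> S - {i}" and x: "x \<in> space ?P"
      interpret U: strongly_convex_potential "\<lambda>s. - ln (f k s)" "b k" l by (rule potential) (use k in auto)
      have fe: "exp (- (- ln (f k s))) = f k s" for s using f_pos[of k s] k by simp
      have ki: "k \<noteq> i" using k by auto
      have xs: "x(i := s) \<in> space (Pi\<^sub>M S (\<lambda>_. borel))" by (rule upd_space[OF i x])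
      note tw = fun_upd_twist[OF ki]
      show "(\<integral>\<^sup>+ t. \<integral>\<^sup>+ t'. ennreal ((D i (x(k := t, i := s)) - D i (x(k := t', i := s)))\<^sup>2) \<partial>N k \<partial>N k)
         \<le> (\<integral>\<^sup>+ t. ennreal (2 / l * (K k (x(k := t, i := s)))\<^sup>2) \<partial>N k)"
        unfolding tw using U.poincare[OF dK[OF k xs] cK[OF k xs]] unfolding fe .
    qed
    also have "\<dots> = 2 * (\<Sum>k\<in>S - {i}. \<integral>\<^sup>+x. ennreal (1 / l * (K k (x(i := s)))\<^sup>2) \<partial>?P)"
      unfolding sum_distrib_left
    proof (rule sum.cong[OF refl])
      fix k assume k: "k \<in> S - {i}"
      have "(\<integral>\<^sup>+x. ennreal (2 / l * (K k (x(i := s)))\<^sup>2) \<partial>?P) = (\<integral>\<^sup>+x. 2 * ennreal (1 / l * (K k (x(i := s)))\<^sup>2) \<partial>?P)"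
      proof (rule nn_integral_cong)
        fix x
        have "2 * ennreal a = ennreal (2 * a)" if "0 \<le> a" for a using that by (simp add: ennreal_mult)
        from this[of "1 / l * (K k (x(i := s)))\<^sup>2"] show "ennreal (2 / l * (K k (x(i := s)))\<^sup>2) = 2 * ennreal (1 / l * (K k (x(i := s)))\<^sup>2)"
          using l by simp
      qed
      also have "\<dots> = 2 * (\<integral>\<^sup>+x. ennreal (1 / l * (K k (x(i := s)))\<^sup>2) \<partial>?P)"
        by (rule nn_integral_cmult) (use Km[OF k] in measurable)
      finally show "(\<integral>\<^sup>+x. ennreal (2 / l * (K k (x(i := s)))\<^sup>2) \<partial>?P) = \<dots>" .
    qed
    finally show ?thesis by (subst (asm) ennreal_mult_le_mult_iff) auto
  qed
  have split: "(\<integral>\<^sup>+x. F x \<partial>Pi\<^sub>M S N) = (\<integral>\<^sup>+s. \<integral>\<^sup>+x. F (x(i := s)) \<partial>?P \<partial>N i)" if "F \<in> borel_measurable (Pi\<^sub>M S N)" for F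
    using N.product_nn_integral_insert_rev[OF iS(2,3), of F] that unfolding iS(1) by simp
  have "(\<integral>\<^sup>+x. ennreal ((D i x - b i (x i))\<^sup>2) \<partial>Pi\<^sub>M S N) = (\<integral>\<^sup>+s. \<integral>\<^sup>+x. ennreal ((D i (x(i := s)) - b i s)\<^sup>2) \<partial>?P \<partial>N i)"
  proof -
    have Fm: "(\<lambda>x. ennreal ((D i x - b i (x i))\<^sup>2)) \<in> borel_measurable (Pi\<^sub>M S N)" using i by measurable
    show ?thesis unfolding split[OF Fm] by simp
  qed
  also have "\<dots> \<le> (\<integral>\<^sup>+s. (\<Sum>k\<in>S - {i}. \<integral>\<^sup>+x. ennreal (1 / l * (K k (x(i := s)))\<^sup>2) \<partial>?P) \<partial>N i)"
    by (rule nn_integral_mono) (rule step)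
  also have "\<dots> = (\<Sum>k\<in>S - {i}. \<integral>\<^sup>+s. \<integral>\<^sup>+x. ennreal (1 / l * (K k (x(i := s)))\<^sup>2) \<partial>?P \<partial>N i)"
  proof (rule nn_integral_sum)
    fix k assume k: "k \<in> S - {i}"
    have "(\<lambda>w. (snd w)(i := fst w)) \<in> measurable (N i \<Otimes>\<^sub>M ?P) (Pi\<^sub>M (insert i (S - {i})) (\<lambda>_. borel))"
      by (rule measurable_fun_upd[of _ "S - {i}"]) auto
    then have "(\<lambda>w. K k ((snd w)(i := fst w))) \<in> borel_measurable (N i \<Otimes>\<^sub>M ?P)"
      unfolding iS(1) by (rule measurable_compose[OF _ K[OF k]])
    then show "(\<lambda>s. \<integral>\<^sup>+x. ennreal (1 / l * (K k (x(i := s)))\<^sup>2) \<partial>?P) \<in> borel_measurable (N i)"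
      by (intro P.borel_measurable_nn_integral) (simp add: case_prod_beta')
  qed
  also have "\<dots> = (\<Sum>k\<in>S - {i}. \<integral>\<^sup>+x. ennreal (1 / l * (K k x)\<^sup>2) \<partial>Pi\<^sub>M S N)"
    by (intro sum.cong refl split[symmetric]) measurable
  finally show ?thesis .
qed

text \<open>The first-order condition at x_i = s is averaged over s, which is legitimate now that
  f_i is known to be positive everywhere and all summands are integrable.\<close>

lemma mean_energy:
  assumes i: "i \<in> S"
  shows "integrable (Pi\<^sub>M S N) (\<lambda>x. (\<Sum>j\<in>S. ln (f j (x j))) + W x)"
    and "(\<integral>x. (\<Sum>j\<in>S. ln (f j (x j))) + W x \<partial>Pi\<^sub>M S N) = c i"
proof -
  have iS: "insert i (S - {i}) = S" "finite (S - {i})" "i \<notin> S - {i}" using i fin by auto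
  let ?F = "\<lambda>x. (\<Sum>j\<in>S. ln (f j (x j))) + W x"
  show I: "integrable (Pi\<^sub>M S N) ?F"
    by (intro Bochner_Integration.integrable_add Bochner_Integration.integrable_sum ln_integrable W_integrable)
  have F: "?F (x(i := s)) = (\<Sum>j\<in>S - {i}. ln (f j (x j))) + ln (f i s) + W (x(i := s))" for x s
    using i fin by (subst sum.remove[of S i]) (auto intro!: sum.cong)
  have "(\<integral>x. ?F x \<partial>Pi\<^sub>M S N) = (\<integral>s. \<integral>x. ?F (x(i := s)) \<partial>Pi\<^sub>M (S - {i}) N \<partial>N i)"
    using N.integrable_insert(3)[OF iS(2,3), of ?F] I unfolding iS(1) by simp
  also have "\<dots> = (\<integral>s. c i \<partial>N i)"
  proof (rule integral_cong_AE)
    show "(\<lambda>s. \<integral>x. ?F (x(i := s)) \<partial>Pi\<^sub>M (S - {i}) N) \<in> borel_measurable (N i)"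
      using N.integrable_insert(2)[OF iS(2,3), of ?F] I unfolding iS(1) by (auto dest: borel_measurable_integrable)
    have "AE s in lborel. (\<integral>x. ?F (x(i := s)) \<partial>Pi\<^sub>M (S - {i}) N) = c i"
      using opt[OF i] by eventually_elim (simp only: F f_pos[OF i] simp_thms)
    then show "AE s in N i. (\<integral>x. ?F (x(i := s)) \<partial>Pi\<^sub>M (S - {i}) N) = c i"
      by (subst AE_density) (auto elim: eventually_mono)
  qed simp
  also have "\<dots> = c i" using prob_space.prob_space[OF prob, of i] by simp
  finally show "(\<integral>x. ?F x \<partial>Pi\<^sub>M S N) = c i" .
qed

end

lemma AE_shift:
  fixes h :: real
  assumes "AE t in lborel. P t" shows "AE t in lborel. P (t + h)"
proof -
  have "AE t in distr lborel borel ((+) h). P t" using assms by (simp only: lborel_distr_plus)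
  then have "AE t in lborel. P (h + t)" by (rule AE_distrD[rotated]) simp
  then show ?thesis by (simp add: add.commute)
qed

lemma density_mean_eq:
  fixes h c E :: "'a \<Rightarrow> real"
  assumes hm: "h \<in> borel_measurable M" and cm: "c \<in> borel_measurable M" and Em: "E \<in> borel_measurable M"
    and c0: "\<And>x. 0 \<le> c x" and pr: "prob_space (density M (\<lambda>x. ennreal (c x)))" and K: "K \<noteq> 0"
    and h: "AE x in M. h x = K * (c x * (E x - a))" "integrable M h" "(\<integral>x. h x \<partial>M) = 0"
  shows "integrable (density M (\<lambda>x. ennreal (c x))) E" "(\<integral>x. E x \<partial>density M (\<lambda>x. ennreal (c x))) = a"
proof -
  have m: "(\<lambda>x. K * (c x * (E x - a))) \<in> borel_measurable M" using cm Em by measurable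
  have "integrable M (\<lambda>x. K * (c x * (E x - a)))" using integrable_cong_AE[OF hm m h(1)] h(2) by simp
  then have I1: "integrable M (\<lambda>x. c x * (E x - a))" using K by simp
  have "(\<integral>x. K * (c x * (E x - a)) \<partial>M) = 0" using integral_cong_AE[OF hm m h(1)] h(3) by simp
  then have I2: "(\<integral>x. c x * (E x - a) \<partial>M) = 0" using K by simp
  interpret prob_space "density M (\<lambda>x. ennreal (c x))" by (rule pr)
  have EE: "(\<lambda>x. E x - a) \<in> borel_measurable M" using Em by measurable
  have J1: "integrable (density M (\<lambda>x. ennreal (c x))) (\<lambda>x. E x - a)"
    using I1 by (subst integrable_density[OF EE cm]) (simp_all add: c0)
  have J2: "(\<integral>x. E x - a \<partial>density M (\<lambda>x. ennreal (c x))) = 0"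
    using I2 by (subst integral_density[OF EE cm]) (simp_all add: c0)
  show K1: "integrable (density M (\<lambda>x. ennreal (c x))) E"
    using Bochner_Integration.integrable_add[OF J1 integrable_const[of a]] by simp
  have "(\<integral>x. E x - a \<partial>density M (\<lambda>x. ennreal (c x))) = (\<integral>x. E x \<partial>density M (\<lambda>x. ennreal (c x))) - a"
    by (subst Bochner_Integration.integral_diff[OF K1 integrable_const]) (use prob_space in simp)
  then show "(\<integral>x. E x \<partial>density M (\<lambda>x. ennreal (c x))) = a" using J2 by simp
qed

section \<open>The mean field problem on almost every slice\<close>

locale regular_minimizer = factored_minimizer V G H r lV lV' LV' p p1 q
  for V :: "real ^ 'n \<Rightarrow> real" and G H r lV lV' LV' p p1 q +
  assumes growth: "\<forall>c2>0. \<exists>c1>0. \<forall>z. \<bar>V z\<bar> \<le> c1 * exp (c2 * (norm z)\<^sup>2)"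
    and S_ne: "UNIV - {r} \<noteq> {}"
begin

abbreviation "LS \<equiv> rc.LS"
abbreviation "v \<equiv> rc.v"

lemma q_prob: "prob_space (density lborel (\<lambda>s. ennreal (q j t s)))"
  by (rule prob_spaceI) (simp add: emeasure_density q1)

definition Nq where "Nq t = Pi\<^sub>M S (\<lambda>j. density lborel (\<lambda>s. ennreal (q j t s)))"
definition w where "w t x = (\<Prod>j\<in>S. q j t (x j))"

lemma w_nonneg: "0 \<le> w t x" unfolding w_def by (intro prod_nonneg ballI q_nonneg)

lemma Nq_prob: "prob_space (Nq t)" unfolding Nq_def by (intro prob_space_PiM q_prob)

lemma Nq_density: "Nq t = density LS (\<lambda>x. ennreal (w t x))"
  unfolding Nq_def w_def by (rule PiM_density_lborel) (auto simp: q_nonneg q_prob)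

lemma sets_Nq[measurable_cong]: "sets (Nq t) = sets (Pi\<^sub>M S (\<lambda>_. borel))"
  unfolding Nq_def by (rule sets_PiM_cong) auto

lemma w_meas[measurable (raw)]:
  assumes [measurable]: "f \<in> borel_measurable M" "e \<in> measurable M (Pi\<^sub>M S (\<lambda>_. borel))"
  shows "(\<lambda>z. w (f z) (e z)) \<in> borel_measurable M"
  unfolding w_def by measurable

lemma Nq_integral:
  fixes F :: "('n \<Rightarrow> real) \<Rightarrow> real"
  assumes [measurable]: "F \<in> borel_measurable (Pi\<^sub>M S (\<lambda>_. borel))"
  shows "integrable (Nq t) F \<longleftrightarrow> integrable LS (\<lambda>x. w t x * F x)"
    and "(\<integral>x. F x \<partial>Nq t) = (\<integral>x. w t x * F x \<partial>LS)"
  unfolding Nq_density by (subst integrable_density integral_density; auto simp: w_nonneg)+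

lemma p_slice: "AE t in lborel. AE x in LS. p (v t x) = p1 t * w t x"
  using rc.AE_vec[OF p_star] by (simp add: rc.star_v w_def)

lemma v_upd: "j \<in> S \<Longrightarrow> v t (x(j := s)) = v t x + (s - x j) *\<^sub>R axis j 1"
  by (auto simp: vec_eq_iff rc.v_def axis_def)

lemma v_shift: "v (t + h) x = v t x + h *\<^sub>R axis r 1"
  by (auto simp: vec_eq_iff rc.v_def axis_def)

lemma norm_v: "(norm (v t x))\<^sup>2 = t\<^sup>2 + (\<Sum>j\<in>S. (x j)\<^sup>2)"
proof -
  have "(norm (v t x))\<^sup>2 = (\<Sum>i\<in>UNIV. (v t x $ i)\<^sup>2)"
    by (simp add: norm_eq_sqrt_inner inner_vec_def power2_eq_square sum_nonneg)
  also have "\<dots> = t\<^sup>2 + (\<Sum>j\<in>S. (x j)\<^sup>2)"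
    unfolding sum_split_r by (auto intro!: sum.cong simp: rc.v_other)
  finally show ?thesis .
qed

text \<open>With all coordinates but j frozen at a point where the other factors do not vanish, p
  along the line is a positive multiple of \<open>q j t\<close> almost everywhere, and the quotient
  is a differentiable version. Such a point exists because the other factors have total mass
  1.\<close>

lemma density_version:
  assumes ps: "AE x in LS. p (v t x) = p1 t * w t x" and t: "0 < p1 t" and j: "j \<in> S"
  shows "\<exists>f. (\<forall>s. 0 \<le> f s) \<and> (\<forall>s. f differentiable (at s)) \<and> (AE s in lborel. f s = q j t s)"
proof -
  let ?Lj = "Pi\<^sub>M (S - {j}) (\<lambda>_. lborel :: real measure)"
  have iS: "insert j (S - {j}) = S" "finite (S - {j})" "j \<notin> S - {j}" using j by auto
  have A: "AE x in ?Lj. AE s in lborel. p (v t (x(j := s))) = p1 t * w t (x(j := s))"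
    using rc.L.AE_insert_rev[OF iS(2,3), of "\<lambda>x. p (v t x) = p1 t * w t x"] ps unfolding iS(1) by simp
  let ?c = "\<lambda>x. \<Prod>i\<in>S - {j}. q i t (x i)"
  have nz: "\<not> (AE x in ?Lj. ?c x = 0)"
  proof
    assume z: "AE x in ?Lj. ?c x = 0"
    have "(\<integral>\<^sup>+x. (\<Prod>i\<in>S - {j}. ennreal (q i t (x i))) \<partial>?Lj) = (\<Prod>i\<in>S - {j}. \<integral>\<^sup>+s. ennreal (q i t s) \<partial>lborel)"
      by (rule rc.L.product_nn_integral_prod) auto
    then have "(\<integral>\<^sup>+x. ennreal (?c x) \<partial>?Lj) = 1" by (simp add: q1 prod_ennreal q_nonneg)
    moreover have "(\<integral>\<^sup>+x. ennreal (?c x) \<partial>?Lj) = 0"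
    proof (rule nn_integral_zero')
      show "AE x in ?Lj. ennreal (?c x) = 0" using z by eventually_elim (simp only: ennreal_0)
    qed
    ultimately show False by simp
  qed
  have "\<exists>x. (AE s in lborel. p (v t (x(j := s))) = p1 t * w t (x(j := s))) \<and> ?c x \<noteq> 0"
  proof (rule ccontr)
    assume n: "\<not> ?thesis"
    have "AE x in ?Lj. ?c x = 0" using A by eventually_elim (use n in blast)
    with nz show False by contradiction
  qed
  then obtain x where x: "AE s in lborel. p (v t (x(j := s))) = p1 t * w t (x(j := s))" "?c x \<noteq> 0" by (elim exE conjE)
  have c0: "0 < ?c x" using x(2) prod_nonneg[of "S - {j}" "\<lambda>i. q i t (x i)"] q_nonneg by (auto simp: order_le_less)
  define f where "f s = p (v t (x(j := s))) / (p1 t * ?c x)" for s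
  have "f s \<ge> 0" for s using p_nonneg c0 t by (simp add: f_def)
  moreover have "f differentiable (at s)" for s
  proof -
    have l: "((\<lambda>s. v t x + (s - x j) *\<^sub>R axis j 1) has_derivative (\<lambda>h. h *\<^sub>R axis j 1)) (at s)"
      by (auto intro!: derivative_eq_intros)
    obtain D where D: "(p has_derivative D) (at (v t x + (s - x j) *\<^sub>R axis j 1))" using p_diff unfolding differentiable_def by blast
    have "((\<lambda>s. p (v t x + (s - x j) *\<^sub>R axis j 1)) has_derivative (\<lambda>h. D (h *\<^sub>R axis j 1))) (at s)"
      by (rule has_derivative_compose[OF l D])
    then have "(\<lambda>s. p (v t (x(j := s)))) differentiable (at s)" unfolding v_upd[OF j] differentiable_def by blast
    then show ?thesis unfolding f_def using mult_pos_pos[OF t c0] by (intro differentiable_divide differentiable_const) (assumption | linarith)+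
  qed
  moreover have "AE s in lborel. f s = q j t s"
    using x(1)
  proof eventually_elim
    case (elim s)
    have w1: "w t (x(j := s)) = q j t s * (\<Prod>i\<in>S - {j}. q i t ((x(j := s)) i))"
      unfolding w_def using j by (subst prod.remove[of S j]) auto
    have w2: "(\<Prod>i\<in>S - {j}. q i t ((x(j := s)) i)) = ?c x" by (intro prod.cong) auto
    have "p1 t * (q j t s * c) / (p1 t * c) = q j t s" if "0 < c" for c using that t by simp
    from this[OF c0] show ?case by (simp only: f_def elim w1 w2)
  qed
  ultimately show ?thesis by (intro exI[of _ f] conjI allI)
qed

text \<open>On almost every slice ln p is ln p1(t) plus the sum of ln f_j, wherever p is positive,
  so the first-order condition becomes the mean field equation with constant C - ln p1(t). The
  densities are altered on null sets to be differentiable. At the root index a Gaussian fills in,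
  because the locale asks for a probability density at every index.\<close>

lemma slice_mean_field:
  "AE t in lborel. 0 < p1 t \<longrightarrow> (\<exists>f. mean_field S (\<lambda>x. V (v t x)) (\<lambda>i x. G (v t x) $ i) f lV (\<lambda>i. C - ln (p1 t))
     \<and> (\<forall>j\<in>S. AE s in lborel. f j s = q j t s) \<and> (\<forall>j. j \<notin> S \<longrightarrow> f j = std_normal_density))"
proof -
  have "AE t in lborel. \<forall>i\<in>S. AE s in lborel.
     integrable (Pi\<^sub>M (S - {i}) (\<lambda>_. lborel)) (\<lambda>x. p (v t (x(i := s))) * (g (v t (x(i := s))) - C)) \<and>
     (\<integral>x. p (v t (x(i := s))) * (g (v t (x(i := s))) - C) \<partial>Pi\<^sub>M (S - {i}) (\<lambda>_. lborel)) = 0"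
    by (rule AE_finite_allI[OF _ first_order]) simp_all
  then show ?thesis
    using p_slice
  proof eventually_elim
    case (elim t)
    note fo = elim(1) and ps = elim(2)
    show ?case
    proof
      assume t: "0 < p1 t"
      have "\<forall>j\<in>S. \<exists>f. (\<forall>s. 0 \<le> f s) \<and> (\<forall>s. f differentiable (at s)) \<and> (AE s in lborel. f s = q j t s)"
        using density_version[OF ps t] by blast
      from bchoice[OF this] obtain f0 where f0': "\<forall>j\<in>S. (\<forall>s. 0 \<le> f0 j s) \<and> (\<forall>s. f0 j differentiable (at s)) \<and> (AE s in lborel. f0 j s = q j t s)"
        by (elim exE)
      have f0: "0 \<le> f0 j s" "f0 j differentiable (at s)" "AE s in lborel. f0 j s = q j t s" if "j \<in> S" for j s
        using bspec[OF f0' that] by (simp_all only: simp_thms)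
      define f where "f j = (if j \<in> S then f0 j else std_normal_density)" for j
      have fq: "AE s in lborel. f j s = q j t s" if "j \<in> S" for j using f0(3)[OF that] that by (simp only: f_def if_True)
      have f_nonneg: "0 \<le> f j s" for j s using f0(1)[of j s] by (cases "j \<in> S") (simp_all only: f_def if_True if_False normal_density_nonneg)
      have f_diff: "f j differentiable (at s)" if "j \<in> S" for j s using f0(2)[OF that] that by (simp only: f_def if_True)
      have f_meas[measurable]: "f j \<in> borel_measurable borel" for j
      proof (cases "j \<in> S")
        case True
        then show ?thesis
          by (intro borel_measurable_continuous_onI continuous_at_imp_continuous_on ballI differentiable_imp_continuous_within f_diff True)
      qed (simp add: f_def)
      have f_prob: "prob_space (density lborel (\<lambda>s. ennreal (f j s)))" for j
      proof (cases "j \<in> S")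
        case True
        have "density lborel (\<lambda>s. ennreal (f j s)) = density lborel (\<lambda>s. ennreal (q j t s))"
          using fq[OF True] by (intro density_cong) (auto elim: eventually_mono)
        then show ?thesis using q_prob by simp
      next
        case False
        then show ?thesis using prob_space_normal_density[of 1 0] by (simp add: f_def)
      qed
      have mf: "mean_field S (\<lambda>x. V (v t x)) (\<lambda>i x. G (v t x) $ i) f lV (\<lambda>i. C - ln (p1 t))"
      proof (rule mean_field.intro)
        show "finite S" by simp
        show "0 < lV" by (rule pos)
        show "(\<lambda>x. V (v t x)) \<in> borel_measurable (Pi\<^sub>M S (\<lambda>_. borel))" by measurable
        show "(\<lambda>x. G (v t x) $ i) \<in> borel_measurable (Pi\<^sub>M S (\<lambda>_. borel))" for i
          by (rule measurable_compose[OF _ G_meas]) measurable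
        show "V (v t x) + G (v t x) $ i * (s - x i) + lV / 2 * (s - x i)\<^sup>2 \<le> V (v t (x(i := s)))" if "i \<in> S" for i x s
          unfolding v_upd[OF that] by (rule coordinate_convex[OF that])
        show "\<exists>b>0. \<forall>x\<in>space (Pi\<^sub>M S (\<lambda>_. borel)). \<bar>V (v t x)\<bar> \<le> b * exp (a * (\<Sum>i\<in>S. (x i)\<^sup>2))" if a: "0 < a" for a
        proof -
          from mp[OF spec[OF growth, of a] a] obtain c1 where c1: "0 < c1" "\<forall>z. \<bar>V z\<bar> \<le> c1 * exp (a * (norm z)\<^sup>2)"
            by (elim exE conjE)
          show ?thesis
          proof (intro exI[of _ "c1 * exp (a * t\<^sup>2)"] conjI ballI)
            show "0 < c1 * exp (a * t\<^sup>2)" using c1(1) by simp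
            show "\<bar>V (v t x)\<bar> \<le> (c1 * exp (a * t\<^sup>2)) * exp (a * (\<Sum>i\<in>S. (x i)\<^sup>2))" for x
              using spec[OF c1(2), of "v t x"] by (simp only: norm_v distrib_left exp_add mult.assoc)
          qed
        qed
        fix i assume i: "i \<in> S"
        let ?Li = "Pi\<^sub>M (S - {i}) (\<lambda>_. lborel :: real measure)"
        have iS: "insert i (S - {i}) = S" "finite (S - {i})" "i \<notin> S - {i}" using i by auto
        have A: "AE s in lborel. AE x in ?Li. p (v t (x(i := s))) = p1 t * w t (x(i := s))"
          using rc.L.AE_insert[OF iS(2,3), of "\<lambda>x. p (v t x) = p1 t * w t x"] ps unfolding iS(1) by simp
        \<comment> \<open>A null set in one coordinate is null in the product, so all versions f_j
          can replace the q_j simultaneously.\<close>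
        have Bq: "AE x in ?Li. \<forall>j\<in>S - {i}. f j (x j) = q j t (x j)"
        proof (rule AE_finite_allI)
          fix j assume j: "j \<in> S - {i}"
          have jS: "insert j (S - {i} - {j}) = S - {i}" "finite (S - {i} - {j})" "j \<notin> S - {i} - {j}" using j by auto
          have jm: "j \<in> S" using j by simp
          obtain X where X: "{s \<in> space lborel. f j s \<noteq> q j t s} \<subseteq> X" "emeasure lborel X = 0" "X \<in> sets lborel"
            by (rule AE_E[OF fq[OF jm]]) (rule that)
          then have X': "X \<in> sets borel" "emeasure lborel X = 0" by simp_all
          have "(\<integral>\<^sup>+x. indicator X (x j) \<partial>?Li) = (\<integral>\<^sup>+x. \<integral>\<^sup>+s. indicator X s \<partial>lborel \<partial>Pi\<^sub>M (S - {i} - {j}) (\<lambda>_. lborel :: real measure))"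
            by (subst jS(1)[symmetric], subst rc.L.product_nn_integral_insert[OF jS(2,3)]) (use X' in simp_all)
          also have "\<dots> = 0" using X' by simp
          finally have "AE x in ?Li. indicator X (x j) = (0::ennreal)"
            by (subst (asm) nn_integral_0_iff_AE) (use X' j in auto)
          then show "AE x in ?Li. f j (x j) = q j t (x j)"
            by eventually_elim (use X(1) in \<open>auto simp: indicator_def split: if_splits\<close>)
        qed simp
        let ?N = "Pi\<^sub>M (S - {i}) (\<lambda>j. density lborel (\<lambda>s. ennreal (f j s)))"
        let ?c = "\<lambda>x. \<Prod>j\<in>S - {i}. f j (x j)"
        have Nd: "?N = density ?Li (\<lambda>x. ennreal (?c x))"
          by (rule PiM_density_lborel) (auto simp: f_nonneg f_prob)
        have c0: "0 \<le> ?c x" for x by (intro prod_nonneg ballI f_nonneg)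
        have cm: "?c \<in> borel_measurable ?Li" by measurable
        show "AE s in lborel. 0 < f i s \<longrightarrow>
           integrable ?N (\<lambda>x. (\<Sum>j\<in>S - {i}. ln (f j (x j))) + ln (f i s) + V (v t (x(i := s)))) \<and>
           (\<integral>x. (\<Sum>j\<in>S - {i}. ln (f j (x j))) + ln (f i s) + V (v t (x(i := s))) \<partial>?N) = C - ln (p1 t)"
          using bspec[OF fo i] A fq[OF i]
        proof eventually_elim
          case (elim s)
          show ?case
          proof
            assume fs: "0 < f i s"
            let ?E = "\<lambda>x. (\<Sum>j\<in>S - {i}. ln (f j (x j))) + ln (f i s) + V (v t (x(i := s)))"
            let ?h = "\<lambda>x. p (v t (x(i := s))) * (g (v t (x(i := s))) - C)"
            have Vm: "(\<lambda>x. V (v t (x(i := s)))) \<in> borel_measurable ?Li"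
              by (rule measurable_compose[OF rc.measurable_v_upd[OF i] V_meas]) measurable
            have Em: "?E \<in> borel_measurable ?Li" using Vm by measurable
            have hE: "AE x in ?Li. ?h x = (p1 t * f i s) * (?c x * (?E x - (C - ln (p1 t))))"
              using elim(2) Bq
            proof eventually_elim
              case (elim x)
              have w1: "w t (x(i := s)) = q i t s * (\<Prod>j\<in>S - {i}. q j t ((x(i := s)) j))"
                unfolding w_def using i by (subst prod.remove[of S i]) auto
              have w2: "(\<Prod>j\<in>S - {i}. q j t ((x(i := s)) j)) = ?c x"
              proof (rule prod.cong[OF refl])
                fix j assume j: "j \<in> S - {i}"
                then have "j \<noteq> i" by simp
                then show "q j t ((x(i := s)) j) = f j (x j)" using bspec[OF elim(2) j] by simp
              qed
              have px: "p (v t (x(i := s))) = (p1 t * f i s) * ?c x"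
                by (simp only: elim(1) w1 w2 \<open>f i s = q i t s\<close> mult.assoc)
              show ?case
              proof (cases "?c x = 0")
                case True then show ?thesis using px by simp
              next
                case False
                then have fj: "0 < f j (x j)" if "j \<in> S - {i}" for j
                proof -
                  have "f j (x j) \<noteq> 0"
                  proof
                    assume "f j (x j) = 0"
                    with that have "?c x = 0" by (intro prod_zero bexI[of _ j]) simp_all
                    with False show False by contradiction
                  qed
                  with f_nonneg[of j "x j"] show ?thesis by linarith
                qed
                have cp: "0 < ?c x" by (rule prod_pos) (rule fj)
                have lc: "ln (?c x) = (\<Sum>j\<in>S - {i}. ln (f j (x j)))"
                  by (rule ln_prod) (simp, drule fj, linarith)
                have "ln (p1 t * f i s * ?c x) = ln (p1 t) + ln (f i s) + ln (?c x)"
                  using t fs cp by (simp only: ln_mult_pos mult_pos_pos)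
                then have gx: "g (v t (x(i := s))) = ln (p1 t) + ln (f i s) + (\<Sum>j\<in>S - {i}. ln (f j (x j))) + V (v t (x(i := s)))"
                  by (simp only: g_def px lc)
                show ?thesis unfolding px gx by (simp only: algebra_simps)
              qed
            qed
            have vm: "(\<lambda>x. v t (x(i := s))) \<in> borel_measurable ?Li"
              by (rule rc.measurable_v_upd[OF i]) measurable
            have mh: "?h \<in> borel_measurable ?Li"
              using measurable_compose[OF vm p_meas] measurable_compose[OF vm g_meas] by measurable
            have k0: "p1 t * f i s \<noteq> 0" using t fs by simp
            have pN: "prob_space (density ?Li (\<lambda>x. ennreal (?c x)))" unfolding Nd[symmetric] by (intro prob_space_PiM f_prob)
            note dm = density_mean_eq[OF mh cm Em c0 pN k0 hE elim(1)[THEN conjunct1] elim(1)[THEN conjunct2]]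
            show "integrable ?N ?E \<and> (\<integral>x. ?E x \<partial>?N) = C - ln (p1 t)" unfolding Nd by (intro conjI dm)
          qed
        qed
      qed (rule f_nonneg f_diff f_meas f_prob | assumption)+
      show "\<exists>f. mean_field S (\<lambda>x. V (v t x)) (\<lambda>i x. G (v t x) $ i) f lV (\<lambda>i. C - ln (p1 t))
         \<and> (\<forall>j\<in>S. AE s in lborel. f j s = q j t s) \<and> (\<forall>j. j \<notin> S \<longrightarrow> f j = std_normal_density)"
        by (intro exI[of _ f] conjI mf ballI fq allI impI) (assumption | simp add: f_def)+
    qed
  qed
qed

end

section \<open>Partition function of a slice\<close>

lemma completed_square:
  fixes k :: real assumes k: "0 < k"
  shows "0 \<le> (b - g)\<^sup>2 / (2 * k) + (g - b) * d + k / 2 * d\<^sup>2"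
proof -
  have "(b - g)\<^sup>2 / (2 * k) + (g - b) * d + k / 2 * d\<^sup>2 = ((g - b) + k * d)\<^sup>2 / (2 * k)"
    using k by (simp add: power2_eq_square field_simps)
  then show ?thesis using k by simp
qed

context regular_minimizer
begin

definition "B t = (\<integral>x. G (v t x) $ r \<partial>Nq t)"
text \<open>What the Poincare inequality yields as a bound for 1 / (2 \<kappa>) times the sum of
  E[(d_i V - b_i)^2 | t]; kept in \<open>ennreal\<close> because it may be infinite.\<close>

definition "e t = (\<Sum>i\<in>S. \<Sum>k\<in>S - {i}. \<integral>\<^sup>+x. ennreal (1 / (2 * \<kappa> * lV) * (H (v t x) $ i $ k)\<^sup>2) \<partial>Nq t)"

lemma H_meas[measurable]: "(\<lambda>z. H z $ i $ j) \<in> borel_measurable borel"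
  by (rule borel_measurable_continuous_onI[OF H_entry_cont])

text \<open>The last claim is the product transport bound for exp(-V(y, .)) against the factors at
  root value t. The tangent plane at (t, x) supplies the score terms up to the mismatch G_j - b_j,
  and completing the square trades this mismatch against the gain \<kappa>/2. The root component of
  the gradient belongs to none of these factors; it stays in \<Xi> and contributes its mean
  B(t).\<close>

lemma slice_bound:
  assumes mf: "mean_field S (\<lambda>x. V (v t x)) (\<lambda>i x. G (v t x) $ i) f lV (\<lambda>i. C - ln (p1 t))"
    and fq: "\<forall>j\<in>S. AE s in lborel. f j s = q j t s" and fS: "\<forall>j. j \<notin> S \<longrightarrow> f j = std_normal_density" and t: "0 < p1 t"
  shows "integrable (Nq t) (\<lambda>x. ln (w t x) + V (v t x))" "(\<integral>x. ln (w t x) + V (v t x) \<partial>Nq t) = C - ln (p1 t)"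
    "integrable (Nq t) (\<lambda>x. G (v t x) $ r)"
    "e t < \<infinity> \<Longrightarrow> (\<integral>\<^sup>+x. ennreal (exp (- V (v y x))) \<partial>LS) \<le> ennreal (p1 t * exp (- C + enn2real (e t) - B t * (y - t)))"
proof -
  interpret M: mean_field S "\<lambda>x. V (v t x)" "\<lambda>i x. G (v t x) $ i" f lV "\<lambda>i. C - ln (p1 t)" by (rule mf)
  have NN: "Nq t = Pi\<^sub>M S M.N"
    unfolding Nq_def
  proof (rule PiM_cong[OF refl])
    fix j assume j: "j \<in> S"
    show "density lborel (\<lambda>s. ennreal (q j t s)) = M.N j"
    proof (rule density_cong)
      show "AE s in lborel. ennreal (q j t s) = ennreal (f j s)" using bspec[OF fq j] by eventually_elim simp
    qed (use M.f_meas in measurable)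
  qed
  interpret Nt: prob_space "Nq t" by (rule Nq_prob)
  have fp: "0 < f j s" for j s
  proof (cases "j \<in> S")
    case True then show ?thesis by (rule M.f_pos)
  next
    case False
    then have "f j = std_normal_density" using fS by simp
    then show ?thesis by (simp add: normal_density_pos)
  qed
  have fm[measurable]: "f j \<in> borel_measurable borel" for j by (rule M.f_meas)
  obtain i0 where i0: "i0 \<in> S" using S_ne by (meson ex_in_conv)
  let ?E = "\<lambda>x. (\<Sum>j\<in>S. ln (f j (x j))) + V (v t x)"
  have E1: "integrable (Nq t) ?E" "(\<integral>x. ?E x \<partial>Nq t) = C - ln (p1 t)"
    unfolding NN by (rule M.mean_energy[OF i0])+
  have Vm: "(\<lambda>x. V (v y x)) \<in> borel_measurable (Pi\<^sub>M S (\<lambda>_. borel))" for y by measurable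
  have wae: "AE x in Nq t. ln (w t x) + V (v t x) = ?E x"
  proof -
    have d: "Nq t = density LS (\<lambda>x. ennreal (\<Prod>j\<in>S. f j (x j)))"
      unfolding NN by (rule PiM_density_lborel[OF M.fin M.f_meas M.f_nonneg M.prob])
    have m1: "(\<lambda>x. ennreal (w t x)) \<in> borel_measurable LS" by measurable
    have m2: "(\<lambda>x. ennreal (\<Prod>j\<in>S. f j (x j))) \<in> borel_measurable LS" by measurable
    have "AE x in LS. ennreal (w t x) = ennreal (\<Prod>j\<in>S. f j (x j))"
      using rc.LS.density_unique_iff[OF m1 m2] Nq_density[of t] d by simp
    then have "AE x in LS. 0 < ennreal (w t x) \<longrightarrow> ln (w t x) + V (v t x) = ?E x"
    proof eventually_elim
      case (elim x)
      have "w t x = (\<Prod>j\<in>S. f j (x j))"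
        using elim w_nonneg[of t x] prod_nonneg[of S "\<lambda>j. f j (x j)"] M.f_nonneg by simp
      moreover have "ln (\<Prod>j\<in>S. f j (x j)) = (\<Sum>j\<in>S. ln (f j (x j)))"
        by (rule ln_prod) (use fp in \<open>simp_all add: less_imp_neq[symmetric]\<close>)
      ultimately show ?case by simp
    qed
    then show ?thesis unfolding Nq_density by (subst AE_density[OF m1])
  qed
  have wm: "(\<lambda>x. ln (w t x) + V (v t x)) \<in> borel_measurable (Nq t)" by measurable
  have Em: "?E \<in> borel_measurable (Nq t)" using E1(1) by (rule borel_measurable_integrable)
  show "integrable (Nq t) (\<lambda>x. ln (w t x) + V (v t x))"
    using integrable_cong_AE[OF wm Em wae] E1(1) by simp
  show "(\<integral>x. ln (w t x) + V (v t x) \<partial>Nq t) = C - ln (p1 t)"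
    using integral_cong_AE[OF wm Em wae] E1(2) by simp
  obtain c where c: "0 \<le> c" "\<And>z. \<bar>G z $ r\<bar> \<le> c * (1 + norm z)" by (rule root_gradient_bound) (rule that)
  show Gr: "integrable (Nq t) (\<lambda>x. G (v t x) $ r)"
    unfolding NN
  proof (rule M.integrable_prod_subgaussian[OF subset_refl, of _ "c * (2 + t\<^sup>2 + 16 / lV)"])
    fix x :: "'n \<Rightarrow> real"
    let ?s = "\<Sum>j\<in>S. (x j)\<^sup>2"
    have s0: "0 \<le> ?s" by (intro sum_nonneg) simp
    have ex: "1 \<le> exp (lV / 16 * ?s)" "lV / 16 * ?s \<le> exp (lV / 16 * ?s)"
      using mult_nonneg_nonneg[OF _ s0, of "lV / 16"] pos(1) exp_ge_add_one_self[of "lV / 16 * ?s"] by linarith+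
    have "16 / lV * (lV / 16 * ?s) \<le> 16 / lV * exp (lV / 16 * ?s)" using pos(1) by (intro mult_left_mono[OF ex(2)]) simp
    then have s1: "?s \<le> 16 / lV * exp (lV / 16 * ?s)" using pos(1) by simp
    have "0 \<le> (norm (v t x) - 1)\<^sup>2" by simp
    then have "2 * norm (v t x) \<le> 1 + (norm (v t x))\<^sup>2" by (simp add: power2_eq_square algebra_simps)
    then have "1 + norm (v t x) \<le> 2 + t\<^sup>2 + ?s" using norm_v[of t x] norm_ge_zero[of "v t x"] by (smt (verit) zero_le_power2)
    also have "\<dots> \<le> (2 + t\<^sup>2) * exp (lV / 16 * ?s) + 16 / lV * exp (lV / 16 * ?s)"
      using s1 mult_left_mono[OF ex(1), of "2 + t\<^sup>2"] by simp
    also have "\<dots> = (2 + t\<^sup>2 + 16 / lV) * exp (lV / 16 * ?s)" by (simp add: distrib_right)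
    finally have "c * (1 + norm (v t x)) \<le> c * ((2 + t\<^sup>2 + 16 / lV) * exp (lV / 16 * ?s))" by (rule mult_left_mono[OF _ c(1)])
    then show "\<bar>G (v t x) $ r\<bar> \<le> c * (2 + t\<^sup>2 + 16 / lV) * exp (lV / 16 * ?s)" using c(2)[of "v t x"] by (simp add: mult.assoc)
  qed measurable
  assume efin: "e t < \<infinity>"
  have bm[measurable]: "M.b j \<in> borel_measurable borel" if "j \<in> S" for j
    by (rule strongly_convex_potential.U'_meas[OF M.potential[OF that]])
  have Gm[measurable]: "(\<lambda>x. G (v t x) $ j) \<in> borel_measurable (Pi\<^sub>M S (\<lambda>_. borel))" for j
    by (rule measurable_compose[OF _ G_meas]) measurable
  have sqm: "(\<lambda>x. (M.b j (x j) - G (v t x) $ j)\<^sup>2) \<in> borel_measurable (Nq t)" if j: "j \<in> S" for j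
  proof -
    have "(\<lambda>x. M.b j (x j)) \<in> borel_measurable (Pi\<^sub>M S (\<lambda>_. borel))"
      by (rule measurable_compose[OF measurable_component_singleton[OF j] bm[OF j]])
    then have "(\<lambda>x. M.b j (x j)) \<in> borel_measurable (Nq t)" using measurable_cong_sets[OF sets_Nq[of t] refl] by simp
    moreover have "(\<lambda>x. G (v t x) $ j) \<in> borel_measurable (Nq t)" using Gm[of j] measurable_cong_sets[OF sets_Nq[of t] refl] by simp
    ultimately show ?thesis by measurable
  qed
  define R where "R x = (\<Sum>j\<in>S. (M.b j (x j) - G (v t x) $ j)\<^sup>2 / (2 * \<kappa>))" for x
  have R0: "0 \<le> R x" for x unfolding R_def using \<kappa>_pos by (intro sum_nonneg) simp
  have Rm: "R \<in> borel_measurable (Nq t)" unfolding R_def[abs_def] by (intro borel_measurable_sum borel_measurable_divide sqm borel_measurable_const)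
  have Rle: "(\<integral>\<^sup>+x. ennreal (R x) \<partial>Nq t) \<le> e t"
  proof -
    have "(\<integral>\<^sup>+x. ennreal (R x) \<partial>Nq t) = (\<integral>\<^sup>+x. (\<Sum>j\<in>S. ennreal (1 / (2 * \<kappa>)) * ennreal ((M.b j (x j) - G (v t x) $ j)\<^sup>2)) \<partial>Nq t)"
    proof (rule nn_integral_cong)
      fix x
      have "ennreal (R x) = (\<Sum>j\<in>S. ennreal ((M.b j (x j) - G (v t x) $ j)\<^sup>2 / (2 * \<kappa>)))"
        unfolding R_def using \<kappa>_pos by (intro sum_ennreal[symmetric]) simp
      also have "\<dots> = (\<Sum>j\<in>S. ennreal (1 / (2 * \<kappa>)) * ennreal ((M.b j (x j) - G (v t x) $ j)\<^sup>2))"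
      proof (rule sum.cong[OF refl])
        fix j show "ennreal ((M.b j (x j) - G (v t x) $ j)\<^sup>2 / (2 * \<kappa>)) = ennreal (1 / (2 * \<kappa>)) * ennreal ((M.b j (x j) - G (v t x) $ j)\<^sup>2)"
          using \<kappa>_pos by (subst ennreal_mult[symmetric]) simp_all
      qed
      finally show "ennreal (R x) = (\<Sum>j\<in>S. ennreal (1 / (2 * \<kappa>)) * ennreal ((M.b j (x j) - G (v t x) $ j)\<^sup>2))" .
    qed
    also have "\<dots> = (\<Sum>j\<in>S. \<integral>\<^sup>+x. ennreal (1 / (2 * \<kappa>)) * ennreal ((M.b j (x j) - G (v t x) $ j)\<^sup>2) \<partial>Nq t)"
    proof (rule nn_integral_sum)
      fix j assume j: "j \<in> S"
      show "(\<lambda>x. ennreal (1 / (2 * \<kappa>)) * ennreal ((M.b j (x j) - G (v t x) $ j)\<^sup>2)) \<in> borel_measurable (Nq t)"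
        using sqm[OF j] by measurable
    qed
    also have "\<dots> \<le> e t"
      unfolding e_def
    proof (rule sum_mono)
      fix j assume j: "j \<in> S"
      have "(\<integral>\<^sup>+x. ennreal (1 / (2 * \<kappa>)) * ennreal ((M.b j (x j) - G (v t x) $ j)\<^sup>2) \<partial>Nq t)
         = ennreal (1 / (2 * \<kappa>)) * (\<integral>\<^sup>+x. ennreal ((M.b j (x j) - G (v t x) $ j)\<^sup>2) \<partial>Nq t)"
        by (rule nn_integral_cmult[OF measurable_compose[OF sqm[OF j] measurable_ennreal]])
      also have "(\<integral>\<^sup>+x. ennreal ((M.b j (x j) - G (v t x) $ j)\<^sup>2) \<partial>Nq t) \<le> (\<Sum>k\<in>S - {j}. \<integral>\<^sup>+x. ennreal (1 / lV * (H (v t x) $ j $ k)\<^sup>2) \<partial>Nq t)"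
        unfolding NN power2_commute[of "M.b j _"]
      proof (rule M.fisher_le[OF j])
        show "(\<lambda>x. H (v t x) $ j $ k) \<in> borel_measurable (Pi\<^sub>M S (\<lambda>_. borel))" for k
          by (rule measurable_compose[OF _ H_meas]) measurable
        fix k x s assume k: "k \<in> S - {j}"
        then have kS: "k \<in> S" by simp
        have e1: "v t (x(k := s')) = (v t x - x k *\<^sub>R axis k 1) + s' *\<^sub>R axis k 1" for s'
          by (simp add: v_upd[OF kS] scaleR_left_diff_distrib)
        show "((\<lambda>s. G (v t (x(k := s))) $ j) has_real_derivative H (v t (x(k := s))) $ j $ k) (at s)"
          unfolding e1 by (rule G_coordinate_deriv)
      next
        fix k x assume k: "k \<in> S - {j}"
        then have kS: "k \<in> S" by simp
        show "continuous_on UNIV (\<lambda>s. H (v t (x(k := s))) $ j $ k)"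
          unfolding v_upd[OF kS] by (rule continuous_on_compose2[OF H_entry_cont[of UNIV]]) (auto intro!: continuous_intros)
      qed
      finally have "(\<integral>\<^sup>+x. ennreal (1 / (2 * \<kappa>)) * ennreal ((M.b j (x j) - G (v t x) $ j)\<^sup>2) \<partial>Nq t)
         \<le> (\<Sum>k\<in>S - {j}. ennreal (1 / (2 * \<kappa>)) * (\<integral>\<^sup>+x. ennreal (1 / lV * (H (v t x) $ j $ k)\<^sup>2) \<partial>Nq t))"
        by (simp only: sum_distrib_left mult_left_mono zero_le)
      also have "\<dots> = (\<Sum>k\<in>S - {j}. \<integral>\<^sup>+x. ennreal (1 / (2 * \<kappa> * lV) * (H (v t x) $ j $ k)\<^sup>2) \<partial>Nq t)"
      proof (rule sum.cong[OF refl])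
        fix k
        have Hm: "(\<lambda>x. ennreal (1 / lV * (H (v t x) $ j $ k)\<^sup>2)) \<in> borel_measurable (Nq t)" by measurable
        have "ennreal (1 / (2 * \<kappa>)) * ennreal (1 / lV * (H (v t x) $ j $ k)\<^sup>2) = ennreal (1 / (2 * \<kappa> * lV) * (H (v t x) $ j $ k)\<^sup>2)" for x
          using \<kappa>_pos pos(1) by (subst ennreal_mult[symmetric]) simp_all
        then show "ennreal (1 / (2 * \<kappa>)) * (\<integral>\<^sup>+x. ennreal (1 / lV * (H (v t x) $ j $ k)\<^sup>2) \<partial>Nq t) = (\<integral>\<^sup>+x. ennreal (1 / (2 * \<kappa> * lV) * (H (v t x) $ j $ k)\<^sup>2) \<partial>Nq t)"
          by (simp only: nn_integral_cmult[OF Hm, symmetric])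
      qed
      finally show "(\<integral>\<^sup>+x. ennreal (1 / (2 * \<kappa>)) * ennreal ((M.b j (x j) - G (v t x) $ j)\<^sup>2) \<partial>Nq t)
         \<le> (\<Sum>k\<in>S - {j}. \<integral>\<^sup>+x. ennreal (1 / (2 * \<kappa> * lV) * (H (v t x) $ j $ k)\<^sup>2) \<partial>Nq t)" .
    qed
    finally show ?thesis .
  qed
  have Ri: "integrable (Nq t) R"
  proof (rule integrableI_nonneg[OF Rm])
    show "AE x in Nq t. 0 \<le> R x" using R0 by simp
    show "(\<integral>\<^sup>+x. ennreal (R x) \<partial>Nq t) < \<infinity>" using Rle efin by (rule le_less_trans)
  qed
  have RI: "(\<integral>x. R x \<partial>Nq t) \<le> enn2real (e t)"
    using integral_eq_nn_integral[OF Rm] R0 enn2real_mono[OF Rle] efin by simp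
  \<comment> \<open>The sum of logarithms in \<open>?E\<close> cancels the product of densities in
    the transport bound and leaves -V(t, x). Entropy and V are kept together because the mean of
    their sum is known exactly, C - ln p1(t).\<close>
  define \<Xi> where "\<Xi> x = - ?E x + R x - G (v t x) $ r * (y - t)" for x
  have \<Xi>i: "integrable (Nq t) \<Xi>" unfolding \<Xi>_def[abs_def]
    by (intro Bochner_Integration.integrable_add Bochner_Integration.integrable_diff Bochner_Integration.integrable_minus E1 Ri integrable_mult_left Gr)
  have m1: "integrable (Nq t) (\<lambda>x. - ?E x)" by (intro Bochner_Integration.integrable_minus E1)
  have m2: "integrable (Nq t) (\<lambda>x. - ?E x + R x)" by (intro Bochner_Integration.integrable_add m1 Ri)
  have m3: "integrable (Nq t) (\<lambda>x. G (v t x) $ r * (y - t))" by (intro integrable_mult_left Gr)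
  have \<Xi>I: "(\<integral>x. \<Xi> x \<partial>Nq t) = - (C - ln (p1 t)) + (\<integral>x. R x \<partial>Nq t) - B t * (y - t)"
    unfolding \<Xi>_def Bochner_Integration.integral_diff[OF m2 m3] Bochner_Integration.integral_add[OF m1 Ri]
      Bochner_Integration.integral_minus E1(2) integral_mult_left_zero B_def by (rule refl)
  have "(\<integral>\<^sup>+x. ennreal (exp (- V (v y x))) \<partial>LS) \<le> ennreal (exp (\<integral>x. \<Xi> x \<partial>Pi\<^sub>M S M.N))"
  proof (rule score_bound_PiM)
    show "score_bound (f j) (M.b j)" if "j \<in> S" for j by (rule M.score_bound_f[OF that])
    show "prob_space (density lborel (\<lambda>s. ennreal (f j s)))" for j by (rule M.prob)
    show "(\<lambda>x. exp (- V (v y x))) \<in> borel_measurable (Pi\<^sub>M S (\<lambda>_. lborel))" by measurable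
    show "integrable (Pi\<^sub>M S M.N) \<Xi>" using \<Xi>i unfolding NN .
    fix x x' :: "'n \<Rightarrow> real"
    have "G (v t x) \<bullet> (v y x' - v t x) = G (v t x) $ r * (y - t) + (\<Sum>j\<in>S. G (v t x) $ j * (x' j - x j))"
      unfolding inner_vec_def sum_split_r by (auto intro!: sum.cong simp: rc.v_other)
    moreover have "(\<Sum>i\<in>S. (v y x' $ i - v t x $ i)\<^sup>2) = (\<Sum>j\<in>S. (x' j - x j)\<^sup>2)"
      by (intro sum.cong) (auto simp: rc.v_other)
    ultimately have tg: "V (v t x) + (G (v t x) $ r * (y - t) + (\<Sum>j\<in>S. G (v t x) $ j * (x' j - x j))) + \<kappa> / 2 * (\<Sum>j\<in>S. (x' j - x j)\<^sup>2) \<le> V (v y x')"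
      using tangent[of "v t x" "v y x'"] by (simp only:)
    have "0 \<le> (\<Sum>j\<in>S. (M.b j (x j) - G (v t x) $ j)\<^sup>2 / (2 * \<kappa>) + (G (v t x) $ j - M.b j (x j)) * (x' j - x j) + \<kappa> / 2 * (x' j - x j)\<^sup>2)"
      by (intro sum_nonneg completed_square \<kappa>_pos)
    also have "\<dots> = R x + (\<Sum>j\<in>S. G (v t x) $ j * (x' j - x j)) - (\<Sum>j\<in>S. M.b j (x j) * (x' j - x j)) + \<kappa> / 2 * (\<Sum>j\<in>S. (x' j - x j)\<^sup>2)"
      unfolding R_def by (simp only: sum.distrib left_diff_distrib sum_subtractf sum_distrib_left)
    finally have "- V (v y x') \<le> (\<Sum>j\<in>S. ln (f j (x j))) + (\<Xi> x - (\<Sum>j\<in>S. M.b j (x j) * (x' j - x j)))"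
      using tg unfolding \<Xi>_def by linarith
    then have "exp (- V (v y x')) \<le> exp (\<Sum>j\<in>S. ln (f j (x j))) * exp (\<Xi> x - (\<Sum>j\<in>S. M.b j (x j) * (x' j - x j)))"
      by (simp only: exp_le_cancel_iff exp_add[symmetric])
    also have "exp (\<Sum>j\<in>S. ln (f j (x j))) = (\<Prod>j\<in>S. f j (x j))" using fp by (simp add: exp_sum)
    finally show "exp (- V (v y x')) \<le> (\<Prod>j\<in>S. f j (x j)) * exp (\<Xi> x - (\<Sum>j\<in>S. M.b j (x j) * (x' j - x j)))" .
  qed (rule fp fm finite exp_gt_zero | simp)+
  also have "\<dots> \<le> ennreal (p1 t * exp (- C + enn2real (e t) - B t * (y - t)))"
  proof (rule ennreal_leI)
    have "exp (\<integral>x. \<Xi> x \<partial>Nq t) \<le> exp (ln (p1 t) + (- C + enn2real (e t) - B t * (y - t)))" using \<Xi>I RI by simp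
    then show "exp (\<integral>x. \<Xi> x \<partial>Pi\<^sub>M S M.N) \<le> p1 t * exp (- C + enn2real (e t) - B t * (y - t))"
      using t unfolding NN exp_add[of "ln (p1 t)"] by simp
  qed
  finally show "(\<integral>\<^sup>+x. ennreal (exp (- V (v y x))) \<partial>LS) \<le> ennreal (p1 t * exp (- C + enn2real (e t) - B t * (y - t)))" .
qed

lemma slice_facts:
  "AE t in lborel. 0 < p1 t \<longrightarrow> integrable (Nq t) (\<lambda>x. ln (w t x) + V (v t x)) \<and> (\<integral>x. ln (w t x) + V (v t x) \<partial>Nq t) = C - ln (p1 t) \<and>
     integrable (Nq t) (\<lambda>x. G (v t x) $ r)"
  using slice_mean_field
proof eventually_elim
  case (elim t)
  show ?case
  proof
    assume t: "0 < p1 t"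
    from mp[OF elim t] obtain f where f: "mean_field S (\<lambda>x. V (v t x)) (\<lambda>i x. G (v t x) $ i) f lV (\<lambda>i. C - ln (p1 t))"
      "\<forall>j\<in>S. AE s in lborel. f j s = q j t s" "\<forall>j. j \<notin> S \<longrightarrow> f j = std_normal_density" by (elim exE conjE)
    show "integrable (Nq t) (\<lambda>x. ln (w t x) + V (v t x)) \<and> (\<integral>x. ln (w t x) + V (v t x) \<partial>Nq t) = C - ln (p1 t) \<and>
     integrable (Nq t) (\<lambda>x. G (v t x) $ r)" by (intro conjI slice_bound(1-3)[OF f t])
  qed
qed

text \<open>The exceptional set of t does not depend on y, since the versions of the factors are
  chosen before y; the transport in the root variable uses all y at once.\<close>

lemma slice_partition:
  "AE t in lborel. 0 < p1 t \<longrightarrow> e t < \<infinity> \<longrightarrow> (\<forall>y. (\<integral>\<^sup>+x. ennreal (exp (- V (v y x))) \<partial>LS) \<le> ennreal (p1 t * exp (- C + enn2real (e t) - B t * (y - t))))"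
  using slice_mean_field
proof eventually_elim
  case (elim t)
  show ?case
  proof (intro impI allI)
    fix y assume t: "0 < p1 t" and et: "e t < \<infinity>"
    from mp[OF elim t] obtain f where f: "mean_field S (\<lambda>x. V (v t x)) (\<lambda>i x. G (v t x) $ i) f lV (\<lambda>i. C - ln (p1 t))"
      "\<forall>j\<in>S. AE s in lborel. f j s = q j t s" "\<forall>j. j \<notin> S \<longrightarrow> f j = std_normal_density" by (elim exE conjE)
    show "(\<integral>\<^sup>+x. ennreal (exp (- V (v y x))) \<partial>LS) \<le> ennreal (p1 t * exp (- C + enn2real (e t) - B t * (y - t)))"
      by (rule slice_bound(4)[OF f t et])
  qed
qed

end

section \<open>The root marginal\<close>

text \<open>Convex duality between n ln n and the exponential. It makes n (ln n + u) + exp(-u)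
  nonnegative, so that energies of competitors can be integrated by Tonelli before they are known to
  be integrable.\<close>

lemma entropy_dual: "0 \<le> n \<Longrightarrow> n - exp (- u) \<le> n * (ln n + (u::real))"
proof (cases "n = 0")
  case False
  assume "0 \<le> n"
  with False have n: "0 < n" by simp
  have "n * exp u - 1 \<le> n * exp u * ln (n * exp u)" using n by (intro mult_ln_ge) simp
  then have "(n * exp u - 1) * exp (- u) \<le> n * exp u * (ln n + u) * exp (- u)"
    using n by (intro mult_right_mono) (simp_all add: ln_mult_pos)
  moreover have e: "exp u * exp (- u) = 1" by (simp flip: exp_add)
  have "(n * exp u - 1) * exp (- u) = n * (exp u * exp (- u)) - exp (- u)" by (simp only: left_diff_distrib mult.assoc mult_1)
  moreover have "n * exp u * (ln n + u) * exp (- u) = n * (ln n + u) * (exp u * exp (- u))" by (simp only: ac_simps)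
  ultimately show ?thesis unfolding e by simp
qed simp

context regular_minimizer
begin

lemma B_meas[measurable]: "B \<in> borel_measurable borel"
proof -
  have e: "B t = (\<integral>x. w t x * G (v t x) $ r \<partial>LS)" for t
    unfolding B_def by (rule Nq_integral(2)) (rule measurable_compose[OF _ G_meas], measurable)
  have "(\<lambda>(t, x). w t x * G (v t x) $ r) \<in> borel_measurable (borel \<Otimes>\<^sub>M LS)" by measurable
  from rc.LS.borel_measurable_lebesgue_integral[OF this] show ?thesis unfolding e[abs_def] .
qed

lemma p1_integrable: "integrable lborel p1" "(\<integral>t. p1 t \<partial>lborel) = 1"
  using p11 p1_nonneg by (auto simp: integral_eq_nn_integral intro!: integrableI_nonneg)

text \<open>The slice at u is copied to the root value u + h with root density a.
  \<open>root_upper\<close> bounds V(u + h, .) by its expansion at u, and a is chosen so that the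
  resulting upper bound F has mean exactly C: the copied slice costs at most C per unit of mass. The
  case h = 0 covers slices left unchanged.\<close>

lemma competitor_slice:
  assumes pu: "0 < p1 u" and a: "ln a = ln (p1 u) - B u * h - LV' / 4 * h\<^sup>2" "0 < a"
    and i: "integrable (Nq u) (\<lambda>x. ln (w u x) + V (v u x))" "(\<integral>x. ln (w u x) + V (v u x) \<partial>Nq u) = C - ln (p1 u)"
      "integrable (Nq u) (\<lambda>x. G (v u x) $ r)"
    and E: "integrable LS (\<lambda>x. exp (- V (v (u + h) x)))"
  shows "(\<integral>\<^sup>+x. ennreal (a * w u x * (ln (a * w u x) + V (v (u + h) x)) + exp (- V (v (u + h) x))) \<partial>LS)
      \<le> ennreal (C * a + (\<integral>x. exp (- V (v (u + h) x)) \<partial>LS))"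
    and "0 \<le> C * a + (\<integral>x. exp (- V (v (u + h) x)) \<partial>LS)"
proof -
  interpret Nu: prob_space "Nq u" by (rule Nq_prob)
  define F where "F x = (ln a + LV' / 4 * h\<^sup>2) + ((ln (w u x) + V (v u x)) + G (v u x) $ r * h)" for x
  have Gh: "integrable (Nq u) (\<lambda>x. G (v u x) $ r * h)" by (intro integrable_mult_left i)
  have i2: "integrable (Nq u) (\<lambda>x. (ln (w u x) + V (v u x)) + G (v u x) $ r * h)" by (rule Bochner_Integration.integrable_add[OF i(1) Gh])
  have Fi: "integrable (Nq u) F" unfolding F_def[abs_def] by (rule Bochner_Integration.integrable_add[OF Nu.integrable_const i2])
  have "(\<integral>x. F x \<partial>Nq u) = (ln a + LV' / 4 * h\<^sup>2) + ((C - ln (p1 u)) + B u * h)"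
    unfolding F_def Bochner_Integration.integral_add[OF Nu.integrable_const i2] Bochner_Integration.integral_add[OF i(1) Gh] i(2) B_def
    using Nu.prob_space by simp
  then have FI: "(\<integral>x. F x \<partial>Nq u) = C" using a by simp
  have Gm: "(\<lambda>x. G (v u x) $ r) \<in> borel_measurable (Pi\<^sub>M S (\<lambda>_. borel))" by (rule measurable_compose[OF _ G_meas]) measurable
  have Fm: "F \<in> borel_measurable (Pi\<^sub>M S (\<lambda>_. borel))" unfolding F_def[abs_def] using Gm by measurable
  have wF: "integrable LS (\<lambda>x. w u x * F x)" "(\<integral>x. w u x * F x \<partial>LS) = C"
    using Nq_integral[OF Fm, of u] Fi FI by simp_all
  let ?r = "\<lambda>x. a * (w u x * F x) + exp (- V (v (u + h) x))"
  have le: "a * w u x * (ln (a * w u x) + V (v (u + h) x)) + exp (- V (v (u + h) x)) \<le> ?r x"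
    and ge: "0 \<le> a * w u x * (ln (a * w u x) + V (v (u + h) x)) + exp (- V (v (u + h) x))" for x
  proof -
    have n0: "0 \<le> a * w u x" using a(2) w_nonneg[of u x] by simp
    from entropy_dual[OF n0, of "V (v (u + h) x)"] n0
    show "0 \<le> a * w u x * (ln (a * w u x) + V (v (u + h) x)) + exp (- V (v (u + h) x))" by linarith
    show "a * w u x * (ln (a * w u x) + V (v (u + h) x)) + exp (- V (v (u + h) x)) \<le> ?r x"
    proof (cases "w u x = 0")
      case False
      then have w0: "0 < w u x" using w_nonneg[of u x] by simp
      have "ln (a * w u x) + V (v (u + h) x) \<le> F x"
        unfolding F_def ln_mult_pos[OF a(2) w0] v_shift using root_upper[of "v u x" h] by linarith
      then have "a * w u x * (ln (a * w u x) + V (v (u + h) x)) \<le> a * w u x * F x" by (rule mult_left_mono[OF _ n0])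
      then show ?thesis by (simp only: mult.assoc add_le_cancel_right)
    qed simp
  qed
  have ri: "integrable LS ?r" by (intro Bochner_Integration.integrable_add integrable_mult_right wF E)
  have rI: "(\<integral>x. ?r x \<partial>LS) = C * a + (\<integral>x. exp (- V (v (u + h) x)) \<partial>LS)"
    using wF E by (simp add: mult.commute)
  have r0: "0 \<le> ?r x" for x using le ge by (rule order_trans[rotated])
  have "(\<integral>\<^sup>+x. ennreal (a * w u x * (ln (a * w u x) + V (v (u + h) x)) + exp (- V (v (u + h) x))) \<partial>LS) \<le> (\<integral>\<^sup>+x. ennreal (?r x) \<partial>LS)"
    by (intro nn_integral_mono ennreal_leI le)
  also have "\<dots> = ennreal (\<integral>x. ?r x \<partial>LS)" by (rule nn_integral_eq_integral[OF ri AE_I2]) (rule r0)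
  finally show "(\<integral>\<^sup>+x. ennreal (a * w u x * (ln (a * w u x) + V (v (u + h) x)) + exp (- V (v (u + h) x))) \<partial>LS)
      \<le> ennreal (C * a + (\<integral>x. exp (- V (v (u + h) x)) \<partial>LS))" unfolding rI .
  show "0 \<le> C * a + (\<integral>x. exp (- V (v (u + h) x)) \<partial>LS)"
    unfolding rI[symmetric] by (rule Bochner_Integration.integral_nonneg) (rule r0)
qed

text \<open>Where the asserted bound fails, the slice is replaced by the copied one with the larger
  root density \<rho>. The competitor has mass c \<ge> 1 and energy at most C c, so minimality
  leaves c ln c \<le> 0; thus c = 1, and the set of failure is null.\<close>

lemma translation: "AE t in lborel. p1 t * exp (- B t * h - LV' / 4 * h\<^sup>2) \<le> p1 (t + h)"
proof -
  define \<rho> where "\<rho> t = p1 (t - h) * exp (- B (t - h) * h - LV' / 4 * h\<^sup>2)" for t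
  have \<rho>m[measurable]: "\<rho> \<in> borel_measurable borel" unfolding \<rho>_def[abs_def] by measurable
  \<comment> \<open>Cutting the bad set off at height n and distance n keeps the root density of the
    competitor integrable; countably many n exhaust the bad set.\<close>
  have n: "AE t in lborel. \<not> (p1 t < \<rho> t \<and> \<rho> t \<le> real n \<and> \<bar>t\<bar> \<le> real n)" for n
  proof -
    define A where "A = {t. p1 t < \<rho> t \<and> \<rho> t \<le> real n \<and> \<bar>t\<bar> \<le> real n}"
    have Am[measurable]: "A \<in> sets borel" unfolding A_def by measurable
    define a where "a t = (if t \<in> A then \<rho> t else p1 t)" for t
    define k where "k j t s = (if t \<in> A then q j (t - h) s else q j t s)" for j t s
    have ap: "p1 t \<le> a t" for t by (auto simp: a_def A_def)
    have a0: "0 \<le> a t" for t using ap[of t] p1_nonneg[of t] by linarith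
    have am[measurable]: "a \<in> borel_measurable borel" unfolding a_def[abs_def] by measurable
    have fk: "rc.factors a k"
      unfolding rc.factors_def
    proof (intro conjI allI am a0)
      show "(\<lambda>w. k j (fst w) (snd w)) \<in> borel_measurable (borel \<Otimes>\<^sub>M borel)" for j unfolding k_def by measurable
      show "0 \<le> k j t s" for j t s by (simp add: k_def q_nonneg)
    qed
    have ai: "integrable lborel a"
    proof (rule Bochner_Integration.integrable_bound)
      show "integrable lborel (\<lambda>t. p1 t + real n * indicator {- real n..real n} t)"
        by (intro Bochner_Integration.integrable_add p1_integrable integrable_mult_right) (simp add: emeasure_lborel_Icc)
      show "AE t in lborel. norm (a t) \<le> norm (p1 t + real n * indicator {- real n..real n} t)"
      proof (rule AE_I2)
        fix t
        have "a t \<le> p1 t + real n * indicator {- real n..real n} t"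
        proof (cases "t \<in> A")
          case True
          then have "t \<in> {- real n..real n}" "\<rho> t \<le> real n" unfolding A_def by auto
          then show ?thesis using True p1_nonneg[of t] by (simp add: a_def)
        qed (simp add: a_def)
        then show "norm (a t) \<le> norm (p1 t + real n * indicator {- real n..real n} t)" using a0[of t] by simp
      qed
    qed measurable
    define c where "c = (\<integral>t. a t \<partial>lborel)"
    have c1: "1 \<le> c" unfolding c_def p1_integrable(2)[symmetric] by (rule integral_mono[OF p1_integrable(1) ai ap])
    then have c0: "0 < c" by simp
    have k1: "(\<integral>\<^sup>+s. ennreal (k j t s) \<partial>lborel) = 1" for j t by (cases "t \<in> A") (simp_all add: k_def q1)
    have mass: "(\<integral>\<^sup>+z. ennreal (rc.star a k z) \<partial>lborel) = ennreal c"
      using rc.star_nn_rect[OF fk, of "\<lambda>_. UNIV"] nn_integral_eq_integral[OF ai AE_I2] a0 by (simp add: k1 c_def)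
    have sm[measurable]: "rc.star a k \<in> borel_measurable borel" by (rule rc.star_meas[OF fk])
    define j where "j z = rc.star a k z * (ln (rc.star a k z) + V z)" for z
    have jm[measurable]: "j \<in> borel_measurable borel" unfolding j_def[abs_def] by measurable
    have j0: "0 \<le> j z + exp (- V z)" for z
      using entropy_dual[OF rc.star_nonneg[OF fk], of z "V z"] rc.star_nonneg[OF fk, of z] unfolding j_def by linarith
    define E where "E t = (\<integral>x. exp (- V (v t x)) \<partial>LS)" for t
    have Ei: "integrable lborel E" "(\<integral>t. E t \<partial>lborel) = Z"
      using rc.integrable_vec(2,3)[OF normalizable] by (simp_all add: E_def[abs_def] Z_def)
    have slice: "AE t in lborel. (\<integral>\<^sup>+x. ennreal (j (v t x) + exp (- V (v t x))) \<partial>LS) \<le> ennreal (C * a t + E t) \<and> 0 \<le> C * a t + E t"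
      using slice_facts AE_shift[OF slice_facts, of "- h"] rc.integrable_vec(1)[OF normalizable]
    proof eventually_elim
      case (elim t)
      show ?case
      proof (cases "a t = 0")
        case True
        then have "j (v t x) = 0" for x by (simp add: j_def rc.star_v)
        moreover have "0 \<le> E t" unfolding E_def by (rule Bochner_Integration.integral_nonneg) simp
        moreover have "(\<integral>\<^sup>+x. ennreal (exp (- V (v t x))) \<partial>LS) = ennreal (E t)"
          unfolding E_def by (rule nn_integral_eq_integral[OF elim(3)]) simp
        ultimately show ?thesis using True by simp
      next
        case False
        then have at: "0 < a t" using a0[of t] by simp
        \<comment> \<open>Treats copied slices (\<epsilon> = h) and unchanged ones (\<epsilon> = 0)
          uniformly, with source t - \<epsilon>.\<close>
        define \<epsilon> where "\<epsilon> = (if t \<in> A then h else 0)"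
        have pu: "0 < p1 (t - \<epsilon>)"
        proof (cases "t \<in> A")
          case True
          then have "p1 (t - h) \<noteq> 0" using at by (auto simp: a_def \<rho>_def)
          then show ?thesis using True p1_nonneg[of "t - h"] by (simp add: \<epsilon>_def)
        next
          case False then show ?thesis using at by (simp add: a_def \<epsilon>_def)
        qed
        have la: "ln (a t) = ln (p1 (t - \<epsilon>)) - B (t - \<epsilon>) * \<epsilon> - LV' / 4 * \<epsilon>\<^sup>2"
          using pu by (auto simp: a_def \<epsilon>_def \<rho>_def ln_mult_pos)
        have sf: "integrable (Nq (t - \<epsilon>)) (\<lambda>x. ln (w (t - \<epsilon>) x) + V (v (t - \<epsilon>) x)) \<and>
          (\<integral>x. ln (w (t - \<epsilon>) x) + V (v (t - \<epsilon>) x) \<partial>Nq (t - \<epsilon>)) = C - ln (p1 (t - \<epsilon>)) \<and> integrable (Nq (t - \<epsilon>)) (\<lambda>x. G (v (t - \<epsilon>) x) $ r)"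
        proof (cases "t \<in> A")
          case True then show ?thesis using mp[OF elim(2)] pu by (simp add: \<epsilon>_def)
        next
          case False then show ?thesis using mp[OF elim(1)] pu by (simp add: \<epsilon>_def)
        qed
        have tt: "t - \<epsilon> + \<epsilon> = t" by simp
        have jj: "j (v t x) = a t * w (t - \<epsilon>) x * (ln (a t * w (t - \<epsilon>) x) + V (v t x))" for x
        proof -
          have "rc.star a k (v t x) = a t * w (t - \<epsilon>) x" unfolding rc.star_v w_def k_def \<epsilon>_def by simp
          then show ?thesis by (simp only: j_def)
        qed
        note cs = competitor_slice[OF pu la at sf[THEN conjunct1] sf[THEN conjunct2, THEN conjunct1] sf[THEN conjunct2, THEN conjunct2], unfolded tt, OF elim(3)]
        show ?thesis unfolding jj E_def by (intro conjI cs)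
      qed
    qed
    have "(\<integral>\<^sup>+z. ennreal (j z + exp (- V z)) \<partial>lborel) = (\<integral>\<^sup>+t. \<integral>\<^sup>+x. ennreal (j (v t x) + exp (- V (v t x))) \<partial>LS \<partial>lborel)"
      by (rule rc.nn_integral_vec) measurable
    also have "\<dots> \<le> (\<integral>\<^sup>+t. ennreal (C * a t + E t) \<partial>lborel)"
      by (rule nn_integral_mono_AE) (use slice in eventually_elim, simp)
    also have "\<dots> = ennreal (\<integral>t. C * a t + E t \<partial>lborel)"
    proof (rule nn_integral_eq_integral)
      show "integrable lborel (\<lambda>t. C * a t + E t)" by (intro Bochner_Integration.integrable_add integrable_mult_right ai Ei)
      show "AE t in lborel. 0 \<le> C * a t + E t" using slice by eventually_elim simp
    qed
    also have "(\<integral>t. C * a t + E t \<partial>lborel) = C * c + Z" using ai Ei by (simp add: c_def)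
    finally have jle: "(\<integral>\<^sup>+z. ennreal (j z + exp (- V z)) \<partial>lborel) \<le> ennreal (C * c + Z)" .
    have jEi: "integrable lborel (\<lambda>z. j z + exp (- V z))"
    proof (rule integrableI_nonneg)
      show "(\<integral>\<^sup>+z. ennreal (j z + exp (- V z)) \<partial>lborel) < \<infinity>" using jle by (rule le_less_trans) simp
    qed (simp_all add: j0)
    have ji: "integrable lborel j" using Bochner_Integration.integrable_diff[OF jEi normalizable] by simp
    have jI: "(\<integral>z. j z + exp (- V z) \<partial>lborel) = (\<integral>z. j z \<partial>lborel) + Z"
      using ji normalizable by (simp add: Z_def)
    have sle: "0 \<le> C * c + Z"
    proof -
      have "0 \<le> (\<integral>t. C * a t + E t \<partial>lborel)" by (rule integral_nonneg_AE) (use slice in eventually_elim, simp)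
      then show ?thesis using ai Ei by (simp add: c_def)
    qed
    have "ennreal (\<integral>z. j z + exp (- V z) \<partial>lborel) \<le> ennreal (C * c + Z)"
      using jle nn_integral_eq_integral[OF jEi AE_I2] j0 by simp
    then have jC: "(\<integral>z. j z \<partial>lborel) \<le> C * c" using sle unfolding jI by simp
    have "C * c \<le> (\<integral>z. j z \<partial>lborel) - c * ln c"
      unfolding j_def by (rule optimality[OF fk c0 mass]) (use ji in \<open>simp add: j_def[abs_def]\<close>)
    then have "c * ln c \<le> 0" using jC by linarith
    then have "ln c \<le> 0" using c0 by (simp add: mult_le_0_iff)
    then have c2: "c = 1" using c1 c0 by simp
    have di: "integrable lborel (\<lambda>t. a t - p1 t)" by (rule Bochner_Integration.integrable_diff[OF ai p1_integrable(1)])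
    have "(\<integral>t. a t - p1 t \<partial>lborel) = 0" using ai p1_integrable c2 by (simp add: c_def)
    moreover have "AE t in lborel. 0 \<le> a t - p1 t" using ap by simp
    ultimately have "AE t in lborel. a t - p1 t = 0" using integral_nonneg_eq_0_iff_AE[OF di] by simp
    then show ?thesis by eventually_elim (auto simp: a_def A_def)
  qed
  have "AE t in lborel. \<forall>n. \<not> (p1 t < \<rho> t \<and> \<rho> t \<le> real n \<and> \<bar>t\<bar> \<le> real n)" unfolding AE_all_countable by (rule allI) (rule n)
  then have "AE t in lborel. \<rho> t \<le> p1 t"
  proof eventually_elim
    case (elim t)
    obtain n where "max (\<rho> t) \<bar>t\<bar> \<le> real n" using real_arch_simple by blast
    with spec[OF elim, of n] show ?case by linarith
  qed
  from AE_shift[OF this, of h] show ?thesis by (simp add: \<rho>_def)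
qed

section \<open>Moments of the minimizer and the score of the root marginal\<close>

lemma gaussian_norm_integrable:
  assumes b: "0 < b" shows "integrable lborel (\<lambda>z::real^'n. exp (- b * (norm z)\<^sup>2))"
proof (rule integrableI_nonneg)
  \<comment> \<open>A Gaussian is a product, hence a star density, and the rectangle formula reduces
    its mass to one-dimensional integrals.\<close>
  define k where "k j t s = exp (- b * s\<^sup>2)" for j :: 'n and t s :: real
  define a where "a t = exp (- b * t\<^sup>2)" for t :: real
  have fk: "rc.factors a k" unfolding rc.factors_def k_def a_def by auto
  have st: "rc.star a k z = exp (- b * (norm z)\<^sup>2)" for z
  proof -
    have "rc.star a k z = exp (- b * (z $ r)\<^sup>2) * exp (\<Sum>j\<in>S. - b * (z $ j)\<^sup>2)"
      by (simp add: rc.star_def a_def k_def exp_sum)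
    also have "\<dots> = exp (\<Sum>j\<in>UNIV. - b * (z $ j)\<^sup>2)" unfolding sum_split_r by (simp only: exp_add)
    also have "(\<Sum>j\<in>UNIV. - b * (z $ j)\<^sup>2) = - b * (norm z)\<^sup>2"
      by (simp add: norm_eq_sqrt_inner inner_vec_def power2_eq_square sum_nonneg sum_distrib_left)
    finally show ?thesis .
  qed
  have f: "(\<integral>\<^sup>+s. ennreal (exp (- b * (s::real)\<^sup>2)) \<partial>lborel) = ennreal (\<integral>s. exp (- b * s\<^sup>2) \<partial>lborel)"
    by (rule nn_integral_eq_integral[OF integrable_gaussian[OF b]]) simp
  have "(\<integral>\<^sup>+z. ennreal (rc.star a k z) \<partial>lborel) = (\<integral>\<^sup>+t. ennreal (a t) * (\<Prod>j\<in>S. \<integral>\<^sup>+s. ennreal (k j t s) \<partial>lborel) \<partial>lborel)"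
    using rc.star_nn_rect[OF fk, of "\<lambda>_. UNIV"] by simp
  also have "\<dots> = (\<integral>\<^sup>+t. ennreal (exp (- b * t\<^sup>2)) * ennreal (\<integral>s. exp (- b * s\<^sup>2) \<partial>lborel) ^ card S \<partial>lborel)"
    unfolding k_def a_def f by simp
  also have "\<dots> = ennreal (\<integral>s. exp (- b * s\<^sup>2) \<partial>lborel) * ennreal (\<integral>s. exp (- b * s\<^sup>2) \<partial>lborel) ^ card S"
    by (subst nn_integral_multc) (simp_all only: f, measurable)
  also have "\<dots> < \<infinity>" by (simp add: ennreal_mult_less_top power_less_top_ennreal)
  finally show "(\<integral>\<^sup>+z. ennreal (exp (- b * (norm (z::real^'n))\<^sup>2)) \<partial>lborel) < \<infinity>" unfolding st .
qed simp_all

text \<open>Half of V is enough to control the entropy: p (ln p + V/2) \<ge> p - exp(-V/2).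
  Subtracting this from p g leaves an upper bound for p V/2, and V/2 dominates |z|^2 by quadratic
  growth; the same growth puts exp(-V/2) below a Gaussian.\<close>

lemma second_moment: "integrable lborel (\<lambda>z. p z * (norm z)\<^sup>2)"
proof -
  obtain m where m: "0 < m" "\<And>x y. V x + G x \<bullet> (y - x) + m / 2 * (norm (y - x))\<^sup>2 \<le> V y"
    by (rule quadratic_growth) (rule that)
  \<comment> \<open>Young's inequality for the linear term |G 0| |z| takes half of the quadratic
    term m/2 |z|^2 and costs |G 0|^2 / m.\<close>
  define a0 where "a0 = V 0 - (norm (G 0))\<^sup>2 / m"
  have low: "a0 + m / 4 * (norm z)\<^sup>2 \<le> V z" for z
  proof -
    have "0 \<le> (norm (G 0) - m / 2 * norm z)\<^sup>2 / m" using m(1) by simp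
    also have "\<dots> = (norm (G 0))\<^sup>2 / m - norm (G 0) * norm z + m / 4 * (norm z)\<^sup>2"
      using m(1) by (simp add: power2_eq_square field_simps)
    finally show ?thesis using m(2)[of 0 z] Cauchy_Schwarz_ineq2[of "G 0" z] by (simp add: a0_def abs_le_iff)
  qed
  let ?D = "\<lambda>z. 8 / m * (\<bar>p z * g z\<bar> + (1 + \<bar>a0\<bar> / 2) * p z + exp (- a0 / 2) * exp (- (m / 8) * (norm z)\<^sup>2))"
  show ?thesis
  proof (rule Bochner_Integration.integrable_bound)
    show "integrable lborel ?D"
      by (intro integrable_mult_right Bochner_Integration.integrable_add integrable_abs pg_integrable p_integrable gaussian_norm_integrable) (use m in simp)
    show "AE z in lborel. norm (p z * (norm z)\<^sup>2) \<le> norm (?D z)"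
    proof (rule AE_I2)
      fix z
      have d: "p z - exp (- (V z / 2)) \<le> p z * (ln (p z) + V z / 2)" by (rule entropy_dual[OF p_nonneg])
      have e1: "p z * (ln (p z) + V z / 2) = p z * g z - p z * (V z / 2)" by (simp add: g_def algebra_simps)
      have e2: "p z * (a0 / 2 + m / 8 * (norm z)\<^sup>2) \<le> p z * (V z / 2)" using low[of z] p_nonneg[of z] by (intro mult_left_mono) auto
      have e3: "exp (- (V z / 2)) \<le> exp (- a0 / 2) * exp (- (m / 8) * (norm z)\<^sup>2)"
        using low[of z] by (simp flip: exp_add)
      have e4: "- (\<bar>a0\<bar> / 2 * p z) \<le> p z * (a0 / 2)"
      proof -
        have "p z * (- \<bar>a0\<bar> / 2) \<le> p z * (a0 / 2)" by (intro mult_left_mono p_nonneg) simp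
        then show ?thesis by (simp add: mult.commute)
      qed
      have "m / 8 * (p z * (norm z)\<^sup>2) \<le> \<bar>p z * g z\<bar> + (1 + \<bar>a0\<bar> / 2) * p z + exp (- a0 / 2) * exp (- (m / 8) * (norm z)\<^sup>2)"
        using d e2 e3 e4 p_nonneg[of z] abs_ge_self[of "p z * g z"] unfolding e1 by (simp add: distrib_left distrib_right mult.left_commute)
      then have "8 / m * (m / 8 * (p z * (norm z)\<^sup>2)) \<le> ?D z" using m(1) by (intro mult_left_mono) auto
      then have "p z * (norm z)\<^sup>2 \<le> ?D z" using m(1) by simp
      then have "p z * (norm z)\<^sup>2 \<le> norm (?D z)" unfolding real_norm_def by (rule order_trans[OF _ abs_ge_self])
      moreover have "norm (p z * (norm z)\<^sup>2) = p z * (norm z)\<^sup>2" using p_nonneg[of z] by simp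
      ultimately show "norm (p z * (norm z)\<^sup>2) \<le> norm (?D z)" by (simp only:)
    qed
  qed measurable
qed

text \<open>The function is the slice integral of p \<phi> G_r, which has at most quadratic growth
  relative to p; it will be used for \<phi> = 1 and for \<phi> the identity.\<close>

lemma p1_B_integrable:
  assumes [measurable]: "\<phi> \<in> borel_measurable borel" and b: "\<And>z. \<bar>\<phi> (z $ r) * G z $ r\<bar> \<le> K * (1 + (norm z)\<^sup>2)"
  shows "integrable lborel (\<lambda>t. p1 t * (\<phi> t * B t))"
proof -
  have K: "0 \<le> K" using b[of 0] by simp
  have i: "integrable lborel (\<lambda>z. p z * (\<phi> (z $ r) * G z $ r))"
  proof (rule Bochner_Integration.integrable_bound)
    show "integrable lborel (\<lambda>z. K * (p z + p z * (norm z)\<^sup>2))"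
      by (intro integrable_mult_right Bochner_Integration.integrable_add p_integrable second_moment)
    show "AE z in lborel. norm (p z * (\<phi> (z $ r) * G z $ r)) \<le> norm (K * (p z + p z * (norm z)\<^sup>2))"
    proof (rule AE_I2)
      fix z
      have "p z * \<bar>\<phi> (z $ r) * G z $ r\<bar> \<le> p z * (K * (1 + (norm z)\<^sup>2))" by (rule mult_left_mono[OF b p_nonneg])
      also have "\<dots> = K * (p z + p z * (norm z)\<^sup>2)" by (simp add: algebra_simps)
      finally show "norm (p z * (\<phi> (z $ r) * G z $ r)) \<le> norm (K * (p z + p z * (norm z)\<^sup>2))"
        using p_nonneg[of z] K by (simp add: abs_mult)
    qed
    have "(\<lambda>z. \<phi> (z $ r)) \<in> borel_measurable (borel :: (real ^ 'n) measure)" by measurable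
    then show "(\<lambda>z. p z * (\<phi> (z $ r) * G z $ r)) \<in> borel_measurable lborel" by measurable
  qed
  have ae: "AE t in lborel. (\<integral>x. p (v t x) * (\<phi> (v t x $ r) * G (v t x) $ r) \<partial>LS) = p1 t * (\<phi> t * B t)"
    using p_slice
  proof eventually_elim
    case (elim t)
    have Gm: "(\<lambda>x. G (v t x) $ r) \<in> borel_measurable (Pi\<^sub>M S (\<lambda>_. borel))" by (rule measurable_compose[OF _ G_meas]) measurable
    then have Gm': "(\<lambda>x. G (v t x) $ r) \<in> borel_measurable LS" using measurable_cong_sets[OF rc.sets_LS refl] by simp
    have "(\<integral>x. p (v t x) * (\<phi> (v t x $ r) * G (v t x) $ r) \<partial>LS) = (\<integral>x. (p1 t * \<phi> t) * (w t x * G (v t x) $ r) \<partial>LS)"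
    proof (rule integral_cong_AE)
      show "AE x in LS. p (v t x) * (\<phi> (v t x $ r) * G (v t x) $ r) = (p1 t * \<phi> t) * (w t x * G (v t x) $ r)"
        using elim by eventually_elim (simp add: ac_simps)
      show "(\<lambda>x. p (v t x) * (\<phi> (v t x $ r) * G (v t x) $ r)) \<in> borel_measurable LS" using Gm' by simp
      show "(\<lambda>x. (p1 t * \<phi> t) * (w t x * G (v t x) $ r)) \<in> borel_measurable LS" using Gm' by measurable
    qed
    also have "\<dots> = (p1 t * \<phi> t) * B t" unfolding B_def Nq_integral(2)[OF Gm] by (rule integral_mult_right_zero)
    finally show ?case by (simp add: mult.assoc)
  qed
  have m1: "(\<lambda>t. \<integral>x. p (v t x) * (\<phi> (v t x $ r) * G (v t x) $ r) \<partial>LS) \<in> borel_measurable lborel"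
    using rc.integrable_vec(2)[OF i] by (rule borel_measurable_integrable)
  have m2: "(\<lambda>t. p1 t * (\<phi> t * B t)) \<in> borel_measurable lborel" by measurable
  show ?thesis using integrable_cong_AE[OF m1 m2 ae] rc.integrable_vec(2)[OF i] by simp
qed

text \<open>The translation inequality holds for each step k outside a null set of x that depends on
  k. Fubini exchanges the two almost-everywhere quantifiers, and integrating over 0 \<le> k < h
  produces the mass of (x - h, x].\<close>

lemma increment:
  assumes h: "0 < h"
  shows "AE x in lborel. 0 < p1 x \<longrightarrow> h * p1 x * exp (- h * \<bar>B x\<bar> - h * (LV' / 4 * h)) \<le> measure (density lborel p1) {x - h<..x}"
proof -
  have "AE k in lborel. AE x in lborel. p1 x * exp (B x * k - LV' / 4 * k\<^sup>2) \<le> p1 (x - k)"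
    using translation[of "- _"] by simp
  then have "AE x in lborel. AE k in lborel. p1 x * exp (B x * k - LV' / 4 * k\<^sup>2) \<le> p1 (x - k)"
  proof (rule iffD1[OF lborel_pair.AE_commute, rotated])
    show "{z \<in> space (lborel \<Otimes>\<^sub>M lborel). p1 (snd z) * exp (B (snd z) * fst z - LV' / 4 * (fst z)\<^sup>2) \<le> p1 (snd z - fst z)} \<in> sets (lborel \<Otimes>\<^sub>M lborel)"
      by measurable
  qed
  then show ?thesis
  proof eventually_elim
    case (elim x)
    let ?c = "p1 x * exp (- h * \<bar>B x\<bar> - h * (LV' / 4 * h))"
    have "ennreal (h * ?c) = (\<integral>\<^sup>+k. ennreal ?c * indicator {0..<h} k \<partial>lborel)"
    proof -
      have "ennreal (h * ?c) = ennreal ?c * ennreal h" using p1_nonneg[of x] by (subst mult.commute) (rule ennreal_mult', simp)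
      also have "\<dots> = (\<integral>\<^sup>+k. ennreal ?c * indicator {0..<h} k \<partial>lborel)"
        using h by (subst nn_integral_cmult_indicator) simp_all
      finally show ?thesis .
    qed
    also have "\<dots> \<le> (\<integral>\<^sup>+k. ennreal (p1 (x - k)) * indicator {x - h<..x} (x - k) \<partial>lborel)"
    proof (rule nn_integral_mono_AE, use elim in eventually_elim)
      case (elim k)
      show ?case
      proof (cases "k \<in> {0..<h}")
        case True
        then have k: "0 \<le> k" "k \<le> h" by auto
        have "- h * \<bar>B x\<bar> \<le> B x * k"
        proof -
          have "\<bar>B x\<bar> * k \<le> \<bar>B x\<bar> * h" using k by (intro mult_left_mono) auto
          moreover have "- (\<bar>B x\<bar> * k) \<le> B x * k" using k abs_ge_minus_self[of "B x"] mult_right_mono[of "- \<bar>B x\<bar>" "B x" k] by simp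
          ultimately show ?thesis by (simp add: mult.commute)
        qed
        moreover have "LV' / 4 * k\<^sup>2 \<le> h * (LV' / 4 * h)"
        proof -
          have "LV' / 4 * k\<^sup>2 \<le> LV' / 4 * h\<^sup>2" using k pos by (intro mult_left_mono power_mono) auto
          then show ?thesis by (simp add: power2_eq_square ac_simps)
        qed
        ultimately have "exp (- h * \<bar>B x\<bar> - h * (LV' / 4 * h)) \<le> exp (B x * k - LV' / 4 * k\<^sup>2)" by simp
        from order_trans[OF mult_left_mono[OF this p1_nonneg] elim] have "?c \<le> p1 (x - k)" .
        then show ?thesis using True by (simp add: ennreal_leI)
      qed simp
    qed
    also have "\<dots> = (\<integral>\<^sup>+u. ennreal (p1 u) * indicator {x - h<..x} u \<partial>lborel)"
      using nn_integral_real_affine[of "\<lambda>u. ennreal (p1 u) * indicator {x - h<..x} u" "-1" x] by simp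
    also have "\<dots> = emeasure (density lborel p1) {x - h<..x}" by (rule emeasure_density[symmetric]) simp_all
    also have "\<dots> = ennreal (measure (density lborel p1) {x - h<..x})"
    proof -
      interpret prob_space "density lborel p1" by (rule prob_spaceI) (simp add: emeasure_density p11)
      show ?thesis by (rule emeasure_eq_measure)
    qed
    finally show ?case by (simp add: mult.assoc)
  qed
qed

text \<open>The Gaussian factor in the translation inequality is a spatially constant error \<delta>
  = LV' h / 4, which vanishes with h, and exp(u) \<ge> 1 + u brings the inequality into the form of
  \<open>up\<close> and \<open>dn\<close>. The score B thus acts as -(ln p1)' although p1 itself is
  controlled only up to null sets.\<close>

lemma score_bound_root: "score_bound p1 B"
proof -
  obtain c where c: "0 \<le> c" "\<And>z. \<bar>G z $ r\<bar> \<le> c * (1 + norm z)" by (rule root_gradient_bound) (rule that)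
  have nz: "1 + norm z \<le> 2 * (1 + (norm z)\<^sup>2)" "norm z * (1 + norm z) \<le> 2 * (1 + (norm z)\<^sup>2)" for z :: "real ^ 'n"
  proof -
    have "0 \<le> (norm z - 1)\<^sup>2" by simp
    then have "2 * norm z \<le> 1 + (norm z)\<^sup>2" by (simp add: power2_eq_square algebra_simps)
    note a = this
    have b: "0 \<le> (norm z)\<^sup>2" by simp
    have c: "norm z * (1 + norm z) = norm z + (norm z)\<^sup>2" by (simp add: power2_eq_square algebra_simps)
    have de: "1 + x \<le> 2 * (1 + s) \<and> x + s \<le> 2 * (1 + s)" if "2 * x \<le> 1 + s" "0 \<le> s" for x s :: real using that by auto
    from de[OF a b] have d: "1 + norm z \<le> 2 * (1 + (norm z)\<^sup>2)" and e: "norm z + (norm z)\<^sup>2 \<le> 2 * (1 + (norm z)\<^sup>2)"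
      by (rule conjunct1, rule conjunct2)
    show "1 + norm z \<le> 2 * (1 + (norm z)\<^sup>2)" by (rule d)
    show "norm z * (1 + norm z) \<le> 2 * (1 + (norm z)\<^sup>2)" unfolding c by (rule e)
  qed
  have G1: "\<bar>1 * G z $ r\<bar> \<le> 2 * c * (1 + (norm z)\<^sup>2)" for z
    using order_trans[OF c(2)[of z] mult_left_mono[OF nz(1)[of z] c(1)]] by (simp only: mult_1 ac_simps)
  have G2: "\<bar>z $ r * G z $ r\<bar> \<le> 2 * c * (1 + (norm z)\<^sup>2)" for z
  proof -
    have "\<bar>z $ r\<bar> * \<bar>G z $ r\<bar> \<le> norm z * (c * (1 + norm z))" using c(2)[of z] component_le_norm_cart[of z r] by (intro mult_mono) auto
    also have "norm z * (c * (1 + norm z)) = c * (norm z * (1 + norm z))" by (rule mult.left_commute)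
    also have "\<dots> \<le> c * (2 * (1 + (norm z)\<^sup>2))" by (rule mult_left_mono[OF nz(2) c(1)])
    finally show ?thesis by (simp only: abs_mult ac_simps)
  qed
  let ?h = "\<lambda>n. 1 / real (Suc n)"
  have e1: "1 - h * b - X \<le> exp (- b * h - X)" and e2: "1 + h * b - X \<le> exp (- b * - h - X)" for h b X :: real
    by (rule order_trans[OF _ exp_ge_add_one_self], simp add: mult.commute)+
  have lim: "?h \<longlonglongrightarrow> 0" by (rule LIMSEQ_inverse_real_of_nat[unfolded inverse_eq_divide])
  have "score_density p1 B (\<lambda>n x. LV' / 4 * ?h n) ?h"
  proof (rule score_density.intro)
    show "integrable lborel (\<lambda>x. p1 x * B x)" using p1_B_integrable[of "\<lambda>_. 1", OF _ G1] by simp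
    show "integrable lborel (\<lambda>x. p1 x * (x * B x))" using p1_B_integrable[of "\<lambda>x. x", OF _ G2] by simp
    show "?h \<longlonglongrightarrow> 0" by (rule lim)
    show "integrable lborel (\<lambda>x. p1 x * (LV' / 4 * ?h n))" for n by (intro integrable_mult_left p1_integrable)
    have I: "(\<integral>x. p1 x * (LV' / 4 * ?h n) \<partial>lborel) = LV' / 4 * ?h n" for n
      by (simp only: integral_mult_left_zero p1_integrable(2) mult_1_left)
    show "(\<lambda>n. \<integral>x. p1 x * (LV' / 4 * ?h n) \<partial>lborel) \<longlonglongrightarrow> 0"
      unfolding I by (rule tendsto_mult_right_zero[OF lim])
    fix n
    have hh: "LV' / 4 * (?h n)\<^sup>2 = ?h n * (LV' / 4 * ?h n)" by (simp add: power2_eq_square)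
    show "AE x in lborel. p1 x * (1 - ?h n * B x - ?h n * (LV' / 4 * ?h n)) \<le> p1 (x + ?h n)"
      using translation[of "?h n"]
    proof eventually_elim
      case (elim x)
      have "1 - ?h n * B x - ?h n * (LV' / 4 * ?h n) \<le> exp (- B x * ?h n - LV' / 4 * (?h n)\<^sup>2)"
        unfolding hh by (rule e1)
      from order_trans[OF mult_left_mono[OF this p1_nonneg] elim] show ?case .
    qed
    show "AE x in lborel. p1 x * (1 + ?h n * B x - ?h n * (LV' / 4 * ?h n)) \<le> p1 (x - ?h n)"
      using translation[of "- ?h n"]
    proof eventually_elim
      case (elim x)
      have "1 + ?h n * B x - ?h n * (LV' / 4 * ?h n) \<le> exp (- B x * - ?h n - LV' / 4 * (- ?h n)\<^sup>2)"
        unfolding power2_minus hh by (rule e2)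
      from order_trans[OF mult_left_mono[OF this p1_nonneg] elim] show ?case unfolding diff_conv_add_uminus[of x "?h n"] .
    qed
    show "AE x in lborel. 0 < p1 x \<longrightarrow> ?h n * p1 x * exp (- ?h n * \<bar>B x\<bar> - ?h n * (LV' / 4 * ?h n)) \<le> measure (density lborel p1) {x - ?h n<..x}"
      by (rule increment) simp
  qed (use p1_nonneg p1_integrable pos in \<open>simp_all\<close>)
  then show ?thesis by (rule score_density.score_bound)
qed

end

section \<open>The entropy bound\<close>

text \<open>Upward closure of S holds when the root is the smallest index; then pairs i < j with i
  in S lie entirely in S, and each unordered pair occurs twice in the full off-diagonal sum.\<close>

lemma sum_off_diagonal:
  fixes a :: "'n::{finite,linorder} \<Rightarrow> 'n \<Rightarrow> ennreal"
  assumes sym: "\<And>i j. a i j = a j i" and up: "\<And>i j. i \<in> S \<Longrightarrow> i < j \<Longrightarrow> j \<in> S"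
  shows "(\<Sum>i\<in>S. \<Sum>k\<in>S - {i}. a i k) = 2 * (\<Sum>i\<in>S. \<Sum>j\<in>{j. i < j}. a i j)"
proof -
  let ?u = "\<lambda>i k. if i < k then a i k else 0"
  have "(\<Sum>k\<in>S - {i}. a i k) = (\<Sum>k\<in>S. ?u i k) + (\<Sum>k\<in>S. ?u k i)" for i
  proof -
    have "(\<Sum>k\<in>S - {i}. a i k) = (\<Sum>k\<in>S. ?u i k + ?u k i)"
      by (rule sum.mono_neutral_cong_left) (auto simp: sym)
    then show ?thesis by (simp add: sum.distrib)
  qed
  then have "(\<Sum>i\<in>S. \<Sum>k\<in>S - {i}. a i k) = (\<Sum>i\<in>S. \<Sum>k\<in>S. ?u i k) + (\<Sum>i\<in>S. \<Sum>k\<in>S. ?u k i)"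
    by (simp only: sum.distrib)
  also have "(\<Sum>i\<in>S. \<Sum>k\<in>S. ?u k i) = (\<Sum>i\<in>S. \<Sum>k\<in>S. ?u i k)" by (rule sum.swap)
  also have "(\<Sum>i\<in>S. \<Sum>k\<in>S. ?u i k) = (\<Sum>i\<in>S. \<Sum>j\<in>{j. i < j}. a i j)"
  proof (rule sum.cong[OF refl])
    fix i assume i: "i \<in> S"
    show "(\<Sum>k\<in>S. ?u i k) = (\<Sum>j\<in>{j. i < j}. a i j)"
      by (rule sum.mono_neutral_cong_right) (use up[OF i] in auto)
  qed
  finally show ?thesis by (simp only: mult_2)
qed

section \<open>Averaging the slice bounds over the root\<close>

context regular_minimizer
begin

lemma Nq_nn_integral:
  assumes F: "F \<in> borel_measurable (Pi\<^sub>M S (\<lambda>_. borel))"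
  shows "(\<integral>\<^sup>+x. F x \<partial>Nq t) = (\<integral>\<^sup>+x. ennreal (w t x) * F x \<partial>LS)"
proof -
  have m: "(\<lambda>x. ennreal (w t x)) \<in> borel_measurable LS" by measurable
  have "F \<in> borel_measurable LS" using F measurable_cong_sets[OF rc.sets_LS refl] by simp
  then show ?thesis unfolding Nq_density by (rule nn_integral_density[OF m])
qed

lemma e_meas[measurable]: "e \<in> borel_measurable borel"
proof -
  have Hm: "(\<lambda>x. ennreal (1 / (2 * \<kappa> * lV) * (H (v t x) $ i $ k)\<^sup>2)) \<in> borel_measurable (Pi\<^sub>M S (\<lambda>_. borel))" for t i k
  proof -
    have "(\<lambda>x. H (v t x) $ i $ k) \<in> borel_measurable (Pi\<^sub>M S (\<lambda>_. borel))" by (rule measurable_compose[OF _ H_meas]) measurable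
    then show ?thesis by measurable
  qed
  have "(\<lambda>t. \<integral>\<^sup>+x. ennreal (w t x) * ennreal (1 / (2 * \<kappa> * lV) * (H (v t x) $ i $ k)\<^sup>2) \<partial>LS) \<in> borel_measurable borel" for i k
  proof -
    have vm: "(\<lambda>z. v (fst z) (snd z)) \<in> borel_measurable (borel \<Otimes>\<^sub>M LS)" by measurable
    have "(\<lambda>z. ennreal (w (fst z) (snd z)) * ennreal (1 / (2 * \<kappa> * lV) * (H (v (fst z) (snd z)) $ i $ k)\<^sup>2)) \<in> borel_measurable (borel \<Otimes>\<^sub>M LS)"
      using measurable_compose[OF vm H_meas[of i k]] by measurable
    then have "(\<lambda>(t, x). ennreal (w t x) * ennreal (1 / (2 * \<kappa> * lV) * (H (v t x) $ i $ k)\<^sup>2)) \<in> borel_measurable (borel \<Otimes>\<^sub>M LS)"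
      by (simp only: split_beta')
    then show ?thesis by (rule rc.LS.borel_measurable_nn_integral)
  qed
  then show ?thesis unfolding e_def[abs_def] Nq_nn_integral[OF Hm] by (intro borel_measurable_sum)
qed

lemma nn_integral_tree:
  assumes F[measurable]: "F \<in> borel_measurable borel"
  shows "(\<integral>\<^sup>+t. ennreal (p1 t) * (\<integral>\<^sup>+x. F (v t x) \<partial>Nq t) \<partial>lborel) = (\<integral>\<^sup>+z. F z \<partial>density lborel (\<lambda>z. ennreal (p z)))"
proof -
  have Fm: "(\<lambda>x. F (v t x)) \<in> borel_measurable (Pi\<^sub>M S (\<lambda>_. borel))" for t by (rule measurable_compose[OF _ F]) measurable
  have "(\<integral>\<^sup>+z. F z \<partial>density lborel (\<lambda>z. ennreal (p z))) = (\<integral>\<^sup>+z. ennreal (p z) * F z \<partial>lborel)"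
    by (rule nn_integral_density) simp_all
  also have "\<dots> = (\<integral>\<^sup>+t. \<integral>\<^sup>+x. ennreal (p (v t x)) * F (v t x) \<partial>LS \<partial>lborel)" by (rule rc.nn_integral_vec) measurable
  also have "\<dots> = (\<integral>\<^sup>+t. ennreal (p1 t) * (\<integral>\<^sup>+x. F (v t x) \<partial>Nq t) \<partial>lborel)"
  proof (rule nn_integral_cong_AE, use p_slice in eventually_elim)
    case (elim t)
    have m: "(\<lambda>x. ennreal (w t x) * F (v t x)) \<in> borel_measurable LS"
    proof -
      have "(\<lambda>x. F (v t x)) \<in> borel_measurable LS" using Fm[of t] measurable_cong_sets[OF rc.sets_LS refl] by simp
      then show ?thesis by measurable
    qed
    have "(\<integral>\<^sup>+x. ennreal (p (v t x)) * F (v t x) \<partial>LS) = (\<integral>\<^sup>+x. ennreal (p1 t) * (ennreal (w t x) * F (v t x)) \<partial>LS)"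
    proof (rule nn_integral_cong_AE, use elim in eventually_elim)
      case (elim x)
      then show ?case by (simp add: ennreal_mult' p1_nonneg mult.assoc)
    qed
    also have "\<dots> = ennreal (p1 t) * (\<integral>\<^sup>+x. F (v t x) \<partial>Nq t)" unfolding Nq_nn_integral[OF Fm] by (rule nn_integral_cmult[OF m])
    finally show ?case .
  qed
  finally show ?thesis by (rule sym)
qed

lemma e_total:
  "(\<integral>\<^sup>+t. ennreal (p1 t) * e t \<partial>lborel)
   = (\<Sum>i\<in>S. \<Sum>k\<in>S - {i}. \<integral>\<^sup>+z. ennreal (1 / (2 * \<kappa> * lV) * (H z $ i $ k)\<^sup>2) \<partial>density lborel (\<lambda>z. ennreal (p z)))"
proof -
  let ?I = "\<lambda>i k t. \<integral>\<^sup>+x. ennreal (1 / (2 * \<kappa> * lV) * (H (v t x) $ i $ k)\<^sup>2) \<partial>Nq t"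
  have Hm: "(\<lambda>z. ennreal (1 / (2 * \<kappa> * lV) * (H z $ i $ k)\<^sup>2)) \<in> borel_measurable borel" for i k by measurable
  have Im: "?I i k \<in> borel_measurable lborel" for i k
  proof -
    have Fm: "(\<lambda>x. ennreal (1 / (2 * \<kappa> * lV) * (H (v t x) $ i $ k)\<^sup>2)) \<in> borel_measurable (Pi\<^sub>M S (\<lambda>_. borel))" for t
      by (rule measurable_compose[OF _ Hm]) measurable
    have vm: "(\<lambda>z. v (fst z) (snd z)) \<in> borel_measurable (borel \<Otimes>\<^sub>M LS)" by measurable
    have "(\<lambda>z. ennreal (w (fst z) (snd z)) * ennreal (1 / (2 * \<kappa> * lV) * (H (v (fst z) (snd z)) $ i $ k)\<^sup>2)) \<in> borel_measurable (borel \<Otimes>\<^sub>M LS)"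
      using measurable_compose[OF vm Hm[of i k]] by measurable
    then have "(\<lambda>(t, x). ennreal (w t x) * ennreal (1 / (2 * \<kappa> * lV) * (H (v t x) $ i $ k)\<^sup>2)) \<in> borel_measurable (borel \<Otimes>\<^sub>M LS)"
      by (simp only: split_beta')
    from rc.LS.borel_measurable_nn_integral[OF this] show ?thesis unfolding Nq_nn_integral[OF Fm] by simp
  qed
  have pm: "(\<lambda>t. ennreal (p1 t)) \<in> borel_measurable lborel" by measurable
  have "(\<integral>\<^sup>+t. ennreal (p1 t) * e t \<partial>lborel) = (\<integral>\<^sup>+t. (\<Sum>i\<in>S. \<Sum>k\<in>S - {i}. ennreal (p1 t) * ?I i k t) \<partial>lborel)"
    by (simp only: e_def sum_distrib_left)
  also have "\<dots> = (\<Sum>i\<in>S. \<integral>\<^sup>+t. (\<Sum>k\<in>S - {i}. ennreal (p1 t) * ?I i k t) \<partial>lborel)"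
    by (rule nn_integral_sum) (use pm Im in measurable)
  also have "\<dots> = (\<Sum>i\<in>S. \<Sum>k\<in>S - {i}. \<integral>\<^sup>+t. ennreal (p1 t) * ?I i k t \<partial>lborel)"
    by (intro sum.cong refl nn_integral_sum) (use pm Im in measurable)
  also have "\<dots> = (\<Sum>i\<in>S. \<Sum>k\<in>S - {i}. \<integral>\<^sup>+z. ennreal (1 / (2 * \<kappa> * lV) * (H z $ i $ k)\<^sup>2) \<partial>density lborel (\<lambda>z. ennreal (p z)))"
    by (intro sum.cong refl nn_integral_tree Hm)
  finally show ?thesis .
qed

text \<open>A last transport, in the root variable: the slice partition function W(y) plays the part
  of \<open>w\<close>, and \<Xi>(t) = -C + e(t). The tilt -B(t) (y - t) left over by the slices is
  exactly the score term of p1. Since W integrates to Z, the outcome is Z \<le> exp(-C +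
  E[e]).\<close>

lemma root_bound: "ereal (C + ln Z) \<le> enn2ereal (\<integral>\<^sup>+t. ennreal (p1 t) * e t \<partial>lborel)"
proof (cases "(\<integral>\<^sup>+t. ennreal (p1 t) * e t \<partial>lborel) = \<infinity>")
  case True
  then show ?thesis by simp
next
  case fin: False
  let ?T = "\<integral>\<^sup>+t. ennreal (p1 t) * e t \<partial>lborel"
  define W where "W y = (\<integral>\<^sup>+x. ennreal (exp (- V (v y x))) \<partial>LS)" for y
  have Wm[measurable]: "W \<in> borel_measurable borel"
  proof -
    have vm: "(\<lambda>z. v (fst z) (snd z)) \<in> borel_measurable (borel \<Otimes>\<^sub>M LS)" by measurable
    have "(\<lambda>z. ennreal (exp (- V (v (fst z) (snd z))))) \<in> borel_measurable (borel \<Otimes>\<^sub>M LS)"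
      using measurable_compose[OF vm V_meas] by measurable
    then have "(\<lambda>(y, x). ennreal (exp (- V (v y x)))) \<in> borel_measurable (borel \<Otimes>\<^sub>M LS)" by (simp only: split_beta')
    from rc.LS.borel_measurable_nn_integral[OF this] show ?thesis unfolding W_def[abs_def] .
  qed
  have "AE t in lborel. ennreal (p1 t) * e t \<noteq> \<infinity>" by (rule nn_integral_PInf_AE[OF _ fin]) measurable
  then have ef: "AE t in lborel. 0 < p1 t \<longrightarrow> e t < \<infinity>"
    by eventually_elim (auto simp: less_top ennreal_mult_eq_top_iff)
  have good: "AE t in lborel. 0 < p1 t \<longrightarrow> (\<forall>y. W y \<le> ennreal (p1 t * exp (- C + enn2real (e t) - B t * (y - t))))"
    using ef slice_partition unfolding W_def by eventually_elim simp
  \<comment> \<open>A single admissible root value already shows every W(y) to be finite, which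
    permits the passage to real numbers.\<close>
  have "\<exists>t. 0 < p1 t \<and> (\<forall>y. W y \<le> ennreal (p1 t * exp (- C + enn2real (e t) - B t * (y - t))))"
  proof (rule ccontr)
    assume n: "\<not> ?thesis"
    have "AE t in lborel. ennreal (p1 t) = 0"
      using good
    proof eventually_elim
      case (elim t)
      then have "\<not> 0 < p1 t" using n by blast
      then show ?case by (simp add: ennreal_neg)
    qed
    then have "(\<integral>\<^sup>+t. ennreal (p1 t) \<partial>lborel) = 0" by (rule nn_integral_zero')
    then show False using p11 by simp
  qed
  then obtain t0 where t0: "0 < p1 t0" "\<forall>y. W y \<le> ennreal (p1 t0 * exp (- C + enn2real (e t0) - B t0 * (y - t0)))" by (elim exE conjE)
  have Wfin: "W y < top" for y using spec[OF t0(2), of y] by (rule le_less_trans) simp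
  have Wpos: "W y \<noteq> 0" for y
  proof
    assume "W y = 0"
    moreover have m: "(\<lambda>x. ennreal (exp (- V (v y x)))) \<in> borel_measurable LS" by measurable
    ultimately have "emeasure LS {x \<in> space LS. ennreal (exp (- V (v y x))) \<noteq> 0} = 0"
      unfolding W_def by (simp only: nn_integral_0_iff[OF m])
    then have "emeasure LS (space LS) = 0" by (simp add: not_le)
    with PiM_lborel_nonnull[of S] show False by simp
  qed
  have WW: "ennreal (enn2real (W y)) = W y" for y using Wfin by simp
  have Wp: "0 < enn2real (W y)" for y using Wfin[of y] Wpos[of y] by (simp add: enn2real_positive_iff zero_less_iff_neq_zero)
  have pe: "AE t in lborel. ennreal (p1 t * enn2real (e t)) = ennreal (p1 t) * e t"
    using ef
  proof eventually_elim
    case (elim t)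
    show ?case
    proof (cases "0 < p1 t")
      case True
      then show ?thesis using elim by (simp add: ennreal_mult' less_top)
    next
      case False
      then have "p1 t = 0" using p1_nonneg[of t] by simp
      then show ?thesis by simp
    qed
  qed
  have peT: "(\<integral>\<^sup>+t. ennreal (p1 t * enn2real (e t)) \<partial>lborel) = ?T" by (rule nn_integral_cong_AE[OF pe])
  have pe0: "0 \<le> p1 t * enn2real (e t)" for t by (intro mult_nonneg_nonneg p1_nonneg enn2real_nonneg)
  have pei: "integrable lborel (\<lambda>t. p1 t * enn2real (e t))"
  proof (rule integrableI_nonneg)
    show "(\<integral>\<^sup>+t. ennreal (p1 t * enn2real (e t)) \<partial>lborel) < \<infinity>" unfolding peT using fin by (simp add: less_top)
  qed (measurable, simp add: pe0)
  have peI: "(\<integral>t. p1 t * enn2real (e t) \<partial>lborel) = enn2real ?T"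
    unfolding peT[symmetric] by (rule integral_eq_nn_integral) (measurable, simp add: pe0)
  have \<Xi>i: "integrable lborel (\<lambda>t. p1 t * (- C + enn2real (e t)))"
    unfolding distrib_left by (intro Bochner_Integration.integrable_add integrable_mult_left p1_integrable pei)
  have \<Xi>I: "(\<integral>t. p1 t * (- C + enn2real (e t)) \<partial>lborel) = - C + enn2real ?T"
    unfolding distrib_left using p1_integrable pei peI by simp
  have bound: "AE t in lborel. 0 < p1 t \<longrightarrow> (\<forall>y. enn2real (W y) \<le> p1 t * exp ((- C + enn2real (e t)) - B t * (y - t)))"
    using good
  proof eventually_elim
    case (elim t)
    show ?case
    proof (intro impI allI)
      fix y assume t: "0 < p1 t"
      have "ennreal (enn2real (W y)) \<le> ennreal (p1 t * exp (- C + enn2real (e t) - B t * (y - t)))"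
        unfolding WW by (rule spec[OF mp[OF elim t]])
      then show "enn2real (W y) \<le> p1 t * exp ((- C + enn2real (e t)) - B t * (y - t))" using t by simp
    qed
  qed
  have Wrm: "(\<lambda>y. enn2real (W y)) \<in> borel_measurable borel" by measurable
  have "(\<integral>\<^sup>+y. ennreal (enn2real (W y)) \<partial>lborel) \<le> ennreal (exp (- C + enn2real ?T))"
    unfolding \<Xi>I[symmetric] by (rule score_bound_root[unfolded score_bound_def, rule_format]) (rule Wrm Wp \<Xi>i bound[simplified] | use bound in simp)+
  also have "(\<integral>\<^sup>+y. ennreal (enn2real (W y)) \<partial>lborel) = (\<integral>\<^sup>+z. ennreal (exp (- V z)) \<partial>lborel)"
    unfolding WW unfolding W_def by (rule rc.nn_integral_vec[symmetric]) measurable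
  also have "\<dots> = ennreal Z" unfolding Z_def by (rule nn_integral_eq_integral[OF normalizable]) simp
  finally have "Z \<le> exp (- C + enn2real ?T)" by simp
  then have "ln Z \<le> ln (exp (- C + enn2real ?T))" using Z_pos by (subst ln_le_cancel_iff) simp_all
  then have "ln Z \<le> - C + enn2real ?T" by (simp only: ln_exp)
  then have "ereal (C + ln Z) \<le> ereal (enn2real ?T)" by simp
  also have "\<dots> = enn2ereal ?T" using fin by (metis enn2ereal_ennreal enn2real_nonneg ennreal_enn2real infinity_ennreal_def less_top)
  finally show ?thesis .
qed

end

theorem mainTheorem6:
  fixes V :: "(real, 'n::{finite,linorder}) vec \<Rightarrow> real"
    and G :: "(real, 'n) vec \<Rightarrow> (real, 'n) vec"
    and H :: "(real, 'n) vec \<Rightarrow> ((real, 'n) vec, 'n) vec"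
    and r :: 'n
    and lV lV' LV' :: real
    and pstar :: "((real, 'n) vec) measure"
    and p :: "(real, 'n) vec \<Rightarrow> real"
  assumes dim: "card (UNIV :: 'n set) \<ge> 2"
    and root: "\<And>i. r \<le> i"
    and grad: "\<And>z. (V has_derivative (\<lambda>h. G z \<bullet> h)) (at z)"
    and hess: "\<And>z. (G has_derivative (\<lambda>h. H z *v h)) (at z)"
    and hess_cont: "continuous_on UNIV H"
    and growth: "\<forall>c2>0. \<exists>c1>0. \<forall>z. \<bar>V z\<bar> \<le> c1 * exp (c2 * (norm z)\<^sup>2)"
    and normalizable: "integrable lborel (\<lambda>z. exp (- V z))"
    and pos: "lV > 0" "lV' > 0" "LV' > 0"
    and R: "\<And>z. H z $ r $ r \<le> LV' / 2"
    and P1: "\<And>z. loewner_ge_sub (H z) (UNIV - {r}) lV"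
    and RD_bdd: "bdd_above (range (\<lambda>w. \<Sum>j\<in>UNIV - {r}. (H w $ r $ j)\<^sup>2))"
    and RD: "\<And>z. H z $ r $ r - (SUP w. \<Sum>j\<in>UNIV - {r}. (H w $ r $ j)\<^sup>2) / lV \<ge> lV'"
    and pstar_in: "pstar \<in> C_star r"
    and pstar_min: "\<And>\<mu>. \<mu> \<in> C_star r \<Longrightarrow> KL_div pstar (gibbs V) \<le> KL_div \<mu> (gibbs V)"
    and pstar_dens: "pstar = density lborel (\<lambda>z. ennreal (p z))"
    and p_nonneg: "\<And>z. p z \<ge> 0"
    and p_diff: "\<And>z. p differentiable (at z)"
  shows "(INF \<mu>\<in>C_star r. KL_div \<mu> (gibbs V)) = KL_div pstar (gibbs V)
    \<and> KL_div pstar (gibbs V) \<le>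
      ereal (LV' / (2 * lV' * lV\<^sup>2)) *
      (\<Sum>i\<in>UNIV - {r}. \<Sum>j\<in>{j. i < j}.
         enn2ereal (\<integral>\<^sup>+ z. ennreal ((H z $ i $ j)\<^sup>2) \<partial>pstar))"
proof
  show "(INF \<mu>\<in>C_star r. KL_div \<mu> (gibbs V)) = KL_div pstar (gibbs V)"
    by (rule antisym, rule INF_lower[OF pstar_in], rule INF_greatest, rule pstar_min)
  interpret star_minimizer V G H r lV lV' LV' p
  proof unfold_locales
    show "density lborel (\<lambda>z. ennreal (p z)) \<in> C_star r" using pstar_in by (simp only: pstar_dens)
    show "KL_div (density lborel (\<lambda>z. ennreal (p z))) (gibbs V) \<le> KL_div \<mu> (gibbs V)" if "\<mu> \<in> C_star r" for \<mu>
      using pstar_min[OF that] by (simp only: pstar_dens)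
  qed (rule grad hess hess_cont normalizable pos R P1 RD_bdd RD p_nonneg p_diff)+
  obtain p1 q where pq: "rc.factors p1 q" "\<And>j t. (\<integral>\<^sup>+s. ennreal (q j t s) \<partial>lborel) = 1"
    "(\<integral>\<^sup>+t. ennreal (p1 t) \<partial>lborel) = 1" "AE z in lborel. p z = rc.star p1 q z"
    by (rule rc.C_star_density_factor[OF p_meas p_nonneg p_in]) (rule that)
  interpret regular_minimizer V G H r lV lV' LV' p p1 q
  proof unfold_locales
    show "UNIV - {r} \<noteq> {}"
    proof
      assume "UNIV - {r} = {}"
      then have "(UNIV :: 'n set) = {r}" by blast
      then have "card (UNIV :: 'n set) = card {r}" by (rule arg_cong)
      then show False using dim by simp
    qed
  qed (rule pq growth)+
  let ?b = "\<lambda>i j. \<integral>\<^sup>+ z. ennreal ((H z $ i $ j)\<^sup>2) \<partial>pstar"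
  let ?c = "1 / (2 * \<kappa> * lV)"
  let ?K = "LV' / (2 * lV' * lV\<^sup>2)"
  \<comment> \<open>Each off-diagonal pair is counted twice, and 2 / (2 \<kappa> lV) with \<kappa> =
    2 lV' lV / LV' is the constant of the statement.\<close>
  have c: "0 \<le> ?c" "2 * ?c = ?K" and K0: "0 \<le> ?K"
    using pos by (simp_all add: \<kappa>_def power2_eq_square field_simps)
  have cb: "(\<integral>\<^sup>+z. ennreal (?c * (H z $ i $ k)\<^sup>2) \<partial>density lborel (\<lambda>z. ennreal (p z))) = ennreal ?c * ?b i k" for i k
  proof -
    have m: "(\<lambda>z. ennreal ((H z $ i $ k)\<^sup>2)) \<in> borel_measurable (density lborel (\<lambda>z. ennreal (p z)))" by measurable
    show ?thesis unfolding pstar_dens nn_integral_cmult[OF m, symmetric] using c(1) by (simp only: ennreal_mult')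
  qed
  have "KL_div pstar (gibbs V) = ereal (C + ln Z)" unfolding pstar_dens by (rule KL_eq)
  also have "\<dots> \<le> enn2ereal (\<Sum>i\<in>S. \<Sum>k\<in>S - {i}. ennreal ?c * ?b i k)"
    using root_bound unfolding e_total cb .
  also have "(\<Sum>i\<in>S. \<Sum>k\<in>S - {i}. ennreal ?c * ?b i k) = 2 * (\<Sum>i\<in>S. \<Sum>j\<in>{j. i < j}. ennreal ?c * ?b i j)"
  proof (rule sum_off_diagonal)
    show "ennreal ?c * ?b i j = ennreal ?c * ?b j i" for i j by (simp only: hess_sym[of _ i j])
    show "j \<in> S" if "i \<in> S" "i < j" for i j using that root[of i] by auto
  qed
  also have "\<dots> = ennreal ?K * (\<Sum>i\<in>S. \<Sum>j\<in>{j. i < j}. ?b i j)"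
  proof -
    have "2 * ennreal ?c = ennreal ?K" using ennreal_mult[of 2 ?c] c by (simp only: ennreal_numeral zero_le_numeral)
    then show ?thesis by (simp only: sum_distrib_left[symmetric] mult.assoc[symmetric])
  qed
  also have "enn2ereal \<dots> = ereal ?K * (\<Sum>i\<in>S. \<Sum>j\<in>{j. i < j}. enn2ereal (?b i j))"
    using K0 by (simp add: times_ennreal.rep_eq enn2ereal_ennreal)
  finally show "KL_div pstar (gibbs V) \<le> ereal ?K * (\<Sum>i\<in>UNIV - {r}. \<Sum>j\<in>{j. i < j}. enn2ereal (?b i j))" .
qed

end
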